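(* Let $\theta\ge 1$ and let $\mathcal X_k=(X_k,d_k)$, $k\in\mathbb N$, and $\mathcal X=(X,d)$ be compact $\theta$-geodesic spaces such that $(\mathcal X_k)_k$ converges to $\mathcal X$ in the $\theta$-Gromov-Hausdorff topology, by means of Borel $\epsilon_k$-isometries $f_k:X_k\to X$ with $\epsilon_k\to0$. For each $k$ let $\Pi_k$ be a Borel probability measure on $\Gamma(X_k)$, and set $\pi_k=(e_0,e_1)_\sharp\Pi_k$, $\mu_{k,t}=(e_t)_\sharp\Pi_k$ and $\varepsilon_{k,t}=(e_t)_\sharp[L_{d_k}^2\,\Pi_k/2]$. Then, after passing to a subsequence (still indexed by $k$), there is a dynamical transference plan $\Pi$ on $X$ (a Borel probability measure on $\Gamma(X)$), with associated transference plan $\pi=(e_0,e_1)_\sharp\Pi$, measure-valued path $\mu_t=(e_t)_\sharp\Pi$, $t\in[0,1]$, and kinetic energy $\varepsilon_t=(e_t)_\sharp[L_d^2\,\Pi/2]$, such that: (i) $\lim_{k\to\infty}(i\circ f_k\circ)_\sharp\Pi_k=i_\sharp\Pi$ in the weak topology on $P(P([0,1]\times X))$, where $f_k\circ$ denotes the map $C([0,1];X_k)\to\mathbb M([0,1];X)$, $\gamma\mapsto f_k\circ\gamma$; (ii) $\lim_{k\to\infty}(f_k,f_k)_\sharp\pi_k=\pi$ in the weak topology on $P(X\times X)$; (iii) for every $p\in[1,\infty)$, $\lim_{k\to\infty}\sup_{t\in[0,1]}W_p(\mu_t,(f_k)_\sharp\mu_{k,t})=0$; (iv) for each $t\in(0,1)$,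 $\lim_{k\to\infty}(f_k)_\sharp\varepsilon_{k,t}=\varepsilon_t$ in the weak topology of measures. Suppose additionally that each $\Pi_k$ is a dynamical optimal transference plan with respect to the cost $d_k^{\,p}$ for some $p\in[1,\infty)$. Then: (v) $\Pi$ is a dynamical optimal transference plan (with respect to $d^{\,p}$); hence $\pi$ is an optimal transference plan and $(\mu_t)_{0\le t\le1}$ is a displacement interpolation; (vi) if $p=2$, then for each $t\in(0,1)$ there is a choice of the speed fields $|v_{k,t}|=|v_k|(t,\cdot)$ associated with the plans $\Pi_k$ such that $\lim_{k\to\infty}|v_{k,t}|\circ f_{r,k}=|v_t|$ uniformly on $X$, where $|v_t|=|v|(t,\cdot)$ is the speed field associated with $\Pi$ and $f_{r,k}:X\to X_k$ is the approximate inverse of $f_k$.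
   Context: An irreversible metric on a set $X$ is a function $d:X\times X\to[0,\infty)$ with $d(x,y)=0$ iff $x=y$ and $d(x,z)\le d(x,y)+d(y,z)$ (no symmetry). The topology is generated by the forward balls $B_x^+(r)=\{y:d(x,y)<r\}$. For $\theta\ge1$, $(X,d)$ is a $\theta$-metric space if $d(x,y)\le\theta\,d(y,x)$ for all $x,y\in X$. A $\theta$-geodesic space is a $\theta$-metric space in which any two points $x,y$ are joined by a constant-speed minimal geodesic, i.e. a continuous $\gamma:[0,1]\to X$ with $\gamma(0)=x$, $\gamma(1)=y$ and $d(\gamma(s),\gamma(t))=(t-s)d(x,y)$ for $0\le s\le t\le1$. $\Gamma(X)$ is the set of all constant-speed minimal geodesics $[0,1]\to X$, with the uniform topology; $L_d(\gamma)$ is the length of $\gamma$ (so $L_d(\gamma)=d(\gamma(0),\gamma(1))$ for $\gamma\in\Gamma(X)$); $e_t(\gamma)=\gamma(t)$. For $\epsilon>0$ an $\epsilon$-isometry $f:X_1\to X_2$ is a (not necessarily continuous) map with $\sup_{x,x'}|d_2(f(x),f(x'))-d_1(x,x')|\le\epsilon$ and $X_2\subset\overline{[f(X_1)]^\epsilon}$, where $A^\epsilon=\{y:d_2(A,y)<\epsilon\}$. Convergence in the $\theta$-Gromov-Hausdorff topology of compact $\theta$-metric spaces is equivalent to the existence of $\epsilon_k$-isometries $f_k:X_k\to X$ with $\epsilon_k\to0$. The approximate inverse $f_{r,k}:X\to X_k$ of $f_k$ is a map obtained by choosing, for each $y\in X$, a point $f_{r,k}(y)\in X_k$ with $d(f_k(f_{r,k}(y)),y)\le\epsilon_k$;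 it is a $(2+\theta)\epsilon_k$-isometry and $d_k(f_{r,k}(f_k(x)),x)\le2\epsilon_k$. $P(\cdot)$ denotes Borel probability measures. $W_p(\mu,\nu)=\big(\inf_\pi\int d(x,y)^p\,d\pi(x,y)\big)^{1/p}$, the infimum being over couplings $\pi$ with first marginal $\mu$ and second marginal $\nu$; minimizers are called optimal transference plans (with respect to $d^{\,p}$). A dynamical optimal transference plan (w.r.t. $d^{\,p}$) is $\Pi\in P(\Gamma(X))$ such that $(e_0,e_1)_\sharp\Pi$ is an optimal transference plan w.r.t. $d^{\,p}$ between its marginals; then $\mu_t=(e_t)_\sharp\Pi$ is called a displacement interpolation. $\mathbb M([0,1];X)$ is the set of measurable paths $[0,1]\to X$, and $i:\mathbb M([0,1];X)\to P([0,1]\times X)$ is $i(\gamma)=(\mathrm{Id},\gamma)_\sharp\mathscr L$ with $\mathscr L$ the Lebesgue measure on $[0,1]$. Given $\Pi\in P(\Gamma(X))$, with $\mu_t=(e_t)_\sharp\Pi$ and $\varepsilon_t=(e_t)_\sharp[L_d^2\,\Pi/2]$, $t\in(0,1)$, the speed field is $|v|(t,\cdot)=\sqrt{2\,d\varepsilon_t/d\mu_t}$ (on a compact space $\varepsilon_t\ll\mu_t$); it is defined up to modification on a $\mu_t$-negligible set, and a "choice" of speed field is a choice of such a representative. *)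

theory Defs
  imports "HOL-Probability.Probability"
begin

section \<open>Irreversible metric spaces\<close>

locale irreversible_metric_space =
  fixes X :: "'a set" and d :: "'a \<Rightarrow> 'a \<Rightarrow> real"
  assumes nonneg: "\<lbrakk>x \<in> X; y \<in> X\<rbrakk> \<Longrightarrow> 0 \<le> d x y"
    and zero: "\<lbrakk>x \<in> X; y \<in> X\<rbrakk> \<Longrightarrow> d x y = 0 \<longleftrightarrow> x = y"
    and triangle: "\<lbrakk>x \<in> X; y \<in> X; z \<in> X\<rbrakk> \<Longrightarrow> d x z \<le> d x y + d y z"

locale theta_metric_space = irreversible_metric_space X d
  for \<theta> :: real and X :: "'a set" and d :: "'a \<Rightarrow> 'a \<Rightarrow> real" +
  assumes theta_ge_1: "1 \<le> \<theta>"
    and theta: "\<lbrakk>x \<in> X; y \<in> X\<rbrakk> \<Longrightarrow> d x y \<le> \<theta> * d y x"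

definition forward_ball :: "'a set \<Rightarrow> ('a \<Rightarrow> 'a \<Rightarrow> real) \<Rightarrow> 'a \<Rightarrow> real \<Rightarrow> 'a set" where
  "forward_ball X d x r = {y \<in> X. d x y < r}"

definition forward_topology :: "'a set \<Rightarrow> ('a \<Rightarrow> 'a \<Rightarrow> real) \<Rightarrow> 'a topology" where
  "forward_topology X d =
     topology_generated_by {forward_ball X d x r |x r. x \<in> X \<and> 0 < r}"

text \<open>Paths on $[0,1]$ are represented by functions on \<^typ>\<open>real\<close> that are
  \<^const>\<open>extensional\<close>, so that equal paths are equal functions.\<close>

definition geodesics :: "'a set \<Rightarrow> ('a \<Rightarrow> 'a \<Rightarrow> real) \<Rightarrow> (real \<Rightarrow> 'a) set" where
  "geodesics X d = {\<gamma> \<in> extensional {0..1}.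
     continuous_map (top_of_set {0..1}) (forward_topology X d) \<gamma> \<and>
     (\<forall>s t. 0 \<le> s \<and> s \<le> t \<and> t \<le> 1 \<longrightarrow> d (\<gamma> s) (\<gamma> t) = (t - s) * d (\<gamma> 0) (\<gamma> 1))}"

locale theta_geodesic_space = theta_metric_space \<theta> X d
  for \<theta> :: real and X :: "'a set" and d :: "'a \<Rightarrow> 'a \<Rightarrow> real" +
  assumes geodesic: "\<lbrakk>x \<in> X; y \<in> X\<rbrakk> \<Longrightarrow> \<exists>\<gamma> \<in> geodesics X d. \<gamma> 0 = x \<and> \<gamma> 1 = y"

text \<open>The uniform topology is the forward topology of the (irreversible) uniform distance.\<close>

definition uniform_dist :: "('a \<Rightarrow> 'a \<Rightarrow> real) \<Rightarrow> (real \<Rightarrow> 'a) \<Rightarrow> (real \<Rightarrow> 'a) \<Rightarrow> real" where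
  "uniform_dist d \<gamma> \<eta> = (SUP t\<in>{0..1}. d (\<gamma> t) (\<eta> t))"

definition geodesic_topology :: "'a set \<Rightarrow> ('a \<Rightarrow> 'a \<Rightarrow> real) \<Rightarrow> (real \<Rightarrow> 'a) topology" where
  "geodesic_topology X d = forward_topology (geodesics X d) (uniform_dist d)"

definition curve_length :: "('a \<Rightarrow> 'a \<Rightarrow> real) \<Rightarrow> (real \<Rightarrow> 'a) \<Rightarrow> ennreal" where
  "curve_length d \<gamma> =
     (SUP (n, \<tau>) \<in> {(n :: nat, \<tau> :: nat \<Rightarrow> real).
                      \<tau> 0 = 0 \<and> \<tau> n = 1 \<and> (\<forall>i<n. \<tau> i \<le> \<tau> (Suc i))}.
        \<Sum>i<n. ennreal (d (\<gamma> (\<tau> i)) (\<gamma> (\<tau> (Suc i)))))"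


section \<open>Approximate isometries\<close>

text \<open>The infimum is taken in \<^typ>\<open>ereal\<close>, so that the enlargement of the empty set is empty.\<close>

definition enlargement :: "'a set \<Rightarrow> ('a \<Rightarrow> 'a \<Rightarrow> real) \<Rightarrow> 'a set \<Rightarrow> real \<Rightarrow> 'a set" where
  "enlargement X d A \<epsilon> = {y \<in> X. (INF a\<in>A. ereal (d a y)) < ereal \<epsilon>}"

definition eps_isometry ::
    "'a set \<Rightarrow> ('a \<Rightarrow> 'a \<Rightarrow> real) \<Rightarrow> 'b set \<Rightarrow> ('b \<Rightarrow> 'b \<Rightarrow> real) \<Rightarrow> real \<Rightarrow> ('a \<Rightarrow> 'b) \<Rightarrow> bool" where
  "eps_isometry X1 d1 X2 d2 \<epsilon> f \<longleftrightarrow>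
     f \<in> X1 \<rightarrow> X2 \<and>
     (\<forall>x\<in>X1. \<forall>x'\<in>X1. \<bar>d2 (f x) (f x') - d1 x x'\<bar> \<le> \<epsilon>) \<and>
     X2 \<subseteq> forward_topology X2 d2 closure_of enlargement X2 d2 (f ` X1) \<epsilon>"

definition approx_inverse ::
    "'a set \<Rightarrow> 'b set \<Rightarrow> ('b \<Rightarrow> 'b \<Rightarrow> real) \<Rightarrow> real \<Rightarrow> ('a \<Rightarrow> 'b) \<Rightarrow> ('b \<Rightarrow> 'a) \<Rightarrow> bool" where
  "approx_inverse X1 X2 d2 \<epsilon> f g \<longleftrightarrow> g \<in> X2 \<rightarrow> X1 \<and> (\<forall>y\<in>X2. d2 (f (g y)) y \<le> \<epsilon>)"


section \<open>Borel measures and the weak topology\<close>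

definition borel_of :: "'a topology \<Rightarrow> 'a measure" where
  "borel_of T = sigma (topspace T) {U. openin T U}"

definition finite_borel_measures :: "'a topology \<Rightarrow> 'a measure set" where
  "finite_borel_measures T = {M. sets M = sets (borel_of T) \<and> finite_measure M}"

definition prob_borel_measures :: "'a topology \<Rightarrow> 'a measure set" where
  "prob_borel_measures T = {M. sets M = sets (borel_of T) \<and> prob_space M}"

definition weak_topology :: "'a topology \<Rightarrow> 'a measure topology" where
  "weak_topology T = topology_generated_by
     {{M \<in> finite_borel_measures T. (\<integral>x. g x \<partial>M) \<in> U} |g U.
        continuous_map T euclideanreal g \<and> bounded (g ` topspace T) \<and> open U}"

definition weak_prob_topology :: "'a topology \<Rightarrow> 'a measure topology" where
  "weak_prob_topology T = subtopology (weak_topology T) (prob_borel_measures T)"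


section \<open>Optimal transport\<close>

definition couplings :: "'a topology \<Rightarrow> 'a measure \<Rightarrow> 'a measure \<Rightarrow> ('a \<times> 'a) measure set" where
  "couplings T \<mu> \<nu> = {\<pi> \<in> prob_borel_measures (prod_topology T T).
     distr \<pi> (borel_of T) fst = \<mu> \<and> distr \<pi> (borel_of T) snd = \<nu>}"

definition transport_cost :: "('a \<Rightarrow> 'a \<Rightarrow> real) \<Rightarrow> real \<Rightarrow> ('a \<times> 'a) measure \<Rightarrow> ennreal" where
  "transport_cost d p \<pi> = (\<integral>\<^sup>+(x, y). ennreal (d x y powr p) \<partial>\<pi>)"

text \<open>The value is \<^term>\<open>\<infinity> :: ennreal\<close> if the infimum is infinite, in particular if there is
  no coupling.\<close>

definition wasserstein ::
    "'a set \<Rightarrow> ('a \<Rightarrow> 'a \<Rightarrow> real) \<Rightarrow> real \<Rightarrow> 'a measure \<Rightarrow> 'a measure \<Rightarrow> ennreal" where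
  "wasserstein X d p \<mu> \<nu> =
     (let c = (INF \<pi>\<in>couplings (forward_topology X d) \<mu> \<nu>. transport_cost d p \<pi>)
      in if c = \<infinity> then \<infinity> else ennreal (enn2real c powr (1 / p)))"

definition optimal_plan ::
    "'a set \<Rightarrow> ('a \<Rightarrow> 'a \<Rightarrow> real) \<Rightarrow> real \<Rightarrow> 'a measure \<Rightarrow> 'a measure \<Rightarrow> ('a \<times> 'a) measure \<Rightarrow> bool" where
  "optimal_plan X d p \<mu> \<nu> \<pi> \<longleftrightarrow>
     \<pi> \<in> couplings (forward_topology X d) \<mu> \<nu> \<and>
     (\<forall>\<pi>'\<in>couplings (forward_topology X d) \<mu> \<nu>. transport_cost d p \<pi> \<le> transport_cost d p \<pi>')"


section \<open>Dynamical transference plans\<close>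

definition endpoint_plan ::
    "'a set \<Rightarrow> ('a \<Rightarrow> 'a \<Rightarrow> real) \<Rightarrow> (real \<Rightarrow> 'a) measure \<Rightarrow> ('a \<times> 'a) measure" where
  "endpoint_plan X d P =
     distr P (borel_of (prod_topology (forward_topology X d) (forward_topology X d)))
       (\<lambda>\<gamma>. (\<gamma> 0, \<gamma> 1))"

definition interpolation ::
    "'a set \<Rightarrow> ('a \<Rightarrow> 'a \<Rightarrow> real) \<Rightarrow> (real \<Rightarrow> 'a) measure \<Rightarrow> real \<Rightarrow> 'a measure" where
  "interpolation X d P t = distr P (borel_of (forward_topology X d)) (\<lambda>\<gamma>. \<gamma> t)"

definition kinetic_energy ::
    "'a set \<Rightarrow> ('a \<Rightarrow> 'a \<Rightarrow> real) \<Rightarrow> (real \<Rightarrow> 'a) measure \<Rightarrow> real \<Rightarrow> 'a measure" where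
  "kinetic_energy X d P t =
     distr (density P (\<lambda>\<gamma>. curve_length d \<gamma> ^ 2 / 2)) (borel_of (forward_topology X d)) (\<lambda>\<gamma>. \<gamma> t)"

definition dynamical_optimal_plan ::
    "'a set \<Rightarrow> ('a \<Rightarrow> 'a \<Rightarrow> real) \<Rightarrow> real \<Rightarrow> (real \<Rightarrow> 'a) measure \<Rightarrow> bool" where
  "dynamical_optimal_plan X d p P \<longleftrightarrow>
     P \<in> prob_borel_measures (geodesic_topology X d) \<and>
     optimal_plan X d p
       (distr (endpoint_plan X d P) (borel_of (forward_topology X d)) fst)
       (distr (endpoint_plan X d P) (borel_of (forward_topology X d)) snd)
       (endpoint_plan X d P)"

definition displacement_interpolation ::
    "'a set \<Rightarrow> ('a \<Rightarrow> 'a \<Rightarrow> real) \<Rightarrow> real \<Rightarrow> (real \<Rightarrow> 'a measure) \<Rightarrow> bool" where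
  "displacement_interpolation X d p \<mu> \<longleftrightarrow>
     (\<exists>P. dynamical_optimal_plan X d p P \<and> (\<forall>t\<in>{0..1}. \<mu> t = interpolation X d P t))"

text \<open>The function \<open>v\<close> is a representative of the speed field at time \<open>t\<close>.\<close>

definition speed_field ::
    "'a set \<Rightarrow> ('a \<Rightarrow> 'a \<Rightarrow> real) \<Rightarrow> (real \<Rightarrow> 'a) measure \<Rightarrow> real \<Rightarrow> ('a \<Rightarrow> real) \<Rightarrow> bool" where
  "speed_field X d P t v \<longleftrightarrow>
     v \<in> borel_measurable (borel_of (forward_topology X d)) \<and> v \<in> X \<rightarrow> {0..} \<and>
     (AE x in interpolation X d P t.
        v x = sqrt (2 * enn2real (RN_deriv (interpolation X d P t) (kinetic_energy X d P t) x)))"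

text \<open>The measure on $[0,1] \times X$ carried by the graph of a measurable path in \<open>X\<close>.\<close>

definition path_measure ::
    "'a set \<Rightarrow> ('a \<Rightarrow> 'a \<Rightarrow> real) \<Rightarrow> (real \<Rightarrow> 'a) \<Rightarrow> (real \<times> 'a) measure" where
  "path_measure X d \<gamma> =
     distr (lebesgue_on {0..1})
       (borel_of (prod_topology (top_of_set {0..1}) (forward_topology X d))) (\<lambda>t. (t, \<gamma> t))"

definition path_measure_topology ::
    "'a set \<Rightarrow> ('a \<Rightarrow> 'a \<Rightarrow> real) \<Rightarrow> (real \<times> 'a) measure topology" where
  "path_measure_topology X d =
     weak_prob_topology (prod_topology (top_of_set {0..1}) (forward_topology X d))"

end

theory Submission
  imports Defs
begin

text \<open>
  The paths \<open>f k \<circ> \<gamma>\<close>, for geodesics \<open>\<gamma>\<close> of the approximating spaces, are uniformly close to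
  geodesics of the limit space (Arzela-Ascoli), and the geodesics of a compact space form a compact
  metric space. Replacing \<open>f k \<circ> \<gamma>\<close> by a nearby geodesic \<open>\<Phi> k \<gamma>\<close> therefore yields measures on one
  fixed compact space, where a weakly convergent subsequence exists; all limits of integrals follow
  by uniform continuity. Weak convergence is upgraded to couplings with small cost by means of
  partitions of unity. Gluing such couplings transports any competitor of the limit plan back to the
  approximating spaces, which proves optimality. For quadratic cost, curves in the support of an
  optimal plan satisfy Mather's shortening lemma, so at an intermediate time the speed is a
  Hoelder continuous function of the position on the support; the subsequence is chosen such that
  the supports converge as well, and the speed functions of the limit and of the approximations are
  extended from the supports.
\<close>

section \<open>Compact metric spaces and Borel sets\<close>

text \<open>Three obstacles shape the proof. The distance is not symmetric; bounded reversibility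
  makes the forward topology that of the symmetrised distance \<open>symd\<close>, so metric space
  theory applies, and \<open>d\<close> itself returns only as a function that is Lipschitz for
  \<open>symd\<close>. The maps \<open>f k\<close> are merely Borel, so
  \<open>f k \<circ> \<gamma>\<close> need not be continuous; hence the curves
  \<open>\<Phi> k \<gamma>\<close> and, for paths, measures on graphs. The speed fields are
  determined only almost everywhere, while uniform convergence on all of \<open>X\<close> is
  claimed. The speed is forced on the compact set of points that supporting curves visit at time
  \<open>t\<close>; off it the representative for the \<open>k\<close>-th plan is the limit speed
  composed with \<open>f k\<close>, which leaves only continuity of the limit speed to be used
  there. The Hoelder exponent is 1/2 because the shortening estimate bounds the square of the
  difference of two lengths by the first power of the distance of the curves at time
  \<open>t\<close>.\<close>

lemma space_borel_of [simp]: "space (borel_of T) = topspace T"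
  by (simp add: borel_of_def space_measure_of_conv)

lemma sets_borel_of: "sets (borel_of T) = sigma_sets (topspace T) {U. openin T U}"
  unfolding borel_of_def by (rule sets_measure_of) (auto dest: openin_subset)

lemma openin_sets_borel_of: "openin T U \<Longrightarrow> U \<in> sets (borel_of T)"
  by (simp add: sets_borel_of)

lemma closedin_sets_borel_of: "closedin T U \<Longrightarrow> U \<in> sets (borel_of T)"
  using sets.compl_sets[OF openin_sets_borel_of, of T "topspace T - U"]
  by (metis closedin_def double_diff order_refl space_borel_of)

lemma measurable_into_borel_of:
  assumes "f \<in> space M \<rightarrow> topspace T" "\<And>U. openin T U \<Longrightarrow> f -` U \<inter> space M \<in> sets M"
  shows "f \<in> M \<rightarrow>\<^sub>M borel_of T"
  unfolding borel_of_def
  by (rule measurable_measure_of) (use assms in \<open>auto dest: openin_subset\<close>)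

lemma continuous_map_measurable:
  assumes "continuous_map S T f"
  shows "f \<in> borel_of S \<rightarrow>\<^sub>M borel_of T"
proof (rule measurable_into_borel_of)
  show "f \<in> space (borel_of S) \<rightarrow> topspace T"
    using assms by (simp add: continuous_map_funspace)
  fix U assume "openin T U"
  then have "openin S {x \<in> topspace S. f x \<in> U}"
    using assms by (simp add: continuous_map_def)
  moreover have "f -` U \<inter> space (borel_of S) = {x \<in> topspace S. f x \<in> U}" by auto
  ultimately show "f -` U \<inter> space (borel_of S) \<in> sets (borel_of S)"
    by (simp add: openin_sets_borel_of)
qed

lemma borel_of_euclidean: "borel_of euclidean = borel"
  by (simp add: borel_of_def borel_def)

lemma continuous_map_real_measurable:
  fixes g :: "'a \<Rightarrow> real"
  assumes "continuous_map T euclideanreal g"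
  shows "g \<in> borel_measurable (borel_of T)"
  using continuous_map_measurable[OF assms] by (simp add: borel_of_euclidean)

lemma continuous_map_real_comp_measurable:
  fixes g :: "'a \<Rightarrow> real"
  assumes "continuous_map T euclideanreal g" "f \<in> M \<rightarrow>\<^sub>M borel_of T"
  shows "(\<lambda>x. g (f x)) \<in> borel_measurable M"
  using measurable_compose[OF assms(2) continuous_map_real_measurable[OF assms(1)]] .

locale compact_metric = Metric_space M d for M :: "'a set" and d +
  assumes compact: "compact_space mtopology"
begin

lemma finite_net:
  assumes "0 < e"
  obtains Z where "finite Z" "Z \<subseteq> M" "\<And>x. x \<in> M \<Longrightarrow> \<exists>z\<in>Z. d z x < e"
proof -
  have tb: "mtotally_bounded M"
    using compact compactin_imp_mtotally_bounded compact_space_def by fastforce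
  then obtain Z where Z: "finite Z" "Z \<subseteq> M" "M \<subseteq> (\<Union>x\<in>Z. mball x e)"
    using tb[unfolded mtotally_bounded_def, rule_format, OF assms] by (elim exE conjE)
  show thesis
  proof (rule that[OF Z(1,2)])
    fix x assume "x \<in> M"
    then obtain z where "z \<in> Z" "x \<in> mball z e" using Z(3) by blast
    then show "\<exists>z\<in>Z. d z x < e" by auto
  qed
qed

lemma convergent_subseq:
  assumes "\<And>n::nat. \<sigma> n \<in> M"
  obtains l r where "l \<in> M" "strict_mono (r::nat\<Rightarrow>nat)" "(\<lambda>n. d (\<sigma> (r n)) l) \<longlonglongrightarrow> 0"
proof -
  obtain l r where *: "l \<in> M" "strict_mono (r::nat\<Rightarrow>nat)" "limitin mtopology (\<sigma> \<circ> r) l sequentially"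
    using compact assms unfolding compact_space_sequentially by blast
  have "(\<lambda>n. d (\<sigma> (r n)) l) \<longlonglongrightarrow> 0"
    using *(3) unfolding limitin_metric
    by (intro tendstoI) (auto elim: eventually_mono)
  with * show thesis by (intro that)
qed

lemma Cauchy_limit:
  assumes "\<And>n::nat. \<sigma> n \<in> M" "\<And>e. 0 < e \<Longrightarrow> \<exists>N. \<forall>n\<ge>N. \<forall>m\<ge>N. d (\<sigma> n) (\<sigma> m) < e"
  obtains l where "l \<in> M" "(\<lambda>n. d (\<sigma> n) l) \<longlonglongrightarrow> 0"
proof -
  have "MCauchy \<sigma>"
    unfolding MCauchy_def using assms by blast
  then obtain l where *: "limitin mtopology \<sigma> l sequentially"
    using compact_space_imp_mcomplete[OF compact] unfolding mcomplete_def by blast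
  have "(\<lambda>n. d (\<sigma> n) l) \<longlonglongrightarrow> 0" "l \<in> M"
    using * unfolding limitin_metric
    by (auto intro!: tendstoI elim!: eventually_mono dest: spec)
  then show thesis by (intro that)
qed

lemma continuous_map_realI:
  fixes g :: "'a \<Rightarrow> real"
  assumes "\<And>x e. x \<in> M \<Longrightarrow> 0 < e \<Longrightarrow> \<exists>\<delta>>0. \<forall>y\<in>M. d x y < \<delta> \<longrightarrow> \<bar>g x - g y\<bar> < e"
  shows "continuous_map mtopology euclideanreal g"
proof -
  have "continuous_map mtopology Met_TC.mtopology g"
    unfolding metric_continuous_map[OF Met_TC.Metric_space_axioms]
    using assms by (fastforce simp: dist_real_def)
  then show ?thesis by simp
qed

lemma uniform_continuity:
  fixes g :: "'a \<Rightarrow> real"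
  assumes "continuous_map mtopology euclideanreal g" "0 < e"
  obtains \<delta> where "0 < \<delta>" "\<And>x y. x \<in> M \<Longrightarrow> y \<in> M \<Longrightarrow> d x y < \<delta> \<Longrightarrow> \<bar>g x - g y\<bar> < e"
proof -
  have "uniformly_continuous_map Self euclidean_metric g"
    by (rule continuous_imp_uniformly_continuous_map)
      (use assms compact in \<open>auto simp: Self_def\<close>)
  then show thesis
    unfolding uniformly_continuous_map_def using assms(2) that
    by (auto simp: dist_real_def)
qed

lemma mdist_bounded:
  obtains B where "0 < B" "\<And>x y. x \<in> M \<Longrightarrow> y \<in> M \<Longrightarrow> d x y \<le> B"
proof -
  have "mbounded M"
    using compact compactin_imp_mbounded compact_space_def by fastforce
  then show thesis
    using that unfolding mbounded_alt_pos by blast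
qed

lemma continuous_map_real_bounded:
  fixes g :: "'a \<Rightarrow> real"
  assumes "continuous_map mtopology euclideanreal g"
  obtains B where "0 < B" "\<And>x. x \<in> M \<Longrightarrow> \<bar>g x\<bar> \<le> B"
proof -
  have "compactin euclideanreal (g ` M)"
    using image_compactin[OF _ assms] compact unfolding compact_space_def by simp
  then have "bounded (g ` M)" by (simp add: compact_imp_bounded)
  then show thesis
    using that unfolding bounded_pos by auto
qed

lemma mdist_continuous: "z \<in> M \<Longrightarrow> continuous_map mtopology euclideanreal (d z)"
  by (rule continuous_map_realI) (metis commute mdist_reverse_triangle le_less_trans)

text \<open>Normalised tent functions of height \<open>e\<close> over a finite \<open>e\<close>-net;
  every point lies under some tent, so the normalising sum is positive. Continuity is what counts:
  integrals of these functions survive weak limits, those of indicators of a partition would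
  not.\<close>

lemma partition_of_unity:
  assumes "0 < e"
  obtains n :: nat and z and u :: "nat \<Rightarrow> 'a \<Rightarrow> real" where
    "\<And>i. i < n \<Longrightarrow> z i \<in> M"
    "\<And>i. i < n \<Longrightarrow> continuous_map mtopology euclideanreal (u i)"
    "\<And>i x. i < n \<Longrightarrow> x \<in> M \<Longrightarrow> 0 \<le> u i x"
    "\<And>i x. i < n \<Longrightarrow> x \<in> M \<Longrightarrow> u i x \<noteq> 0 \<Longrightarrow> d (z i) x < e"
    "\<And>x. x \<in> M \<Longrightarrow> (\<Sum>i<n. u i x) = 1"
proof -
  obtain Z where Z: "finite Z" "Z \<subseteq> M" "\<And>x. x \<in> M \<Longrightarrow> \<exists>z\<in>Z. d z x < e"
    using finite_net[OF assms] by metis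
  obtain z where z: "bij_betw z {..<card Z} Z"
    using ex_bij_betw_nat_finite[OF Z(1)] by (auto simp: atLeast0LessThan)
  define n where "n = card Z"
  define b where "b i x = max 0 (e - d (z i) x)" for i x
  define s where "s x = (\<Sum>i<n. b i x)" for x
  have zM: "z i \<in> M" if "i < n" for i
    using that z Z(2) unfolding n_def bij_betw_def by auto
  have spos: "0 < s x" if "x \<in> M" for x
  proof -
    obtain y where y: "y \<in> Z" "d y x < e" using Z(3) \<open>x \<in> M\<close> by blast
    have "y \<in> z ` {..<n}" using z y(1) by (simp add: n_def bij_betw_def)
    then obtain i where i: "i < n" "z i = y" by auto
    show ?thesis unfolding s_def
      by (rule sum_pos2[where i=i]) (use i y in \<open>auto simp: b_def\<close>)
  qed
  have cb: "continuous_map mtopology euclideanreal (b i)" if "i < n" for i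
    unfolding b_def using mdist_continuous[OF zM[OF that]]
    by (intro continuous_map_real_max continuous_map_diff continuous_map_const[THEN iffD2]) auto
  show thesis
  proof (rule that[of n z "\<lambda>i x. b i x / s x"])
    show "continuous_map mtopology euclideanreal (\<lambda>x. b i x / s x)" if "i < n" for i
    proof -
      have "continuous_map mtopology euclideanreal s"
        unfolding s_def using cb by (intro continuous_map_sum) auto
      then show ?thesis
        using cb[OF that] spos by (intro continuous_map_real_divide) (auto simp: less_imp_neq[symmetric])
    qed
    show "(\<Sum>i<n. b i x / s x) = 1" if "x \<in> M" for x
      using spos[OF that] by (simp add: sum_divide_distrib[symmetric] s_def)
    show "0 \<le> b i x / s x" if "i < n" "x \<in> M" for i x
      using spos[OF that(2)] by (simp add: b_def)
    show "d (z i) x < e" if "i < n" "x \<in> M" "b i x / s x \<noteq> 0" for i x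
      using that by (auto simp: b_def split: if_splits)
  qed (use zM in auto)
qed

text \<open>Each point is sent to the first point of a finite net within distance \<open>e\<close>.
  Taking the least index makes the level sets Borel, and since the target carries the discrete
  sigma-algebra, \<open>q\<close> may be followed by an arbitrary function without losing
  measurability.\<close>

lemma simple_approximation:
  assumes "0 < e"
  obtains q where "q \<in> borel_of mtopology \<rightarrow>\<^sub>M count_space M" "finite (q ` M)"
    "\<And>x. x \<in> M \<Longrightarrow> d x (q x) < e"
proof -
  obtain Z where Z: "finite Z" "Z \<subseteq> M" "\<And>x. x \<in> M \<Longrightarrow> \<exists>z\<in>Z. d z x < e"
    using finite_net[OF assms] by metis
  obtain z where z: "bij_betw z {..<card Z} Z"
    using ex_bij_betw_nat_finite[OF Z(1)] by (auto simp: atLeast0LessThan)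
  define n where "n = card Z"
  define c where "c x = (LEAST i. i < n \<and> d (z i) x < e)" for x
  note z = z[folded n_def]
  have c: "c x < n \<and> d (z (c x)) x < e" if "x \<in> M" for x
  proof -
    have "\<exists>i. i < n \<and> d (z i) x < e" using Z(3)[OF that] z unfolding bij_betw_def by auto
    then show ?thesis unfolding c_def by (rule LeastI_ex)
  qed
  have zM: "z i \<in> M" if "i < n" for i
    using that z Z(2) unfolding bij_betw_def by auto
  have lev: "{x\<in>M. i < n \<and> d (z i) x < e} \<in> sets (borel_of mtopology)" for i
  proof (cases "i < n")
    case True
    then have "{x\<in>M. i < n \<and> d (z i) x < e} = mball (z i) e" using zM by auto
    then show ?thesis by (simp add: openin_sets_borel_of)
  qed simp
  have "(\<lambda>x. i < n \<and> d (z i) x < e) \<in> borel_of mtopology \<rightarrow>\<^sub>M count_space UNIV" for i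
    unfolding pred_def using lev[of i] by (simp only: space_borel_of topspace_mtopology)
  then have "c \<in> borel_of mtopology \<rightarrow>\<^sub>M count_space UNIV"
    unfolding c_def by (rule measurable_Least)
  then have "c -` {a} \<inter> M \<in> sets (borel_of mtopology)" for a
    using measurable_sets[of c _ _ "{a}"] by fastforce
  then have mc: "c \<in> borel_of mtopology \<rightarrow>\<^sub>M count_space {..<n}"
    using c by (subst measurable_count_space_eq2) auto
  have "(\<lambda>x. z (c x)) \<in> borel_of mtopology \<rightarrow>\<^sub>M count_space M"
    by (rule measurable_compose[OF mc]) (use zM in auto)
  moreover have "finite ((\<lambda>x. z (c x)) ` M)"
  proof (rule finite_subset[OF _ Z(1)])
    have "z i \<in> Z" if "i < n" for i using bij_betwE[OF z] that by simp
    then show "(\<lambda>x. z (c x)) ` M \<subseteq> Z" using c by (metis image_subsetI)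
  qed
  moreover have "d x (z (c x)) < e" if "x \<in> M" for x
    using c[OF that] by (simp add: commute)
  ultimately show thesis by (rule that)
qed

text \<open>Balls of radius \<open>1 / (n+1)\<close> around finite nets of the same mesh. The
  countability is what product measurability and the negligibility of the complement of a support
  rest on.\<close>

lemma countable_basis:
  obtains \<B> where "countable \<B>" "\<And>V. V \<in> \<B> \<Longrightarrow> openin mtopology V"
    "\<And>U x. openin mtopology U \<Longrightarrow> x \<in> U \<Longrightarrow> \<exists>V\<in>\<B>. x \<in> V \<and> V \<subseteq> U"
proof -
  have "\<exists>Z. finite Z \<and> Z \<subseteq> M \<and> (\<forall>x\<in>M. \<exists>z\<in>Z. d z x < 1 / real (Suc n))" for n
    by (rule finite_net[of "1 / real (Suc n)"]) auto
  then obtain Z where Z: "\<And>n::nat. finite (Z n)" "\<And>n. Z n \<subseteq> M"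
      "\<And>n x. x \<in> M \<Longrightarrow> \<exists>z\<in>Z n. d z x < 1 / real (Suc n)"
    by metis
  show thesis
  proof (rule that[of "\<Union>n. (\<lambda>z. mball z (1 / real (Suc n))) ` Z n"])
    show "countable (\<Union>n. (\<lambda>z. mball z (1 / real (Suc n))) ` Z n)"
      using Z(1) by (intro countable_UN countable_image) (auto intro: countable_finite)
    fix U x assume U: "openin mtopology U" "x \<in> U"
    then obtain r where r: "r > 0" "mball x r \<subseteq> U" and xM: "x \<in> M"
      unfolding openin_mtopology by blast
    obtain n where n: "1 / real (Suc n) < r / 2"
      using nat_approx_posE[of "r/2"] r(1) by auto
    obtain z where z: "z \<in> Z n" "d z x < 1 / real (Suc n)" using Z(3) xM by blast
    have "mball z (1 / real (Suc n)) \<subseteq> U"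
    proof
      fix y assume y: "y \<in> mball z (1 / real (Suc n))"
      then have "d x y \<le> d x z + d z y" using xM triangle by auto
      then show "y \<in> U" using y z(2) n r(2) xM by (auto simp: commute)
    qed
    then show "\<exists>V\<in>\<Union>n. (\<lambda>z. mball z (1 / real (Suc n))) ` Z n. x \<in> V \<and> V \<subseteq> U"
      using z xM Z(2) by (intro bexI[of _ "mball z (1 / real (Suc n))"]) auto
  qed auto
qed

end

lemma compact_metric_prod:
  assumes "compact_metric M1 d1" "compact_metric M2 d2"
  shows "compact_metric (M1 \<times> M2) (prod_dist d1 d2)"
    and "Metric_space.mtopology (M1 \<times> M2) (prod_dist d1 d2)
      = prod_topology (Metric_space.mtopology M1 d1) (Metric_space.mtopology M2 d2)"
proof -
  interpret S1: compact_metric M1 d1 by fact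
  interpret S2: compact_metric M2 d2 by fact
  interpret Metric_space12 M1 d1 M2 d2 by unfold_locales
  show "Metric_space.mtopology (M1 \<times> M2) (prod_dist d1 d2)
      = prod_topology (Metric_space.mtopology M1 d1) (Metric_space.mtopology M2 d2)"
    by (rule mtopology_prod_metric)
  show "compact_metric (M1 \<times> M2) (prod_dist d1 d2)"
    by unfold_locales
      (simp add: mtopology_prod_metric compact_space_prod_topology S1.compact S2.compact)
qed

text \<open>By second countability every open set of the product is a countable union of open boxes.
  This makes measurability of the two coordinates sufficient for the Borel sigma-algebra of the
  product topology.\<close>

lemma measurable_borel_of_prod:
  assumes "compact_metric M1 d1" "compact_metric M2 d2"
    and f: "f \<in> N \<rightarrow>\<^sub>M borel_of (Metric_space.mtopology M1 d1)"
    and g: "g \<in> N \<rightarrow>\<^sub>M borel_of (Metric_space.mtopology M2 d2)"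
  shows "(\<lambda>x. (f x, g x)) \<in> N \<rightarrow>\<^sub>M
    borel_of (prod_topology (Metric_space.mtopology M1 d1) (Metric_space.mtopology M2 d2))"
proof -
  interpret S1: compact_metric M1 d1 by fact
  interpret S2: compact_metric M2 d2 by fact
  obtain B1 where B1: "countable B1" "\<And>V. V \<in> B1 \<Longrightarrow> openin S1.mtopology V"
    "\<And>U x. openin S1.mtopology U \<Longrightarrow> x \<in> U \<Longrightarrow> \<exists>V\<in>B1. x \<in> V \<and> V \<subseteq> U"
    by (rule S1.countable_basis) blast
  obtain B2 where B2: "countable B2" "\<And>V. V \<in> B2 \<Longrightarrow> openin S2.mtopology V"
    "\<And>U x. openin S2.mtopology U \<Longrightarrow> x \<in> U \<Longrightarrow> \<exists>V\<in>B2. x \<in> V \<and> V \<subseteq> U"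
    by (rule S2.countable_basis) blast
  show ?thesis
  proof (rule measurable_into_borel_of)
    show "(\<lambda>x. (f x, g x)) \<in> space N \<rightarrow> topspace (prod_topology S1.mtopology S2.mtopology)"
      using measurable_space[OF f] measurable_space[OF g] by auto
    fix W assume W: "openin (prod_topology S1.mtopology S2.mtopology) W"
    define C where "C = {(U, V) \<in> B1 \<times> B2. U \<times> V \<subseteq> W}"
    have "W = (\<Union>(U, V)\<in>C. U \<times> V)"
    proof
      show "W \<subseteq> (\<Union>(U, V)\<in>C. U \<times> V)"
      proof
        fix p assume p: "p \<in> W"
        obtain x y where xy: "p = (x, y)" by fastforce
        obtain U V where UV: "openin S1.mtopology U" "openin S2.mtopology V" "x \<in> U" "y \<in> V" "U \<times> V \<subseteq> W"
          using W p unfolding openin_prod_topology_alt xy by metis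
        then obtain U' V' where "U' \<in> B1" "x \<in> U'" "U' \<subseteq> U" "V' \<in> B2" "y \<in> V'" "V' \<subseteq> V"
          using B1(3)[OF UV(1,3)] B2(3)[OF UV(2,4)] by blast
        then have "(U', V') \<in> C" unfolding C_def using UV(5) by blast
        then show "p \<in> (\<Union>(U, V)\<in>C. U \<times> V)" using \<open>x \<in> U'\<close> \<open>y \<in> V'\<close> xy by blast
      qed
    qed (auto simp: C_def)
    then have "(\<lambda>x. (f x, g x)) -` W \<inter> space N
        = (\<Union>(U, V)\<in>C. (f -` U \<inter> space N) \<inter> (g -` V \<inter> space N))"
      by auto
    moreover have "countable C"
      by (rule countable_subset[of _ "B1 \<times> B2"]) (use B1(1) B2(1) in \<open>auto simp: C_def\<close>)
    moreover have "(f -` U \<inter> space N) \<inter> (g -` V \<inter> space N) \<in> sets N" if "(U, V) \<in> C" for U V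
    proof -
      have "f -` U \<inter> space N \<in> sets N" "g -` V \<inter> space N \<in> sets N"
        using that B1(2) B2(2) openin_sets_borel_of
        by (auto intro!: measurable_sets[OF f] measurable_sets[OF g] simp: C_def)
      then show ?thesis by (rule sets.Int)
    qed
    ultimately show "(\<lambda>x. (f x, g x)) -` W \<inter> space N \<in> sets N"
      by (auto intro!: sets.countable_UN')
  qed
qed

section \<open>Weak compactness of probability measures\<close>

lemma summable_code: "summable (\<lambda>n. of_bool (a n) * (1/3::real) ^ n)"
  by (rule summable_comparison_test'[of "\<lambda>n. (1/3::real) ^ n" 0]) auto

text \<open>With ratio 1/3 all digits after position \<open>j\<close> together weigh at most half of
  digit \<open>j\<close>, so the first differing digit decides with a margin. With ratio 1/2 the
  tail could cancel it and the coding would not be invertible.\<close>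

lemma code_separates:
  fixes a b :: "nat \<Rightarrow> bool"
  assumes "\<And>n. n < j \<Longrightarrow> a n = b n" "a j" "\<not> b j"
  shows "(1/3::real) ^ j / 2 \<le> (\<Sum>n. of_bool (a n) * (1/3) ^ n) - (\<Sum>n. of_bool (b n) * (1/3) ^ n)"
proof -
  have split: "(\<Sum>n. of_bool (c n) * (1/3::real) ^ n)
      = (\<Sum>n. of_bool (c (n + Suc j)) * (1/3) ^ (n + Suc j)) + (\<Sum>n<Suc j. of_bool (c n) * (1/3) ^ n)" for c
    by (rule suminf_split_initial_segment[OF summable_code])
  have "0 \<le> (\<Sum>n. of_bool (a (n + Suc j)) * (1/3::real) ^ (n + Suc j))"
    using summable_code[of a] by (intro suminf_nonneg summable_ignore_initial_segment) auto
  moreover have "(\<Sum>n. of_bool (b (n + Suc j)) * (1/3::real) ^ (n + Suc j)) \<le> (\<Sum>n. (1/3) ^ n * (1/3) ^ Suc j)"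
    using summable_code[of b]
    by (intro suminf_le summable_ignore_initial_segment summable_mult2 summable_geometric)
       (auto simp: power_add)
  moreover have "(\<Sum>n. (1/3::real) ^ n * (1/3) ^ Suc j) = (1/3) ^ j / 2"
    by (subst suminf_mult2[symmetric]) (auto simp: suminf_geometric)
  moreover have "(\<Sum>n<j. of_bool (a n) * (1/3::real) ^ n) = (\<Sum>n<j. of_bool (b n) * (1/3) ^ n)"
    using assms(1) by (intro sum.cong) auto
  ultimately show ?thesis
    using assms(2,3) unfolding split by simp
qed

lemma code_close_imp_agree:
  fixes a b :: "nat \<Rightarrow> bool"
  assumes "\<bar>(\<Sum>n. of_bool (a n) * (1/3) ^ n) - (\<Sum>n. of_bool (b n) * (1/3::real) ^ n)\<bar> < (1/3) ^ N / 2"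
  shows "\<forall>n<N. a n = b n"
proof (rule ccontr)
  assume "\<not> ?thesis"
  then have ex: "\<exists>j. j < N \<and> a j \<noteq> b j" by auto
  define j where "j = (LEAST j. j < N \<and> a j \<noteq> b j)"
  have j: "j < N" "a j \<noteq> b j" using LeastI_ex[OF ex] by (auto simp: j_def)
  have lt: "a n = b n" if "n < j" for n
    using not_less_Least[of n "\<lambda>j. j < N \<and> a j \<noteq> b j"] that j(1) by (auto simp: j_def)
  have "(1/3::real) ^ N \<le> (1/3) ^ j" using j(1) by (intro power_decreasing) auto
  moreover have "(1/3::real) ^ j / 2 \<le> \<bar>(\<Sum>n. of_bool (a n) * (1/3) ^ n) - (\<Sum>n. of_bool (b n) * (1/3)^n)\<bar>"
  proof (cases "a j")
    case True
    have "(1/3::real) ^ j / 2 \<le> (\<Sum>n. of_bool (a n) * (1/3) ^ n) - (\<Sum>n. of_bool (b n) * (1/3) ^ n)"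
      by (rule code_separates) (use True lt j in auto)
    then show ?thesis by linarith
  next
    case False
    have "(1/3::real) ^ j / 2 \<le> (\<Sum>n. of_bool (b n) * (1/3) ^ n) - (\<Sum>n. of_bool (a n) * (1/3) ^ n)"
      by (rule code_separates) (use False lt j in auto)
    then show ?thesis by linarith
  qed
  ultimately show False using assms by linarith
qed

context compact_metric
begin

text \<open>An enumerated countable base; the uniformity in \<open>e\<close> comes from compactness.
  Base sets inside balls of radius \<open>e/2\<close> cover the space, finitely many of them
  suffice, and their indices are bounded by some \<open>N\<close>; two points with the same first
  \<open>N\<close> memberships lie in a common one of them.\<close>

lemma separating_sequence:
  obtains B :: "nat \<Rightarrow> 'a set" where "\<And>n. B n \<in> sets (borel_of mtopology)"
    "\<And>e. 0 < e \<Longrightarrow> \<exists>N. \<forall>x\<in>M. \<forall>y\<in>M. (\<forall>n<N. x \<in> B n \<longleftrightarrow> y \<in> B n) \<longrightarrow> d x y < e"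
proof -
  obtain \<B> where \<B>: "countable \<B>" "\<And>V. V \<in> \<B> \<Longrightarrow> openin mtopology V"
    "\<And>U x. openin mtopology U \<Longrightarrow> x \<in> U \<Longrightarrow> \<exists>V\<in>\<B>. x \<in> V \<and> V \<subseteq> U"
    by (rule countable_basis) blast
  \<comment> \<open>The empty set is added so that there is something to enumerate even if the base
    is empty.\<close>
  define B where "B = from_nat_into (insert {} \<B>)"
  have Bin: "B n \<in> insert {} \<B>" for n
    unfolding B_def by (rule from_nat_into) simp
  have Bsurj: "\<exists>n. B n = V" if "V \<in> \<B>" for V
    unfolding B_def using from_nat_into_surj[of "insert {} \<B>" V] \<B>(1) that by auto
  show thesis
  proof (rule that)
    show "B n \<in> sets (borel_of mtopology)" for n
      using Bin[of n] \<B>(2) openin_sets_borel_of by auto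
    fix e :: real assume e: "0 < e"
    define C where "C = {V\<in>\<B>. \<exists>x\<in>M. V \<subseteq> mball x (e/2)}"
    have "M \<subseteq> \<Union>C"
    proof
      fix x assume x: "x \<in> M"
      then obtain V where "V \<in> \<B>" "x \<in> V" "V \<subseteq> mball x (e/2)"
        using \<B>(3)[of "mball x (e/2)" x] e by auto
      then show "x \<in> \<Union>C" unfolding C_def using x by blast
    qed
    then obtain F where F: "finite F" "F \<subseteq> C" "M \<subseteq> \<Union>F"
      using compact[unfolded compact_space_alt] \<B>(2) unfolding C_def
      by (smt (verit, best) mem_Collect_eq subset_iff topspace_mtopology)
    define \<iota> where "\<iota> V = (SOME n. B n = V)" for V
    have \<iota>: "B (\<iota> V) = V" if "V \<in> F" for V
      unfolding \<iota>_def by (rule someI_ex) (use Bsurj that F(2) in \<open>auto simp: C_def\<close>)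
    define N where "N = Suc (Max (\<iota> ` F))"
    have N: "\<iota> V < N" if "V \<in> F" for V
      unfolding N_def using F(1) that by (simp add: le_imp_less_Suc)
    show "\<exists>N. \<forall>x\<in>M. \<forall>y\<in>M. (\<forall>n<N. x \<in> B n \<longleftrightarrow> y \<in> B n) \<longrightarrow> d x y < e"
    proof (intro exI[of _ N] ballI impI)
      fix x y assume xy: "x \<in> M" "y \<in> M" "\<forall>n<N. x \<in> B n \<longleftrightarrow> y \<in> B n"
      obtain V where V: "V \<in> F" "x \<in> V" using F(3) xy(1) by blast
      then have "y \<in> V" using xy(3) N[OF V(1)] \<iota>[OF V(1)] by metis
      obtain z where z: "z \<in> M" "V \<subseteq> mball z (e/2)" using V(1) F(2) unfolding C_def by blast
      have "d z x < e/2" "d z y < e/2" using z(2) V(2) \<open>y \<in> V\<close> by auto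
      then show "d x y < e" using triangle''[OF xy(1) z(1) xy(2)] by linarith
    qed
  qed
qed

text \<open>Coding points by real numbers reduces compactness of the space of probability measures to
  Helly's selection theorem on the real line.\<close>

theorem weakly_convergent_subseq:
  assumes prob: "\<And>n::nat. prob_space (\<mu> n)"
    and sets: "\<And>n. sets (\<mu> n) = sets (borel_of mtopology)"
  obtains r Q where "strict_mono (r :: nat \<Rightarrow> nat)" "prob_space Q" "sets Q = sets (borel_of mtopology)"
    "\<And>g. continuous_map mtopology euclideanreal g \<Longrightarrow> (\<lambda>n. \<integral>x. g x \<partial>\<mu> (r n)) \<longlonglongrightarrow> (\<integral>x. g x \<partial>Q)"
proof -
  have space: "space (\<mu> n) = M" for n
    using sets_eq_imp_space_eq[OF sets[of n]] by simp
  obtain B :: "nat \<Rightarrow> 'a set" where B: "\<And>n. B n \<in> sets (borel_of mtopology)"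
    "\<And>e. 0 < e \<Longrightarrow> \<exists>N. \<forall>x\<in>M. \<forall>y\<in>M. (\<forall>n<N. x \<in> B n \<longleftrightarrow> y \<in> B n) \<longrightarrow> d x y < e"
    using separating_sequence by metis
  \<comment> \<open>\<open>E\<close> is Borel and injective but in general not continuous. What
    matters is that its inverse is uniformly continuous: this turns continuous functions on
    \<open>M\<close> into continuous functions of the code.\<close>
  define E where "E x = (\<Sum>n. of_bool (x \<in> B n) * (1/3::real) ^ n)" for x
  have E_close: "\<exists>\<delta>>0. \<forall>x\<in>M. \<forall>y\<in>M. \<bar>E x - E y\<bar> < \<delta> \<longrightarrow> d x y < e" if e: "0 < e" for e
  proof -
    obtain N where N: "\<forall>x\<in>M. \<forall>y\<in>M. (\<forall>n<N. x \<in> B n \<longleftrightarrow> y \<in> B n) \<longrightarrow> d x y < e"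
      using B(2)[OF e] by blast
    show ?thesis
    proof (intro exI[of _ "(1/3) ^ N / 2"] conjI ballI impI)
      fix x y assume xy: "x \<in> M" "y \<in> M" "\<bar>E x - E y\<bar> < (1/3) ^ N / 2"
      have "\<forall>n<N. (x \<in> B n) = (y \<in> B n)"
        by (rule code_close_imp_agree) (use xy(3) in \<open>simp add: E_def\<close>)
      then show "d x y < e" using N xy(1,2) by blast
    qed simp
  qed
  have E_range: "0 \<le> E x" "E x \<le> 3/2" for x
  proof -
    show "0 \<le> E x" unfolding E_def by (intro suminf_nonneg summable_code) auto
    have "E x \<le> (\<Sum>n. (1/3::real) ^ n)"
      unfolding E_def by (intro suminf_le summable_code summable_geometric) auto
    then show "E x \<le> 3/2" by (simp add: suminf_geometric)
  qed
  have E_meas: "E \<in> borel_measurable (borel_of mtopology)"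
    unfolding E_def
  proof (intro borel_measurable_suminf)
    show "(\<lambda>x. of_bool (x \<in> B n) * (1/3::real) ^ n) \<in> borel_measurable (borel_of mtopology)" for n
      using borel_measurable_times[OF borel_measurable_indicator[OF B(1)[of n]] borel_measurable_const[of "(1/3::real) ^ n"]]
      by (simp add: indicator_def of_bool_def)
  qed
  have E_meas': "E \<in> borel_measurable (\<mu> n)" for n
    using E_meas measurable_cong_sets[OF sets refl] by blast
  define \<nu> where "\<nu> n = distr (\<mu> n) borel E" for n
  have rd: "real_distribution (\<nu> n)" for n
    unfolding \<nu>_def real_distribution_def real_distribution_axioms_def
    using prob_space.prob_space_distr[OF prob E_meas'] by simp
  \<comment> \<open>Codes stay in a bounded interval, so no mass escapes and the limit on the line
    is again a probability measure.\<close>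
  have "tight \<nu>"
    unfolding tight_def
  proof (intro conjI allI impI rd)
    fix \<epsilon> :: real assume "0 < \<epsilon>"
    have "measure (\<nu> n) {-1<..2} = 1" for n
    proof -
      interpret prob_space "\<mu> n" by (rule prob)
      have "-1 < E x" "E x \<le> 2" for x using E_range[of x] by linarith+
      then have "E -` {-1<..2} \<inter> space (\<mu> n) = space (\<mu> n)" by auto
      then show ?thesis
        unfolding \<nu>_def by (subst measure_distr) (use E_meas' prob_space in auto)
    qed
    then show "\<exists>a b. a < b \<and> (\<forall>n. 1 - \<epsilon> < measure (\<nu> n) {a<..b})"
      using \<open>0 < \<epsilon>\<close> by (intro exI[of _ "-1"] exI[of _ 2]) auto
  qed
  from tight_imp_convergent_subsubsequence[OF this strict_mono_id]
  obtain r Q' where r: "strict_mono (r::nat\<Rightarrow>nat)" and Q': "real_distribution Q'"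
    and wc: "weak_conv_m (\<nu> \<circ> r) Q'" by auto
  interpret Q': real_distribution Q' by fact
  have conv: "(\<lambda>n. \<integral>x. g (E x) \<partial>\<mu> (r n)) \<longlonglongrightarrow> (\<integral>y. g y \<partial>Q')"
    if g: "continuous_on UNIV g" "\<And>y. \<bar>g y\<bar> \<le> b" for g :: "real \<Rightarrow> real" and b
  proof -
    have "(\<lambda>n. integral\<^sup>L ((\<nu> \<circ> r) n) g) \<longlonglongrightarrow> integral\<^sup>L Q' g"
      by (rule weak_conv_imp_integral_bdd_continuous_conv[of "\<nu> \<circ> r" Q' g b])
        (use rd Q' wc g in \<open>auto simp: continuous_on_eq_continuous_at\<close>)
    moreover have "integral\<^sup>L ((\<nu> \<circ> r) n) g = (\<integral>x. g (E x) \<partial>\<mu> (r n))" for n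
      unfolding \<nu>_def comp_def
      by (rule integral_distr[OF E_meas']) (use g(1) borel_measurable_continuous_onI in blast)
    ultimately show ?thesis by simp
  qed
  have "M \<noteq> {}" using prob_space.not_empty[OF prob[of 0]] space by auto
  then obtain x0 where x0: "x0 \<in> M" by blast
  \<comment> \<open>The set of codes need not be closed, so the limit on the line may charge limits
    of codes that code no point. On the closure the inverse of \<open>E\<close> still extends,
    because it is uniformly continuous and \<open>M\<close> is complete.\<close>
  define C where "C = closure (E ` M)"
  have C: "closed C" "C \<noteq> {}" "E x \<in> C" if "x \<in> M" for x
    using that x0 closure_subset[of "E ` M"] unfolding C_def by auto
  have Cclosed: "closed C" and CE: "\<And>x. x \<in> M \<Longrightarrow> E x \<in> C" and Cne: "C \<noteq> {}"
    using C x0 by auto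
  have AEC: "AE y in Q'. y \<in> C"
  proof -
    \<comment> \<open>A bounded continuous test function vanishing exactly on \<open>C\<close>; its
      integral is zero before the limit, hence after it.\<close>
    define g where "g y = min 1 (infdist y C)" for y
    have gc: "continuous_on UNIV g" unfolding g_def by (intro continuous_intros)
    have gb: "\<bar>g y\<bar> \<le> 1" for y unfolding g_def using infdist_nonneg[of y C] by auto
    have "(\<lambda>n. \<integral>x. g (E x) \<partial>\<mu> (r n)) = (\<lambda>n. 0)"
    proof
      fix n
      have "(\<integral>x. g (E x) \<partial>\<mu> (r n)) = (\<integral>x. 0 \<partial>\<mu> (r n))"
        by (rule Bochner_Integration.integral_cong) (use CE space in \<open>auto simp: g_def\<close>)
      then show "(\<integral>x. g (E x) \<partial>\<mu> (r n)) = 0" by simp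
    qed
    then have "(\<integral>y. g y \<partial>Q') = 0" using conv[OF gc gb] LIMSEQ_unique tendsto_const by metis
    moreover have "integrable Q' g"
      by (rule Q'.integrable_const_bound[where B=1])
        (use gb borel_measurable_continuous_onI[OF gc] in auto)
    moreover have "0 \<le> g y" for y unfolding g_def using infdist_nonneg[of y C] by auto
    ultimately have "AE y in Q'. g y = 0"
      by (subst (asm) integral_nonneg_eq_0_iff_AE) auto
    then show ?thesis
    proof eventually_elim
      case (elim y)
      then have "infdist y C = 0" unfolding g_def by (auto simp: min_def split: if_splits)
      then show ?case using in_closed_iff_infdist_zero[OF Cclosed Cne] by blast
    qed
  qed
  \<comment> \<open>\<open>near y x\<close> says that \<open>x\<close> is the value at
    \<open>y\<close> of the extended inverse: points whose codes approach \<open>y\<close> approach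
    \<open>x\<close>.\<close>
  define near where "near y x \<longleftrightarrow> (\<forall>e>0. \<exists>\<delta>>0. \<forall>x'\<in>M. \<bar>E x' - y\<bar> < \<delta> \<longrightarrow> d x' x < e)" for y x
  have ex_near: "\<exists>x\<in>M. near y x" if y: "y \<in> C" for y
  proof -
    obtain s where s: "\<And>n::nat. s n \<in> E ` M" "s \<longlonglongrightarrow> y"
      using y unfolding C_def closure_sequential by metis
    have "\<forall>n. \<exists>x. x \<in> M \<and> s n = E x" using s(1) by blast
    then obtain \<sigma> where \<sigma>: "\<And>n. \<sigma> n \<in> M" "\<And>n. s n = E (\<sigma> n)" by metis
    have "\<exists>N. \<forall>n\<ge>N. \<forall>m\<ge>N. d (\<sigma> n) (\<sigma> m) < e" if e: "0 < e" for e
    proof -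
      obtain \<delta> where \<delta>: "\<delta> > 0" "\<forall>x\<in>M. \<forall>y\<in>M. \<bar>E x - E y\<bar> < \<delta> \<longrightarrow> d x y < e"
        using E_close[OF e] by blast
      have "Cauchy s" using s(2) LIMSEQ_imp_Cauchy by blast
      then obtain N where "\<forall>m\<ge>N. \<forall>n\<ge>N. dist (s m) (s n) < \<delta>"
        using \<delta>(1) unfolding Cauchy_def by blast
      then show ?thesis using \<delta>(2) \<sigma> by (intro exI[of _ N]) (auto simp: dist_real_def)
    qed
    then obtain l where l: "l \<in> M" "(\<lambda>n. d (\<sigma> n) l) \<longlonglongrightarrow> 0"
      using Cauchy_limit[of \<sigma>] \<sigma>(1) by metis
    have "near y l"
      unfolding near_def
    proof (intro allI impI)
      fix e :: real assume e: "0 < e"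
      obtain \<delta> where \<delta>: "\<delta> > 0" "\<forall>x\<in>M. \<forall>y\<in>M. \<bar>E x - E y\<bar> < \<delta> \<longrightarrow> d x y < e/2"
        using E_close[of "e/2"] e by auto
      have "\<forall>\<^sub>F n in sequentially. d (\<sigma> n) l < e/2" by (rule order_tendstoD(2)[OF l(2)]) (use e in simp)
      moreover have "\<forall>\<^sub>F n in sequentially. dist (s n) y < \<delta>/2" by (rule tendstoD[OF s(2)]) (use \<delta>(1) in simp)
      ultimately obtain n where n: "d (\<sigma> n) l < e/2" "dist (s n) y < \<delta>/2"
        using eventually_happens[OF eventually_conj] by fastforce
      show "\<exists>\<delta>>0. \<forall>x'\<in>M. \<bar>E x' - y\<bar> < \<delta> \<longrightarrow> d x' l < e"
      proof (intro exI[of _ "\<delta>/2"] conjI ballI impI)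
        fix x' assume x': "x' \<in> M" "\<bar>E x' - y\<bar> < \<delta>/2"
        then have "\<bar>E x' - E (\<sigma> n)\<bar> < \<delta>" using n(2) \<sigma>(2)[of n] unfolding dist_real_def by linarith
        then have "d x' (\<sigma> n) < e/2" using \<delta>(2) x'(1) \<sigma>(1) by blast
        then show "d x' l < e" using n(1) triangle[OF x'(1) \<sigma>(1) l(1), of n] by linarith
      qed (use \<delta>(1) in simp)
    qed
    then show ?thesis using l(1) by blast
  qed
  \<comment> \<open>Off \<open>C\<close> the value is the arbitrary point \<open>x0\<close>, so that
    \<open>D\<close> maps the whole line into \<open>M\<close>; on codes \<open>D\<close> inverts
    \<open>E\<close>.\<close>
  define D where "D y = (if y \<in> C then SOME x. x \<in> M \<and> near y x else x0)" for y
  have D: "D y \<in> M \<and> near y (D y)" if "y \<in> C" for y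
    unfolding D_def using that someI_ex[of "\<lambda>x. x \<in> M \<and> near y x"] ex_near by auto
  have DM: "D y \<in> M" for y using D[of y] x0 by (cases "y \<in> C") (auto simp: D_def)
  have DE: "D (E x) = x" if x: "x \<in> M" for x
  proof (rule ccontr)
    assume ne: "D (E x) \<noteq> x"
    then have "0 < d x (D (E x))" using mdist_pos_less[OF _ x DM] by simp
    then obtain \<delta> where "\<delta> > 0" "\<forall>x'\<in>M. \<bar>E x' - E x\<bar> < \<delta> \<longrightarrow> d x' (D (E x)) < d x (D (E x))"
      using D[OF CE[OF x]] unfolding near_def by blast
    then show False using x by auto
  qed
  have D_close: "\<exists>\<delta>>0. \<forall>y\<in>C. \<forall>z\<in>C. \<bar>y - z\<bar> < \<delta> \<longrightarrow> d (D y) (D z) < e" if e: "0 < e" for e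
  proof -
    obtain \<delta> where \<delta>: "\<delta> > 0" "\<forall>x\<in>M. \<forall>y\<in>M. \<bar>E x - E y\<bar> < \<delta> \<longrightarrow> d x y < e/3"
      using E_close[of "e/3"] e by auto
    have pt: "\<exists>x\<in>M. \<bar>E x - y\<bar> < \<delta>/3 \<and> d x (D y) < e/3" if y: "y \<in> C" for y
    proof -
      obtain \<eta> where \<eta>: "\<eta> > 0" "\<forall>x'\<in>M. \<bar>E x' - y\<bar> < \<eta> \<longrightarrow> d x' (D y) < e/3"
      proof -
        have "near y (D y)" "0 < e/3" using D[OF y] e by auto
        then show thesis using that unfolding near_def by blast
      qed
      have "0 < min \<eta> (\<delta>/3)" using \<eta>(1) \<delta>(1) by simp
      then obtain x where "x \<in> M" "dist (E x) y < min \<eta> (\<delta>/3)"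
        using y unfolding C_def closure_approachable by blast
      then show ?thesis using \<eta>(2) by (auto simp: dist_real_def)
    qed
    show ?thesis
    proof (intro exI[of _ "\<delta>/3"] conjI ballI impI)
      fix y z assume yz: "y \<in> C" "z \<in> C" "\<bar>y - z\<bar> < \<delta>/3"
      obtain p where p: "p \<in> M" "\<bar>E p - y\<bar> < \<delta>/3" "d p (D y) < e/3" using pt[OF yz(1)] by blast
      obtain q where q: "q \<in> M" "\<bar>E q - z\<bar> < \<delta>/3" "d q (D z) < e/3" using pt[OF yz(2)] by blast
      have "\<bar>E p - E q\<bar> < \<delta>" using p(2) q(2) yz(3) by linarith
      then have "d p q < e/3" using \<delta>(2) p(1) q(1) by blast
      then show "d (D y) (D z) < e"
        using p(3) q(3) triangle''[OF DM p(1) DM, of y z] triangle[OF p(1) q(1) DM, of z] by linarith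
    qed (use \<delta>(1) in simp)
  qed
  have Dc: "continuous_map (top_of_set C) mtopology D"
    unfolding continuous_map_to_metric
  proof (intro ballI allI impI)
    fix y \<epsilon> :: real assume y: "y \<in> topspace (top_of_set C)" "0 < \<epsilon>"
    obtain \<delta> where \<delta>: "\<delta> > 0" "\<forall>y\<in>C. \<forall>z\<in>C. \<bar>y - z\<bar> < \<delta> \<longrightarrow> d (D y) (D z) < \<epsilon>"
      using D_close[OF y(2)] by blast
    show "\<exists>U. openin (top_of_set C) U \<and> y \<in> U \<and> (\<forall>z\<in>U. D z \<in> mball (D y) \<epsilon>)"
      using \<delta> y(1) DM by (intro exI[of _ "C \<inter> ball y \<delta>"]) (auto simp: dist_real_def openin_open)
  qed
  have Dm: "D \<in> Q' \<rightarrow>\<^sub>M borel_of mtopology"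
  proof (rule measurable_into_borel_of)
    fix U assume "openin mtopology U"
    then have "openin (top_of_set C) {y\<in>C. D y \<in> U}" using Dc by (simp add: continuous_map_def)
    then obtain O' where O': "open O'" "{y\<in>C. D y \<in> U} = C \<inter> O'" unfolding openin_open by blast
    have "D -` U \<inter> space Q' = (C \<inter> O') \<union> (if x0 \<in> U then - C else {})"
      unfolding O'(2)[symmetric] by (auto simp: D_def split: if_splits)
    then show "D -` U \<inter> space Q' \<in> sets Q'"
      using O'(1) Cclosed by auto
  qed (use DM in auto)
  define Q where "Q = distr Q' (borel_of mtopology) D"
  show thesis
  proof (rule that[OF r])
    show "prob_space Q" unfolding Q_def by (rule Q'.prob_space_distr[OF Dm])
    show "sets Q = sets (borel_of mtopology)" by (simp add: Q_def)
    fix g assume g: "continuous_map mtopology euclideanreal g"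
    obtain b where b: "0 < b" "\<And>x. x \<in> M \<Longrightarrow> \<bar>g x\<bar> \<le> b"
      using continuous_map_real_bounded[OF g] by metis
    have "continuous_on C (g \<circ> D)"
      using continuous_map_compose[OF Dc g] by simp
    \<comment> \<open>Convergence on the line is known for bounded continuous functions on all of
      it, whereas \<open>g \<circ> D\<close> is continuous on \<open>C\<close> only; Tietze's
      theorem extends it without increasing the bound.\<close>
    then obtain G where G: "continuous_on UNIV G" "\<And>y. y \<in> C \<Longrightarrow> G y = (g \<circ> D) y" "\<And>y. norm (G y) \<le> b"
      by (rule Tietze[of C "g \<circ> D" UNIV b]) (use b DM Cclosed in auto)
    have "(\<integral>x. G (E x) \<partial>\<mu> (r n)) = (\<integral>x. g x \<partial>\<mu> (r n))" for n
      by (rule Bochner_Integration.integral_cong) (use G(2) CE DE space in auto)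
    moreover have "(\<integral>y. G y \<partial>Q') = (\<integral>x. g x \<partial>Q)"
    proof -
      have "(\<integral>x. g x \<partial>Q) = (\<integral>y. g (D y) \<partial>Q')"
        unfolding Q_def by (rule integral_distr[OF Dm continuous_map_real_measurable[OF g]])
      also have "\<dots> = (\<integral>y. G y \<partial>Q')"
      proof (rule integral_cong_AE)
        show "(\<lambda>y. g (D y)) \<in> borel_measurable Q'"
          by (rule continuous_map_real_comp_measurable[OF g Dm])
        show "G \<in> borel_measurable Q'"
          using borel_measurable_continuous_onI[OF G(1)] by simp
        show "AE y in Q'. g (D y) = G y" using AEC by eventually_elim (simp add: G(2))
      qed
      finally show ?thesis by simp
    qed
    ultimately show "(\<lambda>n. \<integral>x. g x \<partial>\<mu> (r n)) \<longlonglongrightarrow> (\<integral>x. g x \<partial>Q)"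
      using conv[of G b] G by simp
  qed
qed

end

section \<open>Geodesics of irreversible metric spaces\<close>

text \<open>Convergence of one column passes to subsequences and ignores initial segments, the two
  facts that let one diagonal sequence serve all columns.\<close>

lemma (in compact_metric) diagonal_subseq:
  assumes "\<And>k n. a k n \<in> M"
  obtains r where "strict_mono (r :: nat \<Rightarrow> nat)"
    "\<And>n :: nat. \<exists>l\<in>M. (\<lambda>k. d (a (r k) n) l) \<longlonglongrightarrow> 0"
proof -
  define P where "P n s \<longleftrightarrow> (\<exists>l\<in>M. (\<lambda>k. d (a (s k) n) l) \<longlonglongrightarrow> 0)" for n and s :: "nat \<Rightarrow> nat"
  interpret subseqs P
  proof
    fix n and s :: "nat \<Rightarrow> nat" assume "strict_mono s"
    obtain l r where "l \<in> M" "strict_mono (r::nat\<Rightarrow>nat)" "(\<lambda>k. d (a (s (r k)) n) l) \<longlonglongrightarrow> 0"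
      by (rule convergent_subseq[of "\<lambda>k. a (s k) n"]) (use assms in auto)
    then show "\<exists>r'. strict_mono r' \<and> P n (s \<circ> r')" by (auto simp: P_def)
  qed
  show thesis
  proof (rule that[OF subseq_diagseq])
    fix n
    have "P n (diagseq \<circ> (+) (Suc n))"
    proof (rule diagseq_holds)
      fix r s :: "nat \<Rightarrow> nat" and n assume "strict_mono r" "P n s"
      then show "P n (s \<circ> r)"
        unfolding P_def using LIMSEQ_subseq_LIMSEQ[of _ 0 r] by (fastforce simp: o_def)
    qed
    then obtain l where "l \<in> M" "(\<lambda>k. d (a (diagseq (k + Suc n)) n) l) \<longlonglongrightarrow> 0"
      unfolding P_def by (auto simp: o_def add.commute)
    then show "\<exists>l\<in>M. (\<lambda>k. d (a (diagseq k) n) l) \<longlonglongrightarrow> 0"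
      using LIMSEQ_offset[where k="Suc n" and f="\<lambda>k. d (a (diagseq k) n) _"] by blast
  qed
qed

text \<open>The outer maximum with 0 matters only off the carrier, where \<open>d\<close> is
  arbitrary: a metric space with carrier set demands nonnegativity and symmetry for all
  arguments.\<close>

definition symd :: "('a \<Rightarrow> 'a \<Rightarrow> real) \<Rightarrow> 'a \<Rightarrow> 'a \<Rightarrow> real" where
  "symd d x y = max 0 (max (d x y) (d y x))"

lemma symd_nonneg [simp]: "0 \<le> symd d x y"
  by (simp add: symd_def)

lemma symd_commute: "symd d x y = symd d y x"
  by (simp add: symd_def max.commute)

lemma le_symd: "d x y \<le> symd d x y" "d y x \<le> symd d x y"
  by (auto simp: symd_def)

section \<open>The symmetrised distance, and geodesics of constant speed\<close>

context theta_metric_space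
begin

lemma symd_le:
  assumes "x \<in> X" "y \<in> X" shows "symd d x y \<le> \<theta> * d x y"
proof -
  have "0 \<le> d x y" using nonneg assms by blast
  then have "d x y \<le> \<theta> * d x y" "0 \<le> \<theta> * d x y"
    using theta_ge_1 mult_right_mono[of 1 \<theta> "d x y"] by auto
  then show ?thesis using theta[of y x] assms by (simp add: symd_def)
qed

lemma symd_eq_0_iff: "x \<in> X \<Longrightarrow> y \<in> X \<Longrightarrow> symd d x y = 0 \<longleftrightarrow> x = y"
  using nonneg[of x y] nonneg[of y x] zero[of x y] zero[of y x] by (auto simp: symd_def max_def)

lemma symd_triangle:
  assumes "x \<in> X" "y \<in> X" "z \<in> X" shows "symd d x z \<le> symd d x y + symd d y z"
proof -
  have "d x z \<le> d x y + d y z" "d z x \<le> d z y + d y x" using triangle assms by auto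
  then show ?thesis
    using le_symd[where x=x and y=y] le_symd[where x=y and y=z] symd_nonneg[of d x y] symd_nonneg[of d y z]
    unfolding symd_def[of d x z] by (smt (verit, best))
qed

lemma Metric_space_symd: "Metric_space X (symd d)"
  by unfold_locales (use symd_commute symd_eq_0_iff symd_triangle in auto)

text \<open>The form in which continuity of the irreversible distance is used: a detour in each
  direction shows that \<open>d\<close> is 1-Lipschitz in each argument with respect to
  \<open>symd\<close>.\<close>

lemma dist_perturb:
  assumes "x \<in> X" "y \<in> X" "x' \<in> X" "y' \<in> X"
  shows "\<bar>d x y - d x' y'\<bar> \<le> symd d x x' + symd d y y'"
proof -
  have "d x y \<le> d x x' + (d x' y' + d y' y)" "d x' y' \<le> d x' x + (d x y + d y y')"
    using triangle[of x x' y] triangle[of x' y' y] triangle[of x' x y'] triangle[of x y y'] assms by auto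
  then show ?thesis
    using le_symd(1)[of d x x'] le_symd(2)[of d x' x] le_symd(1)[of d y y'] le_symd(2)[of d y' y] by linarith
qed

lemma openin_forward_ball:
  assumes x: "x \<in> X" shows "openin (Metric_space.mtopology X (symd d)) (forward_ball X d x r)"
proof -
  interpret S: Metric_space X "symd d" by (rule Metric_space_symd)
  show ?thesis
    unfolding S.openin_mtopology
  proof (intro conjI allI impI)
    show "forward_ball X d x r \<subseteq> X" by (auto simp: forward_ball_def)
    fix y assume y: "y \<in> forward_ball X d x r"
    have "S.mball y (r - d x y) \<subseteq> forward_ball X d x r"
    proof
      fix z assume "z \<in> S.mball y (r - d x y)"
      then show "z \<in> forward_ball X d x r"
        using triangle[of x y z] x le_symd(1)[of d y z] by (auto simp: forward_ball_def)
    qed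
    then show "\<exists>r'>0. S.mball y r' \<subseteq> forward_ball X d x r"
      using y by (intro exI[of _ "r - d x y"]) (auto simp: forward_ball_def)
  qed
qed

text \<open>Forward balls are open for \<open>symd\<close> by the triangle inequality; conversely a
  forward ball of radius \<open>r / \<theta>\<close> fits into a \<open>symd\<close>-ball of radius
  \<open>r\<close>, which is where bounded reversibility enters. This moves all topological
  arguments about \<open>d\<close> to a genuine metric.\<close>

lemma forward_topology_eq: "forward_topology X d = Metric_space.mtopology X (symd d)"
proof -
  interpret S: Metric_space X "symd d" by (rule Metric_space_symd)
  show ?thesis
    unfolding topology_eq
  proof (intro allI iffI)
    fix U assume "openin (forward_topology X d) U"
    then have "generate_topology_on {forward_ball X d x r |x r. x \<in> X \<and> 0 < r} U"
      unfolding forward_topology_def by (rule openin_topology_generated_by)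
    then show "openin S.mtopology U"
      by (rule generate_topology_on_coarsest[OF istopology_openin, rotated]) (use openin_forward_ball in auto)
  next
    fix U assume U: "openin S.mtopology U"
    show "openin (forward_topology X d) U"
    proof (subst openin_subopen, intro ballI)
      fix x assume x: "x \<in> U"
      then obtain r where r: "r > 0" "S.mball x r \<subseteq> U" "x \<in> X"
        using U unfolding S.openin_mtopology by blast
      have "forward_ball X d x (r/\<theta>) \<subseteq> S.mball x r"
      proof
        fix y assume "y \<in> forward_ball X d x (r/\<theta>)"
        then have "y \<in> X" "\<theta> * d x y < r"
          using theta_ge_1 by (auto simp: forward_ball_def pos_less_divide_eq mult.commute)
        then show "y \<in> S.mball x r" using symd_le[OF r(3), of y] r(3) by simp
      qed
      moreover have "openin (forward_topology X d) (forward_ball X d x (r/\<theta>))"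
        unfolding forward_topology_def
      proof (rule topology_generated_by_Basis)
        have "0 < r / \<theta>" using r(1) theta_ge_1 by simp
        then show "forward_ball X d x (r/\<theta>) \<in> {forward_ball X d x r |x r. x \<in> X \<and> 0 < r}" using r(3) by (intro CollectI exI[of _ x] exI[of _ "r / \<theta>"] conjI refl)
      qed
      moreover have "x \<in> forward_ball X d x (r/\<theta>)"
        using r theta_ge_1 zero[of x x] by (simp add: forward_ball_def)
      ultimately show "\<exists>T. openin (forward_topology X d) T \<and> x \<in> T \<and> T \<subseteq> U"
        using r(2) by blast
    qed
  qed
qed

lemma topspace_forward_topology [simp]: "topspace (forward_topology X d) = X"
  using Metric_space.topspace_mtopology[OF Metric_space_symd] by (simp add: forward_topology_eq)

lemma geodesics_in: "\<gamma> \<in> geodesics X d \<Longrightarrow> t \<in> {0..1} \<Longrightarrow> \<gamma> t \<in> X"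
  unfolding geodesics_def continuous_map_def by auto

lemma geodesics_dist: "\<gamma> \<in> geodesics X d \<Longrightarrow> 0 \<le> s \<Longrightarrow> s \<le> t \<Longrightarrow> t \<le> 1
    \<Longrightarrow> d (\<gamma> s) (\<gamma> t) = (t - s) * d (\<gamma> 0) (\<gamma> 1)"
  unfolding geodesics_def by blast

lemma geodesics_symd_le:
  assumes "\<gamma> \<in> geodesics X d" "s \<in> {0..1}" "t \<in> {0..1}"
  shows "symd d (\<gamma> s) (\<gamma> t) \<le> \<theta> * d (\<gamma> 0) (\<gamma> 1) * \<bar>t - s\<bar>"
  using assms(2,3)
proof (induction s t rule: linorder_wlog)
  case (le s t)
  have "symd d (\<gamma> s) (\<gamma> t) \<le> \<theta> * d (\<gamma> s) (\<gamma> t)"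
    using symd_le geodesics_in assms(1) le by blast
  then show ?case using geodesics_dist[OF assms(1), of s t] le by (simp add: mult.assoc mult.left_commute mult.commute)
next
  case (sym s t)
  then show ?case by (simp add: symd_commute abs_minus_commute)
qed

text \<open>Constant speed already makes a curve Lipschitz with constant
  \<open>\<theta> * d (\<eta> 0) (\<eta> 1)\<close>, so continuity comes for free. This is
  convenient for limits of curves, where the speed identity is what is inherited directly.\<close>

lemma geodesicsI:
  assumes "\<eta> \<in> extensional {0..1}" "\<And>t. t \<in> {0..1} \<Longrightarrow> \<eta> t \<in> X"
    and dist: "\<And>s t. 0 \<le> s \<Longrightarrow> s \<le> t \<Longrightarrow> t \<le> 1 \<Longrightarrow> d (\<eta> s) (\<eta> t) = (t - s) * d (\<eta> 0) (\<eta> 1)"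
  shows "\<eta> \<in> geodesics X d"
proof -
  interpret S: Metric_space X "symd d" by (rule Metric_space_symd)
  define L where "L = \<theta> * d (\<eta> 0) (\<eta> 1)"
  have "0 \<le> L" unfolding L_def using nonneg[of "\<eta> 0" "\<eta> 1"] assms(2) theta_ge_1 by simp
  have lip: "symd d (\<eta> s) (\<eta> t) \<le> L * \<bar>t - s\<bar>" if "s \<in> {0..1}" "t \<in> {0..1}" for s t
    using that
  proof (induction s t rule: linorder_wlog)
    case (le s t)
    have "symd d (\<eta> s) (\<eta> t) \<le> \<theta> * d (\<eta> s) (\<eta> t)"
      using symd_le assms(2) le by blast
    then show ?case using dist[of s t] le by (simp add: L_def mult.assoc mult.left_commute mult.commute)
  next
    case (sym s t)
    then show ?case by (simp add: symd_commute abs_minus_commute)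
  qed
  have "continuous_map (top_of_set {0..1}) S.mtopology \<eta>"
    unfolding S.continuous_map_to_metric
  proof (intro ballI allI impI)
    fix s e :: real assume s: "s \<in> topspace (top_of_set {0..1})" and e: "0 < e"
    \<comment> \<open>\<open>L + 1\<close> instead of \<open>L\<close> keeps the denominator
      positive for constant curves.\<close>
    define \<delta> where "\<delta> = e / (L + 1)"
    have "0 < \<delta>" unfolding \<delta>_def using e \<open>0 \<le> L\<close> by simp
    have "symd d (\<eta> s) (\<eta> t) < e" if "t \<in> {0..1}" "\<bar>t - s\<bar> < \<delta>" for t
    proof -
      have "L * \<bar>t - s\<bar> \<le> L * \<delta>" using that \<open>0 \<le> L\<close> by (intro mult_left_mono) auto
      also have "\<dots> < (L + 1) * \<delta>" using \<open>0 < \<delta>\<close> by simp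
      also have "\<dots> = e" unfolding \<delta>_def using \<open>0 \<le> L\<close> by simp
      finally show ?thesis using lip[of s t] that s by simp
    qed
    with assms(2) s show "\<exists>U. openin (top_of_set {0..1}) U \<and> s \<in> U \<and> (\<forall>t\<in>U. \<eta> t \<in> S.mball (\<eta> s) e)"
    proof (intro exI[of _ "{0..1} \<inter> ball s \<delta>"] conjI ballI)
      show "openin (top_of_set {0..1}) ({0..1} \<inter> ball s \<delta>)" by (simp add: openin_open_Int)
    qed (use s assms(2) \<open>0 < \<delta>\<close> in \<open>auto simp: dist_real_def abs_minus_commute\<close>)
  qed
  then show ?thesis
    unfolding geodesics_def forward_topology_eq using assms(1) dist
    by (intro CollectI conjI allI impI) (elim conjE, assumption | assumption)+
qed

text \<open>Along a curve of constant speed the sums over a partition telescope, so the supremum is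
  taken over a single value.\<close>

lemma curve_length_geodesic:
  assumes "\<gamma> \<in> geodesics X d"
  shows "curve_length d \<gamma> = ennreal (d (\<gamma> 0) (\<gamma> 1))"
proof -
  define S where "S = {(n :: nat, \<tau> :: nat \<Rightarrow> real). \<tau> 0 = 0 \<and> \<tau> n = 1 \<and> (\<forall>i<n. \<tau> i \<le> \<tau> (Suc i))}"
  have "(\<Sum>i<n. ennreal (d (\<gamma> (\<tau> i)) (\<gamma> (\<tau> (Suc i))))) = ennreal (d (\<gamma> 0) (\<gamma> 1))"
    if "(n, \<tau>) \<in> S" for n \<tau>
  proof -
    have \<tau>: "\<tau> 0 = 0" "\<tau> n = 1" "\<And>i. i < n \<Longrightarrow> \<tau> i \<le> \<tau> (Suc i)" using that by (auto simp: S_def)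
    have ge: "0 \<le> \<tau> i" if "i \<le> n" for i
      using that by (induction i) (use \<tau> in \<open>auto intro: order_trans\<close>)
    have le: "\<tau> i \<le> 1" if "i \<le> n" for i
      using that by (induction i rule: inc_induct) (use \<tau> in \<open>auto intro: order_trans\<close>)
    have nn: "0 \<le> d (\<gamma> (\<tau> i)) (\<gamma> (\<tau> (Suc i)))" if "i < n" for i
      using that ge[of i] le[of i] ge[of "Suc i"] le[of "Suc i"] by (intro nonneg geodesics_in[OF assms]) auto
    have "(\<Sum>i<n. ennreal (d (\<gamma> (\<tau> i)) (\<gamma> (\<tau> (Suc i)))))
        = ennreal (\<Sum>i<n. d (\<gamma> (\<tau> i)) (\<gamma> (\<tau> (Suc i))))"
      by (rule sum_ennreal) (use nn in auto)
    also have "(\<Sum>i<n. d (\<gamma> (\<tau> i)) (\<gamma> (\<tau> (Suc i)))) = (\<Sum>i<n. (\<tau> (Suc i) - \<tau> i) * d (\<gamma> 0) (\<gamma> 1))"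
      by (rule sum.cong) (use ge le \<tau>(3) in \<open>auto intro!: geodesics_dist[OF assms]\<close>)
    also have "\<dots> = d (\<gamma> 0) (\<gamma> 1)"
      unfolding sum_distrib_right[symmetric] sum_lessThan_telescope using \<tau> by simp
    finally show ?thesis .
  qed
  then have eq: "(case x of (n, \<tau>) \<Rightarrow> \<Sum>i<n. ennreal (d (\<gamma> (\<tau> i)) (\<gamma> (\<tau> (Suc i))))) = ennreal (d (\<gamma> 0) (\<gamma> 1))"
    if "x \<in> S" for x using that by (cases x) auto
  \<comment> \<open>The one-step partition: the supremum is not over the empty set.\<close>
  have "(1, real) \<in> S" unfolding S_def by simp
  then have "S \<noteq> {}" by blast
  then show ?thesis
    unfolding curve_length_def S_def[symmetric] by (subst SUP_cong[OF refl eq]) (simp_all add: SUP_constant)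
qed

end

locale compact_theta_space = theta_metric_space \<theta> X d
  for \<theta> :: real and X :: "'a set" and d :: "'a \<Rightarrow> 'a \<Rightarrow> real" +
  assumes compact_forward_topology: "compact_space (forward_topology X d)"

sublocale compact_theta_space \<subseteq> S: compact_metric X "symd d"
proof -
  interpret S: Metric_space X "symd d" by (rule Metric_space_symd)
  show "compact_metric X (symd d)"
    by unfold_locales (use compact_forward_topology in \<open>simp add: forward_topology_eq\<close>)
qed

context compact_theta_space
begin

lemma dist_bounded:
  obtains B where "0 < B" "\<And>x y. x \<in> X \<Longrightarrow> y \<in> X \<Longrightarrow> d x y \<le> B" "\<And>x y. x \<in> X \<Longrightarrow> y \<in> X \<Longrightarrow> symd d x y \<le> B"
  using S.mdist_bounded le_symd(1)[of d] by (metis order_trans)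

text \<open>Arzela-Ascoli for curves in varying spaces, seen through maps that need not be
  continuous. The images are Lipschitz up to the additive error \<open>\<epsilon> k\<close>; as this
  tends to 0, convergence at a countable dense set of times still spreads uniformly over the unit
  interval. A constant sequence of spaces is allowed and yields compactness of the set of
  geodesics.\<close>

theorem geodesics_subconverge:
  assumes Y: "\<And>k::nat. theta_metric_space \<theta> (Y k) (\<rho> k)"
    and f: "\<And>k. f k \<in> Y k \<rightarrow> X"
    and isom: "\<And>k x x'. x \<in> Y k \<Longrightarrow> x' \<in> Y k \<Longrightarrow> \<bar>d (f k x) (f k x') - \<rho> k x x'\<bar> \<le> \<epsilon> k"
    and \<epsilon>: "\<epsilon> \<longlonglongrightarrow> 0"
    and \<gamma>: "\<And>k. \<gamma> k \<in> geodesics (Y k) (\<rho> k)"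
  obtains \<eta> r where "\<eta> \<in> geodesics X d" "strict_mono (r :: nat \<Rightarrow> nat)"
    "\<And>e. 0 < e \<Longrightarrow> \<exists>N. \<forall>k\<ge>N. \<forall>t\<in>{0..1}. symd d (f (r k) (\<gamma> (r k) t)) (\<eta> t) < e"
proof -
  define a where "a k t = f k (\<gamma> k t)" for k t
  \<comment> \<open>An enumeration of the rationals \<open>i / (m+1)\<close> of the unit interval;
    the minimum with 1 disposes of pairs in which \<open>i\<close> is too large.\<close>
  define q :: "nat \<Rightarrow> real" where "q n = (case prod_decode n of (i, m) \<Rightarrow> min 1 (real i / real (Suc m)))" for n
  have q: "q n \<in> {0..1}" for n unfolding q_def by (auto split: prod.split)
  have \<gamma>Y: "\<gamma> k t \<in> Y k" if "t \<in> {0..1}" for k t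
    using theta_metric_space.geodesics_in[OF Y \<gamma> that] .
  have aX: "a k t \<in> X" if "t \<in> {0..1}" for k t
    unfolding a_def using f[of k] \<gamma>Y[OF that, of k] by auto
  obtain r where r: "strict_mono (r::nat\<Rightarrow>nat)"
    "\<And>n. \<exists>l\<in>X. (\<lambda>k. symd d (a (r k) (q n)) l) \<longlonglongrightarrow> 0"
    using S.diagonal_subseq[of "\<lambda>k n. a k (q n)"] aX[OF q] by metis
  obtain B where B: "0 < B" "\<And>x y. x \<in> X \<Longrightarrow> y \<in> X \<Longrightarrow> d x y \<le> B"
    using dist_bounded by metis
  obtain E where E: "0 < E" "\<And>k. \<bar>\<epsilon> k\<bar> \<le> E"
    using BseqE[OF convergent_imp_Bseq[OF convergentI[OF \<epsilon>]]] by (metis real_norm_def)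
  \<comment> \<open>\<open>B + E\<close> bounds the lengths of all \<open>\<gamma> k\<close>, since
    the distortion of \<open>f k\<close> is at most \<open>E\<close>; the factor
    \<open>\<theta>\<close> is the price of symmetrising.\<close>
  define L where "L = \<theta> * (B + E)"
  have Lpos: "0 < L" unfolding L_def using theta_ge_1 B(1) E(1) by simp
  have lip: "symd d (a k s) (a k t) \<le> L * \<bar>t - s\<bar> + \<epsilon> k" if st: "s \<in> {0..1}" "t \<in> {0..1}" for k s t
  proof -
    have "d (a k s) (a k t) \<le> symd (\<rho> k) (\<gamma> k s) (\<gamma> k t) + \<epsilon> k" "d (a k t) (a k s) \<le> symd (\<rho> k) (\<gamma> k s) (\<gamma> k t) + \<epsilon> k"
      using isom[OF \<gamma>Y[OF st(1)] \<gamma>Y[OF st(2)], of k] isom[OF \<gamma>Y[OF st(2)] \<gamma>Y[OF st(1)], of k]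
        le_symd(1)[of "\<rho> k" "\<gamma> k s" "\<gamma> k t"] le_symd(2)[where d="\<rho> k" and x="\<gamma> k s" and y="\<gamma> k t"]
      unfolding a_def by linarith+
    moreover have "0 \<le> \<epsilon> k" using isom[OF \<gamma>Y[OF st(1)] \<gamma>Y[OF st(1)], of k] by linarith
    ultimately have 1: "symd d (a k s) (a k t) \<le> symd (\<rho> k) (\<gamma> k s) (\<gamma> k t) + \<epsilon> k"
      unfolding symd_def[of d] using symd_nonneg[of "\<rho> k" "\<gamma> k s" "\<gamma> k t"] by linarith
    have "\<rho> k (\<gamma> k 0) (\<gamma> k 1) \<le> B + E"
      using isom[OF \<gamma>Y[of 0 k] \<gamma>Y[of 1 k]] B(2)[OF aX[of 0 k] aX[of 1 k]] E(2)[of k] by (simp add: a_def)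
    then have "\<theta> * \<rho> k (\<gamma> k 0) (\<gamma> k 1) * \<bar>t - s\<bar> \<le> L * \<bar>t - s\<bar>"
      unfolding L_def using theta_ge_1 by (intro mult_right_mono mult_left_mono) auto
    then show ?thesis
      using 1 theta_metric_space.geodesics_symd_le[OF Y \<gamma> st, of k] by linarith
  qed
  define c where "c k = a (r k)" for k
  have \<epsilon>r: "(\<lambda>k. \<epsilon> (r k)) \<longlonglongrightarrow> 0" using LIMSEQ_subseq_LIMSEQ[OF \<epsilon> r(1)] by (simp add: o_def)
  have net: "\<exists>I. finite I \<and> (\<forall>t\<in>{0..1}. \<exists>n\<in>I. \<bar>t - q n\<bar> < \<delta>)" if \<delta>: "0 < \<delta>" for \<delta>
  proof -
    obtain m where m: "1 / real (Suc m) < \<delta>" using nat_approx_posE[OF \<delta>] by auto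
    have "\<exists>n\<in>(\<lambda>i. prod_encode (i, m)) ` {..Suc m}. \<bar>t - q n\<bar> < \<delta>" if t: "t \<in> {0..1}" for t
    proof -
      define i where "i = nat \<lfloor>t * real (Suc m)\<rfloor>"
      have "real i \<le> t * real (Suc m)" "t * real (Suc m) < real i + 1"
        unfolding i_def using t by (auto simp: of_nat_nat)
      moreover have "t * real (Suc m) \<le> real (Suc m)" using t by (simp add: mult_left_le_one_le)
      ultimately have i: "i \<le> Suc m" "real i / real (Suc m) \<le> t" "t < real i / real (Suc m) + 1 / real (Suc m)"
        by (linarith, auto simp: field_simps)
      have "q (prod_encode (i, m)) = real i / real (Suc m)" unfolding q_def using order_trans[OF i(2), of 1] t by simp
      then have "\<bar>t - q (prod_encode (i, m))\<bar> < \<delta>" using i(2,3) m by linarith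
      then show ?thesis using i(1) by blast
    qed
    then show ?thesis by (intro exI[of _ "(\<lambda>i. prod_encode (i, m)) ` {..Suc m}"]) auto
  qed
  have cX: "c k t \<in> X" if "t \<in> {0..1}" for k t unfolding c_def using aX[OF that] .
  have unif: "\<exists>N. \<forall>k\<ge>N. \<forall>m\<ge>N. \<forall>t\<in>{0..1}. symd d (c k t) (c m t) < e" if e: "0 < e" for e
  proof -
    \<comment> \<open>For each of the two indices the error will be below \<open>3 * e / 8\<close>:
      one eighth each from the Lipschitz bound, from \<open>\<epsilon>\<close>, and from convergence
      at the grid time.\<close>
    obtain I where I: "finite I" "\<And>t. t \<in> {0..1} \<Longrightarrow> \<exists>n\<in>I. \<bar>t - q n\<bar> < e / (8 * L)"
      using net[of "e / (8 * L)"] e Lpos by auto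
    have "\<forall>n. \<exists>l. l \<in> X \<and> (\<lambda>k. symd d (c k (q n)) l) \<longlonglongrightarrow> 0" using r(2) unfolding c_def by blast
    then obtain l where l: "\<And>n. l n \<in> X" "\<And>n. (\<lambda>k. symd d (c k (q n)) (l n)) \<longlonglongrightarrow> 0" by metis
    have "\<forall>\<^sub>F k in sequentially. \<forall>n\<in>I. symd d (c k (q n)) (l n) < e/8"
      using I(1) l(2) e by (intro eventually_ball_finite ballI order_tendstoD(2)) auto
    moreover have "\<forall>\<^sub>F k in sequentially. \<epsilon> (r k) < e/8"
      by (rule order_tendstoD(2)[OF \<epsilon>r]) (use e in simp)
    ultimately have "\<forall>\<^sub>F k in sequentially. (\<forall>n\<in>I. symd d (c k (q n)) (l n) < e/8) \<and> \<epsilon> (r k) < e/8"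
      by (rule eventually_conj)
    then obtain N where N: "\<And>k n. k \<ge> N \<Longrightarrow> n \<in> I \<Longrightarrow> symd d (c k (q n)) (l n) < e/8" "\<And>k. k \<ge> N \<Longrightarrow> \<epsilon> (r k) < e/8"
      unfolding eventually_sequentially by blast
    have "symd d (c k t) (c m t) < e" if km: "k \<ge> N" "m \<ge> N" and t: "t \<in> {0..1}" for k m t
    proof -
      obtain n where n: "n \<in> I" "\<bar>t - q n\<bar> < e / (8 * L)" using I(2)[OF t] by blast
      have Lq: "L * \<bar>q n - t\<bar> < e/8" using n(2) Lpos by (simp add: field_simps abs_minus_commute)
      have *: "symd d (c j t) (l n) < 3 * e / 8" if "j \<ge> N" for j
      proof -
        have "symd d (c j t) (c j (q n)) \<le> L * \<bar>q n - t\<bar> + \<epsilon> (r j)"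
          unfolding c_def by (rule lip[OF t q])
        then show ?thesis
          using Lq N(1)[OF that n(1)] N(2)[OF that] symd_triangle[of "c j t" "c j (q n)" "l n", OF cX[OF t] cX[OF q] l(1)] by linarith
      qed
      show ?thesis
        using *[OF km(1)] *[OF km(2)] S.triangle'[OF cX[OF t, of k] l(1)[of n] cX[OF t, of m]] e by linarith
    qed
    then show ?thesis by blast
  qed
  have lim: "\<exists>l. l \<in> X \<and> (\<lambda>k. symd d (c k t) l) \<longlonglongrightarrow> 0" if t: "t \<in> {0..1}" for t
  proof -
    have "\<exists>N. \<forall>n\<ge>N. \<forall>m\<ge>N. symd d (c n t) (c m t) < e" if e: "0 < e" for e using unif[OF e] t by blast
    then show ?thesis using S.Cauchy_limit[of "\<lambda>k. c k t"] cX[OF t] by metis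
  qed
  define \<eta> where "\<eta> = (\<lambda>t\<in>{0..1}. SOME l. l \<in> X \<and> (\<lambda>k. symd d (c k t) l) \<longlonglongrightarrow> 0)"
  have \<eta>: "\<eta> t \<in> X" "(\<lambda>k. symd d (c k t) (\<eta> t)) \<longlonglongrightarrow> 0" if t: "t \<in> {0..1}" for t
    using someI_ex[OF lim[OF t]] t unfolding \<eta>_def by auto
  have close: "\<exists>N. \<forall>k\<ge>N. \<forall>t\<in>{0..1}. symd d (c k t) (\<eta> t) < e" if e: "0 < e" for e
  proof -
    obtain N where N: "\<And>k m t. k \<ge> N \<Longrightarrow> m \<ge> N \<Longrightarrow> t \<in> {0..1} \<Longrightarrow> symd d (c k t) (c m t) < e/2"
      using unif[of "e/2"] e by (metis half_gt_zero)
    have "symd d (c k t) (\<eta> t) < e" if k: "k \<ge> N" and t: "t \<in> {0..1}" for k t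
    proof -
      have "\<forall>\<^sub>F m in sequentially. symd d (c m t) (\<eta> t) < e/2"
        by (rule order_tendstoD(2)[OF \<eta>(2)[OF t]]) (use e in simp)
      then obtain m where "m \<ge> N" "symd d (c m t) (\<eta> t) < e/2"
        using eventually_conj[OF eventually_ge_at_top[of N]] eventually_happens by (metis (mono_tags, lifting) sequentially_bot)
      then show ?thesis
        using N[OF k \<open>m \<ge> N\<close> t] symd_triangle[OF cX[OF t, of k] cX[OF t, of m] \<eta>(1)[OF t]] by linarith
    qed
    then show ?thesis by blast
  qed
  \<comment> \<open>Not only the curves but also the distances in the varying spaces converge.
    Constant speed is an equation between such distances and so passes to the limit.\<close>
  have lim_d: "(\<lambda>k. \<rho> (r k) (\<gamma> (r k) s) (\<gamma> (r k) t)) \<longlonglongrightarrow> d (\<eta> s) (\<eta> t)" if st: "s \<in> {0..1}" "t \<in> {0..1}" for s t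
  proof (rule LIM_zero_cancel)
    show "(\<lambda>k. \<rho> (r k) (\<gamma> (r k) s) (\<gamma> (r k) t) - d (\<eta> s) (\<eta> t)) \<longlonglongrightarrow> 0"
    proof (rule Lim_null_comparison)
      show "(\<lambda>k. symd d (c k s) (\<eta> s) + symd d (c k t) (\<eta> t) + \<epsilon> (r k)) \<longlonglongrightarrow> 0"
        using tendsto_add[OF tendsto_add[OF \<eta>(2)[OF st(1)] \<eta>(2)[OF st(2)]] \<epsilon>r] by simp
      have "norm (\<rho> (r k) (\<gamma> (r k) s) (\<gamma> (r k) t) - d (\<eta> s) (\<eta> t))
          \<le> symd d (c k s) (\<eta> s) + symd d (c k t) (\<eta> t) + \<epsilon> (r k)" for k
        using isom[OF \<gamma>Y[OF st(1)] \<gamma>Y[OF st(2)], of "r k"]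
          dist_perturb[OF cX[OF st(1)] cX[OF st(2)] \<eta>(1)[OF st(1)] \<eta>(1)[OF st(2)], of k k]
        unfolding c_def a_def real_norm_def by linarith
      then show "\<forall>\<^sub>F k in sequentially. norm (\<rho> (r k) (\<gamma> (r k) s) (\<gamma> (r k) t) - d (\<eta> s) (\<eta> t))
          \<le> symd d (c k s) (\<eta> s) + symd d (c k t) (\<eta> t) + \<epsilon> (r k)" by simp
    qed
  qed
  have "\<eta> \<in> geodesics X d"
  proof (rule geodesicsI)
    show "\<eta> \<in> extensional {0..1}" by (simp add: \<eta>_def)
    fix s t :: real assume st: "0 \<le> s" "s \<le> t" "t \<le> 1"
    have "\<rho> (r k) (\<gamma> (r k) s) (\<gamma> (r k) t) = (t - s) * \<rho> (r k) (\<gamma> (r k) 0) (\<gamma> (r k) 1)" for k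
      by (rule theta_metric_space.geodesics_dist[OF Y \<gamma> st])
    moreover have "(\<lambda>k. \<rho> (r k) (\<gamma> (r k) s) (\<gamma> (r k) t)) \<longlonglongrightarrow> d (\<eta> s) (\<eta> t)"
      by (rule lim_d) (use st in auto)
    moreover have "(\<lambda>k. (t - s) * \<rho> (r k) (\<gamma> (r k) 0) (\<gamma> (r k) 1)) \<longlonglongrightarrow> (t - s) * d (\<eta> 0) (\<eta> 1)"
      by (intro tendsto_mult_left lim_d) auto
    ultimately show "d (\<eta> s) (\<eta> t) = (t - s) * d (\<eta> 0) (\<eta> 1)"
      using LIMSEQ_unique by simp
  qed (use \<eta> in auto)
  then show thesis
    by (rule that[OF _ r(1)]) (use close in \<open>auto simp: c_def a_def\<close>)
qed

end

section \<open>The compact space of geodesics and its evaluation maps\<close>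

context compact_theta_space
begin

lemma dist_le_uniform_dist:
  assumes "\<gamma> \<in> geodesics X d" "\<eta> \<in> geodesics X d" "t \<in> {0..1}"
  shows "d (\<gamma> t) (\<eta> t) \<le> uniform_dist d \<gamma> \<eta>"
proof -
  obtain B where "\<And>x y. x \<in> X \<Longrightarrow> y \<in> X \<Longrightarrow> d x y \<le> B" using dist_bounded by metis
  then have "bdd_above ((\<lambda>t. d (\<gamma> t) (\<eta> t)) ` {0..1})"
    using geodesics_in assms(1,2) by (intro bdd_aboveI2[of _ _ B]) blast
  then show ?thesis
    unfolding uniform_dist_def using assms(3) by (rule cSUP_upper[rotated])
qed

lemma uniform_dist_le:
  "(\<And>t. t \<in> {0..1} \<Longrightarrow> d (\<gamma> t) (\<eta> t) \<le> c) \<Longrightarrow> uniform_dist d \<gamma> \<eta> \<le> c"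
  unfolding uniform_dist_def by (rule cSUP_least) auto

text \<open>The geodesics form a space of the same kind as \<open>X\<close>, with the same
  \<open>\<theta>\<close>. Results on compact spaces therefore apply to measures on curves without
  new proofs.\<close>

lemma theta_metric_geodesics: "theta_metric_space \<theta> (geodesics X d) (uniform_dist d)"
proof
  fix \<gamma> \<eta> \<zeta> assume \<gamma>: "\<gamma> \<in> geodesics X d" and \<eta>: "\<eta> \<in> geodesics X d"
  have nn: "0 \<le> d (\<gamma> t) (\<eta> t)" if "t \<in> {0..1}" for t
    using nonneg geodesics_in \<gamma> \<eta> that by blast
  show ge: "0 \<le> uniform_dist d \<gamma> \<eta>"
    using nn[of 0] dist_le_uniform_dist[OF \<gamma> \<eta>, of 0] by simp
  show "uniform_dist d \<gamma> \<eta> = 0 \<longleftrightarrow> \<gamma> = \<eta>"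
  proof
    assume 0: "uniform_dist d \<gamma> \<eta> = 0"
    have "\<gamma> t = \<eta> t" if t: "t \<in> {0..1}" for t
      using nn[OF t] dist_le_uniform_dist[OF \<gamma> \<eta> t] 0 zero[OF geodesics_in[OF \<gamma> t] geodesics_in[OF \<eta> t]] by simp
    then show "\<gamma> = \<eta>"
      using \<gamma> \<eta> unfolding geodesics_def by (blast intro: extensionalityI)
  next
    assume "\<gamma> = \<eta>"
    then have "d (\<gamma> t) (\<eta> t) \<le> 0" if "t \<in> {0..1}" for t
      using zero[OF geodesics_in[OF \<gamma> that] geodesics_in[OF \<eta> that]] by simp
    then show "uniform_dist d \<gamma> \<eta> = 0" using uniform_dist_le[of \<gamma> \<eta> 0] ge by force
  qed
  show "uniform_dist d \<gamma> \<eta> \<le> \<theta> * uniform_dist d \<eta> \<gamma>"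
  proof (rule uniform_dist_le)
    fix t :: real assume t: "t \<in> {0..1}"
    have "d (\<gamma> t) (\<eta> t) \<le> \<theta> * d (\<eta> t) (\<gamma> t)" using theta geodesics_in \<gamma> \<eta> t by blast
    also have "\<dots> \<le> \<theta> * uniform_dist d \<eta> \<gamma>"
      using dist_le_uniform_dist[OF \<eta> \<gamma> t] theta_ge_1 by simp
    finally show "d (\<gamma> t) (\<eta> t) \<le> \<theta> * uniform_dist d \<eta> \<gamma>" .
  qed
  assume \<zeta>: "\<zeta> \<in> geodesics X d"
  show "uniform_dist d \<gamma> \<zeta> \<le> uniform_dist d \<gamma> \<eta> + uniform_dist d \<eta> \<zeta>"
  proof (rule uniform_dist_le)
    fix t :: real assume t: "t \<in> {0..1}"
    show "d (\<gamma> t) (\<zeta> t) \<le> uniform_dist d \<gamma> \<eta> + uniform_dist d \<eta> \<zeta>"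
      using triangle[OF geodesics_in[OF \<gamma> t] geodesics_in[OF \<eta> t] geodesics_in[OF \<zeta> t]]
        dist_le_uniform_dist[OF \<gamma> \<eta> t] dist_le_uniform_dist[OF \<eta> \<zeta> t] by linarith
  qed
qed (rule theta_ge_1)

lemma symd_le_symd_uniform:
  assumes "\<gamma> \<in> geodesics X d" "\<eta> \<in> geodesics X d" "t \<in> {0..1}"
  shows "symd d (\<gamma> t) (\<eta> t) \<le> symd (uniform_dist d) \<gamma> \<eta>"
  using dist_le_uniform_dist[OF assms] dist_le_uniform_dist[OF assms(2,1,3)] unfolding symd_def by linarith

lemma symd_uniform_le:
  assumes "\<And>t. t \<in> {0..1} \<Longrightarrow> symd d (\<gamma> t) (\<eta> t) \<le> c"
  shows "symd (uniform_dist d) \<gamma> \<eta> \<le> c"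
proof -
  have "uniform_dist d \<gamma> \<eta> \<le> c" "uniform_dist d \<eta> \<gamma> \<le> c"
    by (rule uniform_dist_le, rule order_trans[OF le_symd(1) assms], assumption)
      (rule uniform_dist_le, rule order_trans[OF le_symd(2) assms], assumption)
  moreover have "0 \<le> c" by (rule order_trans[OF symd_nonneg assms[of 0]]) simp
  ultimately show ?thesis by (simp add: symd_def)
qed

text \<open>Sequential compactness is the subconvergence theorem for the constant sequence
  \<open>X\<close> with identity maps and error 0.\<close>

lemma compact_theta_geodesics: "compact_theta_space \<theta> (geodesics X d) (uniform_dist d)"
proof -
  interpret G: theta_metric_space \<theta> "geodesics X d" "uniform_dist d" by (rule theta_metric_geodesics)
  interpret GM: Metric_space "geodesics X d" "symd (uniform_dist d)" by (rule G.Metric_space_symd)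
  have "compact_space GM.mtopology"
    unfolding GM.compact_space_sequentially
  proof (intro allI impI)
    fix \<sigma> :: "nat \<Rightarrow> real \<Rightarrow> 'a" assume \<sigma>: "range \<sigma> \<subseteq> geodesics X d"
    obtain \<eta> r where \<eta>: "\<eta> \<in> geodesics X d" "strict_mono (r :: nat \<Rightarrow> nat)"
      and close: "\<And>e. 0 < e \<Longrightarrow> \<exists>N. \<forall>k\<ge>N. \<forall>t\<in>{0..1}. symd d (\<sigma> (r k) t) (\<eta> t) < e"
    proof (rule geodesics_subconverge[of "\<lambda>_. X" "\<lambda>_. d" "\<lambda>_ x. x" "\<lambda>_. 0" \<sigma>])
      show "theta_metric_space \<theta> X d" by (rule theta_metric_space_axioms)
    qed (use \<sigma> in auto)
    have "limitin GM.mtopology (\<sigma> \<circ> r) \<eta> sequentially"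
      unfolding GM.limit_metric_sequentially
    proof (intro conjI \<eta>(1) allI impI)
      fix e :: real assume "0 < e"
      then obtain N where N: "\<forall>k\<ge>N. \<forall>t\<in>{0..1}. symd d (\<sigma> (r k) t) (\<eta> t) < e/2"
        using close[of "e/2"] by auto
      have "symd (uniform_dist d) (\<sigma> (r k)) \<eta> < e" if "k \<ge> N" for k
      proof -
        have "symd (uniform_dist d) (\<sigma> (r k)) \<eta> \<le> e/2"
          by (rule symd_uniform_le) (use N that in \<open>auto intro: less_imp_le\<close>)
        then show ?thesis using \<open>0 < e\<close> by simp
      qed
      then show "\<exists>N. \<forall>n\<ge>N. (\<sigma> \<circ> r) n \<in> geodesics X d \<and> symd (uniform_dist d) ((\<sigma> \<circ> r) n) \<eta> < e"
        using \<sigma> by (intro exI[of _ N]) auto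
    qed
    then show "\<exists>l r. l \<in> geodesics X d \<and> strict_mono r \<and> limitin GM.mtopology (\<sigma> \<circ> r) l sequentially"
      using \<eta> by blast
  qed
  then show ?thesis
    by unfold_locales (simp add: G.forward_topology_eq)
qed

lemma evaluation_continuous:
  assumes "t \<in> {0..1}"
  shows "continuous_map (geodesic_topology X d) (forward_topology X d) (\<lambda>\<gamma>. \<gamma> t)"
proof -
  interpret G: compact_theta_space \<theta> "geodesics X d" "uniform_dist d" by (rule compact_theta_geodesics)
  show ?thesis
    unfolding geodesic_topology_def G.forward_topology_eq forward_topology_eq
    unfolding G.S.metric_continuous_map[OF Metric_space_symd]
  proof (intro conjI ballI allI impI)
    show "(\<lambda>\<gamma>. \<gamma> t) ` geodesics X d \<subseteq> X" using geodesics_in assms by auto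
    fix \<gamma> and e :: real assume \<gamma>: "\<gamma> \<in> geodesics X d" and e: "0 < e"
    have "symd d (\<gamma> t) (\<eta> t) < e" if "\<eta> \<in> geodesics X d \<and> symd (uniform_dist d) \<gamma> \<eta> < e" for \<eta>
      using symd_le_symd_uniform[OF \<gamma> _ assms, of \<eta>] that by simp
    then show "\<exists>\<delta>>0. \<forall>\<eta>. \<eta> \<in> geodesics X d \<and> symd (uniform_dist d) \<gamma> \<eta> < \<delta> \<longrightarrow> symd d (\<gamma> t) (\<eta> t) < e"
      using e by blast
  qed
qed

lemma evaluation_measurable:
  assumes "t \<in> {0..1}"
  shows "(\<lambda>\<gamma>. \<gamma> t) \<in> borel_of (geodesic_topology X d) \<rightarrow>\<^sub>M borel_of (forward_topology X d)"
  by (rule continuous_map_measurable[OF evaluation_continuous[OF assms]])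

lemma topspace_geodesic_topology: "topspace (geodesic_topology X d) = geodesics X d"
  unfolding geodesic_topology_def
  by (rule theta_metric_space.topspace_forward_topology[OF theta_metric_geodesics])

lemma dist_continuous:
  "continuous_map (prod_topology (forward_topology X d) (forward_topology X d)) euclideanreal (\<lambda>(x, y). d x y)"
proof -
  have P: "compact_metric (X \<times> X) (prod_dist (symd d) (symd d))"
    by (rule compact_metric_prod(1)) (rule S.compact_metric_axioms)+
  interpret P: compact_metric "X \<times> X" "prod_dist (symd d) (symd d)" by (rule P)
  interpret Q: Metric_space12 X "symd d" X "symd d" by unfold_locales
  show ?thesis
    unfolding forward_topology_eq compact_metric_prod(2)[OF S.compact_metric_axioms S.compact_metric_axioms, symmetric]
  proof (rule P.continuous_map_realI)
    fix p e assume p: "p \<in> X \<times> X" and e: "0 < (e::real)"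
    obtain x y where xy: "p = (x, y)" "x \<in> X" "y \<in> X" using p by auto
    have "\<bar>d x y - d x' y'\<bar> < e" if q: "x' \<in> X" "y' \<in> X" "prod_dist (symd d) (symd d) (x,y) (x',y') < e/2" for x' y'
      using dist_perturb[OF xy(2,3) q(1,2)] q(3) Q.component_le_prod_metric(1)[of x x' y y'] Q.component_le_prod_metric(2)[of y y' x x'] by linarith
    then show "\<exists>\<delta>>0. \<forall>q\<in>X \<times> X. prod_dist (symd d) (symd d) p q < \<delta> \<longrightarrow> \<bar>(case p of (x, y) \<Rightarrow> d x y) - (case q of (x, y) \<Rightarrow> d x y)\<bar> < e"
      using e xy by (intro exI[of _ "e/2"]) auto
  qed
qed

lemma measurable_pairI:
  assumes "f \<in> N \<rightarrow>\<^sub>M borel_of (forward_topology X d)" "g \<in> N \<rightarrow>\<^sub>M borel_of (forward_topology X d)"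
  shows "(\<lambda>x. (f x, g x)) \<in> N \<rightarrow>\<^sub>M borel_of (prod_topology (forward_topology X d) (forward_topology X d))"
  using measurable_borel_of_prod[OF S.compact_metric_axioms S.compact_metric_axioms] assms
  unfolding forward_topology_eq by blast

lemma dist_measurable:
  assumes "f \<in> N \<rightarrow>\<^sub>M borel_of (forward_topology X d)" "g \<in> N \<rightarrow>\<^sub>M borel_of (forward_topology X d)"
  shows "(\<lambda>x. d (f x) (g x)) \<in> borel_measurable N"
  using continuous_map_real_comp_measurable[OF dist_continuous measurable_pairI[OF assms]] by simp

lemma endpoint_continuous:
  "continuous_map (geodesic_topology X d) (prod_topology (forward_topology X d) (forward_topology X d)) (\<lambda>\<gamma>. (\<gamma> 0, \<gamma> 1))"
  using evaluation_continuous[of 0] evaluation_continuous[of 1] by (simp add: continuous_map_pairedI)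

lemma length_continuous:
  "continuous_map (geodesic_topology X d) euclideanreal (\<lambda>\<gamma>. d (\<gamma> 0) (\<gamma> 1))"
  using continuous_map_compose[OF endpoint_continuous dist_continuous] by (simp add: o_def)

end

section \<open>Weak topologies and path measures\<close>

lemma topspace_weak_topology: "topspace (weak_topology T) = finite_borel_measures T"
proof -
  have "finite_borel_measures T \<in> {{M \<in> finite_borel_measures T. (\<integral>x. g x \<partial>M) \<in> U} |g U.
        continuous_map T euclideanreal g \<and> bounded (g ` topspace T) \<and> open U}"
    by (intro CollectI exI[of _ "\<lambda>_. 0"] exI[of _ UNIV]) (auto simp: image_constant_conv)
  then show ?thesis
    unfolding weak_topology_def topology_generated_by_topspace by blast
qed

lemma prob_imp_finite_borel_measures: "prob_borel_measures T \<subseteq> finite_borel_measures T"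
  by (auto simp: prob_borel_measures_def finite_borel_measures_def prob_space_def)

lemma topspace_weak_prob_topology: "topspace (weak_prob_topology T) = prob_borel_measures T"
  using prob_imp_finite_borel_measures by (auto simp: weak_prob_topology_def topspace_weak_topology)

text \<open>Open sets of a generated topology arise from subbasic ones by finite intersections and
  unions. That a neighbourhood of \<open>Q\<close> contains almost all terms is preserved by both
  operations, so it need be checked on subbasic sets only.\<close>

lemma limitin_weak_topologyI:
  assumes "\<And>n. N n \<in> finite_borel_measures T" "Q \<in> finite_borel_measures T"
    and conv: "\<And>g. continuous_map T euclideanreal g \<Longrightarrow> bounded (g ` topspace T)
      \<Longrightarrow> (\<lambda>n. \<integral>x. g x \<partial>N n) \<longlonglongrightarrow> (\<integral>x. g x \<partial>Q)"
  shows "limitin (weak_topology T) N Q sequentially"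
proof -
  have "\<forall>\<^sub>F n in sequentially. N n \<in> U" if "openin (weak_topology T) U" "Q \<in> U" for U
  proof -
    have "generate_topology_on {{M \<in> finite_borel_measures T. (\<integral>x. g x \<partial>M) \<in> U} |g U.
        continuous_map T euclideanreal g \<and> bounded (g ` topspace T) \<and> open U} U"
      using that(1) unfolding weak_topology_def by (rule openin_topology_generated_by)
    then show ?thesis using that(2)
    proof (induction)
      case (Int a b)
      then show ?case by (auto intro: eventually_conj)
    next
      case (UN K)
      then obtain k where "k \<in> K" "Q \<in> k" by blast
      from UN.IH[OF this] show ?case by (rule eventually_mono) (use \<open>k \<in> K\<close> in blast)
    next
      case (Basis s)
      then obtain g V where s: "s = {M \<in> finite_borel_measures T. (\<integral>x. g x \<partial>M) \<in> V}"
        "continuous_map T euclideanreal g" "bounded (g ` topspace T)" "open V" by blast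
      then have "\<forall>\<^sub>F n in sequentially. (\<integral>x. g x \<partial>N n) \<in> V"
        using topological_tendstoD[OF conv[OF s(2,3)] s(4)] Basis.prems by simp
      then show ?case using s(1) assms(1) by simp
    qed simp
  qed
  then show ?thesis
    unfolding limitin_def topspace_weak_topology using assms(2) by blast
qed

lemma limitin_weak_prob_topologyI:
  assumes "\<And>n. N n \<in> prob_borel_measures T" "Q \<in> prob_borel_measures T"
    and "\<And>g. continuous_map T euclideanreal g \<Longrightarrow> bounded (g ` topspace T)
      \<Longrightarrow> (\<lambda>n. \<integral>x. g x \<partial>N n) \<longlonglongrightarrow> (\<integral>x. g x \<partial>Q)"
  shows "limitin (weak_prob_topology T) N Q sequentially"
  unfolding weak_prob_topology_def limitin_subtopology
proof (intro conjI)
  show "limitin (weak_topology T) N Q sequentially"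
    by (rule limitin_weak_topologyI) (use assms prob_imp_finite_borel_measures in blast)+
qed (use assms in auto)

lemma continuous_map_into_weak_prob_topology:
  assumes "\<And>s. s \<in> topspace S \<Longrightarrow> F s \<in> prob_borel_measures T"
    and "\<And>g. continuous_map T euclideanreal g \<Longrightarrow> bounded (g ` topspace T)
      \<Longrightarrow> continuous_map S euclideanreal (\<lambda>s. \<integral>x. g x \<partial>F s)"
  shows "continuous_map S (weak_prob_topology T) F"
proof -
  have fin: "F s \<in> finite_borel_measures T" if "s \<in> topspace S" for s
    using assms(1)[OF that] prob_imp_finite_borel_measures by blast
  have "continuous_map S (weak_topology T) F"
    unfolding weak_topology_def
  proof (rule continuous_on_generated_topo)
    fix W assume "W \<in> {{M \<in> finite_borel_measures T. (\<integral>x. g x \<partial>M) \<in> U} |g U.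
      continuous_map T euclideanreal g \<and> bounded (g ` topspace T) \<and> open U}"
    then obtain g U where W: "W = {M \<in> finite_borel_measures T. (\<integral>x. g x \<partial>M) \<in> U}"
      "continuous_map T euclideanreal g" "bounded (g ` topspace T)" "open U" by blast
    have "F -` W \<inter> topspace S = {s \<in> topspace S. (\<integral>x. g x \<partial>F s) \<in> U}"
      unfolding W(1) using fin by auto
    also have "openin S \<dots>"
      by (rule openin_continuous_map_preimage[OF assms(2)[OF W(2,3)]]) (use W(4) in simp)
    finally show "openin S (F -` W \<inter> topspace S)" .
  next
    show "F ` topspace S \<subseteq> \<Union> {{M \<in> finite_borel_measures T. (\<integral>x. g x \<partial>M) \<in> U} |g U.
      continuous_map T euclideanreal g \<and> bounded (g ` topspace T) \<and> open U}"
      using fin topspace_weak_topology[of T]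
      unfolding weak_topology_def topology_generated_by_topspace by blast
  qed
  then show ?thesis
    unfolding weak_prob_topology_def using assms(1) by (auto simp: continuous_map_in_subtopology)
qed

lemma prob_borel_measuresD:
  assumes "Q \<in> prob_borel_measures T"
  shows "prob_space Q" "sets Q = sets (borel_of T)" "space Q = topspace T"
  using assms sets_eq_imp_space_eq[of Q "borel_of T"] by (auto simp: prob_borel_measures_def)

lemma prob_borel_measures_distr:
  assumes "prob_space N" "f \<in> N \<rightarrow>\<^sub>M borel_of T"
  shows "distr N (borel_of T) f \<in> prob_borel_measures T"
  using prob_space.prob_space_distr[OF assms] by (simp add: prob_borel_measures_def)

context compact_metric
begin

lemma integrable_continuous:
  fixes g :: "'a \<Rightarrow> real"
  assumes "finite_measure Q" "sets Q = sets (borel_of mtopology)" "continuous_map mtopology euclideanreal g"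
  shows "integrable Q g"
proof -
  obtain B where "\<And>x. x \<in> M \<Longrightarrow> \<bar>g x\<bar> \<le> B" using continuous_map_real_bounded[OF assms(3)] by metis
  moreover have "space Q = M" using sets_eq_imp_space_eq[OF assms(2)] by simp
  moreover have "g \<in> borel_measurable Q"
    using continuous_map_real_measurable[OF assms(3)] measurable_cong_sets[OF assms(2) refl] by blast
  ultimately show ?thesis
    by (intro finite_measure.integrable_const_bound[OF assms(1), of _ B]) auto
qed

text \<open>The weak topology on probability measures is induced by the integrals of the countably many
  functions of a sequence of ever finer partitions of unity, hence second countable.\<close>

theorem measurable_into_weak_prob:
  assumes F: "\<And>\<omega>. \<omega> \<in> space N \<Longrightarrow> F \<omega> \<in> prob_borel_measures mtopology"
    and meas: "\<And>g. continuous_map mtopology euclideanreal g \<Longrightarrow> (\<lambda>\<omega>. \<integral>x. g x \<partial>F \<omega>) \<in> borel_measurable N"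
  shows "F \<in> N \<rightarrow>\<^sub>M borel_of (weak_prob_topology mtopology)"
proof -
  define P where "P = prob_borel_measures mtopology"
  \<comment> \<open>Bundled into one predicate so that number, centres and functions can be chosen
    at once for all meshes.\<close>
  define pu where "pu n K z u \<longleftrightarrow>
    (\<forall>i<K. z i \<in> M) \<and> (\<forall>i<K. continuous_map mtopology euclideanreal (u i))
    \<and> (\<forall>i<K. \<forall>x\<in>M. 0 \<le> u i x) \<and> (\<forall>i<K. \<forall>x\<in>M. u i x \<noteq> 0 \<longrightarrow> d (z i) x < 1 / real (Suc n))
    \<and> (\<forall>x\<in>M. (\<Sum>i<K. u i x) = 1)" for n K z and u :: "nat \<Rightarrow> 'a \<Rightarrow> real"
  have "\<exists>K z u. pu n K z u" for n
    unfolding pu_def by (rule partition_of_unity[of "1 / real (Suc n)"]) (simp, blast)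
  then obtain K z u where pu: "\<And>n. pu n (K n) (z n) (u n)" by metis
  have zM: "z n i \<in> M" and cu: "continuous_map mtopology euclideanreal (u n i)" if "i < K n" for n i
    using pu[of n] that unfolding pu_def by blast+
  have u0: "0 \<le> u n i x" and us: "u n i x \<noteq> 0 \<Longrightarrow> d (z n i) x < 1 / real (Suc n)"
    if "i < K n" "x \<in> M" for n i x
    using pu[of n] that unfolding pu_def by blast+
  have u1: "(\<Sum>i<K n. u n i x) = 1" if "x \<in> M" for n x
    using pu[of n] that unfolding pu_def by blast
  \<comment> \<open>The coordinates of a measure: its integrals against all partition functions,
    with 0 for surplus indices. On probability measures every weakly open set turns out to be an
    open condition on these countably many numbers.\<close>
  define V :: "'a measure \<Rightarrow> nat \<times> nat \<Rightarrow> real" where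
    "V Q = (\<lambda>(n, i). if i < K n then \<integral>x. u n i x \<partial>Q else 0)" for Q
  \<comment> \<open>Riemann sums: \<open>g\<close> is replaced by its values at the centres, with an
    error that is uniform over all probability measures.\<close>
  have approx: "\<exists>n. \<forall>Q\<in>P. \<bar>(\<integral>x. g x \<partial>Q) - (\<Sum>i<K n. g (z n i) * V Q (n, i))\<bar> \<le> e"
    if g: "continuous_map mtopology euclideanreal g" and e: "0 < e" for g e
  proof -
    obtain \<delta> where \<delta>: "0 < \<delta>" "\<And>x y. x \<in> M \<Longrightarrow> y \<in> M \<Longrightarrow> d x y < \<delta> \<Longrightarrow> \<bar>g x - g y\<bar> < e"
      using uniform_continuity[OF g e] by metis
    obtain n where n: "1 / real (Suc n) < \<delta>" using nat_approx_posE[OF \<delta>(1)] by auto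
    have pt: "\<bar>g x - (\<Sum>i<K n. g (z n i) * u n i x)\<bar> \<le> e" if x: "x \<in> M" for x
    proof -
      have "g x - (\<Sum>i<K n. g (z n i) * u n i x) = (\<Sum>i<K n. (g x - g (z n i)) * u n i x)"
        using u1[OF x, of n] by (simp add: left_diff_distrib sum_subtractf sum_distrib_left[symmetric])
      also have "\<bar>\<dots>\<bar> \<le> (\<Sum>i<K n. \<bar>(g x - g (z n i)) * u n i x\<bar>)" by (rule sum_abs)
      also have "\<dots> \<le> (\<Sum>i<K n. e * u n i x)"
      proof (rule sum_mono)
        fix i assume "i \<in> {..<K n}"
        then have i: "i < K n" by simp
        show "\<bar>(g x - g (z n i)) * u n i x\<bar> \<le> e * u n i x"
        proof (cases "u n i x = 0")
          case False
          then have "\<bar>g x - g (z n i)\<bar> < e"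
            using \<delta>(2)[OF x zM[OF i]] us[OF i x] n by (simp add: commute)
          then show ?thesis using u0[OF i x] by (simp add: abs_mult mult_right_mono)
        qed simp
      qed
      also have "\<dots> = e" using u1[OF x, of n] by (simp add: sum_distrib_left[symmetric])
      finally show ?thesis .
    qed
    have "\<bar>(\<integral>x. g x \<partial>Q) - (\<Sum>i<K n. g (z n i) * V Q (n, i))\<bar> \<le> e" if Q: "Q \<in> P" for Q
    proof -
      interpret prob_space Q using Q unfolding P_def by (rule prob_borel_measuresD)
      have sQ: "sets Q = sets (borel_of mtopology)" "space Q = M"
        using Q prob_borel_measuresD[of Q mtopology] unfolding P_def by auto
      note int = integrable_continuous[OF finite_measure_axioms sQ(1)]
      have int_sum: "integrable Q (\<lambda>x. \<Sum>i<K n. g (z n i) * u n i x)"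
        using int[OF cu] by (intro Bochner_Integration.integrable_sum integrable_mult_right) auto
      have "(\<Sum>i<K n. g (z n i) * V Q (n, i)) = (\<integral>x. (\<Sum>i<K n. g (z n i) * u n i x) \<partial>Q)"
        using int[OF cu] by (subst Bochner_Integration.integral_sum) (auto simp: V_def)
      then have "\<bar>(\<integral>x. g x \<partial>Q) - (\<Sum>i<K n. g (z n i) * V Q (n, i))\<bar>
          = \<bar>\<integral>x. g x - (\<Sum>i<K n. g (z n i) * u n i x) \<partial>Q\<bar>"
        using int[OF g] int_sum by simp
      also have "\<dots> \<le> (\<integral>x. \<bar>g x - (\<Sum>i<K n. g (z n i) * u n i x)\<bar> \<partial>Q)"
        by (rule integral_abs_bound)
      also have "\<dots> \<le> (\<integral>x. e \<partial>Q)"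
        using int[OF g] int_sum pt sQ(2) by (intro integral_mono integrable_abs Bochner_Integration.integrable_diff) auto
      finally show ?thesis by (simp add: prob_space)
    qed
    then show ?thesis by blast
  qed
  have induced: "\<exists>W. open W \<and> U \<inter> P = {Q \<in> P. V Q \<in> W}" if "openin (weak_topology mtopology) U" for U
  proof -
    have "generate_topology_on {{M \<in> finite_borel_measures mtopology. (\<integral>x. g x \<partial>M) \<in> U} |g U.
        continuous_map mtopology euclideanreal g \<and> bounded (g ` topspace mtopology) \<and> open U} U"
      using that unfolding weak_topology_def by (rule openin_topology_generated_by)
    then show ?thesis
    proof (induction)
      case Empty
      then show ?case by (intro exI[of _ "{}"]) auto
    next
      case (Int a b)
      then obtain Wa Wb where "open Wa" "a \<inter> P = {Q \<in> P. V Q \<in> Wa}" "open Wb" "b \<inter> P = {Q \<in> P. V Q \<in> Wb}" by blast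
      then show ?case by (intro exI[of _ "Wa \<inter> Wb"]) auto
    next
      case (UN K)
      then have "\<forall>k. \<exists>W. k \<in> K \<longrightarrow> open W \<and> k \<inter> P = {Q \<in> P. V Q \<in> W}" by blast
      then obtain W where "\<And>k. k \<in> K \<Longrightarrow> open (W k)" "\<And>k. k \<in> K \<Longrightarrow> k \<inter> P = {Q \<in> P. V Q \<in> W k}" by metis
      then show ?case by (intro exI[of _ "\<Union>k\<in>K. W k"]) blast
    next
      case (Basis s)
      then obtain g U where s: "s = {M \<in> finite_borel_measures mtopology. (\<integral>x. g x \<partial>M) \<in> U}"
        and g: "continuous_map mtopology euclideanreal g" and U: "open U" by blast
      \<comment> \<open>The largest open set of coordinates that fits into \<open>s\<close>; the
        work lies in showing that it is large enough. Two approximation errors and one change of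
        coordinates, \<open>e/4\<close> each, stay below \<open>e\<close>.\<close>
      define W where "W = \<Union>{W'. open W' \<and> (\<forall>Q\<in>P. V Q \<in> W' \<longrightarrow> Q \<in> s)}"
      have "V Q \<in> W" if Q: "Q \<in> P" "Q \<in> s" for Q
      proof -
        have "(\<integral>x. g x \<partial>Q) \<in> U" using Q(2) s by simp
        then obtain e where e: "0 < e" "ball (\<integral>x. g x \<partial>Q) e \<subseteq> U" using U open_contains_ball by blast
        obtain n where n: "\<And>Q. Q \<in> P \<Longrightarrow> \<bar>(\<integral>x. g x \<partial>Q) - (\<Sum>i<K n. g (z n i) * V Q (n, i))\<bar> \<le> e/4"
          using approx[OF g, of "e/4"] e(1) by auto
        define h where "h v = (\<Sum>i<K n. g (z n i) * v (n, i))" for v :: "nat \<times> nat \<Rightarrow> real"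
        have "continuous_on UNIV h"
          unfolding h_def by (intro continuous_intros continuous_on_product_coordinates)
        then have "open (h -` ball (h (V Q)) (e/4))"
          by (intro open_vimage) auto
        moreover have "Q' \<in> s" if Q': "Q' \<in> P" "V Q' \<in> h -` ball (h (V Q)) (e/4)" for Q'
        proof -
          have "\<bar>h (V Q) - h (V Q')\<bar> < e/4" using Q'(2) by (simp add: dist_real_def)
          then have "(\<integral>x. g x \<partial>Q') \<in> ball (\<integral>x. g x \<partial>Q) e"
            using n[OF Q'(1)] n[OF Q(1)] e(1) unfolding h_def[symmetric] mem_ball dist_real_def by linarith
          then show ?thesis
            using e(2) Q'(1) prob_imp_finite_borel_measures unfolding s P_def by blast
        qed
        ultimately show ?thesis unfolding W_def using e(1) by (intro UnionI[of "h -` ball (h (V Q)) (e/4)"]) auto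
      qed
      then have "s \<inter> P = {Q \<in> P. V Q \<in> W}" unfolding W_def by auto
      moreover have "open W" unfolding W_def by blast
      ultimately show ?case by blast
    qed
  qed
  have Vm: "(\<lambda>\<omega>. V (F \<omega>)) \<in> borel_measurable N"
  proof (rule measurable_coordinatewise_then_product)
    fix p :: "nat \<times> nat"
    obtain n i where p: "p = (n, i)" by fastforce
    show "(\<lambda>\<omega>. V (F \<omega>) p) \<in> borel_measurable N"
      using meas[OF cu] by (cases "i < K n") (auto simp: p V_def)
  qed
  show ?thesis
  proof (rule measurable_into_borel_of)
    show "F \<in> space N \<rightarrow> topspace (weak_prob_topology mtopology)"
      using F by (simp add: topspace_weak_prob_topology)
    fix U assume "openin (weak_prob_topology mtopology) U"
    then obtain U' where U': "openin (weak_topology mtopology) U'" "U = U' \<inter> P"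
      unfolding weak_prob_topology_def openin_subtopology P_def by blast
    obtain W where W: "open W" "U = {Q \<in> P. V Q \<in> W}" using induced[OF U'(1)] U'(2) by blast
    have "F -` U \<inter> space N = (\<lambda>\<omega>. V (F \<omega>)) -` W \<inter> space N"
      using F unfolding W(2) P_def by auto
    also have "\<dots> \<in> sets N" by (rule measurable_sets[OF Vm]) (use W(1) in simp)
    finally show "F -` U \<inter> space N \<in> sets N" .
  qed
qed

end

section \<open>Measures carried by the graphs of paths\<close>

lemma compact_metric_unit_interval:
  "compact_metric {0..1::real} dist" "Metric_space.mtopology {0..1::real} dist = top_of_set {0..1}"
proof -
  interpret Submetric UNIV dist "{0..1::real}" by unfold_locales auto
  show eq: "Metric_space.mtopology {0..1::real} dist = top_of_set {0..1}"
    using mtopology_submetric by simp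
  show "compact_metric {0..1::real} dist"
    by unfold_locales (simp add: eq compact_space_subtopology)
qed

lemma lebesgue_on_unit_measurable: "(\<lambda>t. t) \<in> lebesgue_on {0..1::real} \<rightarrow>\<^sub>M borel_of (top_of_set {0..1})"
proof (rule measurable_into_borel_of)
  fix U assume "openin (top_of_set {0..1::real}) U"
  then obtain O' where "open O'" "U = {0..1} \<inter> O'" unfolding openin_open by blast
  then show "(\<lambda>t. t) -` U \<inter> space (lebesgue_on {0..1}) \<in> sets (lebesgue_on {0..1})"
    by (auto simp: sets_restrict_space_iff)
qed simp

lemma prob_space_lebesgue_on_unit: "prob_space (lebesgue_on {0..1::real})"
  by (rule prob_spaceI) (simp add: emeasure_restrict_space)

context compact_theta_space
begin

abbreviation (input) "path_dom \<equiv> prod_topology (top_of_set {0..1::real}) (forward_topology X d)"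

lemma path_dom_eq: "path_dom = Metric_space.mtopology ({0..1::real} \<times> X) (prod_dist dist (symd d))"
  using compact_metric_prod(2)[OF compact_metric_unit_interval(1) S.compact_metric_axioms]
  by (simp add: compact_metric_unit_interval(2) forward_topology_eq)

lemma path_dom_compact_metric: "compact_metric ({0..1::real} \<times> X) (prod_dist dist (symd d))"
  using compact_metric_prod(1)[OF compact_metric_unit_interval(1) S.compact_metric_axioms] .

lemma graph_measurable:
  assumes "f \<in> N \<rightarrow>\<^sub>M borel_of (top_of_set {0..1::real})" "g \<in> N \<rightarrow>\<^sub>M borel_of (forward_topology X d)"
  shows "(\<lambda>x. (f x, g x)) \<in> N \<rightarrow>\<^sub>M borel_of path_dom"
  using measurable_borel_of_prod[OF compact_metric_unit_interval(1) S.compact_metric_axioms, of f N g] assms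
  by (simp add: compact_metric_unit_interval(2) forward_topology_eq)

lemma path_measure_prob:
  assumes "\<alpha> \<in> lebesgue_on {0..1::real} \<rightarrow>\<^sub>M borel_of (forward_topology X d)"
  shows "path_measure X d \<alpha> \<in> prob_borel_measures path_dom"
  unfolding path_measure_def
  by (rule prob_borel_measures_distr[OF prob_space_lebesgue_on_unit graph_measurable[OF lebesgue_on_unit_measurable assms]])

lemma integral_path_measure:
  assumes "\<alpha> \<in> lebesgue_on {0..1::real} \<rightarrow>\<^sub>M borel_of (forward_topology X d)"
    and "continuous_map path_dom euclideanreal g"
  shows "(\<integral>x. g x \<partial>path_measure X d \<alpha>) = (\<integral>t. g (t, \<alpha> t) \<partial>lebesgue_on {0..1::real})"
  unfolding path_measure_def
  by (rule integral_distr[OF graph_measurable[OF lebesgue_on_unit_measurable assms(1)]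
        continuous_map_real_measurable[OF assms(2)]])

text \<open>The \<open>\<delta>\<close> depends on \<open>g\<close> and \<open>e\<close> alone, by
  uniform continuity on a compact product, so all paths are treated at once. The paths are merely
  measurable because \<open>f k \<circ> \<gamma>\<close> has no better regularity.\<close>

lemma path_integral_close:
  assumes g: "continuous_map path_dom euclideanreal g" and e: "0 < e"
  obtains \<delta> where "0 < \<delta>" "\<And>\<alpha> \<beta>. \<alpha> \<in> lebesgue_on {0..1::real} \<rightarrow>\<^sub>M borel_of (forward_topology X d) \<Longrightarrow>
      \<beta> \<in> lebesgue_on {0..1::real} \<rightarrow>\<^sub>M borel_of (forward_topology X d) \<Longrightarrow>
      (\<And>t. t \<in> {0..1::real} \<Longrightarrow> symd d (\<alpha> t) (\<beta> t) < \<delta>) \<Longrightarrow>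
      \<bar>(\<integral>x. g x \<partial>path_measure X d \<alpha>) - (\<integral>x. g x \<partial>path_measure X d \<beta>)\<bar> \<le> e"
proof -
  interpret Z: compact_metric "{0..1::real} \<times> X" "prod_dist dist (symd d)" by (rule path_dom_compact_metric)
  interpret L: prob_space "lebesgue_on {0..1::real}" by (rule prob_space_lebesgue_on_unit)
  obtain \<delta> where \<delta>: "0 < \<delta>" "\<And>x y. x \<in> {0..1::real} \<times> X \<Longrightarrow> y \<in> {0..1::real} \<times> X \<Longrightarrow> prod_dist dist (symd d) x y < \<delta> \<Longrightarrow> \<bar>g x - g y\<bar> < e"
    using Z.uniform_continuity[OF g[unfolded path_dom_eq] e] by metis
  obtain B where B: "\<And>x. x \<in> {0..1::real} \<times> X \<Longrightarrow> \<bar>g x\<bar> \<le> B"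
    using Z.continuous_map_real_bounded[OF g[unfolded path_dom_eq]] by metis
  show thesis
  proof (rule that[OF \<delta>(1)])
    fix \<alpha> \<beta> assume \<alpha>: "\<alpha> \<in> lebesgue_on {0..1::real} \<rightarrow>\<^sub>M borel_of (forward_topology X d)"
      and \<beta>: "\<beta> \<in> lebesgue_on {0..1::real} \<rightarrow>\<^sub>M borel_of (forward_topology X d)"
      and close: "\<And>t. t \<in> {0..1::real} \<Longrightarrow> symd d (\<alpha> t) (\<beta> t) < \<delta>"
    have in_X: "\<alpha> t \<in> X" "\<beta> t \<in> X" if "t \<in> {0..1::real}" for t
      using measurable_space[OF \<alpha>, of t] measurable_space[OF \<beta>, of t] that by auto
    have int: "integrable (lebesgue_on {0..1::real}) (\<lambda>t. g (t, \<eta> t))"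
      if \<eta>: "\<eta> \<in> lebesgue_on {0..1::real} \<rightarrow>\<^sub>M borel_of (forward_topology X d)" for \<eta>
    proof (rule L.integrable_const_bound[of _ B])
      show "(\<lambda>t. g (t, \<eta> t)) \<in> borel_measurable (lebesgue_on {0..1::real})"
        by (rule continuous_map_real_comp_measurable[OF g graph_measurable[OF lebesgue_on_unit_measurable \<eta>]])
      show "AE t in lebesgue_on {0..1::real}. norm (g (t, \<eta> t)) \<le> B"
        using measurable_space[OF \<eta>] B by (intro AE_I2) auto
    qed
    have "\<bar>g (t, \<alpha> t) - g (t, \<beta> t)\<bar> \<le> e" if t: "t \<in> {0..1::real}" for t
    proof -
      have "prod_dist dist (symd d) (t, \<alpha> t) (t, \<beta> t) = symd d (\<alpha> t) (\<beta> t)"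
        by (simp add: prod_dist_def)
      then show ?thesis using \<delta>(2)[of "(t, \<alpha> t)" "(t, \<beta> t)"] in_X[OF t] t close[OF t] by simp
    qed
    note pt = this
    have "\<bar>(\<integral>t. g (t, \<alpha> t) \<partial>lebesgue_on {0..1::real}) - (\<integral>t. g (t, \<beta> t) \<partial>lebesgue_on {0..1::real})\<bar>
        = \<bar>\<integral>t. g (t, \<alpha> t) - g (t, \<beta> t) \<partial>lebesgue_on {0..1::real}\<bar>"
      using int[OF \<alpha>] int[OF \<beta>] by simp
    also have "\<dots> \<le> (\<integral>t. \<bar>g (t, \<alpha> t) - g (t, \<beta> t)\<bar> \<partial>lebesgue_on {0..1::real})"
      by (rule integral_abs_bound)
    also have "\<dots> \<le> (\<integral>t. e \<partial>lebesgue_on {0..1::real})"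
      using int[OF \<alpha>] int[OF \<beta>] pt by (intro integral_mono integrable_abs Bochner_Integration.integrable_diff) auto
    also have "\<dots> = e" using L.prob_space by simp
    finally show "\<bar>(\<integral>x. g x \<partial>path_measure X d \<alpha>) - (\<integral>x. g x \<partial>path_measure X d \<beta>)\<bar> \<le> e"
      by (simp add: integral_path_measure[OF \<alpha> g] integral_path_measure[OF \<beta> g])
  qed
qed

lemma path_measure_limit:
  assumes \<alpha>: "\<And>k. \<alpha> k \<in> lebesgue_on {0..1::real} \<rightarrow>\<^sub>M borel_of (forward_topology X d)"
    and \<beta>: "\<beta> \<in> lebesgue_on {0..1::real} \<rightarrow>\<^sub>M borel_of (forward_topology X d)"
    and close: "\<And>e. 0 < e \<Longrightarrow> \<forall>\<^sub>F k in sequentially. \<forall>t\<in>{0..1::real}. symd d (\<alpha> k t) (\<beta> t) < e"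
  shows "limitin (path_measure_topology X d) (\<lambda>k. path_measure X d (\<alpha> k)) (path_measure X d \<beta>) sequentially"
  unfolding path_measure_topology_def
proof (rule limitin_weak_prob_topologyI)
  fix g assume g: "continuous_map path_dom euclideanreal g"
  show "(\<lambda>n. \<integral>x. g x \<partial>path_measure X d (\<alpha> n)) \<longlonglongrightarrow> (\<integral>x. g x \<partial>path_measure X d \<beta>)"
  proof (rule tendstoI)
    fix e :: real assume e: "0 < e"
    obtain \<delta> where \<delta>: "0 < \<delta>" "\<And>\<alpha> \<beta>. \<alpha> \<in> lebesgue_on {0..1::real} \<rightarrow>\<^sub>M borel_of (forward_topology X d) \<Longrightarrow>
      \<beta> \<in> lebesgue_on {0..1::real} \<rightarrow>\<^sub>M borel_of (forward_topology X d) \<Longrightarrow>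
      (\<And>t. t \<in> {0..1::real} \<Longrightarrow> symd d (\<alpha> t) (\<beta> t) < \<delta>) \<Longrightarrow>
      \<bar>(\<integral>x. g x \<partial>path_measure X d \<alpha>) - (\<integral>x. g x \<partial>path_measure X d \<beta>)\<bar> \<le> e/2"
      by (rule path_integral_close[OF g half_gt_zero[OF e]]) blast
    show "\<forall>\<^sub>F k in sequentially. dist (\<integral>x. g x \<partial>path_measure X d (\<alpha> k)) (\<integral>x. g x \<partial>path_measure X d \<beta>) < e"
      using close[OF \<delta>(1)]
    proof eventually_elim
      case (elim k)
      then show ?case using \<delta>(2)[OF \<alpha> \<beta>, of k] e by (simp add: dist_real_def)
    qed
  qed
qed (use path_measure_prob \<alpha> \<beta> in auto)

text \<open>Fubini arguments over curve and time need joint measurability in both variables; the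
  common Lipschitz constant \<open>\<theta> * B\<close> of all geodesics supplies it through joint
  continuity.\<close>

lemma joint_evaluation_continuous:
  "continuous_map (prod_topology (geodesic_topology X d) (top_of_set {0..1::real})) (forward_topology X d) (\<lambda>(\<gamma>, t). \<gamma> t)"
proof -
  interpret G: compact_theta_space \<theta> "geodesics X d" "uniform_dist d" by (rule compact_theta_geodesics)
  obtain B where B: "0 < B" "\<And>x y. x \<in> X \<Longrightarrow> y \<in> X \<Longrightarrow> d x y \<le> B" using dist_bounded by metis
  show ?thesis
    unfolding forward_topology_eq S.continuous_map_to_metric
  proof (intro ballI allI impI)
    fix p and e :: real
    assume p: "p \<in> topspace (prod_topology (geodesic_topology X d) (top_of_set {0..1::real}))" and e: "0 < e"
    then obtain \<gamma> s where \<gamma>: "p = (\<gamma>, s)" "\<gamma> \<in> geodesics X d" "s \<in> {0..1::real}"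
      by (auto simp: topspace_geodesic_topology)
    define \<delta> where "\<delta> = e / (2 * \<theta> * B)"
    have \<delta>: "0 < \<delta>" unfolding \<delta>_def using e B(1) theta_ge_1 by simp
    define U where "U = G.S.mball \<gamma> (e/2) \<times> ({0..1::real} \<inter> ball s \<delta>)"
    have oU: "openin (prod_topology (geodesic_topology X d) (top_of_set {0..1::real})) U"
      unfolding U_def geodesic_topology_def G.forward_topology_eq
      by (simp add: openin_prod_Times_iff openin_open_Int)
    have pU: "p \<in> U" unfolding U_def using \<gamma> e \<delta> by simp
    have "(case q of (\<gamma>, t) \<Rightarrow> \<gamma> t) \<in> S.mball (case p of (\<gamma>, t) \<Rightarrow> \<gamma> t) e" if q: "q \<in> U" for q
    proof -
      obtain \<eta> t where \<eta>: "q = (\<eta>, t)" "\<eta> \<in> geodesics X d" "symd (uniform_dist d) \<gamma> \<eta> < e/2" "t \<in> {0..1::real}" "\<bar>s - t\<bar> < \<delta>"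
        using q unfolding U_def by (auto simp: dist_real_def)
      have "symd d (\<gamma> s) (\<gamma> t) \<le> \<theta> * d (\<gamma> 0) (\<gamma> 1) * \<bar>t - s\<bar>"
        by (rule geodesics_symd_le[OF \<gamma>(2,3) \<eta>(4)])
      also have "\<dots> \<le> \<theta> * B * \<delta>"
        using B theta_ge_1 \<eta>(5) nonneg geodesics_in[OF \<gamma>(2)] by (intro mult_mono) auto
      also have "\<dots> = e/2" unfolding \<delta>_def using theta_ge_1 B(1) by simp
      finally have "symd d (\<gamma> s) (\<gamma> t) \<le> e/2" .
      moreover have "symd d (\<gamma> t) (\<eta> t) < e/2" using symd_le_symd_uniform[OF \<gamma>(2) \<eta>(2,4)] \<eta>(3) by simp
      ultimately show ?thesis
        using symd_triangle[OF geodesics_in[OF \<gamma>(2,3)] geodesics_in[OF \<gamma>(2) \<eta>(4)] geodesics_in[OF \<eta>(2,4)]]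
          geodesics_in[OF \<gamma>(2,3)] geodesics_in[OF \<eta>(2,4)] by (simp add: \<gamma>(1) \<eta>(1))
    qed
    then show "\<exists>U. openin (prod_topology (geodesic_topology X d) (top_of_set {0..1::real})) U \<and> p \<in> U \<and>
        (\<forall>q\<in>U. (case q of (\<gamma>, t) \<Rightarrow> \<gamma> t) \<in> S.mball (case p of (\<gamma>, t) \<Rightarrow> \<gamma> t) e)"
      using oU pU by blast
  qed
qed

lemma joint_evaluation_measurable:
  assumes "sets N = sets (borel_of (geodesic_topology X d))"
  shows "(\<lambda>(\<gamma>, t). \<gamma> t) \<in> N \<Otimes>\<^sub>M lebesgue_on {0..1::real} \<rightarrow>\<^sub>M borel_of (forward_topology X d)"
proof -
  interpret G: compact_theta_space \<theta> "geodesics X d" "uniform_dist d" by (rule compact_theta_geodesics)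
  have "fst \<in> N \<Otimes>\<^sub>M lebesgue_on {0..1::real} \<rightarrow>\<^sub>M borel_of (geodesic_topology X d)"
    using measurable_fst[of N "lebesgue_on {0..1::real}"] measurable_cong_sets[OF refl assms] by blast
  moreover have "snd \<in> N \<Otimes>\<^sub>M lebesgue_on {0..1::real} \<rightarrow>\<^sub>M borel_of (top_of_set {0..1::real})"
    by (rule measurable_compose[OF measurable_snd lebesgue_on_unit_measurable])
  ultimately have "(\<lambda>p. (fst p, snd p)) \<in> N \<Otimes>\<^sub>M lebesgue_on {0..1::real}
      \<rightarrow>\<^sub>M borel_of (prod_topology (geodesic_topology X d) (top_of_set {0..1::real}))"
    unfolding geodesic_topology_def G.forward_topology_eq compact_metric_unit_interval(2)[symmetric]
    by (rule measurable_borel_of_prod[OF G.S.compact_metric_axioms compact_metric_unit_interval(1)])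
  from measurable_compose[OF this continuous_map_measurable[OF joint_evaluation_continuous]]
  show ?thesis by (simp add: case_prod_beta)
qed

text \<open>Measurability into a space of measures is tested on integrals of continuous functions.
  Here these are parameter integrals over the unit interval, measurable by Fubini's theorem.\<close>

lemma path_measure_measurable:
  assumes F: "(\<lambda>(\<omega>, t). F \<omega> t) \<in> N \<Otimes>\<^sub>M lebesgue_on {0..1::real} \<rightarrow>\<^sub>M borel_of (forward_topology X d)"
  shows "(\<lambda>\<omega>. path_measure X d (F \<omega>)) \<in> N \<rightarrow>\<^sub>M borel_of (path_measure_topology X d)"
proof -
  interpret Z: compact_metric "{0..1::real} \<times> X" "prod_dist dist (symd d)" by (rule path_dom_compact_metric)
  interpret L: prob_space "lebesgue_on {0..1::real}" by (rule prob_space_lebesgue_on_unit)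
  have sec: "F \<omega> \<in> lebesgue_on {0..1::real} \<rightarrow>\<^sub>M borel_of (forward_topology X d)" if "\<omega> \<in> space N" for \<omega>
    using measurable_compose[OF measurable_Pair1'[OF that] F] by simp
  show ?thesis
    unfolding path_measure_topology_def path_dom_eq
  proof (rule Z.measurable_into_weak_prob)
    show "path_measure X d (F \<omega>) \<in> prob_borel_measures Z.mtopology" if "\<omega> \<in> space N" for \<omega>
      using path_measure_prob[OF sec[OF that]] by (simp add: path_dom_eq)
    fix g assume "continuous_map Z.mtopology euclideanreal g"
    then have g: "continuous_map path_dom euclideanreal g" by (simp add: path_dom_eq)
    have "(\<lambda>p. (snd p, F (fst p) (snd p))) \<in> N \<Otimes>\<^sub>M lebesgue_on {0..1::real} \<rightarrow>\<^sub>M borel_of path_dom"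
      by (rule graph_measurable)
        (use measurable_compose[OF measurable_snd lebesgue_on_unit_measurable] F in \<open>simp_all add: case_prod_beta\<close>)
    from continuous_map_real_comp_measurable[OF g this]
    have "(\<lambda>(\<omega>, t). g (t, F \<omega> t)) \<in> borel_measurable (N \<Otimes>\<^sub>M lebesgue_on {0..1::real})"
      by (simp add: case_prod_beta)
    from L.borel_measurable_lebesgue_integral[OF this]
    show "(\<lambda>\<omega>. \<integral>x. g x \<partial>path_measure X d (F \<omega>)) \<in> borel_measurable N"
      by (rule measurable_cong[THEN iffD1, rotated]) (simp add: integral_path_measure[OF sec g])
  qed
qed

end

section \<open>Coupling densities\<close>

text \<open>Couplings are produced by densities with respect to the product measure: this makes gluing
  of couplings a plain iterated integral, without disintegration.\<close>

definition coupling_density :: "'a measure \<Rightarrow> 'b measure \<Rightarrow> ('a \<Rightarrow> 'b \<Rightarrow> ennreal) \<Rightarrow> bool" where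
  "coupling_density M N h \<longleftrightarrow> (\<lambda>(x, y). h x y) \<in> borel_measurable (M \<Otimes>\<^sub>M N) \<and>
    (\<forall>x\<in>space M. (\<integral>\<^sup>+y. h x y \<partial>N) = 1) \<and> (\<forall>y\<in>space N. (\<integral>\<^sup>+x. h x y \<partial>M) = 1)"

lemma integral_linear_combination:
  fixes u :: "nat \<Rightarrow> 'a \<Rightarrow> real"
  assumes "\<And>i. i < n \<Longrightarrow> integrable M (u i)"
  shows "integrable M (\<lambda>x. \<Sum>i<n. c i * u i x)"
    "(\<integral>x. (\<Sum>i<n. c i * u i x) \<partial>M) = (\<Sum>i<n. c i * (\<integral>x. u i x \<partial>M))"
proof -
  have int: "integrable M (\<lambda>x. c i * u i x)" if "i \<in> {..<n}" for i
    using assms that by (intro integrable_mult_right) auto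
  show "integrable M (\<lambda>x. \<Sum>i<n. c i * u i x)"
    by (rule Bochner_Integration.integrable_sum[OF int])
  have "(\<integral>x. (\<Sum>i<n. c i * u i x) \<partial>M) = (\<Sum>i<n. (\<integral>x. c i * u i x \<partial>M))"
    by (rule Bochner_Integration.integral_sum[OF int])
  then show "(\<integral>x. (\<Sum>i<n. c i * u i x) \<partial>M) = (\<Sum>i<n. c i * (\<integral>x. u i x \<partial>M))" by simp
qed

text \<open>\<open>a\<close> is what remains of the density 1 after mass \<open>\<kappa> i\<close>
  has been taken from the \<open>i\<close>-th piece in proportion to \<open>u i\<close>. Where a
  piece has mass 0, so has \<open>\<kappa> i\<close>, and division by zero yields the right value
  0.\<close>

lemma weighted_mass:
  fixes u :: "nat \<Rightarrow> 'a \<Rightarrow> real"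
  assumes "prob_space M"
    and u: "\<And>i. i < n \<Longrightarrow> u i \<in> borel_measurable M"
      "\<And>i x. i < n \<Longrightarrow> x \<in> space M \<Longrightarrow> 0 \<le> u i x" "\<And>x. x \<in> space M \<Longrightarrow> (\<Sum>i<n. u i x) = 1"
    and \<kappa>: "\<And>i. i < n \<Longrightarrow> 0 \<le> \<kappa> i" "\<And>i. i < n \<Longrightarrow> \<kappa> i \<le> (\<integral>x. u i x \<partial>M)"
  defines "a \<equiv> \<lambda>x. 1 - (\<Sum>i<n. \<kappa> i / (\<integral>x. u i x \<partial>M) * u i x)"
  shows "a \<in> borel_measurable M" "\<And>x. x \<in> space M \<Longrightarrow> 0 \<le> a x" "integrable M a"
    "(\<integral>x. a x \<partial>M) = 1 - (\<Sum>i<n. \<kappa> i)" "\<And>i. i < n \<Longrightarrow> integrable M (u i)"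
proof -
  interpret prob_space M by fact
  have u1: "u i x \<le> 1" if "i < n" "x \<in> space M" for i x
  proof -
    have "u i x \<le> (\<Sum>i<n. u i x)" using that u(2) by (intro member_le_sum) auto
    then show ?thesis using u(3)[OF that(2)] by simp
  qed
  show int: "integrable M (u i)" if "i < n" for i
    using that u u1 by (intro integrable_const_bound[of _ 1]) auto
  show "a \<in> borel_measurable M"
    unfolding a_def using u(1) by (intro borel_measurable_diff borel_measurable_sum borel_measurable_times) auto
  show "integrable M a" unfolding a_def by (intro Bochner_Integration.integrable_diff integral_linear_combination(1) int) auto
  have le1: "\<kappa> i / (\<integral>x. u i x \<partial>M) \<le> 1" if "i < n" for i
    using \<kappa>[OF that] by (cases "(\<integral>x. u i x \<partial>M) = 0") (auto simp: divide_le_eq_1)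
  show "0 \<le> a x" if x: "x \<in> space M" for x
  proof -
    have "(\<Sum>i<n. \<kappa> i / (\<integral>x. u i x \<partial>M) * u i x) \<le> (\<Sum>i<n. 1 * u i x)"
      using le1 u(2) x by (intro sum_mono mult_right_mono) auto
    then show ?thesis unfolding a_def using u(3)[OF x] by simp
  qed
  have "\<kappa> i / (\<integral>x. u i x \<partial>M) * (\<integral>x. u i x \<partial>M) = \<kappa> i" if "i < n" for i
    using \<kappa>[OF that] by (cases "(\<integral>x. u i x \<partial>M) = 0") auto
  then have sum: "(\<Sum>i<n. \<kappa> i / (\<integral>x. u i x \<partial>M) * (\<integral>x. u i x \<partial>M)) = (\<Sum>i<n. \<kappa> i)"
    by (intro sum.cong) auto
  have "(\<integral>x. a x \<partial>M) = (\<integral>x. 1 \<partial>M) - (\<integral>x. (\<Sum>i<n. \<kappa> i / (\<integral>x. u i x \<partial>M) * u i x) \<partial>M)"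
    unfolding a_def by (rule Bochner_Integration.integral_diff[OF _ integral_linear_combination(1)[OF int]]) auto
  then show "(\<integral>x. a x \<partial>M) = 1 - (\<Sum>i<n. \<kappa> i)"
    by (simp only: integral_linear_combination(2)[OF int] sum) (simp add: prob_space)
qed

text \<open>Mass \<open>\<kappa> i\<close> of piece \<open>i\<close> on one side is coupled
  independently with piece \<open>i\<close> on the other; the leftovers, of mass
  \<open>1 - s\<close> for \<open>s\<close> the sum of the \<open>\<kappa> i\<close>, are coupled by
  a normalised product. Only the leftovers can be expensive, which gives the cost bound, and
  \<open>lt1\<close> keeps their normalisation meaningful.\<close>

lemma coupling_density_exists:
  fixes u :: "nat \<Rightarrow> 'a \<Rightarrow> real" and w :: "nat \<Rightarrow> 'b \<Rightarrow> real"
  assumes M: "prob_space M" and N: "prob_space N"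
    and u: "\<And>i. i < n \<Longrightarrow> u i \<in> borel_measurable M"
      "\<And>i x. i < n \<Longrightarrow> x \<in> space M \<Longrightarrow> 0 \<le> u i x" "\<And>x. x \<in> space M \<Longrightarrow> (\<Sum>i<n. u i x) = 1"
    and w: "\<And>i. i < n \<Longrightarrow> w i \<in> borel_measurable N"
      "\<And>i y. i < n \<Longrightarrow> y \<in> space N \<Longrightarrow> 0 \<le> w i y" "\<And>y. y \<in> space N \<Longrightarrow> (\<Sum>i<n. w i y) = 1"
    and \<kappa>: "\<And>i. i < n \<Longrightarrow> 0 \<le> \<kappa> i" "\<And>i. i < n \<Longrightarrow> \<kappa> i \<le> (\<integral>x. u i x \<partial>M)" "\<And>i. i < n \<Longrightarrow> \<kappa> i \<le> (\<integral>y. w i y \<partial>N)"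
    and lt1: "(\<Sum>i<n. \<kappa> i) < 1"
  obtains h where "coupling_density M N h"
    "\<And>c e C. (\<lambda>(x, y). c x y) \<in> borel_measurable (M \<Otimes>\<^sub>M N) \<Longrightarrow>
      (\<And>i x y. i < n \<Longrightarrow> x \<in> space M \<Longrightarrow> y \<in> space N \<Longrightarrow> u i x \<noteq> 0 \<Longrightarrow> w i y \<noteq> 0 \<Longrightarrow> c x y \<le> e) \<Longrightarrow>
      (\<And>x y. x \<in> space M \<Longrightarrow> y \<in> space N \<Longrightarrow> c x y \<le> C) \<Longrightarrow>
      (\<integral>\<^sup>+x. \<integral>\<^sup>+y. h x y * c x y \<partial>N \<partial>M) \<le> e + C * ennreal (1 - (\<Sum>i<n. \<kappa> i))"
proof -
  interpret M: prob_space M by fact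
  interpret N: prob_space N by fact
  interpret MN: pair_prob_space M N ..
  define m where "m i = (\<integral>x. u i x \<partial>M)" for i
  define k where "k i = (\<integral>y. w i y \<partial>N)" for i
  define s where "s = (\<Sum>i<n. \<kappa> i)"
  define a where "a x = 1 - (\<Sum>i<n. \<kappa> i / m i * u i x)" for x
  define b where "b y = 1 - (\<Sum>i<n. \<kappa> i / k i * w i y)" for y
  note A = weighted_mass[of M n u \<kappa>, OF M u \<kappa>(1,2), folded m_def, folded a_def, folded s_def]
  note B = weighted_mass[of N n w \<kappa>, OF N w \<kappa>(1,3), folded k_def, folded b_def, folded s_def]
  have s1: "s < 1" using lt1 by (simp add: s_def)
  define g1 where "g1 x y = (\<Sum>i<n. \<kappa> i / (m i * k i) * (u i x * w i y))" for x y
  define g2 where "g2 x y = a x * b y / (1 - s)" for x y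
  have g1_nn: "0 \<le> g1 x y" if "x \<in> space M" "y \<in> space N" for x y
    unfolding g1_def
  proof (rule sum_nonneg)
    fix i assume "i \<in> {..<n}"
    then have i: "i < n" by simp
    have "0 \<le> m i" "0 \<le> k i" using \<kappa>[OF i] by (auto simp: m_def k_def)
    then show "0 \<le> \<kappa> i / (m i * k i) * (u i x * w i y)" using \<kappa>(1)[OF i] u(2) w(2) that i by simp
  qed
  have g2_nn: "0 \<le> g2 x y" if "x \<in> space M" "y \<in> space N" for x y
    unfolding g2_def using A(2) B(2) that s1 by simp
  have g1_meas: "(\<lambda>(x, y). g1 x y) \<in> borel_measurable (M \<Otimes>\<^sub>M N)"
  proof -
    have "(\<lambda>p. u i (fst p)) \<in> borel_measurable (M \<Otimes>\<^sub>M N)" "(\<lambda>p. w i (snd p)) \<in> borel_measurable (M \<Otimes>\<^sub>M N)" if "i < n" for i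
      using measurable_compose[OF measurable_fst u(1)[OF that]] measurable_compose[OF measurable_snd w(1)[OF that]] by auto
    then show ?thesis unfolding g1_def case_prod_beta
      by (intro borel_measurable_sum borel_measurable_times) auto
  qed
  have g2_meas: "(\<lambda>(x, y). g2 x y) \<in> borel_measurable (M \<Otimes>\<^sub>M N)"
    unfolding g2_def case_prod_beta
    using measurable_compose[OF measurable_fst A(1)] measurable_compose[OF measurable_snd B(1)]
    by (intro borel_measurable_times borel_measurable_divide) auto
  define h where "h x y = ennreal (g1 x y) + ennreal (g2 x y)" for x y
  have g1_meas': "(\<lambda>(x, y). ennreal (g1 x y)) \<in> borel_measurable (M \<Otimes>\<^sub>M N)"
    and g2_meas': "(\<lambda>(x, y). ennreal (g2 x y)) \<in> borel_measurable (M \<Otimes>\<^sub>M N)"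
    using g1_meas g2_meas by (auto simp: case_prod_beta)
  have h_meas: "(\<lambda>(x, y). h x y) \<in> borel_measurable (M \<Otimes>\<^sub>M N)"
    unfolding h_def using g1_meas' g2_meas' by (simp add: case_prod_beta)
  have hx: "(\<integral>\<^sup>+y. h x y \<partial>N) = 1" if x: "x \<in> space M" for x
  proof -
    have g1_eq: "g1 x y = (\<Sum>i<n. (\<kappa> i / (m i * k i) * u i x) * w i y)" for y
      unfolding g1_def by (simp add: mult.assoc)
    have I: "integrable N (g1 x)" "(\<integral>y. g1 x y \<partial>N) = (\<Sum>i<n. \<kappa> i / (m i * k i) * (u i x * k i))"
      using integral_linear_combination[where n=n and u=w and M=N, OF B(5), where c="\<lambda>i. \<kappa> i / (m i * k i) * u i x"]
      unfolding g1_eq by (simp_all add: k_def mult.assoc)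
    have J: "integrable N (g2 x)" "(\<integral>y. g2 x y \<partial>N) = a x * (1 - s) / (1 - s)"
      unfolding g2_def using B(3,4) by simp_all
    have "(\<integral>\<^sup>+y. h x y \<partial>N) = (\<integral>\<^sup>+y. ennreal (g1 x y + g2 x y) \<partial>N)"
      unfolding h_def using g1_nn[OF x] g2_nn[OF x] by (intro nn_integral_cong) simp
    also have "\<dots> = ennreal (\<integral>y. g1 x y + g2 x y \<partial>N)"
      using g1_nn[OF x] g2_nn[OF x] I(1) J(1)
      by (intro nn_integral_eq_integral) auto
    also have "(\<integral>y. g1 x y + g2 x y \<partial>N) = (\<Sum>i<n. \<kappa> i / (m i * k i) * (u i x * k i)) + a x * (1 - s) / (1 - s)"
      using I J by simp
    also have "(\<Sum>i<n. \<kappa> i / (m i * k i) * (u i x * k i)) = (\<Sum>i<n. \<kappa> i / m i * u i x)"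
    proof (rule sum.cong[OF refl])
      fix i assume "i \<in> {..<n}"
      then show "\<kappa> i / (m i * k i) * (u i x * k i) = \<kappa> i / m i * u i x"
        using \<kappa>(1,3)[of i] by (cases "k i = 0") (auto simp: k_def)
    qed
    finally show ?thesis using s1 by (simp add: a_def)
  qed
  have hy: "(\<integral>\<^sup>+x. h x y \<partial>M) = 1" if y: "y \<in> space N" for y
  proof -
    have g1_eq: "g1 x y = (\<Sum>i<n. (\<kappa> i / (m i * k i) * w i y) * u i x)" for x
      unfolding g1_def by (simp add: mult.assoc mult.commute mult.left_commute)
    have I: "integrable M (\<lambda>x. g1 x y)" "(\<integral>x. g1 x y \<partial>M) = (\<Sum>i<n. \<kappa> i / (m i * k i) * (m i * w i y))"
      using integral_linear_combination[where n=n and u=u and M=M, OF A(5), where c="\<lambda>i. \<kappa> i / (m i * k i) * w i y"]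
      unfolding g1_eq by (simp_all add: m_def mult.assoc mult.left_commute mult.commute)
    have J: "integrable M (\<lambda>x. g2 x y)" "(\<integral>x. g2 x y \<partial>M) = (1 - s) * b y / (1 - s)"
      unfolding g2_def using A(3,4) by simp_all
    have "(\<integral>\<^sup>+x. h x y \<partial>M) = (\<integral>\<^sup>+x. ennreal (g1 x y + g2 x y) \<partial>M)"
      unfolding h_def using g1_nn[OF _ y] g2_nn[OF _ y] by (intro nn_integral_cong) simp
    also have "\<dots> = ennreal (\<integral>x. g1 x y + g2 x y \<partial>M)"
      using g1_nn[OF _ y] g2_nn[OF _ y] I(1) J(1)
      by (intro nn_integral_eq_integral) auto
    also have "(\<integral>x. g1 x y + g2 x y \<partial>M) = (\<Sum>i<n. \<kappa> i / (m i * k i) * (m i * w i y)) + (1 - s) * b y / (1 - s)"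
      using I J by simp
    also have "(\<Sum>i<n. \<kappa> i / (m i * k i) * (m i * w i y)) = (\<Sum>i<n. \<kappa> i / k i * w i y)"
    proof (rule sum.cong[OF refl])
      fix i assume "i \<in> {..<n}"
      then show "\<kappa> i / (m i * k i) * (m i * w i y) = \<kappa> i / k i * w i y"
        using \<kappa>(1,2)[of i] by (cases "m i = 0") (auto simp: m_def)
    qed
    finally show ?thesis using s1 by (simp add: b_def)
  qed
  have g2_int: "(\<integral>\<^sup>+x. \<integral>\<^sup>+y. ennreal (g2 x y) \<partial>N \<partial>M) = ennreal (1 - s)"
  proof -
    have "(\<integral>\<^sup>+x. \<integral>\<^sup>+y. ennreal (g2 x y) \<partial>N \<partial>M) = (\<integral>\<^sup>+x. ennreal (a x) \<partial>M)"
    proof (rule nn_integral_cong)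
      fix x assume x: "x \<in> space M"
      have "(\<integral>\<^sup>+y. ennreal (g2 x y) \<partial>N) = ennreal (\<integral>y. g2 x y \<partial>N)"
        unfolding g2_def using B(3) g2_nn[OF x] by (intro nn_integral_eq_integral) (auto simp: g2_def)
      also have "(\<integral>y. g2 x y \<partial>N) = a x" unfolding g2_def using B(3,4) s1 by simp
      finally show "(\<integral>\<^sup>+y. ennreal (g2 x y) \<partial>N) = ennreal (a x)" .
    qed
    also have "\<dots> = ennreal (1 - s)"
      using A(2,3,4) by (subst nn_integral_eq_integral) auto
    finally show ?thesis .
  qed
  show thesis
  proof (rule that[of h])
    show "coupling_density M N h" unfolding coupling_density_def using h_meas hx hy by blast
    fix c :: "'a \<Rightarrow> 'b \<Rightarrow> ennreal" and e C
    assume c: "(\<lambda>(x, y). c x y) \<in> borel_measurable (M \<Otimes>\<^sub>M N)"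
      and good: "\<And>i x y. i < n \<Longrightarrow> x \<in> space M \<Longrightarrow> y \<in> space N \<Longrightarrow> u i x \<noteq> 0 \<Longrightarrow> w i y \<noteq> 0 \<Longrightarrow> c x y \<le> e"
      and bad: "\<And>x y. x \<in> space M \<Longrightarrow> y \<in> space N \<Longrightarrow> c x y \<le> C"
    have sec1: "(\<lambda>y. h x y) \<in> borel_measurable N" and sec2: "(\<lambda>y. ennreal (g2 x y)) \<in> borel_measurable N"
      if "x \<in> space M" for x
      using measurable_compose[OF measurable_Pair1'[OF that] h_meas] measurable_compose[OF measurable_Pair1'[OF that] g2_meas'] by auto
    \<comment> \<open>Where no index is active on both sides the matched part \<open>g1\<close>
      vanishes, so that the crude bound \<open>C\<close> meets the leftover density
      \<open>g2\<close> only.\<close>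
    have pt: "h x y * c x y \<le> e * h x y + C * ennreal (g2 x y)" if xy: "x \<in> space M" "y \<in> space N" for x y
    proof (cases "\<exists>i<n. u i x \<noteq> 0 \<and> w i y \<noteq> 0")
      case True
      then have "c x y \<le> e" using good xy by blast
      then have "h x y * c x y \<le> e * h x y" by (subst mult.commute) (rule mult_right_mono, auto)
      then show ?thesis by (meson add_increasing2 zero_le)
    next
      case False
      then have "g1 x y = 0" unfolding g1_def by (intro sum.neutral) auto
      then have "h x y * c x y \<le> C * ennreal (g2 x y)"
        unfolding h_def using bad[OF xy] by (subst mult.commute) (simp add: mult_right_mono)
      then show ?thesis by (meson add_increasing zero_le)
    qed
    have "(\<integral>\<^sup>+x. \<integral>\<^sup>+y. h x y * c x y \<partial>N \<partial>M) \<le> (\<integral>\<^sup>+x. \<integral>\<^sup>+y. e * h x y + C * ennreal (g2 x y) \<partial>N \<partial>M)"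
      by (intro nn_integral_mono pt)
    also have "\<dots> = (\<integral>\<^sup>+x. e + C * (\<integral>\<^sup>+y. ennreal (g2 x y) \<partial>N) \<partial>M)"
      using sec1 sec2 hx by (intro nn_integral_cong) (simp add: nn_integral_add nn_integral_cmult)
    also have "\<dots> = e + C * ennreal (1 - s)"
      using N.borel_measurable_nn_integral[OF g2_meas'] g2_int
      by (subst nn_integral_add) (auto simp: nn_integral_cmult M.emeasure_space_1)
    finally show "(\<integral>\<^sup>+x. \<integral>\<^sup>+y. h x y * c x y \<partial>N \<partial>M) \<le> e + C * ennreal (1 - (\<Sum>i<n. \<kappa> i))"
      by (simp add: s_def)
  qed
qed

text \<open>By weak convergence the masses of corresponding pieces of a fine partition of unity
  become almost equal, so nearly all mass can be matched inside pieces whose points are less than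
  \<open>\<rho>\<close> apart. The density \<open>h\<close> is fixed before the cost is: one
  coupling will serve all times \<open>t\<close> at once.\<close>

lemma (in compact_metric) weak_convergence_coupling:
  assumes Q: "Q \<in> prob_borel_measures mtopology" and N: "\<And>k::nat. prob_space (N k)"
    and \<psi>: "\<And>k. \<psi> k \<in> N k \<rightarrow>\<^sub>M borel_of mtopology"
    and conv: "\<And>g. continuous_map mtopology euclideanreal g \<Longrightarrow> (\<lambda>k. \<integral>y. g (\<psi> k y) \<partial>N k) \<longlonglongrightarrow> (\<integral>x. g x \<partial>Q)"
    and \<rho>: "0 < \<rho>" and \<beta>: "0 < \<beta>" "\<beta> \<le> 1"
  shows "\<forall>\<^sub>F k in sequentially. \<exists>h. coupling_density Q (N k) h \<and>
    (\<forall>c e C. (\<lambda>(x, y). c x y) \<in> borel_measurable (Q \<Otimes>\<^sub>M N k) \<longrightarrow>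
      (\<forall>x\<in>M. \<forall>y\<in>space (N k). d x (\<psi> k y) < \<rho> \<longrightarrow> c x y \<le> e) \<longrightarrow>
      (\<forall>x\<in>M. \<forall>y\<in>space (N k). c x y \<le> C) \<longrightarrow>
      (\<integral>\<^sup>+x. \<integral>\<^sup>+y. h x y * c x y \<partial>N k \<partial>Q) \<le> e + C * ennreal \<beta>)"
proof -
  interpret Q: prob_space Q using Q by (rule prob_borel_measuresD)
  have sQ: "sets Q = sets (borel_of mtopology)" "space Q = M"
    using prob_borel_measuresD[OF Q] by auto
  obtain n :: nat and z and u :: "nat \<Rightarrow> 'a \<Rightarrow> real" where
    z: "\<And>i. i < n \<Longrightarrow> z i \<in> M" and cu: "\<And>i. i < n \<Longrightarrow> continuous_map mtopology euclideanreal (u i)"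
    and u0: "\<And>i x. i < n \<Longrightarrow> x \<in> M \<Longrightarrow> 0 \<le> u i x"
    and us: "\<And>i x. i < n \<Longrightarrow> x \<in> M \<Longrightarrow> u i x \<noteq> 0 \<Longrightarrow> d (z i) x < \<rho>/2"
    and u1: "\<And>x. x \<in> M \<Longrightarrow> (\<Sum>i<n. u i x) = 1"
    apply (rule partition_of_unity[OF half_gt_zero[OF \<rho>]])
    subgoal premises p for n z u by (rule p(1)[of n z u]) (fact p)+
    done
  define m where "m i = (\<integral>x. u i x \<partial>Q)" for i
  define mk where "mk k i = (\<integral>y. u i (\<psi> k y) \<partial>N k)" for k i
  \<comment> \<open>The factor \<open>1 - \<beta>/2\<close> keeps the total strictly below 1, as the
    coupling of the leftovers requires, while the limit \<open>1 - \<beta>/2\<close> of the total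
    still exceeds \<open>1 - \<beta>\<close>.\<close>
  define \<kappa> where "\<kappa> k i = (1 - \<beta>/2) * min (m i) (mk k i)" for k i
  note intu = integrable_continuous[OF Q.finite_measure_axioms sQ(1) cu]
  have sum_m: "(\<Sum>i<n. m i) = 1"
  proof -
    have "(\<Sum>i<n. m i) = (\<integral>x. (\<Sum>i<n. u i x) \<partial>Q)"
      unfolding m_def using intu by (subst Bochner_Integration.integral_sum) auto
    also have "\<dots> = (\<integral>x. 1 \<partial>Q)" by (rule Bochner_Integration.integral_cong) (use u1 sQ(2) in auto)
    finally show ?thesis by (simp add: Q.prob_space)
  qed
  have m0: "0 \<le> m i" if "i < n" for i
    unfolding m_def using u0[OF that] sQ(2) by (intro Bochner_Integration.integral_nonneg_AE AE_I2) auto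
  have \<psi>M: "\<psi> k y \<in> M" if "y \<in> space (N k)" for k y
    using measurable_space[OF \<psi> that] by simp
  have mk0: "0 \<le> mk k i" if "i < n" for k i
    unfolding mk_def using u0[OF that] \<psi>M by (intro Bochner_Integration.integral_nonneg_AE AE_I2) auto
  have "(\<lambda>k. \<Sum>i<n. \<kappa> k i) \<longlonglongrightarrow> (\<Sum>i<n. (1 - \<beta>/2) * min (m i) (m i))"
    unfolding \<kappa>_def using conv[OF cu]
    by (intro tendsto_sum tendsto_mult_left tendsto_min tendsto_const) (auto simp: mk_def m_def)
  moreover have "(\<Sum>i<n. (1 - \<beta>/2) * min (m i) (m i)) = 1 - \<beta>/2"
    using sum_m by (simp add: sum_distrib_left[symmetric])
  ultimately have "\<forall>\<^sub>F k in sequentially. 1 - \<beta> < (\<Sum>i<n. \<kappa> k i)"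
    using \<beta> by (intro order_tendstoD(1)) auto
  then show ?thesis
  proof eventually_elim
    case (elim k)
    have \<kappa>0: "0 \<le> \<kappa> k i" and \<kappa>m: "\<kappa> k i \<le> m i" and \<kappa>mk: "\<kappa> k i \<le> mk k i" if "i < n" for i
    proof -
      have "0 \<le> min (m i) (mk k i)" using m0 mk0 that by simp
      then have "\<kappa> k i \<le> min (m i) (mk k i)" "0 \<le> \<kappa> k i"
        unfolding \<kappa>_def using \<beta> mult_left_le_one_le[of "min (m i) (mk k i)" "1 - \<beta>/2"] by auto
      then show "0 \<le> \<kappa> k i" "\<kappa> k i \<le> m i" "\<kappa> k i \<le> mk k i" by auto
    qed
    have "(\<Sum>i<n. \<kappa> k i) \<le> (\<Sum>i<n. (1 - \<beta>/2) * m i)"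
      unfolding \<kappa>_def using \<beta> by (intro sum_mono mult_left_mono) auto
    also have "\<dots> = 1 - \<beta>/2" using sum_m by (simp add: sum_distrib_left[symmetric])
    finally have lt: "(\<Sum>i<n. \<kappa> k i) < 1" using \<beta>(1) by simp
    have um: "u i \<in> borel_measurable Q" if "i < n" for i
      using continuous_map_real_measurable[OF cu[OF that]] measurable_cong_sets[OF sQ(1) refl] by blast
    have wm: "(\<lambda>y. u i (\<psi> k y)) \<in> borel_measurable (N k)" if "i < n" for i
      by (rule continuous_map_real_comp_measurable[OF cu[OF that] \<psi>])
    obtain h where h: "coupling_density Q (N k) h"
      "\<And>c e C. (\<lambda>(x, y). c x y) \<in> borel_measurable (Q \<Otimes>\<^sub>M N k) \<Longrightarrow>
      (\<And>i x y. i < n \<Longrightarrow> x \<in> space Q \<Longrightarrow> y \<in> space (N k) \<Longrightarrow> u i x \<noteq> 0 \<Longrightarrow> u i (\<psi> k y) \<noteq> 0 \<Longrightarrow> c x y \<le> e) \<Longrightarrow>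
      (\<And>x y. x \<in> space Q \<Longrightarrow> y \<in> space (N k) \<Longrightarrow> c x y \<le> C) \<Longrightarrow>
      (\<integral>\<^sup>+x. \<integral>\<^sup>+y. h x y * c x y \<partial>N k \<partial>Q) \<le> e + C * ennreal (1 - (\<Sum>i<n. \<kappa> k i))"
    proof (rule coupling_density_exists[where n=n and u=u and w="\<lambda>i y. u i (\<psi> k y)" and \<kappa>="\<kappa> k", OF Q.prob_space_axioms N[of k]])
      show "\<kappa> k i \<le> (\<integral>x. u i x \<partial>Q)" if "i < n" for i using \<kappa>m[OF that] by (simp add: m_def)
      show "\<kappa> k i \<le> (\<integral>y. u i (\<psi> k y) \<partial>N k)" if "i < n" for i using \<kappa>mk[OF that] by (simp add: mk_def)
    qed (use um wm u0 u1 \<psi>M sQ(2) \<kappa>0 lt in auto)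
    have "(\<integral>\<^sup>+x. \<integral>\<^sup>+y. h x y * c x y \<partial>N k \<partial>Q) \<le> e + C * ennreal \<beta>"
      if c: "(\<lambda>(x, y). c x y) \<in> borel_measurable (Q \<Otimes>\<^sub>M N k)"
      and good: "\<forall>x\<in>M. \<forall>y\<in>space (N k). d x (\<psi> k y) < \<rho> \<longrightarrow> c x y \<le> e"
      and bad: "\<forall>x\<in>M. \<forall>y\<in>space (N k). c x y \<le> C" for c e C
    proof -
      have "c x y \<le> e" if i: "i < n" and xy: "x \<in> space Q" "y \<in> space (N k)" and ne: "u i x \<noteq> 0" "u i (\<psi> k y) \<noteq> 0" for i x y
      proof -
        have xM: "x \<in> M" using xy(1) sQ(2) by simp
        have "d x (\<psi> k y) < \<rho>"
          using us[OF i xM ne(1)] us[OF i \<psi>M[OF xy(2)] ne(2)] triangle''[OF xM z[OF i] \<psi>M[OF xy(2)]] by linarith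
        then show ?thesis using good xM xy(2) by blast
      qed
      then have "(\<integral>\<^sup>+x. \<integral>\<^sup>+y. h x y * c x y \<partial>N k \<partial>Q) \<le> e + C * ennreal (1 - (\<Sum>i<n. \<kappa> k i))"
        using h(2)[OF c, of e C] bad sQ(2) by blast
      also have "\<dots> \<le> e + C * ennreal \<beta>"
        using elim by (intro add_left_mono mult_left_mono ennreal_leI) auto
      finally show ?thesis .
    qed
    then show ?case using h(1) by blast
  qed
qed

lemma coupling_density_marginals:
  assumes "prob_space M" "prob_space N" and h: "coupling_density M N h"
  shows "prob_space (density (M \<Otimes>\<^sub>M N) (\<lambda>(x, y). h x y))"
    "distr (density (M \<Otimes>\<^sub>M N) (\<lambda>(x, y). h x y)) M fst = M"
    "distr (density (M \<Otimes>\<^sub>M N) (\<lambda>(x, y). h x y)) N snd = N"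
proof -
  interpret M: prob_space M by fact
  interpret N: prob_space N by fact
  interpret MN: pair_prob_space M N ..
  have hm: "(\<lambda>(x, y). h x y) \<in> borel_measurable (M \<Otimes>\<^sub>M N)"
    and hx: "\<And>x. x \<in> space M \<Longrightarrow> (\<integral>\<^sup>+y. h x y \<partial>N) = 1" and hy: "\<And>y. y \<in> space N \<Longrightarrow> (\<integral>\<^sup>+x. h x y \<partial>M) = 1"
    using h unfolding coupling_density_def by auto
  have sec: "(\<lambda>y. h x y) \<in> borel_measurable N" if "x \<in> space M" for x
    using measurable_compose[OF measurable_Pair1'[OF that] hm] by simp
  have sec': "(\<lambda>x. h x y) \<in> borel_measurable M" if "y \<in> space N" for y
    using measurable_compose[OF measurable_Pair2'[OF that] hm] by simp
  show 1: "distr (density (M \<Otimes>\<^sub>M N) (\<lambda>(x, y). h x y)) M fst = M"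
  proof (rule measure_eqI)
    fix A assume "A \<in> sets (distr (density (M \<Otimes>\<^sub>M N) (\<lambda>(x, y). h x y)) M fst)"
    then have A: "A \<in> sets M" by simp
    have "emeasure (distr (density (M \<Otimes>\<^sub>M N) (\<lambda>(x, y). h x y)) M fst) A
        = (\<integral>\<^sup>+p. (case p of (x, y) \<Rightarrow> h x y) * indicator (fst -` A \<inter> space (M \<Otimes>\<^sub>M N)) p \<partial>(M \<Otimes>\<^sub>M N))"
      using A hm by (subst emeasure_distr) (auto simp: emeasure_density intro: measurable_sets)
    also have "\<dots> = (\<integral>\<^sup>+p. (case p of (x, y) \<Rightarrow> h x y * indicator A x) \<partial>(M \<Otimes>\<^sub>M N))"
      by (rule nn_integral_cong) (auto simp: indicator_def)
    also have "\<dots> = (\<integral>\<^sup>+x. \<integral>\<^sup>+y. h x y * indicator A x \<partial>N \<partial>M)"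
      using hm A by (subst N.nn_integral_fst[symmetric]) (auto simp: case_prod_beta intro!: borel_measurable_times_ennreal measurable_compose[OF measurable_fst])
    also have "\<dots> = (\<integral>\<^sup>+x. indicator A x \<partial>M)"
      using hx sec by (intro nn_integral_cong) (simp add: nn_integral_multc)
    finally show "emeasure (distr (density (M \<Otimes>\<^sub>M N) (\<lambda>(x, y). h x y)) M fst) A = emeasure M A"
      using A by simp
  qed simp
  show "distr (density (M \<Otimes>\<^sub>M N) (\<lambda>(x, y). h x y)) N snd = N"
  proof (rule measure_eqI)
    fix A assume "A \<in> sets (distr (density (M \<Otimes>\<^sub>M N) (\<lambda>(x, y). h x y)) N snd)"
    then have A: "A \<in> sets N" by simp
    have "emeasure (distr (density (M \<Otimes>\<^sub>M N) (\<lambda>(x, y). h x y)) N snd) A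
        = (\<integral>\<^sup>+p. (case p of (x, y) \<Rightarrow> h x y) * indicator (snd -` A \<inter> space (M \<Otimes>\<^sub>M N)) p \<partial>(M \<Otimes>\<^sub>M N))"
      using A hm by (subst emeasure_distr) (auto simp: emeasure_density intro: measurable_sets)
    also have "\<dots> = (\<integral>\<^sup>+p. (case p of (x, y) \<Rightarrow> h x y * indicator A y) \<partial>(M \<Otimes>\<^sub>M N))"
      by (rule nn_integral_cong) (auto simp: indicator_def)
    also have "\<dots> = (\<integral>\<^sup>+y. \<integral>\<^sup>+x. h x y * indicator A y \<partial>M \<partial>N)"
      using hm A by (subst MN.nn_integral_snd[symmetric]) (auto simp: case_prod_beta intro!: borel_measurable_times_ennreal measurable_compose[OF measurable_snd])
    also have "\<dots> = (\<integral>\<^sup>+y. indicator A y \<partial>N)"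
      using hy sec' by (intro nn_integral_cong) (simp add: nn_integral_multc)
    finally show "emeasure (distr (density (M \<Otimes>\<^sub>M N) (\<lambda>(x, y). h x y)) N snd) A = emeasure N A"
      using A by simp
  qed simp
  have "emeasure (density (M \<Otimes>\<^sub>M N) (\<lambda>(x, y). h x y)) (space (M \<Otimes>\<^sub>M N)) = 1"
    using arg_cong[OF 1, of "\<lambda>Q. emeasure Q (space M)"] M.emeasure_space_1
    by (simp add: emeasure_distr space_pair_measure vimage_fst Times_Int_Times)
  then show "prob_space (density (M \<Otimes>\<^sub>M N) (\<lambda>(x, y). h x y))"
    by (intro prob_spaceI) simp
qed

lemma wasserstein_le:
  assumes "\<pi> \<in> couplings (forward_topology X d) \<mu> \<nu>" "transport_cost d p \<pi> \<le> ennreal b" "0 \<le> b" "1 \<le> p"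
  shows "wasserstein X d p \<mu> \<nu> \<le> ennreal (b powr (1 / p))"
proof -
  define c where "c = (INF \<pi>\<in>couplings (forward_topology X d) \<mu> \<nu>. transport_cost d p \<pi>)"
  have "c \<le> ennreal b" unfolding c_def using assms(1,2) by (meson INF_lower order_trans)
  then obtain r where r: "c = ennreal r" "0 \<le> r" "r \<le> b" using assms(3) by (cases c) (auto simp: top_unique)
  have "r powr (1 / p) \<le> b powr (1 / p)" using r assms(4) by (intro powr_mono2) auto
  then show ?thesis unfolding wasserstein_def Let_def c_def[symmetric] using r by (simp add: ennreal_leI)
qed

section \<open>Approximating sequences of spaces\<close>

lemma compact_metric_real_interval: "compact_metric {a..b::real} dist"
proof -
  interpret Submetric UNIV dist "{a..b::real}" by unfold_locales auto
  have eq: "Metric_space.mtopology {a..b::real} dist = top_of_set {a..b}"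
    using mtopology_submetric by simp
  show ?thesis
    by unfold_locales (simp add: eq compact_space_subtopology)
qed

section \<open>Uniform limits of Lipschitz functions, and supports of measures\<close>

context compact_metric
begin

lemma dense_sequence:
  assumes "M \<noteq> {}"
  obtains z :: "nat \<Rightarrow> 'a" where "\<And>n. z n \<in> M"
    "\<And>e. 0 < e \<Longrightarrow> \<exists>N. \<forall>x\<in>M. \<exists>n<N. d (z n) x < e"
proof -
  have "\<exists>Z. finite Z \<and> Z \<subseteq> M \<and> (\<forall>x\<in>M. \<exists>z\<in>Z. d z x < 1 / real (Suc n))" for n
    by (rule finite_net[of "1 / real (Suc n)"]) auto
  then obtain Z where Z: "\<And>n::nat. finite (Z n)" "\<And>n. Z n \<subseteq> M"
      "\<And>n x. x \<in> M \<Longrightarrow> \<exists>z\<in>Z n. d z x < 1 / real (Suc n)"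
    by metis
  define A where "A = (\<Union>n. Z n)"
  have "countable A" unfolding A_def using Z(1) by (intro countable_UN countableI_type countable_finite)
  moreover have "A \<noteq> {}"
  proof -
    obtain x where "x \<in> M" using assms by blast
    from Z(3)[OF this, of 0] show ?thesis unfolding A_def by blast
  qed
  moreover have "A \<subseteq> M" unfolding A_def using Z(2) by blast
  ultimately have A: "countable A" "A \<noteq> {}" "A \<subseteq> M" .
  define z where "z = from_nat_into A"
  show thesis
  proof (rule that[of z])
    show "z n \<in> M" for n unfolding z_def using from_nat_into[OF A(2)] A(3) by blast
    fix e :: real assume "0 < e"
    then obtain m where m: "1 / real (Suc m) < e" using nat_approx_posE by blast
    define \<iota> where "\<iota> a = (SOME n. z n = a)" for a
    have \<iota>: "z (\<iota> a) = a" if "a \<in> Z m" for a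
    proof -
      have "\<exists>n. z n = a" unfolding z_def using from_nat_into_surj[OF A(1), of a] that by (auto simp: A_def)
      then show ?thesis unfolding \<iota>_def by (rule someI_ex)
    qed
    define N where "N = Suc (Max (\<iota> ` Z m))"
    have "\<exists>n<N. d (z n) x < e" if x: "x \<in> M" for x
    proof -
      obtain a where a: "a \<in> Z m" "d a x < 1 / real (Suc m)" using Z(3)[OF x] by blast
      have "\<iota> a < N" unfolding N_def using a(1) Z(1)[of m] by (simp add: le_imp_less_Suc)
      then show ?thesis using \<iota>[OF a(1)] a(2) m by (intro exI[of _ "\<iota> a"]) auto
    qed
    then show "\<exists>N. \<forall>x\<in>M. \<exists>n<N. d (z n) x < e" by blast
  qed
qed

text \<open>Arzela-Ascoli for 1-Lipschitz functions with a common bound. Applied to distance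
  functions of sets it expresses compactness with respect to Hausdorff convergence.\<close>

lemma lipschitz_subseq:
  fixes \<phi> :: "nat \<Rightarrow> 'a \<Rightarrow> real"
  assumes ne: "M \<noteq> {}" and bound: "\<And>k x. x \<in> M \<Longrightarrow> \<phi> k x \<in> {0..B}"
    and lip: "\<And>k x y. x \<in> M \<Longrightarrow> y \<in> M \<Longrightarrow> \<bar>\<phi> k x - \<phi> k y\<bar> \<le> d x y"
  obtains r \<phi>' where "strict_mono (r :: nat \<Rightarrow> nat)"
    "\<And>x. x \<in> M \<Longrightarrow> 0 \<le> \<phi>' x" "\<And>x y. x \<in> M \<Longrightarrow> y \<in> M \<Longrightarrow> \<bar>\<phi>' x - \<phi>' y\<bar> \<le> d x y"
    "uniform_limit M (\<lambda>k. \<phi> (r k)) \<phi>' sequentially"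
proof -
  obtain z :: "nat \<Rightarrow> 'a" where z: "\<And>n. z n \<in> M" "\<And>e. 0 < e \<Longrightarrow> \<exists>N. \<forall>x\<in>M. \<exists>n<N. d (z n) x < e"
    using dense_sequence[OF ne] by metis
  interpret I: compact_metric "{0..B}" dist by (rule compact_metric_real_interval)
  obtain r where r: "strict_mono (r::nat\<Rightarrow>nat)" "\<And>n. \<exists>l\<in>{0..B}. (\<lambda>k. dist (\<phi> (r k) (z n)) l) \<longlonglongrightarrow> 0"
    using I.diagonal_subseq[of "\<lambda>k n. \<phi> k (z n)"] bound[OF z(1)] by metis
  have cauchy: "Cauchy (\<lambda>k. \<phi> (r k) (z n))" for n
  proof -
    obtain l where "(\<lambda>k. dist (\<phi> (r k) (z n)) l) \<longlonglongrightarrow> 0" using r(2) by blast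
    then have "(\<lambda>k. \<phi> (r k) (z n)) \<longlonglongrightarrow> l" by (rule tendsto_dist_iff[THEN iffD2])
    then show ?thesis by (rule LIMSEQ_imp_Cauchy)
  qed
  have "uniformly_Cauchy_on M (\<lambda>k. \<phi> (r k))"
    unfolding uniformly_Cauchy_on_def
  proof (intro allI impI)
    fix e :: real assume e: "0 < e"
    obtain N where N: "\<And>x. x \<in> M \<Longrightarrow> \<exists>n<N. d (z n) x < e/3" using z(2)[of "e/3"] e by auto
    have "\<exists>K. \<forall>k\<ge>K. \<forall>j\<ge>K. dist (\<phi> (r k) (z n)) (\<phi> (r j) (z n)) < e/3" for n
      using cauchy[of n] e unfolding Cauchy_def by (meson divide_pos_pos zero_less_numeral)
    then obtain K where K: "\<And>n k j. k \<ge> K n \<Longrightarrow> j \<ge> K n \<Longrightarrow> dist (\<phi> (r k) (z n)) (\<phi> (r j) (z n)) < e/3"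
      by metis
    \<comment> \<open>Inserting 0 guards against the maximum of an empty set when
      \<open>N = 0\<close>.\<close>
    define K' where "K' = Max (insert 0 (K ` {..<N}))"
    have K': "K n \<le> K'" if "n < N" for n unfolding K'_def using that by simp
    have "dist (\<phi> (r k) x) (\<phi> (r j) x) < e" if "x \<in> M" "k \<ge> K'" "j \<ge> K'" for x k j
    proof -
      obtain n where n: "n < N" "d (z n) x < e/3" using N[OF \<open>x \<in> M\<close>] by blast
      have "dist (\<phi> (r k) (z n)) (\<phi> (r j) (z n)) < e/3" using K[of n k j] K'[OF n(1)] that by simp
      then show ?thesis
        using lip[OF z(1) \<open>x \<in> M\<close>, of "r k" n] lip[OF z(1) \<open>x \<in> M\<close>, of "r j" n] n(2)
        unfolding dist_real_def by linarith
    qed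
    then show "\<exists>K. \<forall>x\<in>M. \<forall>m\<ge>K. \<forall>n\<ge>K. dist (\<phi> (r m) x) (\<phi> (r n) x) < e" by blast
  qed
  then have "uniformly_convergent_on M (\<lambda>k. \<phi> (r k))" by (rule Cauchy_uniformly_convergent)
  then obtain \<phi>' where \<phi>': "uniform_limit M (\<lambda>k. \<phi> (r k)) \<phi>' sequentially"
    unfolding uniformly_convergent_on_def by blast
  have lim: "(\<lambda>k. \<phi> (r k) x) \<longlonglongrightarrow> \<phi>' x" if "x \<in> M" for x
    by (rule tendsto_uniform_limitI[OF \<phi>' that])
  show thesis
  proof (rule that[OF r(1) _ _ \<phi>'])
    show "0 \<le> \<phi>' x" if "x \<in> M" for x
      by (rule LIMSEQ_le_const[OF lim[OF that]]) (use bound[OF that] in auto)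
    show "\<bar>\<phi>' x - \<phi>' y\<bar> \<le> d x y" if "x \<in> M" "y \<in> M" for x y
      by (rule LIMSEQ_le_const2[OF tendsto_rabs[OF tendsto_diff[OF lim lim]]]) (use that lip in auto)
  qed
qed

definition supp :: "'a measure \<Rightarrow> 'a set" where
  "supp Q = {x \<in> M. \<forall>r>0. 0 < measure Q (mball x r)}"

lemma supp_subset: "supp Q \<subseteq> M"
  by (auto simp: supp_def)

text \<open>A point off the support lies in a null member of a countable base, and there are only
  countably many of these.\<close>

lemma AE_supp:
  assumes "finite_measure Q" "sets Q = sets (borel_of mtopology)"
  shows "AE x in Q. x \<in> supp Q"
proof -
  interpret finite_measure Q by fact
  have sp: "space Q = M" using sets_eq_imp_space_eq[OF assms(2)] by simp
  obtain \<B> where \<B>: "countable \<B>" "\<And>V. V \<in> \<B> \<Longrightarrow> openin mtopology V"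
    "\<And>U x. openin mtopology U \<Longrightarrow> x \<in> U \<Longrightarrow> \<exists>V\<in>\<B>. x \<in> V \<and> V \<subseteq> U"
    by (rule countable_basis) blast
  define \<N> where "\<N> = {V \<in> \<B>. measure Q V = 0}"
  have sets: "V \<in> sets Q" if "openin mtopology V" for V
    using openin_sets_borel_of[OF that] assms(2) by simp
  have "countable \<N>" unfolding \<N>_def using \<B>(1) by (auto intro: countable_subset)
  moreover have "V \<in> null_sets Q" if "V \<in> \<N>" for V
    using that sets[OF \<B>(2)] unfolding \<N>_def by (auto simp: null_sets_def emeasure_eq_measure)
  ultimately have "(\<Union>V\<in>\<N>. V) \<in> null_sets Q" by (intro null_sets_UN') auto
  then have AE: "AE x in Q. x \<notin> (\<Union>V\<in>\<N>. V)" by (rule AE_not_in)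
  have in_supp: "x \<in> supp Q" if xM: "x \<in> M" and xN: "x \<notin> (\<Union>V\<in>\<N>. V)" for x
  proof (rule ccontr)
    assume "x \<notin> supp Q"
    then obtain r where r: "r > 0" "\<not> 0 < measure Q (mball x r)" using xM unfolding supp_def by blast
    then have r0: "measure Q (mball x r) = 0" using measure_nonneg[of Q "mball x r"] by linarith
    obtain V where V: "V \<in> \<B>" "x \<in> V" "V \<subseteq> mball x r"
      using \<B>(3)[OF openin_mball[of x r], of x] xM r(1) by auto
    have "measure Q V \<le> measure Q (mball x r)"
      by (rule finite_measure_mono[OF V(3) sets[OF openin_mball]])
    then have "measure Q V = 0" using r0 measure_nonneg[of Q V] by linarith
    then show False using xN V(1,2) unfolding \<N>_def by blast
  qed
  from AE AE_space show ?thesis by eventually_elim (use sp in_supp in auto)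
qed

lemma supp_nonempty:
  assumes "prob_space Q" "sets Q = sets (borel_of mtopology)"
  shows "supp Q \<noteq> {}"
proof
  interpret prob_space Q by fact
  assume "supp Q = {}"
  then have "AE x in Q. False" using AE_supp[OF finite_measure_axioms assms(2)] by simp
  then show False by simp
qed

text \<open>If a ball is null, so is every ball of half its radius around a point of the concentric
  half ball.\<close>

lemma closedin_supp:
  assumes "finite_measure Q" "sets Q = sets (borel_of mtopology)"
  shows "closedin mtopology (supp Q)"
proof -
  interpret finite_measure Q by fact
  have "openin mtopology (M - supp Q)"
    unfolding openin_mtopology
  proof (intro conjI allI impI)
    fix x assume "x \<in> M - supp Q"
    then have xM: "x \<in> M" and "\<exists>r>0. \<not> 0 < measure Q (mball x r)" unfolding supp_def by auto
    then obtain r where r: "r > 0" "\<not> 0 < measure Q (mball x r)" by blast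
    have "y \<notin> supp Q" if y: "y \<in> mball x (r/2)" for y
    proof -
      have "mball y (r/2) \<subseteq> mball x r"
      proof
        fix w assume "w \<in> mball y (r/2)"
        then show "w \<in> mball x r" using y triangle[of x y w] by auto
      qed
      then have "measure Q (mball y (r/2)) \<le> measure Q (mball x r)"
        by (rule finite_measure_mono) (simp add: assms(2) openin_sets_borel_of)
      then show ?thesis using r unfolding supp_def by (auto intro!: exI[of _ "r/2"])
    qed
    then show "\<exists>r>0. mball x r \<subseteq> M - supp Q"
      using r(1) by (intro exI[of _ "r/2"]) auto
  qed blast
  then show ?thesis using supp_subset by (simp add: closedin_def)
qed

end

section \<open>Geodesics of the limit space near images of geodesics\<close>

locale gh_convergence = compact_theta_space \<theta> X d
  for \<theta> :: real and X :: "'b set" and d :: "'b \<Rightarrow> 'b \<Rightarrow> real" +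
  fixes Y :: "nat \<Rightarrow> 'a set" and \<rho> :: "nat \<Rightarrow> 'a \<Rightarrow> 'a \<Rightarrow> real"
    and \<epsilon> :: "nat \<Rightarrow> real" and f :: "nat \<Rightarrow> 'a \<Rightarrow> 'b" and P :: "nat \<Rightarrow> (real \<Rightarrow> 'a) measure"
  assumes Y: "compact_theta_space \<theta> (Y k) (\<rho> k)"
    and f_in: "x \<in> Y k \<Longrightarrow> f k x \<in> X"
    and isom: "x \<in> Y k \<Longrightarrow> x' \<in> Y k \<Longrightarrow> \<bar>d (f k x) (f k x') - \<rho> k x x'\<bar> \<le> \<epsilon> k"
    and \<epsilon>_lim: "\<epsilon> \<longlonglongrightarrow> 0"
    and f_meas: "f k \<in> borel_of (forward_topology (Y k) (\<rho> k)) \<rightarrow>\<^sub>M borel_of (forward_topology X d)"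
    and P_prob: "P k \<in> prob_borel_measures (geodesic_topology (Y k) (\<rho> k))"
begin

lemma Y_theta: "theta_metric_space \<theta> (Y k) (\<rho> k)"
  using Y compact_theta_space_def by blast

lemma symd_f_le:
  assumes "x \<in> Y k" "x' \<in> Y k"
  shows "symd d (f k x) (f k x') \<le> symd (\<rho> k) x x' + \<epsilon> k"
proof -
  have "0 \<le> \<epsilon> k" using isom[OF assms] by linarith
  then show ?thesis using isom[OF assms] isom[OF assms(2,1)] unfolding symd_def by linarith
qed

text \<open>A sequence of counterexamples would have a subsequence whose images converge uniformly
  to a geodesic of \<open>X\<close>.\<close>

lemma near_eventually:
  assumes e: "0 < e"
  shows "\<forall>\<^sub>F k in sequentially. \<forall>\<gamma>\<in>geodesics (Y k) (\<rho> k). \<exists>\<eta>\<in>geodesics X d.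
    \<forall>t\<in>{0..1}. symd d (f k (\<gamma> t)) (\<eta> t) \<le> e"
proof (rule ccontr)
  assume "\<not> ?thesis"
  then obtain s where s: "strict_mono (s::nat\<Rightarrow>nat)" and "\<And>n. \<not> (\<forall>\<gamma>\<in>geodesics (Y (s n)) (\<rho> (s n)). \<exists>\<eta>\<in>geodesics X d.
    \<forall>t\<in>{0..1}. symd d (f (s n) (\<gamma> t)) (\<eta> t) \<le> e)"
    using not_eventually_sequentiallyD by blast
  then have "\<forall>n. \<exists>\<gamma>. \<gamma> \<in> geodesics (Y (s n)) (\<rho> (s n)) \<and> (\<forall>\<eta>\<in>geodesics X d. \<exists>t\<in>{0..1}. \<not> symd d (f (s n) (\<gamma> t)) (\<eta> t) \<le> e)"
    by blast
  then obtain \<gamma> where \<gamma>: "\<And>n. \<gamma> n \<in> geodesics (Y (s n)) (\<rho> (s n))"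
    "\<And>n \<eta>. \<eta> \<in> geodesics X d \<Longrightarrow> \<exists>t\<in>{0..1}. \<not> symd d (f (s n) (\<gamma> n t)) (\<eta> t) \<le> e" by metis
  obtain \<eta> r where \<eta>: "\<eta> \<in> geodesics X d" and r: "strict_mono (r :: nat \<Rightarrow> nat)"
    "\<And>e. 0 < e \<Longrightarrow> \<exists>N. \<forall>k\<ge>N. \<forall>t\<in>{0..1}. symd d (f (s (r k)) (\<gamma> (r k) t)) (\<eta> t) < e"
  proof (rule geodesics_subconverge[of "\<lambda>n. Y (s n)" "\<lambda>n. \<rho> (s n)" "\<lambda>n. f (s n)" "\<lambda>n. \<epsilon> (s n)" \<gamma>])
    show "(\<lambda>n. \<epsilon> (s n)) \<longlonglongrightarrow> 0" using LIMSEQ_subseq_LIMSEQ[OF \<epsilon>_lim s] by (simp add: o_def)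
  qed (use Y_theta f_in isom \<gamma>(1) in auto)
  obtain N where "\<forall>k\<ge>N. \<forall>t\<in>{0..1}. symd d (f (s (r k)) (\<gamma> (r k) t)) (\<eta> t) < e" using r(2)[OF e] by blast
  then show False using \<gamma>(2)[OF \<eta>, of "r N"] by (auto simp: not_le intro: less_asym)
qed

lemma constant_geodesic: "x \<in> X \<Longrightarrow> (\<lambda>t\<in>{0..1}. x) \<in> geodesics X d"
  using zero[of x x] by (intro geodesicsI) auto

text \<open>Choosing \<open>\<Phi> k\<close> constant on the pieces of a finite Borel partition makes its measurability
  trivial.\<close>

theorem nearby_geodesics:
  obtains \<Phi> \<delta> where "\<delta> \<longlonglongrightarrow> (0::real)"
    "\<And>k. \<Phi> k \<in> borel_of (geodesic_topology (Y k) (\<rho> k)) \<rightarrow>\<^sub>M borel_of (geodesic_topology X d)"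
    "\<And>k \<gamma> t. \<gamma> \<in> geodesics (Y k) (\<rho> k) \<Longrightarrow> t \<in> {0..1} \<Longrightarrow> symd d (f k (\<gamma> t)) (\<Phi> k \<gamma> t) \<le> \<delta> k"
proof -
  define near where "near k e \<longleftrightarrow> (\<forall>\<gamma>\<in>geodesics (Y k) (\<rho> k). \<exists>\<eta>\<in>geodesics X d.
    \<forall>t\<in>{0..1}. symd d (f k (\<gamma> t)) (\<eta> t) \<le> e)" for k e
  obtain B where B: "0 < B" "\<And>x y. x \<in> X \<Longrightarrow> y \<in> X \<Longrightarrow> symd d x y \<le> B" using dist_bounded by metis
  have Yg: "\<gamma> t \<in> Y k" if "\<gamma> \<in> geodesics (Y k) (\<rho> k)" "t \<in> {0..1}" for k \<gamma> t
    using theta_metric_space.geodesics_in[OF Y_theta that] .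
  \<comment> \<open>Constant geodesics are within the diameter bound \<open>B\<close> of everything,
    so the infimum of admissible errors below is over a nonempty set for every
    \<open>k\<close>.\<close>
  have nearB: "near k B" for k
    unfolding near_def
  proof
    fix \<gamma> assume \<gamma>: "\<gamma> \<in> geodesics (Y k) (\<rho> k)"
    have "f k (\<gamma> 0) \<in> X" using f_in Yg[OF \<gamma>, of 0] by simp
    then show "\<exists>\<eta>\<in>geodesics X d. \<forall>t\<in>{0..1}. symd d (f k (\<gamma> t)) (\<eta> t) \<le> B"
      using B(2) f_in Yg[OF \<gamma>] by (intro bexI[OF _ constant_geodesic[of "f k (\<gamma> 0)"]]) auto
  qed
  define E where "E k = {e. 0 \<le> e \<and> near k e}" for k
  have E: "B \<in> E k" "bdd_below (E k)" for k
    unfolding E_def using nearB B(1) by (auto intro!: bdd_belowI[of _ 0])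
  \<comment> \<open>The infimum need not be attained; the vanishing surplus \<open>1 / (k+1)\<close>
    makes \<open>\<eta> k\<close> an admissible error.\<close>
  define \<eta> where "\<eta> k = Inf (E k) + 1 / real (Suc k)" for k
  have near\<eta>: "near k (\<eta> k)" for k
  proof -
    have "Inf (E k) < \<eta> k" unfolding \<eta>_def by simp
    moreover have "E k \<noteq> {}" using E(1) by blast
    ultimately obtain e where e: "e \<in> E k" "e < \<eta> k" using cInf_lessD by metis
    show ?thesis
      unfolding near_def
    proof
      fix \<gamma> assume "\<gamma> \<in> geodesics (Y k) (\<rho> k)"
      then obtain \<zeta> where "\<zeta> \<in> geodesics X d" "\<forall>t\<in>{0..1}. symd d (f k (\<gamma> t)) (\<zeta> t) \<le> e"
        using e(1) unfolding E_def near_def by blast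
      then show "\<exists>\<zeta>\<in>geodesics X d. \<forall>t\<in>{0..1}. symd d (f k (\<gamma> t)) (\<zeta> t) \<le> \<eta> k"
        using e(2) by (meson less_imp_le order_trans)
    qed
  qed
  have Inf_lim: "(\<lambda>k. Inf (E k)) \<longlonglongrightarrow> 0"
  proof (rule tendstoI)
    fix e :: real assume e: "0 < e"
    have "\<forall>\<^sub>F k in sequentially. near k (e/2)"
      unfolding near_def using near_eventually[of "e/2"] e by simp
    then show "\<forall>\<^sub>F k in sequentially. dist (Inf (E k)) 0 < e"
    proof eventually_elim
      case (elim k)
      have "Inf (E k) \<le> e/2" by (rule cInf_lower[OF _ E(2)]) (use elim e in \<open>simp add: E_def\<close>)
      moreover have "0 \<le> Inf (E k)" by (rule cInf_greatest) (use E(1) in \<open>auto simp: E_def\<close>)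
      ultimately show ?case using e by (simp add: dist_real_def)
    qed
  qed
  have Suc_lim: "(\<lambda>k. 1 / real (Suc k)) \<longlonglongrightarrow> 0" by (rule LIMSEQ_Suc[OF lim_1_over_n])
  \<comment> \<open>The error has three sources: rounding \<open>\<gamma>\<close> to
    \<open>q \<gamma>\<close>, the distortion of \<open>f k\<close>, and the distance from the image
    of \<open>q \<gamma>\<close> to the geodesic chosen for it.\<close>
  have "\<exists>\<Phi>. \<Phi> \<in> borel_of (geodesic_topology (Y k) (\<rho> k)) \<rightarrow>\<^sub>M borel_of (geodesic_topology X d) \<and>
    (\<forall>\<gamma>\<in>geodesics (Y k) (\<rho> k). \<forall>t\<in>{0..1}. symd d (f k (\<gamma> t)) (\<Phi> \<gamma> t) \<le> 1 / real (Suc k) + \<epsilon> k + \<eta> k)" for k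
  proof -
    interpret Yk: compact_theta_space \<theta> "Y k" "\<rho> k" by (rule Y)
    interpret G: compact_theta_space \<theta> "geodesics (Y k) (\<rho> k)" "uniform_dist (\<rho> k)" by (rule Yk.compact_theta_geodesics)
    obtain q where q: "q \<in> borel_of G.S.mtopology \<rightarrow>\<^sub>M count_space (geodesics (Y k) (\<rho> k))"
      "\<And>\<gamma>. \<gamma> \<in> geodesics (Y k) (\<rho> k) \<Longrightarrow> symd (uniform_dist (\<rho> k)) \<gamma> (q \<gamma>) < 1 / real (Suc k)"
      using G.S.simple_approximation[of "1 / real (Suc k)"] by (metis of_nat_0_less_iff zero_less_Suc zero_less_divide_1_iff)
    have qin: "q \<gamma> \<in> geodesics (Y k) (\<rho> k)" if "\<gamma> \<in> geodesics (Y k) (\<rho> k)" for \<gamma>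
      using measurable_space[OF q(1)] that by simp
    obtain h where h: "\<And>\<gamma>. \<gamma> \<in> geodesics (Y k) (\<rho> k) \<Longrightarrow> h \<gamma> \<in> geodesics X d"
      "\<And>\<gamma> t. \<gamma> \<in> geodesics (Y k) (\<rho> k) \<Longrightarrow> t \<in> {0..1} \<Longrightarrow> symd d (f k (\<gamma> t)) (h \<gamma> t) \<le> \<eta> k"
      using near\<eta>[of k] unfolding near_def by metis
    have "(\<lambda>\<gamma>. h (q \<gamma>)) \<in> borel_of (geodesic_topology (Y k) (\<rho> k)) \<rightarrow>\<^sub>M borel_of (geodesic_topology X d)"
      unfolding geodesic_topology_def[of "Y k"] G.forward_topology_eq
      by (rule measurable_compose[OF q(1)]) (use h(1) in \<open>simp add: topspace_geodesic_topology\<close>)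
    moreover have "symd d (f k (\<gamma> t)) (h (q \<gamma>) t) \<le> 1 / real (Suc k) + \<epsilon> k + \<eta> k"
      if \<gamma>: "\<gamma> \<in> geodesics (Y k) (\<rho> k)" and t: "t \<in> {0..1}" for \<gamma> t
    proof -
      note Y1 = Yg[OF \<gamma> t] and Y2 = Yg[OF qin[OF \<gamma>] t]
      have "symd d (f k (\<gamma> t)) (f k (q \<gamma> t)) \<le> symd (\<rho> k) (\<gamma> t) (q \<gamma> t) + \<epsilon> k"
        by (rule symd_f_le[OF Y1 Y2])
      moreover have "symd (\<rho> k) (\<gamma> t) (q \<gamma> t) \<le> 1 / real (Suc k)"
        using Yk.symd_le_symd_uniform[OF \<gamma> qin[OF \<gamma>] t] q(2)[OF \<gamma>] by linarith
      moreover have "symd d (f k (\<gamma> t)) (h (q \<gamma>) t) \<le> symd d (f k (\<gamma> t)) (f k (q \<gamma> t)) + symd d (f k (q \<gamma> t)) (h (q \<gamma>) t)"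
        by (rule symd_triangle[OF f_in[OF Y1] f_in[OF Y2] geodesics_in[OF h(1)[OF qin[OF \<gamma>]] t]])
      ultimately show ?thesis using h(2)[OF qin[OF \<gamma>] t] by linarith
    qed
    ultimately show ?thesis by blast
  qed
  then obtain \<Phi> where \<Phi>: "\<And>k. \<Phi> k \<in> borel_of (geodesic_topology (Y k) (\<rho> k)) \<rightarrow>\<^sub>M borel_of (geodesic_topology X d)"
    "\<And>k \<gamma> t. \<gamma> \<in> geodesics (Y k) (\<rho> k) \<Longrightarrow> t \<in> {0..1} \<Longrightarrow> symd d (f k (\<gamma> t)) (\<Phi> k \<gamma> t) \<le> 1 / real (Suc k) + \<epsilon> k + \<eta> k"
    by metis
  have "(\<lambda>k. 1 / real (Suc k) + \<epsilon> k + \<eta> k) \<longlonglongrightarrow> 0 + 0 + (0 + 0)"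
    unfolding \<eta>_def by (intro tendsto_add Suc_lim \<epsilon>_lim Inf_lim)
  then show thesis using that[OF _ \<Phi>] by simp
qed

end

lemma integral_close_limit:
  fixes a b :: "nat \<Rightarrow> 'a \<Rightarrow> real" and l :: real
  assumes "\<And>k. prob_space (N k)" "\<And>k. integrable (N k) (a k)" "\<And>k. integrable (N k) (b k)"
    and close: "\<And>e. 0 < e \<Longrightarrow> \<forall>\<^sub>F k in sequentially. \<forall>\<omega>\<in>space (N k). \<bar>a k \<omega> - b k \<omega>\<bar> \<le> e"
    and lim: "(\<lambda>k. \<integral>\<omega>. b k \<omega> \<partial>N k) \<longlonglongrightarrow> l"
  shows "(\<lambda>k. \<integral>\<omega>. a k \<omega> \<partial>N k) \<longlonglongrightarrow> l"
proof -
  have "(\<lambda>k. (\<integral>\<omega>. a k \<omega> \<partial>N k) - (\<integral>\<omega>. b k \<omega> \<partial>N k)) \<longlonglongrightarrow> 0"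
  proof (rule tendstoI)
    fix e :: real assume e: "0 < e"
    show "\<forall>\<^sub>F k in sequentially. dist ((\<integral>\<omega>. a k \<omega> \<partial>N k) - (\<integral>\<omega>. b k \<omega> \<partial>N k)) 0 < e"
      using close[OF half_gt_zero[OF e]]
    proof eventually_elim
      case (elim k)
      interpret prob_space "N k" by fact
      have "\<bar>(\<integral>\<omega>. a k \<omega> \<partial>N k) - (\<integral>\<omega>. b k \<omega> \<partial>N k)\<bar> = \<bar>\<integral>\<omega>. a k \<omega> - b k \<omega> \<partial>N k\<bar>"
        using assms(2,3) by simp
      also have "\<dots> \<le> (\<integral>\<omega>. \<bar>a k \<omega> - b k \<omega>\<bar> \<partial>N k)" by (rule integral_abs_bound)
      also have "\<dots> \<le> (\<integral>\<omega>. e/2 \<partial>N k)"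
        using assms(2,3) elim by (intro integral_mono integrable_abs Bochner_Integration.integrable_diff) auto
      also have "\<dots> = e/2" by (simp add: prob_space)
      finally show ?case using e by (simp add: dist_real_def)
    qed
  qed
  from tendsto_add[OF this lim] show ?thesis by simp
qed

text \<open>\<open>M\<close> and \<open>N\<close> may be measures on curves; only their images under
  \<open>\<phi>\<close> and \<open>\<xi>\<close> live on \<open>X\<close>. With the density kept
  upstairs, one coupling of curves induces couplings of positions at any time.\<close>

lemma (in compact_theta_space) density_coupling:
  assumes M: "prob_space M" and N: "prob_space N" and h: "coupling_density M N h"
    and \<phi>: "\<phi> \<in> M \<rightarrow>\<^sub>M borel_of (forward_topology X d)" and \<xi>: "\<xi> \<in> N \<rightarrow>\<^sub>M borel_of (forward_topology X d)"
  defines "\<pi> \<equiv> distr (density (M \<Otimes>\<^sub>M N) (\<lambda>(x, y). h x y))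
    (borel_of (prod_topology (forward_topology X d) (forward_topology X d))) (\<lambda>(x, y). (\<phi> x, \<xi> y))"
  shows "\<pi> \<in> couplings (forward_topology X d) (distr M (borel_of (forward_topology X d)) \<phi>)
      (distr N (borel_of (forward_topology X d)) \<xi>)"
    and "transport_cost d p \<pi> = (\<integral>\<^sup>+x. \<integral>\<^sup>+y. h x y * ennreal (d (\<phi> x) (\<xi> y) powr p) \<partial>N \<partial>M)"
proof -
  interpret M: prob_space M by fact
  interpret N: prob_space N by fact
  let ?T = "forward_topology X d"
  define D where "D = density (M \<Otimes>\<^sub>M N) (\<lambda>(x, y). h x y)"
  have hm: "(\<lambda>(x, y). h x y) \<in> borel_measurable (M \<Otimes>\<^sub>M N)"
    using h unfolding coupling_density_def by auto
  have sD: "sets D = sets (M \<Otimes>\<^sub>M N)" unfolding D_def by simp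
  have \<phi>': "(\<lambda>p. \<phi> (fst p)) \<in> M \<Otimes>\<^sub>M N \<rightarrow>\<^sub>M borel_of ?T"
    by (rule measurable_compose[OF measurable_fst \<phi>])
  have \<xi>': "(\<lambda>p. \<xi> (snd p)) \<in> M \<Otimes>\<^sub>M N \<rightarrow>\<^sub>M borel_of ?T"
    by (rule measurable_compose[OF measurable_snd \<xi>])
  have pm: "(\<lambda>(x, y). (\<phi> x, \<xi> y)) \<in> M \<Otimes>\<^sub>M N \<rightarrow>\<^sub>M borel_of (prod_topology ?T ?T)"
    unfolding case_prod_beta by (rule measurable_pairI[OF \<phi>' \<xi>'])
  then have pD: "(\<lambda>(x, y). (\<phi> x, \<xi> y)) \<in> D \<rightarrow>\<^sub>M borel_of (prod_topology ?T ?T)"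
    using measurable_cong_sets[OF sD refl] by blast
  have fD: "fst \<in> D \<rightarrow>\<^sub>M M" "snd \<in> D \<rightarrow>\<^sub>M N" using measurable_cong_sets[OF sD refl] by auto
  have m1: "fst \<in> borel_of (prod_topology ?T ?T) \<rightarrow>\<^sub>M borel_of ?T" "snd \<in> borel_of (prod_topology ?T ?T) \<rightarrow>\<^sub>M borel_of ?T"
    by (auto intro!: continuous_map_measurable continuous_map_fst continuous_map_snd)
  note marg = coupling_density_marginals[OF M N h, folded D_def]
  have "distr \<pi> (borel_of ?T) fst = distr D (borel_of ?T) (\<lambda>p. \<phi> (fst p))"
    unfolding \<pi>_def D_def[symmetric] by (subst distr_distr[OF m1(1) pD]) (simp add: comp_def case_prod_beta)
  also have "\<dots> = distr (distr D M fst) (borel_of ?T) \<phi>"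
    by (subst distr_distr[OF \<phi> fD(1)]) (simp add: comp_def)
  finally have 1: "distr \<pi> (borel_of ?T) fst = distr M (borel_of ?T) \<phi>" by (simp add: marg)
  have "distr \<pi> (borel_of ?T) snd = distr D (borel_of ?T) (\<lambda>p. \<xi> (snd p))"
    unfolding \<pi>_def D_def[symmetric] by (subst distr_distr[OF m1(2) pD]) (simp add: comp_def case_prod_beta)
  also have "\<dots> = distr (distr D N snd) (borel_of ?T) \<xi>"
    by (subst distr_distr[OF \<xi> fD(2)]) (simp add: comp_def)
  finally have 2: "distr \<pi> (borel_of ?T) snd = distr N (borel_of ?T) \<xi>" by (simp add: marg)
  have "\<pi> \<in> prob_borel_measures (prod_topology ?T ?T)"
    unfolding \<pi>_def D_def[symmetric] by (rule prob_borel_measures_distr[OF marg(1) pD])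
  then show "\<pi> \<in> couplings ?T (distr M (borel_of ?T) \<phi>) (distr N (borel_of ?T) \<xi>)"
    unfolding couplings_def using 1 2 by simp
  have cm: "(\<lambda>(x, y). ennreal (d x y powr p)) \<in> borel_measurable (borel_of (prod_topology ?T ?T))"
    using powr_real_measurable[OF continuous_map_real_measurable[OF dist_continuous] borel_measurable_const[of p]]
    by (simp add: case_prod_beta)
  have cm': "(\<lambda>q. ennreal (d (\<phi> (fst q)) (\<xi> (snd q)) powr p)) \<in> borel_measurable (M \<Otimes>\<^sub>M N)"
    using dist_measurable[OF \<phi>' \<xi>'] by simp
  have "transport_cost d p \<pi> = (\<integral>\<^sup>+q. ennreal (d (\<phi> (fst q)) (\<xi> (snd q)) powr p) \<partial>D)"
    unfolding transport_cost_def \<pi>_def D_def[symmetric]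
    by (subst nn_integral_distr[OF pD]) (use cm in \<open>simp_all add: case_prod_beta\<close>)
  also have "\<dots> = (\<integral>\<^sup>+q. (case q of (x, y) \<Rightarrow> h x y) * ennreal (d (\<phi> (fst q)) (\<xi> (snd q)) powr p) \<partial>(M \<Otimes>\<^sub>M N))"
    unfolding D_def by (rule nn_integral_density[OF hm cm'])
  also have "\<dots> = (\<integral>\<^sup>+x. \<integral>\<^sup>+y. h x y * ennreal (d (\<phi> x) (\<xi> y) powr p) \<partial>N \<partial>M)"
    using hm cm' by (subst N.nn_integral_fst[symmetric]) (simp_all add: case_prod_beta)
  finally show "transport_cost d p \<pi> = (\<integral>\<^sup>+x. \<integral>\<^sup>+y. h x y * ennreal (d (\<phi> x) (\<xi> y) powr p) \<partial>N \<partial>M)" .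
qed

lemma (in compact_theta_space) geodesic_path_measurable:
  assumes "\<gamma> \<in> geodesics X d"
  shows "\<gamma> \<in> lebesgue_on {0..1} \<rightarrow>\<^sub>M borel_of (forward_topology X d)"
proof -
  have "continuous_map (top_of_set {0..1}) (forward_topology X d) \<gamma>"
    using assms unfolding geodesics_def by blast
  from measurable_compose[OF lebesgue_on_unit_measurable continuous_map_measurable[OF this]]
  show ?thesis by simp
qed

lemma (in compact_theta_space) path_measure_continuous:
  "continuous_map (geodesic_topology X d) (path_measure_topology X d) (path_measure X d)"
proof -
  interpret G: compact_theta_space \<theta> "geodesics X d" "uniform_dist d" by (rule compact_theta_geodesics)
  show ?thesis
    unfolding path_measure_topology_def
  proof (rule continuous_map_into_weak_prob_topology)
    show "path_measure X d \<gamma> \<in> prob_borel_measures path_dom" if "\<gamma> \<in> topspace (geodesic_topology X d)" for \<gamma>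
      using that by (simp add: topspace_geodesic_topology path_measure_prob geodesic_path_measurable)
    fix g assume g: "continuous_map path_dom euclideanreal g"
    show "continuous_map (geodesic_topology X d) euclideanreal (\<lambda>\<gamma>. \<integral>x. g x \<partial>path_measure X d \<gamma>)"
      unfolding geodesic_topology_def G.forward_topology_eq
    proof (rule G.S.continuous_map_realI)
      fix \<gamma> and e :: real assume \<gamma>: "\<gamma> \<in> geodesics X d" and e: "0 < e"
      obtain \<delta> where \<delta>: "0 < \<delta>" "\<And>\<alpha> \<beta>. \<alpha> \<in> lebesgue_on {0..1} \<rightarrow>\<^sub>M borel_of (forward_topology X d) \<Longrightarrow>
        \<beta> \<in> lebesgue_on {0..1} \<rightarrow>\<^sub>M borel_of (forward_topology X d) \<Longrightarrow>
        (\<And>t. t \<in> {0..1} \<Longrightarrow> symd d (\<alpha> t) (\<beta> t) < \<delta>) \<Longrightarrow>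
        \<bar>(\<integral>x. g x \<partial>path_measure X d \<alpha>) - (\<integral>x. g x \<partial>path_measure X d \<beta>)\<bar> \<le> e/2"
        by (rule path_integral_close[OF g half_gt_zero[OF e]]) blast
      have "\<bar>(\<integral>x. g x \<partial>path_measure X d \<gamma>) - (\<integral>x. g x \<partial>path_measure X d \<eta>)\<bar> < e"
        if \<eta>: "\<eta> \<in> geodesics X d" "symd (uniform_dist d) \<gamma> \<eta> < \<delta>" for \<eta>
      proof -
        have "symd d (\<gamma> t) (\<eta> t) < \<delta>" if "t \<in> {0..1}" for t
          using symd_le_symd_uniform[OF \<gamma> \<eta>(1) that] \<eta>(2) by linarith
        from \<delta>(2)[OF geodesic_path_measurable[OF \<gamma>] geodesic_path_measurable[OF \<eta>(1)] this]
        show ?thesis using e by linarith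
      qed
      then show "\<exists>\<delta>>0. \<forall>\<eta>\<in>geodesics X d. symd (uniform_dist d) \<gamma> \<eta> < \<delta> \<longrightarrow>
          \<bar>(\<integral>x. g x \<partial>path_measure X d \<gamma>) - (\<integral>x. g x \<partial>path_measure X d \<eta>)\<bar> < e"
        using \<delta>(1) by blast
    qed
  qed
qed

section \<open>Extraction of a convergent subsequence of plans and supports\<close>

context gh_convergence
begin

definition plan_supp :: "nat \<Rightarrow> (real \<Rightarrow> 'a) set" where
  "plan_supp k = compact_metric.supp (geodesics (Y k) (\<rho> k)) (symd (uniform_dist (\<rho> k))) (P k)"

lemma P_props:
  shows "prob_space (P k)" "sets (P k) = sets (borel_of (geodesic_topology (Y k) (\<rho> k)))"
    "space (P k) = geodesics (Y k) (\<rho> k)"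
  using prob_borel_measuresD[OF P_prob[of k]] compact_theta_space.topspace_geodesic_topology[OF Y] by auto

lemma plan_supp:
  shows "plan_supp k \<subseteq> geodesics (Y k) (\<rho> k)" "plan_supp k \<noteq> {}" "AE \<gamma> in P k. \<gamma> \<in> plan_supp k"
    "closedin (geodesic_topology (Y k) (\<rho> k)) (plan_supp k)"
proof -
  interpret Yk: compact_theta_space \<theta> "Y k" "\<rho> k" by (rule Y)
  interpret G: compact_theta_space \<theta> "geodesics (Y k) (\<rho> k)" "uniform_dist (\<rho> k)" by (rule Yk.compact_theta_geodesics)
  interpret Pk: prob_space "P k" by (rule P_props)
  have s: "sets (P k) = sets (borel_of G.S.mtopology)"
    using P_props(2)[of k] by (simp add: geodesic_topology_def G.forward_topology_eq)
  show "plan_supp k \<subseteq> geodesics (Y k) (\<rho> k)" "plan_supp k \<noteq> {}" "AE \<gamma> in P k. \<gamma> \<in> plan_supp k"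
    unfolding plan_supp_def using G.S.supp_subset G.S.supp_nonempty[OF Pk.prob_space_axioms s]
      G.S.AE_supp[OF Pk.finite_measure_axioms s] by auto
  show "closedin (geodesic_topology (Y k) (\<rho> k)) (plan_supp k)"
    unfolding plan_supp_def geodesic_topology_def G.forward_topology_eq
    by (rule G.S.closedin_supp[OF Pk.finite_measure_axioms s])
qed

lemma gh_convergence_subseq:
  assumes "strict_mono r"
  shows "gh_convergence \<theta> X d (\<lambda>k. Y (r k)) (\<lambda>k. \<rho> (r k)) (\<lambda>k. \<epsilon> (r k)) (\<lambda>k. f (r k)) (\<lambda>k. P (r k))"
proof (intro gh_convergence.intro gh_convergence_axioms.intro compact_theta_space_axioms)
  show "(\<lambda>k. \<epsilon> (r k)) \<longlonglongrightarrow> 0" using LIMSEQ_subseq_LIMSEQ[OF \<epsilon>_lim assms] by (simp add: o_def)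
qed (use Y f_in isom f_meas P_prob in auto)

end

text \<open>Apart from weak convergence, the supports of the plans are required to converge in the
  Hausdorff sense: \<open>S_dist\<close> is the uniform limit of the distance functions to the supports. Weak
  convergence alone would not force the speed fields to converge uniformly, since a vanishing
  amount of mass may keep determining them far from the limit measure.\<close>

locale gh_limit = gh_convergence \<theta> X d Y \<rho> \<epsilon> f P
  for \<theta> :: real and X :: "'b set" and d :: "'b \<Rightarrow> 'b \<Rightarrow> real"
    and Y :: "nat \<Rightarrow> 'a set" and \<rho> :: "nat \<Rightarrow> 'a \<Rightarrow> 'a \<Rightarrow> real"
    and \<epsilon> :: "nat \<Rightarrow> real" and f :: "nat \<Rightarrow> 'a \<Rightarrow> 'b" and P :: "nat \<Rightarrow> (real \<Rightarrow> 'a) measure" +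
  fixes \<Phi> :: "nat \<Rightarrow> (real \<Rightarrow> 'a) \<Rightarrow> (real \<Rightarrow> 'b)" and \<delta> :: "nat \<Rightarrow> real" and Q :: "(real \<Rightarrow> 'b) measure"
    and S_dist :: "(real \<Rightarrow> 'b) \<Rightarrow> real"
  assumes \<delta>_lim: "\<delta> \<longlonglongrightarrow> 0"
    and \<Phi>_meas: "\<Phi> k \<in> borel_of (geodesic_topology (Y k) (\<rho> k)) \<rightarrow>\<^sub>M borel_of (geodesic_topology X d)"
    and \<Phi>_near: "\<gamma> \<in> geodesics (Y k) (\<rho> k) \<Longrightarrow> t \<in> {0..1} \<Longrightarrow> symd d (f k (\<gamma> t)) (\<Phi> k \<gamma> t) \<le> \<delta> k"
    and Q_prob: "Q \<in> prob_borel_measures (geodesic_topology X d)"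
    and Q_lim: "continuous_map (geodesic_topology X d) euclideanreal g \<Longrightarrow>
      (\<lambda>k. \<integral>\<gamma>. g (\<Phi> k \<gamma>) \<partial>P k) \<longlonglongrightarrow> (\<integral>\<gamma>. g \<gamma> \<partial>Q)"
    and S_dist_nonneg: "\<eta> \<in> geodesics X d \<Longrightarrow> 0 \<le> S_dist \<eta>"
    and S_dist_lipschitz: "\<eta> \<in> geodesics X d \<Longrightarrow> \<zeta> \<in> geodesics X d \<Longrightarrow>
      \<bar>S_dist \<eta> - S_dist \<zeta>\<bar> \<le> symd (uniform_dist d) \<eta> \<zeta>"
    and S_dist_lim: "uniform_limit (geodesics X d)
      (\<lambda>k \<eta>. INF \<gamma>\<in>plan_supp k. symd (uniform_dist d) (\<Phi> k \<gamma>) \<eta>) S_dist sequentially"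

context gh_convergence
begin

theorem gh_limit_exists:
  "\<exists>r \<Phi> \<delta> Q S_dist. strict_mono r \<and> gh_limit \<theta> X d (\<lambda>k. Y (r k)) (\<lambda>k. \<rho> (r k)) (\<lambda>k. \<epsilon> (r k))
    (\<lambda>k. f (r k)) (\<lambda>k. P (r k)) \<Phi> \<delta> Q S_dist"
proof -
  interpret G: compact_theta_space \<theta> "geodesics X d" "uniform_dist d" by (rule compact_theta_geodesics)
  have T: "geodesic_topology X d = G.S.mtopology"
    by (simp add: geodesic_topology_def G.forward_topology_eq)
  obtain \<Phi> \<delta> where \<delta>: "\<delta> \<longlonglongrightarrow> (0::real)"
    and \<Phi>: "\<And>k. \<Phi> k \<in> borel_of (geodesic_topology (Y k) (\<rho> k)) \<rightarrow>\<^sub>M borel_of (geodesic_topology X d)"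
    and near: "\<And>k \<gamma> t. \<gamma> \<in> geodesics (Y k) (\<rho> k) \<Longrightarrow> t \<in> {0..1} \<Longrightarrow> symd d (f k (\<gamma> t)) (\<Phi> k \<gamma> t) \<le> \<delta> k"
    apply (rule nearby_geodesics)
    subgoal premises p for \<Phi> \<delta> by (rule p(1)[of \<delta> \<Phi>]) (fact p)+
    done
  have \<Phi>P: "\<Phi> k \<in> P k \<rightarrow>\<^sub>M borel_of G.S.mtopology" for k
    using \<Phi>[of k] measurable_cong_sets[OF P_props(2) refl] unfolding T by blast
  have \<Phi>in: "\<Phi> k \<gamma> \<in> geodesics X d" if "\<gamma> \<in> geodesics (Y k) (\<rho> k)" for k \<gamma>
    using measurable_space[OF \<Phi>P, of \<gamma> k] that P_props(3) by simp
  define \<mu> where "\<mu> k = distr (P k) (borel_of G.S.mtopology) (\<Phi> k)" for k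
  obtain r Q where r: "strict_mono (r :: nat \<Rightarrow> nat)" and Q: "prob_space Q" "sets Q = sets (borel_of G.S.mtopology)"
    and lim: "\<And>g. continuous_map G.S.mtopology euclideanreal g \<Longrightarrow> (\<lambda>n. \<integral>x. g x \<partial>\<mu> (r n)) \<longlonglongrightarrow> (\<integral>x. g x \<partial>Q)"
  proof (rule G.S.weakly_convergent_subseq[of \<mu>])
    show "prob_space (\<mu> n)" for n unfolding \<mu>_def by (rule prob_space.prob_space_distr[OF P_props(1) \<Phi>P])
  qed (auto simp: \<mu>_def)
  \<comment> \<open>The distance to the image of the support, 1-Lipschitz in \<open>\<eta>\<close>.
    A second extraction makes these functions converge uniformly, which is Hausdorff convergence of
    the image sets.\<close>
  define \<phi> where "\<phi> k \<eta> = (INF \<gamma>\<in>plan_supp k. symd (uniform_dist d) (\<Phi> k \<gamma>) \<eta>)" for k \<eta>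
  obtain B where B: "0 < B" "\<And>\<gamma> \<eta>. \<gamma> \<in> geodesics X d \<Longrightarrow> \<eta> \<in> geodesics X d \<Longrightarrow> symd (uniform_dist d) \<gamma> \<eta> \<le> B"
    using G.S.mdist_bounded by metis
  have bdd: "bdd_below ((\<lambda>\<gamma>. symd (uniform_dist d) (\<Phi> k \<gamma>) \<eta>) ` plan_supp k)" for k \<eta>
    by (intro bdd_belowI2[of _ 0]) simp
  have \<phi>_range: "\<phi> k \<eta> \<in> {0..B}" if \<eta>: "\<eta> \<in> geodesics X d" for k \<eta>
  proof -
    obtain \<gamma> where \<gamma>: "\<gamma> \<in> plan_supp k" using plan_supp(2) by blast
    have "\<phi> k \<eta> \<le> symd (uniform_dist d) (\<Phi> k \<gamma>) \<eta>" unfolding \<phi>_def by (rule cINF_lower[OF bdd \<gamma>])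
    also have "\<dots> \<le> B" by (rule B(2)[OF \<Phi>in \<eta>]) (use \<gamma> plan_supp(1) in blast)
    moreover have "0 \<le> \<phi> k \<eta>" unfolding \<phi>_def by (rule cINF_greatest[OF plan_supp(2)]) simp
    ultimately show ?thesis by simp
  qed
  have \<phi>_le: "\<phi> k \<eta> \<le> \<phi> k \<zeta> + symd (uniform_dist d) \<eta> \<zeta>" if "\<eta> \<in> geodesics X d" "\<zeta> \<in> geodesics X d" for k \<eta> \<zeta>
  proof -
    have "\<phi> k \<eta> - symd (uniform_dist d) \<eta> \<zeta> \<le> symd (uniform_dist d) (\<Phi> k \<gamma>) \<zeta>" if \<gamma>: "\<gamma> \<in> plan_supp k" for \<gamma>
    proof -
      have "\<phi> k \<eta> \<le> symd (uniform_dist d) (\<Phi> k \<gamma>) \<eta>" unfolding \<phi>_def by (rule cINF_lower[OF bdd \<gamma>])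
      moreover have "\<Phi> k \<gamma> \<in> geodesics X d" using \<Phi>in \<gamma> plan_supp(1) by blast
      ultimately show ?thesis using G.S.triangle'[of "\<Phi> k \<gamma>" \<zeta> \<eta>] \<open>\<eta> \<in> geodesics X d\<close> \<open>\<zeta> \<in> geodesics X d\<close> by linarith
    qed
    then have "\<phi> k \<eta> - symd (uniform_dist d) \<eta> \<zeta> \<le> \<phi> k \<zeta>"
      unfolding \<phi>_def[of k \<zeta>] by (rule cINF_greatest[OF plan_supp(2)])
    then show ?thesis by linarith
  qed
  have ne: "geodesics X d \<noteq> {}"
    using prob_space.not_empty[OF Q(1)] sets_eq_imp_space_eq[OF Q(2)] by simp
  obtain s S_dist where s: "strict_mono (s :: nat \<Rightarrow> nat)"
    "\<And>\<gamma>. \<gamma> \<in> geodesics X d \<Longrightarrow> 0 \<le> S_dist \<gamma>"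
    "\<And>\<gamma> \<eta>. \<gamma> \<in> geodesics X d \<Longrightarrow> \<eta> \<in> geodesics X d \<Longrightarrow> \<bar>S_dist \<gamma> - S_dist \<eta>\<bar> \<le> symd (uniform_dist d) \<gamma> \<eta>"
    "uniform_limit (geodesics X d) (\<lambda>k. \<phi> (r (s k))) S_dist sequentially"
  proof (rule G.S.lipschitz_subseq[OF ne, of "\<lambda>k. \<phi> (r k)" B])
    show "\<bar>\<phi> (r k) x - \<phi> (r k) y\<bar> \<le> symd (uniform_dist d) x y" if "x \<in> geodesics X d" "y \<in> geodesics X d" for k x y
      using \<phi>_le[OF that, of "r k"] \<phi>_le[OF that(2,1), of "r k"] by (simp add: symd_commute)
  qed (use \<phi>_range in auto)
  \<comment> \<open>Weak convergence along \<open>r\<close> persists along the further subsequence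
    \<open>r \<circ> s\<close>.\<close>
  define q where "q k = r (s k)" for k
  have q: "strict_mono q" unfolding q_def using strict_mono_o[OF r s(1)] by (simp add: o_def)
  interpret sub: gh_convergence \<theta> X d "\<lambda>k. Y (q k)" "\<lambda>k. \<rho> (q k)" "\<lambda>k. \<epsilon> (q k)" "\<lambda>k. f (q k)" "\<lambda>k. P (q k)"
    by (rule gh_convergence_subseq[OF q])
  have "gh_limit \<theta> X d (\<lambda>k. Y (q k)) (\<lambda>k. \<rho> (q k)) (\<lambda>k. \<epsilon> (q k)) (\<lambda>k. f (q k)) (\<lambda>k. P (q k))
    (\<lambda>k. \<Phi> (q k)) (\<lambda>k. \<delta> (q k)) Q S_dist"
  proof (intro gh_limit.intro gh_limit_axioms.intro sub.gh_convergence_axioms)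
    show "(\<lambda>k. \<delta> (q k)) \<longlonglongrightarrow> 0" using LIMSEQ_subseq_LIMSEQ[OF \<delta> q] by (simp add: o_def)
    show "Q \<in> prob_borel_measures (geodesic_topology X d)"
      unfolding prob_borel_measures_def T using Q by simp
    show "(\<lambda>k. \<integral>\<gamma>. g (\<Phi> (q k) \<gamma>) \<partial>P (q k)) \<longlonglongrightarrow> (\<integral>\<gamma>. g \<gamma> \<partial>Q)"
      if "continuous_map (geodesic_topology X d) euclideanreal g" for g
    proof -
      have g: "continuous_map G.S.mtopology euclideanreal g" using that by (simp add: T)
      have "(\<integral>x. g x \<partial>\<mu> k) = (\<integral>\<gamma>. g (\<Phi> k \<gamma>) \<partial>P k)" for k
        unfolding \<mu>_def by (rule integral_distr[OF \<Phi>P continuous_map_real_measurable[OF g]])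
      then show ?thesis
        using LIMSEQ_subseq_LIMSEQ[OF lim[OF g] s(1)] by (simp add: o_def q_def)
    qed
    show "uniform_limit (geodesics X d)
      (\<lambda>k \<eta>. INF \<gamma>\<in>sub.plan_supp k. symd (uniform_dist d) (\<Phi> (q k) \<gamma>) \<eta>) S_dist sequentially"
      using s(4) unfolding sub.plan_supp_def \<phi>_def plan_supp_def unfolding q_def .
  qed (use \<Phi> near s(2,3) in auto)
  then show ?thesis using q by blast
qed

end

section \<open>Limits of plans\<close>

context compact_theta_space
begin

lemma geodesic_plan:
  assumes "N \<in> prob_borel_measures (geodesic_topology X d)"
  shows "prob_space N" "sets N = sets (borel_of (geodesic_topology X d))" "space N = geodesics X d"
  using prob_borel_measuresD[OF assms] by (auto simp: topspace_geodesic_topology)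

lemma geodesic_plan_measurable:
  assumes "N \<in> prob_borel_measures (geodesic_topology X d)"
  shows "f \<in> N \<rightarrow>\<^sub>M M' \<longleftrightarrow> f \<in> borel_of (geodesic_topology X d) \<rightarrow>\<^sub>M M'"
  using measurable_cong_sets[OF geodesic_plan(2)[OF assms] refl] by blast

lemma length_nonneg: "\<gamma> \<in> geodesics X d \<Longrightarrow> 0 \<le> d (\<gamma> 0) (\<gamma> 1)"
  using nonneg geodesics_in by (metis atLeastAtMost_iff order_refl zero_le_one)

text \<open>Replaces the length, an extended supremum over partitions, by the continuous function
  \<open>d (\<gamma> 0) (\<gamma> 1)\<close>, to which measurability and weak convergence
  apply.\<close>

lemma kinetic_energy_eq:
  assumes N: "N \<in> prob_borel_measures (geodesic_topology X d)"
  shows "kinetic_energy X d N t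
    = distr (density N (\<lambda>\<gamma>. ennreal ((d (\<gamma> 0) (\<gamma> 1))\<^sup>2 / 2))) (borel_of (forward_topology X d)) (\<lambda>\<gamma>. \<gamma> t)"
proof -
  have eq: "curve_length d \<gamma> ^ 2 / 2 = ennreal ((d (\<gamma> 0) (\<gamma> 1))\<^sup>2 / 2)" if "\<gamma> \<in> space N" for \<gamma>
  proof -
    have "\<gamma> \<in> geodesics X d" using that geodesic_plan(3)[OF N] by simp
    then show ?thesis
      using length_nonneg[of \<gamma>] by (simp add: curve_length_geodesic ennreal_power divide_ennreal[symmetric])
  qed
  have m: "(\<lambda>\<gamma>. ennreal ((d (\<gamma> 0) (\<gamma> 1))\<^sup>2 / 2)) \<in> borel_measurable N"
    using continuous_map_real_measurable[OF length_continuous] unfolding geodesic_plan_measurable[OF N] by simp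
  then have m': "(\<lambda>\<gamma>. curve_length d \<gamma> ^ 2 / 2) \<in> borel_measurable N"
    by (rule measurable_cong[THEN iffD2, rotated]) (rule eq)
  have "density N (\<lambda>\<gamma>. curve_length d \<gamma> ^ 2 / 2) = density N (\<lambda>\<gamma>. ennreal ((d (\<gamma> 0) (\<gamma> 1))\<^sup>2 / 2))"
    by (rule density_cong[OF m' m]) (use eq in \<open>auto intro: AE_I2\<close>)
  then show ?thesis unfolding kinetic_energy_def by simp
qed

lemma endpoint_plan_prob:
  assumes N: "N \<in> prob_borel_measures (geodesic_topology X d)"
  shows "endpoint_plan X d N \<in> prob_borel_measures (prod_topology (forward_topology X d) (forward_topology X d))"
    and "(\<lambda>\<gamma>. (\<gamma> 0, \<gamma> 1)) \<in> N \<rightarrow>\<^sub>M borel_of (prod_topology (forward_topology X d) (forward_topology X d))"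
proof -
  show *: "(\<lambda>\<gamma>. (\<gamma> 0, \<gamma> 1)) \<in> N \<rightarrow>\<^sub>M borel_of (prod_topology (forward_topology X d) (forward_topology X d))"
    unfolding geodesic_plan_measurable[OF N] by (rule continuous_map_measurable[OF endpoint_continuous])
  show "endpoint_plan X d N \<in> prob_borel_measures (prod_topology (forward_topology X d) (forward_topology X d))"
    unfolding endpoint_plan_def by (rule prob_borel_measures_distr[OF geodesic_plan(1)[OF N] *])
qed

lemma plan_evaluation_measurable:
  assumes "N \<in> prob_borel_measures (geodesic_topology X d)" "t \<in> {0..1}"
  shows "(\<lambda>\<gamma>. \<gamma> t) \<in> N \<rightarrow>\<^sub>M borel_of (forward_topology X d)"
  unfolding geodesic_plan_measurable[OF assms(1)] by (rule evaluation_measurable[OF assms(2)])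

lemma square_compact_metric:
  "compact_metric (X \<times> X) (prod_dist (symd d) (symd d))"
  "prod_topology (forward_topology X d) (forward_topology X d) = Metric_space.mtopology (X \<times> X) (prod_dist (symd d) (symd d))"
  using compact_metric_prod[OF S.compact_metric_axioms S.compact_metric_axioms] by (simp_all add: forward_topology_eq)

end

section \<open>Passage to the limit for path measures, endpoint plans and energies\<close>

context gh_limit
begin

interpretation G: compact_theta_space \<theta> "geodesics X d" "uniform_dist d" by (rule compact_theta_geodesics)

lemma geodesic_topology_eq: "geodesic_topology X d = G.S.mtopology"
  by (simp add: geodesic_topology_def G.forward_topology_eq)

lemma Y_in: "\<gamma> \<in> geodesics (Y k) (\<rho> k) \<Longrightarrow> t \<in> {0..1} \<Longrightarrow> \<gamma> t \<in> Y k"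
  using theta_metric_space.geodesics_in[OF Y_theta] .

lemma \<Phi>P: "\<Phi> k \<in> P k \<rightarrow>\<^sub>M borel_of (geodesic_topology X d)"
  using \<Phi>_meas[of k] measurable_cong_sets[OF P_props(2) refl] by blast

lemma \<Phi>_in: "\<gamma> \<in> geodesics (Y k) (\<rho> k) \<Longrightarrow> \<Phi> k \<gamma> \<in> geodesics X d"
  using measurable_space[OF \<Phi>P, of \<gamma> k] P_props(3) by (simp add: topspace_geodesic_topology)

lemma f_eval_measurable:
  assumes "t \<in> {0..1}" shows "(\<lambda>\<gamma>. f k (\<gamma> t)) \<in> P k \<rightarrow>\<^sub>M borel_of (forward_topology X d)"
  by (rule measurable_compose[OF compact_theta_space.plan_evaluation_measurable[OF Y P_prob assms] f_meas])

text \<open>The distortion of \<open>f k\<close> enters once, the distance \<open>\<delta> k\<close>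
  at each of the two endpoints.\<close>

lemma length_\<Phi>:
  assumes "\<gamma> \<in> geodesics (Y k) (\<rho> k)"
  shows "\<bar>\<rho> k (\<gamma> 0) (\<gamma> 1) - d (\<Phi> k \<gamma> 0) (\<Phi> k \<gamma> 1)\<bar> \<le> \<epsilon> k + 2 * \<delta> k"
proof -
  have 0: "(0::real) \<in> {0..1}" and 1: "(1::real) \<in> {0..1}" by auto
  note y = Y_in[OF assms 0] Y_in[OF assms 1]
  note g = geodesics_in[OF \<Phi>_in[OF assms] 0] geodesics_in[OF \<Phi>_in[OF assms] 1]
  show ?thesis
    using isom[OF y] dist_perturb[OF f_in[OF y(1)] f_in[OF y(2)] g] \<Phi>_near[OF assms 0] \<Phi>_near[OF assms 1] by linarith
qed

lemma length_error_lim: "(\<lambda>k. \<epsilon> k + 2 * \<delta> k) \<longlonglongrightarrow> 0"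
  using tendsto_add[OF \<epsilon>_lim tendsto_mult_left[OF \<delta>_lim, of 2]] by simp

text \<open>The limits of integrals reduce to this: an integrand on curves of \<open>Y k\<close>
  that is uniformly close to \<open>g \<circ> \<Phi> k\<close> has the integral of \<open>g\<close>
  as its limit. The bound \<open>C k\<close> serves integrability only and may vary with
  \<open>k\<close>.\<close>

lemma transfer_limit:
  fixes a :: "nat \<Rightarrow> (real \<Rightarrow> 'a) \<Rightarrow> real"
  assumes meas: "\<And>k. a k \<in> borel_measurable (P k)"
    and g: "continuous_map (geodesic_topology X d) euclideanreal g"
    and bound: "\<And>k \<gamma>. \<gamma> \<in> geodesics (Y k) (\<rho> k) \<Longrightarrow> \<bar>a k \<gamma>\<bar> \<le> C k"
    and close: "\<And>e. 0 < e \<Longrightarrow> \<forall>\<^sub>F k in sequentially. \<forall>\<gamma>\<in>geodesics (Y k) (\<rho> k). \<bar>a k \<gamma> - g (\<Phi> k \<gamma>)\<bar> \<le> e"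
  shows "(\<lambda>k. \<integral>\<gamma>. a k \<gamma> \<partial>P k) \<longlonglongrightarrow> (\<integral>\<gamma>. g \<gamma> \<partial>Q)"
proof (rule integral_close_limit[where b="\<lambda>k \<gamma>. g (\<Phi> k \<gamma>)"])
  obtain B where B: "\<And>\<eta>. \<eta> \<in> geodesics X d \<Longrightarrow> \<bar>g \<eta>\<bar> \<le> B"
    using G.S.continuous_map_real_bounded[of g] g unfolding geodesic_topology_eq by metis
  show "integrable (P k) (a k)" for k
  proof -
    interpret prob_space "P k" by (rule P_props)
    show ?thesis
      using bound meas by (intro integrable_const_bound[of _ "C k"] AE_I2) (auto simp: P_props)
  qed
  show "integrable (P k) (\<lambda>\<gamma>. g (\<Phi> k \<gamma>))" for k
  proof -
    interpret prob_space "P k" by (rule P_props)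
    show ?thesis
      using B \<Phi>_in continuous_map_real_comp_measurable[OF g \<Phi>P]
      by (intro integrable_const_bound[of _ B] AE_I2) (auto simp: P_props)
  qed
qed (use close P_props Q_lim[OF g] in auto)

lemma endpoint_limit:
  assumes g: "continuous_map (prod_topology (forward_topology X d) (forward_topology X d)) euclideanreal g"
  shows "(\<lambda>k. \<integral>\<gamma>. g (f k (\<gamma> 0), f k (\<gamma> 1)) \<partial>P k) \<longlonglongrightarrow> (\<integral>\<gamma>. g (\<gamma> 0, \<gamma> 1) \<partial>Q)"
proof -
  interpret Z: compact_metric "X \<times> X" "prod_dist (symd d) (symd d)" by (rule square_compact_metric(1))
  interpret ZZ: Metric_space12 X "symd d" X "symd d" by unfold_locales
  note g' = g[unfolded square_compact_metric(2)]
  obtain B where B: "\<And>p. p \<in> X \<times> X \<Longrightarrow> \<bar>g p\<bar> \<le> B" using Z.continuous_map_real_bounded[OF g'] by metis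
  have 0: "(0::real) \<in> {0..1}" and 1: "(1::real) \<in> {0..1}" by auto
  have fX: "f k (\<gamma> t) \<in> X" if "\<gamma> \<in> geodesics (Y k) (\<rho> k)" "t \<in> {0..1}" for k \<gamma> t
    using f_in Y_in that by blast
  show ?thesis
  proof (rule transfer_limit[where C="\<lambda>_. B"])
    show "(\<lambda>\<gamma>. g (f k (\<gamma> 0), f k (\<gamma> 1))) \<in> borel_measurable (P k)" for k
      by (rule continuous_map_real_comp_measurable[OF g measurable_pairI[OF f_eval_measurable[OF 0] f_eval_measurable[OF 1]]])
    show "continuous_map (geodesic_topology X d) euclideanreal (\<lambda>\<gamma>. g (\<gamma> 0, \<gamma> 1))"
      using continuous_map_compose[OF endpoint_continuous g] by (simp add: o_def)
    show "\<bar>g (f k (\<gamma> 0), f k (\<gamma> 1))\<bar> \<le> B" if "\<gamma> \<in> geodesics (Y k) (\<rho> k)" for k \<gamma>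
      using B fX that by simp
    fix e :: real assume e: "0 < e"
    obtain \<eta> where \<eta>: "0 < \<eta>" "\<And>x y. x \<in> X \<times> X \<Longrightarrow> y \<in> X \<times> X \<Longrightarrow> prod_dist (symd d) (symd d) x y < \<eta> \<Longrightarrow> \<bar>g x - g y\<bar> < e"
      using Z.uniform_continuity[OF g' e] by metis
    have "\<forall>\<^sub>F k in sequentially. \<delta> k < \<eta>/2"
      by (rule order_tendstoD(2)[OF \<delta>_lim]) (use \<eta> in simp)
    then show "\<forall>\<^sub>F k in sequentially. \<forall>\<gamma>\<in>geodesics (Y k) (\<rho> k).
        \<bar>g (f k (\<gamma> 0), f k (\<gamma> 1)) - g (\<Phi> k \<gamma> 0, \<Phi> k \<gamma> 1)\<bar> \<le> e"
    proof eventually_elim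
      case (elim k)
      show ?case
      proof
        fix \<gamma> assume \<gamma>: "\<gamma> \<in> geodesics (Y k) (\<rho> k)"
        note p = fX[OF \<gamma> 0] fX[OF \<gamma> 1] geodesics_in[OF \<Phi>_in[OF \<gamma>] 0] geodesics_in[OF \<Phi>_in[OF \<gamma>] 1]
        have "prod_dist (symd d) (symd d) (f k (\<gamma> 0), f k (\<gamma> 1)) (\<Phi> k \<gamma> 0, \<Phi> k \<gamma> 1) < \<eta>"
          using ZZ.prod_metric_le_components[OF p(1,3,2,4)] \<Phi>_near[OF \<gamma> 0] \<Phi>_near[OF \<gamma> 1] elim by linarith
        then show "\<bar>g (f k (\<gamma> 0), f k (\<gamma> 1)) - g (\<Phi> k \<gamma> 0, \<Phi> k \<gamma> 1)\<bar> \<le> e"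
          using \<eta>(2)[of "(f k (\<gamma> 0), f k (\<gamma> 1))" "(\<Phi> k \<gamma> 0, \<Phi> k \<gamma> 1)"] p by simp
      qed
    qed
  qed
qed

lemma energy_limit:
  assumes h: "continuous_map (forward_topology X d) euclideanreal h" and t: "t \<in> {0..1}"
  shows "(\<lambda>k. \<integral>\<gamma>. (\<rho> k (\<gamma> 0) (\<gamma> 1))\<^sup>2 / 2 * h (f k (\<gamma> t)) \<partial>P k) \<longlonglongrightarrow> (\<integral>\<gamma>. (d (\<gamma> 0) (\<gamma> 1))\<^sup>2 / 2 * h (\<gamma> t) \<partial>Q)"
proof -
  note h' = h[unfolded forward_topology_eq]
  obtain B where B: "0 < B" "\<And>p. p \<in> X \<Longrightarrow> \<bar>h p\<bar> \<le> B" using S.continuous_map_real_bounded[OF h'] by metis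
  obtain L where L: "0 < L" "\<And>x y. x \<in> X \<Longrightarrow> y \<in> X \<Longrightarrow> d x y \<le> L" using dist_bounded by metis
  have 0: "(0::real) \<in> {0..1}" and 1: "(1::real) \<in> {0..1}" by auto
  have fX: "f k (\<gamma> t) \<in> X" if "\<gamma> \<in> geodesics (Y k) (\<rho> k)" "t \<in> {0..1}" for k \<gamma> t
    using f_in Y_in that by blast
  have lenY: "0 \<le> \<rho> k (\<gamma> 0) (\<gamma> 1)" "\<rho> k (\<gamma> 0) (\<gamma> 1) \<le> L + \<epsilon> k" if "\<gamma> \<in> geodesics (Y k) (\<rho> k)" for k \<gamma>
    using compact_theta_space.length_nonneg[OF Y that] isom[OF Y_in[OF that 0] Y_in[OF that 1]]
      L(2)[OF fX[OF that 0] fX[OF that 1]] by auto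
  show ?thesis
  proof (rule transfer_limit[where C="\<lambda>k. (L + \<epsilon> k)\<^sup>2 / 2 * B"])
    show "(\<lambda>\<gamma>. (\<rho> k (\<gamma> 0) (\<gamma> 1))\<^sup>2 / 2 * h (f k (\<gamma> t))) \<in> borel_measurable (P k)" for k
    proof -
      have "(\<lambda>\<gamma>. \<rho> k (\<gamma> 0) (\<gamma> 1)) \<in> borel_measurable (P k)"
        using continuous_map_real_measurable[OF compact_theta_space.length_continuous[OF Y]]
        unfolding compact_theta_space.geodesic_plan_measurable[OF Y P_prob] .
      then show ?thesis
        using continuous_map_real_comp_measurable[OF h f_eval_measurable[OF t]] by simp
    qed
    show "continuous_map (geodesic_topology X d) euclideanreal (\<lambda>\<gamma>. (d (\<gamma> 0) (\<gamma> 1))\<^sup>2 / 2 * h (\<gamma> t))"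
      using continuous_map_compose[OF evaluation_continuous[OF t] h] length_continuous
      by (intro continuous_map_real_mult continuous_map_real_divide continuous_map_real_pow) (auto simp: o_def)
    show "\<bar>(\<rho> k (\<gamma> 0) (\<gamma> 1))\<^sup>2 / 2 * h (f k (\<gamma> t))\<bar> \<le> (L + \<epsilon> k)\<^sup>2 / 2 * B" if "\<gamma> \<in> geodesics (Y k) (\<rho> k)" for k \<gamma>
      using B(2)[OF fX[OF that t]] power_mono[OF lenY(2)[OF that] lenY(1)[OF that], of 2]
      by (subst abs_mult) (intro mult_mono, auto)
    fix e :: real assume e: "0 < e"
    \<comment> \<open>The difference of the two products is split into a change of \<open>h\<close>
      and a change of length, controlled by \<open>e1\<close> and \<open>e2\<close>; each part is
      allowed \<open>e / 2\<close>.\<close>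
    define e1 where "e1 = e / (2 * (L + 1)\<^sup>2)"
    define e2 where "e2 = min 1 (e / (2 * (L + 1) * B))"
    have e1: "0 < e1" unfolding e1_def using e L(1) by simp
    have e2: "0 < e2" unfolding e2_def using e L(1) B(1) by simp
    obtain \<eta> where \<eta>: "0 < \<eta>" "\<And>x y. x \<in> X \<Longrightarrow> y \<in> X \<Longrightarrow> symd d x y < \<eta> \<Longrightarrow> \<bar>h x - h y\<bar> < e1"
      using S.uniform_continuity[OF h' e1] by metis
    have "\<forall>\<^sub>F k in sequentially. \<delta> k < \<eta>" by (rule order_tendstoD(2)[OF \<delta>_lim \<eta>(1)])
    moreover have "\<forall>\<^sub>F k in sequentially. \<epsilon> k + 2 * \<delta> k < e2" by (rule order_tendstoD(2)[OF length_error_lim e2])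
    moreover have "\<forall>\<^sub>F k in sequentially. \<epsilon> k < 1" by (rule order_tendstoD(2)[OF \<epsilon>_lim]) simp
    ultimately show "\<forall>\<^sub>F k in sequentially. \<forall>\<gamma>\<in>geodesics (Y k) (\<rho> k).
      \<bar>(\<rho> k (\<gamma> 0) (\<gamma> 1))\<^sup>2 / 2 * h (f k (\<gamma> t)) - (d (\<Phi> k \<gamma> 0) (\<Phi> k \<gamma> 1))\<^sup>2 / 2 * h (\<Phi> k \<gamma> t)\<bar> \<le> e"
    proof eventually_elim
      case (elim k)
      show ?case
      proof
        fix \<gamma> assume \<gamma>: "\<gamma> \<in> geodesics (Y k) (\<rho> k)"
        define l l' y y' where "l = \<rho> k (\<gamma> 0) (\<gamma> 1)" and "l' = d (\<Phi> k \<gamma> 0) (\<Phi> k \<gamma> 1)"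
          and "y = h (f k (\<gamma> t))" and "y' = h (\<Phi> k \<gamma> t)"
        have l: "0 \<le> l" "l \<le> L + 1" using lenY[OF \<gamma>] elim(3) by (auto simp: l_def)
        have l': "0 \<le> l'" "l' \<le> L + 1"
          using length_nonneg[OF \<Phi>_in[OF \<gamma>]] L(2)[OF geodesics_in[OF \<Phi>_in[OF \<gamma>] 0] geodesics_in[OF \<Phi>_in[OF \<gamma>] 1]]
          by (auto simp: l'_def)
        have ll: "\<bar>l - l'\<bar> \<le> e2" using length_\<Phi>[OF \<gamma>] elim(2) by (simp add: l_def l'_def)
        have yy: "\<bar>y - y'\<bar> \<le> e1"
          using \<eta>(2)[OF fX[OF \<gamma> t] geodesics_in[OF \<Phi>_in[OF \<gamma>] t]] \<Phi>_near[OF \<gamma> t] elim(1) by (simp add: y_def y'_def)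
        have y': "\<bar>y'\<bar> \<le> B" using B(2)[OF geodesics_in[OF \<Phi>_in[OF \<gamma>] t]] by (simp add: y'_def)
        have "l\<^sup>2 / 2 * y - l'\<^sup>2 / 2 * y' = l\<^sup>2 / 2 * (y - y') + (l - l') * ((l + l') / 2) * y'"
          by (simp add: field_simps power2_eq_square)
        also have "\<bar>\<dots>\<bar> \<le> \<bar>l\<^sup>2 / 2 * (y - y')\<bar> + \<bar>(l - l') * ((l + l') / 2) * y'\<bar>" by (rule abs_triangle_ineq)
        also have "\<dots> = l\<^sup>2 / 2 * \<bar>y - y'\<bar> + \<bar>l - l'\<bar> * ((l + l') / 2) * \<bar>y'\<bar>"
          using l l' by (simp add: abs_mult)
        also have "\<dots> \<le> (L + 1)\<^sup>2 * e1 + e2 * (L + 1) * B"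
        proof (rule add_mono)
          have "l\<^sup>2 \<le> (L + 1)\<^sup>2" using l by (intro power_mono) auto
          then have "l\<^sup>2 / 2 \<le> (L + 1)\<^sup>2" using zero_le_power2[of "L + 1"] by linarith
          then show "l\<^sup>2 / 2 * \<bar>y - y'\<bar> \<le> (L + 1)\<^sup>2 * e1" using yy by (intro mult_mono) auto
          show "\<bar>l - l'\<bar> * ((l + l') / 2) * \<bar>y'\<bar> \<le> e2 * (L + 1) * B"
            using ll l l' y' e2 L(1) by (intro mult_mono mult_nonneg_nonneg) auto
        qed
        also have "(L + 1)\<^sup>2 * e1 = e / 2" unfolding e1_def using L(1) by (simp add: field_simps)
        also have "e2 * (L + 1) * B \<le> e / (2 * (L + 1) * B) * (L + 1) * B"
          unfolding e2_def using L(1) B(1) by (intro mult_right_mono) auto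
        also have "e / (2 * (L + 1) * B) * (L + 1) * B = e / 2"
        proof -
          have c: "x / (2 * c) * c = x / 2" if "0 < c" for x c :: real using that by simp
          show ?thesis using c[of "(L + 1) * B" e] L(1) B(1) by (simp only: mult.assoc) simp
        qed
        finally show "\<bar>(\<rho> k (\<gamma> 0) (\<gamma> 1))\<^sup>2 / 2 * h (f k (\<gamma> t)) - (d (\<Phi> k \<gamma> 0) (\<Phi> k \<gamma> 1))\<^sup>2 / 2 * h (\<Phi> k \<gamma> t)\<bar> \<le> e"
          by (simp add: l_def l'_def y_def y'_def)
      qed
    qed
  qed
qed

lemma path_measure_compose_measurable:
  "(\<lambda>\<gamma>. path_measure X d (compose {0..1} (f k) \<gamma>)) \<in> P k \<rightarrow>\<^sub>M borel_of (path_measure_topology X d)"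
proof (rule path_measure_measurable)
  have "(\<lambda>q. f k (case q of (\<gamma>, t) \<Rightarrow> \<gamma> t)) \<in> P k \<Otimes>\<^sub>M lebesgue_on {0..1} \<rightarrow>\<^sub>M borel_of (forward_topology X d)"
    by (rule measurable_compose[OF compact_theta_space.joint_evaluation_measurable[OF Y P_props(2)] f_meas])
  then show "(\<lambda>(\<gamma>, t). compose {0..1} (f k) \<gamma> t) \<in> P k \<Otimes>\<^sub>M lebesgue_on {0..1} \<rightarrow>\<^sub>M borel_of (forward_topology X d)"
    by (rule measurable_cong[THEN iffD1, rotated]) (auto simp: space_pair_measure compose_def)
qed

lemma compose_measurable:
  assumes "\<gamma> \<in> geodesics (Y k) (\<rho> k)"
  shows "compose {0..1} (f k) \<gamma> \<in> lebesgue_on {0..1} \<rightarrow>\<^sub>M borel_of (forward_topology X d)"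
proof -
  have "(\<lambda>t. f k (\<gamma> t)) \<in> lebesgue_on {0..1} \<rightarrow>\<^sub>M borel_of (forward_topology X d)"
    by (rule measurable_compose[OF compact_theta_space.geodesic_path_measurable[OF Y assms] f_meas])
  then show ?thesis
    by (rule measurable_cong[THEN iffD1, rotated]) (simp add: compose_def)
qed

text \<open>\<open>H\<close> is a continuous function on a space of measures, and no uniform modulus
  is at hand. Sequences replace it: along counterexamples a subsequence of the geodesics
  \<open>\<Phi> k \<gamma>\<close> converges, both path measures tend to that of the limit curve,
  and \<open>H\<close> cannot separate them.\<close>

lemma path_measure_close:
  assumes H: "continuous_map (path_measure_topology X d) euclideanreal H" and e: "0 < e"
  shows "\<forall>\<^sub>F k in sequentially. \<forall>\<gamma>\<in>geodesics (Y k) (\<rho> k).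
    \<bar>H (path_measure X d (compose {0..1} (f k) \<gamma>)) - H (path_measure X d (\<Phi> k \<gamma>))\<bar> \<le> e"
proof (rule ccontr)
  assume "\<not> ?thesis"
  then obtain s where s: "strict_mono (s::nat\<Rightarrow>nat)" and "\<And>n. \<not> (\<forall>\<gamma>\<in>geodesics (Y (s n)) (\<rho> (s n)).
    \<bar>H (path_measure X d (compose {0..1} (f (s n)) \<gamma>)) - H (path_measure X d (\<Phi> (s n) \<gamma>))\<bar> \<le> e)"
    using not_eventually_sequentiallyD by blast
  then obtain \<gamma> where \<gamma>: "\<And>n. \<gamma> n \<in> geodesics (Y (s n)) (\<rho> (s n))"
    "\<And>n. e < \<bar>H (path_measure X d (compose {0..1} (f (s n)) (\<gamma> n))) - H (path_measure X d (\<Phi> (s n) (\<gamma> n)))\<bar>"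
    by (metis not_le)
  obtain \<eta> r where \<eta>: "\<eta> \<in> geodesics X d" and r: "strict_mono (r :: nat \<Rightarrow> nat)"
    and lim: "(\<lambda>n. symd (uniform_dist d) (\<Phi> (s (r n)) (\<gamma> (r n))) \<eta>) \<longlonglongrightarrow> 0"
    by (rule G.S.convergent_subseq[of "\<lambda>n. \<Phi> (s n) (\<gamma> n)"]) (use \<Phi>_in \<gamma>(1) in auto)
  define q where "q n = s (r n)" for n
  have q: "strict_mono q" unfolding q_def using strict_mono_o[OF s r] by (simp add: o_def)
  have \<delta>q: "(\<lambda>n. \<delta> (q n)) \<longlonglongrightarrow> 0" using LIMSEQ_subseq_LIMSEQ[OF \<delta>_lim q] by (simp add: o_def)
  have \<gamma>q: "\<gamma> (r n) \<in> geodesics (Y (q n)) (\<rho> (q n))" for n unfolding q_def by (rule \<gamma>(1))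
  have lim1: "limitin (path_measure_topology X d) (\<lambda>n. path_measure X d (\<Phi> (q n) (\<gamma> (r n)))) (path_measure X d \<eta>) sequentially"
  proof (rule path_measure_limit)
    fix e :: real assume e: "0 < e"
    show "\<forall>\<^sub>F n in sequentially. \<forall>t\<in>{0..1}. symd d (\<Phi> (q n) (\<gamma> (r n)) t) (\<eta> t) < e"
      using order_tendstoD(2)[OF lim e]
    proof eventually_elim
      case (elim n)
      then show ?case
        using symd_le_symd_uniform[OF \<Phi>_in[OF \<gamma>q] \<eta>] unfolding q_def by (blast intro: le_less_trans)
    qed
  qed (use geodesic_path_measurable \<eta> \<Phi>_in \<gamma>q in auto)
  have lim2: "limitin (path_measure_topology X d) (\<lambda>n. path_measure X d (compose {0..1} (f (q n)) (\<gamma> (r n)))) (path_measure X d \<eta>) sequentially"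
  proof (rule path_measure_limit)
    fix e :: real assume e: "0 < e"
    show "\<forall>\<^sub>F n in sequentially. \<forall>t\<in>{0..1}. symd d (compose {0..1} (f (q n)) (\<gamma> (r n)) t) (\<eta> t) < e"
      using order_tendstoD(2)[OF lim half_gt_zero[OF e]] order_tendstoD(2)[OF \<delta>q half_gt_zero[OF e]]
    proof eventually_elim
      case (elim n)
      show ?case
      proof
        fix t :: real assume t: "t \<in> {0..1}"
        have "symd d (f (q n) (\<gamma> (r n) t)) (\<eta> t) \<le> symd d (f (q n) (\<gamma> (r n) t)) (\<Phi> (q n) (\<gamma> (r n)) t) + symd d (\<Phi> (q n) (\<gamma> (r n)) t) (\<eta> t)"
          using f_in Y_in[OF \<gamma>q t] geodesics_in[OF \<Phi>_in[OF \<gamma>q] t] geodesics_in[OF \<eta> t] by (intro symd_triangle) auto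
        then show "symd d (compose {0..1} (f (q n)) (\<gamma> (r n)) t) (\<eta> t) < e"
          using \<Phi>_near[OF \<gamma>q t, of n] symd_le_symd_uniform[OF \<Phi>_in[OF \<gamma>q] \<eta> t, of n] elim t
          unfolding q_def by (simp add: compose_def)
      qed
    qed
  qed (use geodesic_path_measurable \<eta> compose_measurable \<gamma>q in auto)
  have "(\<lambda>n. \<bar>H (path_measure X d (compose {0..1} (f (q n)) (\<gamma> (r n)))) - H (path_measure X d (\<Phi> (q n) (\<gamma> (r n))))\<bar>) \<longlonglongrightarrow> \<bar>H (path_measure X d \<eta>) - H (path_measure X d \<eta>)\<bar>"
    using continuous_map_limit[OF H lim1] continuous_map_limit[OF H lim2]
    by (intro tendsto_rabs tendsto_diff) (auto simp: o_def)
  from LIMSEQ_le_const[OF this, of e] have "e \<le> 0"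
    using \<gamma>(2) unfolding q_def by (auto intro: less_imp_le)
  then show False using e by simp
qed

theorem path_plan_limit:
  "limitin (weak_prob_topology (path_measure_topology X d))
      (\<lambda>k. distr (P k) (borel_of (path_measure_topology X d)) (\<lambda>\<gamma>. path_measure X d (compose {0..1} (f k) \<gamma>)))
      (distr Q (borel_of (path_measure_topology X d)) (path_measure X d)) sequentially"
proof (rule limitin_weak_prob_topologyI)
  have Qm: "path_measure X d \<in> Q \<rightarrow>\<^sub>M borel_of (path_measure_topology X d)"
    unfolding geodesic_plan_measurable[OF Q_prob] by (rule continuous_map_measurable[OF path_measure_continuous])
  show "distr (P k) (borel_of (path_measure_topology X d)) (\<lambda>\<gamma>. path_measure X d (compose {0..1} (f k) \<gamma>))
    \<in> prob_borel_measures (path_measure_topology X d)" for k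
    by (rule prob_borel_measures_distr[OF P_props(1) path_measure_compose_measurable])
  show "distr Q (borel_of (path_measure_topology X d)) (path_measure X d) \<in> prob_borel_measures (path_measure_topology X d)"
    by (rule prob_borel_measures_distr[OF geodesic_plan(1)[OF Q_prob] Qm])
  fix H :: "(real \<times> 'b) measure \<Rightarrow> real" assume H: "continuous_map (path_measure_topology X d) euclideanreal H"
    and bd: "bounded (H ` topspace (path_measure_topology X d))"
  obtain B where B: "\<And>x. x \<in> topspace (path_measure_topology X d) \<Longrightarrow> \<bar>H x\<bar> \<le> B"
    using bd unfolding bounded_iff by auto
  have "(\<lambda>k. \<integral>\<gamma>. H (path_measure X d (compose {0..1} (f k) \<gamma>)) \<partial>P k) \<longlonglongrightarrow> (\<integral>\<gamma>. H (path_measure X d \<gamma>) \<partial>Q)"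
  proof (rule transfer_limit[where C="\<lambda>_. B"])
    show "(\<lambda>\<gamma>. H (path_measure X d (compose {0..1} (f k) \<gamma>))) \<in> borel_measurable (P k)" for k
      by (rule continuous_map_real_comp_measurable[OF H path_measure_compose_measurable])
    show "continuous_map (geodesic_topology X d) euclideanreal (\<lambda>\<gamma>. H (path_measure X d \<gamma>))"
      using continuous_map_compose[OF path_measure_continuous H] by (simp add: o_def)
    show "\<bar>H (path_measure X d (compose {0..1} (f k) \<gamma>))\<bar> \<le> B" if "\<gamma> \<in> geodesics (Y k) (\<rho> k)" for k \<gamma>
      using path_measure_prob[OF compose_measurable[OF that]]
      by (intro B) (simp add: path_measure_topology_def topspace_weak_prob_topology)
  qed (rule path_measure_close[OF H])
  then show "(\<lambda>k. \<integral>x. H x \<partial>distr (P k) (borel_of (path_measure_topology X d)) (\<lambda>\<gamma>. path_measure X d (compose {0..1} (f k) \<gamma>)))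
    \<longlonglongrightarrow> (\<integral>x. H x \<partial>distr Q (borel_of (path_measure_topology X d)) (path_measure X d))"
    by (simp add: integral_distr[OF path_measure_compose_measurable continuous_map_real_measurable[OF H]]
        integral_distr[OF Qm continuous_map_real_measurable[OF H]])
qed

theorem endpoint_plan_limit:
  "limitin (weak_prob_topology (prod_topology (forward_topology X d) (forward_topology X d)))
      (\<lambda>k. distr (endpoint_plan (Y k) (\<rho> k) (P k))
             (borel_of (prod_topology (forward_topology X d) (forward_topology X d))) (map_prod (f k) (f k)))
      (endpoint_plan X d Q) sequentially"
proof -
  let ?B = "borel_of (prod_topology (forward_topology X d) (forward_topology X d))"
  have 0: "(0::real) \<in> {0..1}" and 1: "(1::real) \<in> {0..1}" by auto
  have fm: "map_prod (f k) (f k) \<in> borel_of (prod_topology (forward_topology (Y k) (\<rho> k)) (forward_topology (Y k) (\<rho> k))) \<rightarrow>\<^sub>M ?B" for k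
  proof -
    have "(\<lambda>p. (f k (fst p), f k (snd p))) \<in> borel_of (prod_topology (forward_topology (Y k) (\<rho> k)) (forward_topology (Y k) (\<rho> k))) \<rightarrow>\<^sub>M ?B"
      by (rule measurable_pairI; rule measurable_compose[OF continuous_map_measurable f_meas])
        (auto intro: continuous_map_fst continuous_map_snd)
    then show ?thesis by (simp add: map_prod_def case_prod_beta)
  qed
  have eq: "distr (endpoint_plan (Y k) (\<rho> k) (P k)) ?B (map_prod (f k) (f k)) = distr (P k) ?B (\<lambda>\<gamma>. (f k (\<gamma> 0), f k (\<gamma> 1)))" for k
    unfolding endpoint_plan_def
    by (subst distr_distr[OF fm compact_theta_space.endpoint_plan_prob(2)[OF Y P_prob]]) (simp add: comp_def)
  have m: "(\<lambda>\<gamma>. (f k (\<gamma> 0), f k (\<gamma> 1))) \<in> P k \<rightarrow>\<^sub>M ?B" for k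
    by (rule measurable_pairI[OF f_eval_measurable[OF 0] f_eval_measurable[OF 1]])
  show ?thesis
    unfolding eq
  proof (rule limitin_weak_prob_topologyI)
    fix g assume g: "continuous_map (prod_topology (forward_topology X d) (forward_topology X d)) euclideanreal g"
    show "(\<lambda>k. \<integral>x. g x \<partial>distr (P k) ?B (\<lambda>\<gamma>. (f k (\<gamma> 0), f k (\<gamma> 1)))) \<longlonglongrightarrow> (\<integral>x. g x \<partial>endpoint_plan X d Q)"
      using endpoint_limit[OF g] unfolding endpoint_plan_def
      by (simp add: integral_distr[OF m continuous_map_real_measurable[OF g]]
          integral_distr[OF endpoint_plan_prob(2)[OF Q_prob] continuous_map_real_measurable[OF g]])
  qed (use prob_borel_measures_distr[OF P_props(1) m] endpoint_plan_prob(1)[OF Q_prob] in auto)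
qed

end

text \<open>The map \<open>F\<close> lets one computation serve both sides of the limit: it is
  \<open>f k\<close> for the approximating energies and the identity for the limit energy.\<close>

lemma (in compact_theta_space) energy_integral:
  fixes h :: "'b \<Rightarrow> real"
  assumes N: "N \<in> prob_borel_measures (geodesic_topology X d)" and t: "t \<in> {0..1}"
    and F: "F \<in> borel_of (forward_topology X d) \<rightarrow>\<^sub>M borel_of T" and h: "continuous_map T euclideanreal h"
  shows "distr (kinetic_energy X d N t) (borel_of T) F \<in> finite_borel_measures T"
    "(\<integral>x. h x \<partial>distr (kinetic_energy X d N t) (borel_of T) F) = (\<integral>\<gamma>. (d (\<gamma> 0) (\<gamma> 1))\<^sup>2 / 2 * h (F (\<gamma> t)) \<partial>N)"
proof -
  interpret N: prob_space N by (rule geodesic_plan[OF N])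
  define w where "w \<gamma> = (d (\<gamma> 0) (\<gamma> 1))\<^sup>2 / 2" for \<gamma> :: "real \<Rightarrow> 'a"
  obtain L where L: "0 < L" "\<And>x y. x \<in> X \<Longrightarrow> y \<in> X \<Longrightarrow> d x y \<le> L" using dist_bounded by metis
  have wm: "w \<in> borel_measurable N"
    using continuous_map_real_measurable[OF length_continuous] unfolding w_def geodesic_plan_measurable[OF N] by simp
  have Fm: "(\<lambda>\<gamma>. F (\<gamma> t)) \<in> density N w \<rightarrow>\<^sub>M borel_of T"
    using measurable_compose[OF plan_evaluation_measurable[OF N t] F] by simp
  have em: "(\<lambda>\<gamma>. \<gamma> t) \<in> density N w \<rightarrow>\<^sub>M borel_of (forward_topology X d)"
    using plan_evaluation_measurable[OF N t] by simp
  have eq: "distr (kinetic_energy X d N t) (borel_of T) F = distr (density N w) (borel_of T) (\<lambda>\<gamma>. F (\<gamma> t))"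
    unfolding kinetic_energy_eq[OF N] w_def[symmetric] by (subst distr_distr[OF F em]) (simp add: comp_def)
  have "w \<gamma> \<le> L\<^sup>2 / 2" if "\<gamma> \<in> space N" for \<gamma>
  proof -
    have \<gamma>: "\<gamma> \<in> geodesics X d" using that geodesic_plan(3)[OF N] by simp
    then have "d (\<gamma> 0) (\<gamma> 1) \<le> L" using L(2) geodesics_in by simp
    then show ?thesis unfolding w_def using length_nonneg[OF \<gamma>] by (simp add: power_mono)
  qed
  then have "(\<integral>\<^sup>+\<gamma>. ennreal (w \<gamma>) \<partial>N) \<le> (\<integral>\<^sup>+\<gamma>. ennreal (L\<^sup>2 / 2) \<partial>N)"
    by (intro nn_integral_mono ennreal_leI)
  then have fin: "(\<integral>\<^sup>+\<gamma>. ennreal (w \<gamma>) \<partial>N) \<noteq> \<infinity>" by (auto simp: N.emeasure_space_1 top_unique)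
  have "finite_measure (density N w)"
    by (rule finite_measureI) (use fin wm in \<open>simp add: emeasure_density cong: nn_integral_cong\<close>)
  then show "distr (kinetic_energy X d N t) (borel_of T) F \<in> finite_borel_measures T"
    unfolding eq finite_borel_measures_def using finite_measure.finite_measure_distr[OF _ Fm] by simp
  have hm: "(\<lambda>\<gamma>. h (F (\<gamma> t))) \<in> borel_measurable N"
    using continuous_map_real_comp_measurable[OF h measurable_compose[OF plan_evaluation_measurable[OF N t] F]] .
  show "(\<integral>x. h x \<partial>distr (kinetic_energy X d N t) (borel_of T) F) = (\<integral>\<gamma>. (d (\<gamma> 0) (\<gamma> 1))\<^sup>2 / 2 * h (F (\<gamma> t)) \<partial>N)"
    unfolding eq
    by (subst integral_distr[OF Fm continuous_map_real_measurable[OF h]])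
      (subst integral_real_density, use wm hm in \<open>auto simp: w_def\<close>)
qed

context gh_limit
begin

theorem kinetic_energy_limit:
  assumes t: "t \<in> {0..1}"
  shows "limitin (weak_topology (forward_topology X d))
        (\<lambda>k. distr (kinetic_energy (Y k) (\<rho> k) (P k) t) (borel_of (forward_topology X d)) (f k))
        (kinetic_energy X d Q t) sequentially"
proof -
  have eq: "kinetic_energy X d Q t = distr (kinetic_energy X d Q t) (borel_of (forward_topology X d)) (\<lambda>x. x)"
    by (rule distr_id2[symmetric]) (simp add: kinetic_energy_def)
  note E = energy_integral[OF Q_prob t measurable_ident_sets[OF refl]]
    and Ek = compact_theta_space.energy_integral[OF Y P_prob t f_meas]
  show ?thesis
  proof (subst eq, rule limitin_weak_topologyI)
    fix h assume h: "continuous_map (forward_topology X d) euclideanreal h"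
    show "(\<lambda>k. \<integral>x. h x \<partial>distr (kinetic_energy (Y k) (\<rho> k) (P k) t) (borel_of (forward_topology X d)) (f k))
      \<longlonglongrightarrow> (\<integral>x. h x \<partial>distr (kinetic_energy X d Q t) (borel_of (forward_topology X d)) (\<lambda>x. x))"
      unfolding E(2)[OF h] Ek(2)[OF h] by (rule energy_limit[OF h t])
  \<comment> \<open>Finiteness of the energy measures is stated together with a continuous test
    function; a constant one serves.\<close>
  qed (use E(1)[of "\<lambda>_. 0"] Ek(1)[of "\<lambda>_. 0"] in auto)
qed

end

section \<open>Gluing and stability of optimality\<close>

text \<open>\<open>K\<close> leads from \<open>y\<close> to \<open>y'\<close> through a pair
  distributed by \<open>\<pi>\<close>: back along \<open>h0\<close>, across \<open>\<pi>\<close>,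
  forward along \<open>h1\<close>. Integrating out \<open>y'\<close> removes \<open>h1\<close>, and
  the first marginal of \<open>\<pi>\<close> turns the rest into an integral of \<open>h0\<close>
  alone, which is 1. In the cost estimate each of \<open>c'\<close>, \<open>c0\<close>,
  \<open>c1\<close> involves only some of the variables, so the densities in the others integrate to
  1.\<close>

lemma coupling_density_glue:
  fixes \<pi> :: "('a \<times> 'b) measure" and N0 :: "'c measure" and N1 :: "'d measure"
  assumes pr: "prob_space \<pi>" "prob_space N0" "prob_space N1" "prob_space M0" "prob_space M1"
    and fst: "fst \<in> \<pi> \<rightarrow>\<^sub>M M0" "distr \<pi> M0 fst = M0" and snd: "snd \<in> \<pi> \<rightarrow>\<^sub>M M1" "distr \<pi> M1 snd = M1"
    and h0: "coupling_density M0 N0 h0" and h1: "coupling_density M1 N1 h1"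
  defines "K \<equiv> \<lambda>y y'. \<integral>\<^sup>+p. h0 (fst p) y * h1 (snd p) y' \<partial>\<pi>"
  shows "coupling_density N0 N1 K"
    and "\<And>c c' c0 c1. (\<lambda>(y, y'). c y y') \<in> borel_measurable (N0 \<Otimes>\<^sub>M N1) \<Longrightarrow> c' \<in> borel_measurable \<pi> \<Longrightarrow>
      (\<lambda>(x, y). c0 x y) \<in> borel_measurable (M0 \<Otimes>\<^sub>M N0) \<Longrightarrow> (\<lambda>(x, y). c1 x y) \<in> borel_measurable (M1 \<Otimes>\<^sub>M N1) \<Longrightarrow>
      (\<And>p y y'. p \<in> space \<pi> \<Longrightarrow> y \<in> space N0 \<Longrightarrow> y' \<in> space N1 \<Longrightarrow> c y y' \<le> c' p + c0 (fst p) y + c1 (snd p) y') \<Longrightarrow>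
      (\<integral>\<^sup>+y. \<integral>\<^sup>+y'. K y y' * c y y' \<partial>N1 \<partial>N0) \<le> (\<integral>\<^sup>+p. c' p \<partial>\<pi>)
        + (\<integral>\<^sup>+x. \<integral>\<^sup>+y. h0 x y * c0 x y \<partial>N0 \<partial>M0) + (\<integral>\<^sup>+x. \<integral>\<^sup>+y. h1 x y * c1 x y \<partial>N1 \<partial>M1)"
proof -
  interpret \<pi>: prob_space \<pi> by fact
  interpret N0: prob_space N0 by fact
  interpret N1: prob_space N1 by fact
  interpret M0: prob_space M0 by fact
  interpret M1: prob_space M1 by fact
  interpret \<pi>N0: pair_sigma_finite \<pi> N0 ..
  interpret \<pi>N1: pair_sigma_finite \<pi> N1 ..
  note [measurable] = fst(1) snd(1)
  have H0: "(\<lambda>(x, y). h0 x y) \<in> borel_measurable (M0 \<Otimes>\<^sub>M N0)" and H1: "(\<lambda>(x, y). h1 x y) \<in> borel_measurable (M1 \<Otimes>\<^sub>M N1)"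
    and h0x: "\<And>x. x \<in> space M0 \<Longrightarrow> (\<integral>\<^sup>+y. h0 x y \<partial>N0) = 1" and h0y: "\<And>y. y \<in> space N0 \<Longrightarrow> (\<integral>\<^sup>+x. h0 x y \<partial>M0) = 1"
    and h1x: "\<And>x. x \<in> space M1 \<Longrightarrow> (\<integral>\<^sup>+y. h1 x y \<partial>N1) = 1" and h1y: "\<And>y. y \<in> space N1 \<Longrightarrow> (\<integral>\<^sup>+x. h1 x y \<partial>M1) = 1"
    using h0 h1 unfolding coupling_density_def by auto
  have sp: "fst p \<in> space M0" "snd p \<in> space M1" if "p \<in> space \<pi>" for p
    using measurable_space[OF fst(1) that] measurable_space[OF snd(1) that] by auto
  have comp0: "(\<lambda>z. F (fst (a z)) (b z)) \<in> borel_measurable Z"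
    if "(\<lambda>(x, y). F x y) \<in> borel_measurable (M0 \<Otimes>\<^sub>M N0)" "a \<in> Z \<rightarrow>\<^sub>M \<pi>" "b \<in> Z \<rightarrow>\<^sub>M N0" for F :: "_ \<Rightarrow> _ \<Rightarrow> ennreal" and a b Z
    using measurable_compose[OF measurable_Pair[OF measurable_compose[OF that(2) fst(1)] that(3)] that(1)] by simp
  have comp1: "(\<lambda>z. F (snd (a z)) (b z)) \<in> borel_measurable Z"
    if "(\<lambda>(x, y). F x y) \<in> borel_measurable (M1 \<Otimes>\<^sub>M N1)" "a \<in> Z \<rightarrow>\<^sub>M \<pi>" "b \<in> Z \<rightarrow>\<^sub>M N1" for F :: "_ \<Rightarrow> _ \<Rightarrow> ennreal" and a b Z
    using measurable_compose[OF measurable_Pair[OF measurable_compose[OF that(2) snd(1)] that(3)] that(1)] by simp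
  have int0: "(\<integral>\<^sup>+p. g (fst p) \<partial>\<pi>) = (\<integral>\<^sup>+x. g x \<partial>M0)" if "g \<in> borel_measurable M0" for g :: "_ \<Rightarrow> ennreal"
    using nn_integral_distr[OF fst(1), of g] that fst(2) by simp
  have int1: "(\<integral>\<^sup>+p. g (snd p) \<partial>\<pi>) = (\<integral>\<^sup>+x. g x \<partial>M1)" if "g \<in> borel_measurable M1" for g :: "_ \<Rightarrow> ennreal"
    using nn_integral_distr[OF snd(1), of g] that snd(2) by simp
  have sec: "(\<lambda>y'. F x y') \<in> borel_measurable N" if "(\<lambda>(x, y). F x y) \<in> borel_measurable (M \<Otimes>\<^sub>M N)" "x \<in> space M"
    for F :: "_ \<Rightarrow> _ \<Rightarrow> ennreal" and M N x
    using measurable_compose[OF measurable_Pair1'[OF that(2)] that(1)] by simp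
  have sec': "(\<lambda>x. F x y) \<in> borel_measurable M" if "(\<lambda>(x, y). F x y) \<in> borel_measurable (M \<Otimes>\<^sub>M N)" "y \<in> space N"
    for F :: "_ \<Rightarrow> _ \<Rightarrow> ennreal" and M N y
    using measurable_compose[OF measurable_Pair2'[OF that(2)] that(1)] by simp
  have Km: "(\<lambda>(y, y'). K y y') \<in> borel_measurable (N0 \<Otimes>\<^sub>M N1)"
  proof -
    have "(\<lambda>z. h0 (fst (snd z)) (fst (fst z))) \<in> borel_measurable ((N0 \<Otimes>\<^sub>M N1) \<Otimes>\<^sub>M \<pi>)"
      by (rule comp0[OF H0 measurable_snd measurable_compose[OF measurable_fst measurable_fst]])
    moreover have "(\<lambda>z. h1 (snd (snd z)) (snd (fst z))) \<in> borel_measurable ((N0 \<Otimes>\<^sub>M N1) \<Otimes>\<^sub>M \<pi>)"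
      by (rule comp1[OF H1 measurable_snd measurable_compose[OF measurable_fst measurable_snd]])
    ultimately have "(\<lambda>(q, p). h0 (fst p) (fst q) * h1 (snd p) (snd q)) \<in> borel_measurable ((N0 \<Otimes>\<^sub>M N1) \<Otimes>\<^sub>M \<pi>)"
      by (simp add: case_prod_beta)
    from \<pi>.borel_measurable_nn_integral[OF this]
    show ?thesis unfolding K_def by (simp add: case_prod_beta)
  qed
  have hp0: "(\<lambda>p. h0 (fst p) y) \<in> borel_measurable \<pi>" if "y \<in> space N0" for y
    using measurable_compose[OF fst(1) sec'[OF H0 that]] .
  have hp1: "(\<lambda>p. h1 (snd p) y) \<in> borel_measurable \<pi>" if "y \<in> space N1" for y
    using measurable_compose[OF snd(1) sec'[OF H1 that]] .
  have Kx: "(\<integral>\<^sup>+y'. K y y' \<partial>N1) = 1" if y: "y \<in> space N0" for y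
  proof -
    have m: "(\<lambda>(p, y'). h0 (fst p) y * h1 (snd p) y') \<in> borel_measurable (\<pi> \<Otimes>\<^sub>M N1)"
      unfolding case_prod_beta
      by (intro borel_measurable_times_ennreal measurable_compose[OF measurable_fst hp0[OF y]] comp1[OF H1 measurable_fst measurable_snd])
    have "(\<integral>\<^sup>+y'. K y y' \<partial>N1) = (\<integral>\<^sup>+p. \<integral>\<^sup>+y'. h0 (fst p) y * h1 (snd p) y' \<partial>N1 \<partial>\<pi>)"
      unfolding K_def using \<pi>N1.Fubini[OF m] by simp
    also have "\<dots> = (\<integral>\<^sup>+p. h0 (fst p) y \<partial>\<pi>)"
      using h1x sp sec[OF H1] by (intro nn_integral_cong) (simp add: nn_integral_cmult)
    also have "\<dots> = 1" using int0[OF sec'[OF H0 y]] h0y[OF y] by simp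
    finally show ?thesis .
  qed
  have Ky: "(\<integral>\<^sup>+y. K y y' \<partial>N0) = 1" if y: "y' \<in> space N1" for y'
  proof -
    have m: "(\<lambda>(p, y). h0 (fst p) y * h1 (snd p) y') \<in> borel_measurable (\<pi> \<Otimes>\<^sub>M N0)"
      unfolding case_prod_beta
      by (intro borel_measurable_times_ennreal measurable_compose[OF measurable_fst hp1[OF y]] comp0[OF H0 measurable_fst measurable_snd])
    have "(\<integral>\<^sup>+y. K y y' \<partial>N0) = (\<integral>\<^sup>+p. \<integral>\<^sup>+y. h0 (fst p) y * h1 (snd p) y' \<partial>N0 \<partial>\<pi>)"
      unfolding K_def using \<pi>N0.Fubini[OF m] by simp
    also have "\<dots> = (\<integral>\<^sup>+p. h1 (snd p) y' \<partial>\<pi>)"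
      using h0x sp sec[OF H0] by (intro nn_integral_cong) (simp add: nn_integral_multc)
    also have "\<dots> = 1" using int1[OF sec'[OF H1 y]] h1y[OF y] by simp
    finally show ?thesis .
  qed
  show "coupling_density N0 N1 K" unfolding coupling_density_def using Km Kx Ky by blast
  fix c :: "'c \<Rightarrow> 'd \<Rightarrow> ennreal" and c' :: "'a \<times> 'b \<Rightarrow> ennreal" and c0 :: "'a \<Rightarrow> 'c \<Rightarrow> ennreal" and c1 :: "'b \<Rightarrow> 'd \<Rightarrow> ennreal"
  assume cm: "(\<lambda>(y, y'). c y y') \<in> borel_measurable (N0 \<Otimes>\<^sub>M N1)" and c'm: "c' \<in> borel_measurable \<pi>"
    and c0m: "(\<lambda>(x, y). c0 x y) \<in> borel_measurable (M0 \<Otimes>\<^sub>M N0)" and c1m: "(\<lambda>(x, y). c1 x y) \<in> borel_measurable (M1 \<Otimes>\<^sub>M N1)"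
    and le: "\<And>p y y'. p \<in> space \<pi> \<Longrightarrow> y \<in> space N0 \<Longrightarrow> y' \<in> space N1 \<Longrightarrow> c y y' \<le> c' p + c0 (fst p) y + c1 (snd p) y'"
  define D0 where "D0 x = (\<integral>\<^sup>+y. h0 x y * c0 x y \<partial>N0)" for x
  define D1 where "D1 x = (\<integral>\<^sup>+y. h1 x y * c1 x y \<partial>N1)" for x
  have hc0: "(\<lambda>(x, y). h0 x y * c0 x y) \<in> borel_measurable (M0 \<Otimes>\<^sub>M N0)"
    using H0 c0m by (simp add: case_prod_beta)
  have hc1: "(\<lambda>(x, y). h1 x y * c1 x y) \<in> borel_measurable (M1 \<Otimes>\<^sub>M N1)"
    using H1 c1m by (simp add: case_prod_beta)
  have D0m: "D0 \<in> borel_measurable M0" unfolding D0_def by (rule N0.borel_measurable_nn_integral[OF hc0])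
  have D1m: "D1 \<in> borel_measurable M1" unfolding D1_def by (rule N1.borel_measurable_nn_integral[OF hc1])
  \<comment> \<open>The integration over \<open>y'\<close> comes first: terms without
    \<open>y'\<close> keep their value and the one with \<open>c1\<close> becomes \<open>D1\<close>.
    The later integration over \<open>y\<close> treats \<open>c0\<close> in the same way.\<close>
  have inner: "(\<integral>\<^sup>+y'. K y y' * c y y' \<partial>N1) \<le> (\<integral>\<^sup>+p. h0 (fst p) y * (c' p + D1 (snd p)) + h0 (fst p) y * c0 (fst p) y \<partial>\<pi>)"
    if y: "y \<in> space N0" for y
  proof -
    define F where "F p y' = h0 (fst p) y * (h1 (snd p) y' * (c' p + c0 (fst p) y) + h1 (snd p) y' * c1 (snd p) y')" for p y'
    have c0p: "(\<lambda>p. c0 (fst p) y) \<in> borel_measurable \<pi>" using measurable_compose[OF fst(1) sec'[OF c0m y]] .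
    have Fm: "(\<lambda>(p, y'). F p y') \<in> borel_measurable (\<pi> \<Otimes>\<^sub>M N1)"
      unfolding F_def case_prod_beta
      by (intro borel_measurable_times_ennreal borel_measurable_add
          measurable_compose[OF measurable_fst hp0[OF y]] comp1[OF H1 measurable_fst measurable_snd]
          comp1[OF c1m measurable_fst measurable_snd] measurable_compose[OF measurable_fst c'm] measurable_compose[OF measurable_fst c0p])
    have "(\<integral>\<^sup>+y'. K y y' * c y y' \<partial>N1) = (\<integral>\<^sup>+y'. \<integral>\<^sup>+p. h0 (fst p) y * h1 (snd p) y' * c y y' \<partial>\<pi> \<partial>N1)"
      unfolding K_def using hp0[OF y] hp1 by (intro nn_integral_cong) (simp add: nn_integral_multc)
    also have "\<dots> \<le> (\<integral>\<^sup>+y'. \<integral>\<^sup>+p. F p y' \<partial>\<pi> \<partial>N1)"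
    proof (intro nn_integral_mono)
      fix y' p assume y': "y' \<in> space N1" and p: "p \<in> space \<pi>"
      have "h0 (fst p) y * h1 (snd p) y' * c y y' \<le> h0 (fst p) y * h1 (snd p) y' * (c' p + c0 (fst p) y + c1 (snd p) y')"
        by (intro mult_left_mono le[OF p y y']) simp
      also have "\<dots> = F p y'" unfolding F_def by (simp add: distrib_left mult.assoc)
      finally show "h0 (fst p) y * h1 (snd p) y' * c y y' \<le> F p y'" .
    qed
    also have "\<dots> = (\<integral>\<^sup>+p. \<integral>\<^sup>+y'. F p y' \<partial>N1 \<partial>\<pi>)" using \<pi>N1.Fubini[OF Fm] by simp
    also have "\<dots> = (\<integral>\<^sup>+p. h0 (fst p) y * (c' p + D1 (snd p)) + h0 (fst p) y * c0 (fst p) y \<partial>\<pi>)"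
    proof (rule nn_integral_cong)
      fix p assume p: "p \<in> space \<pi>"
      note s1 = sec[OF H1 sp(2)[OF p]] and s2 = sec[OF hc1 sp(2)[OF p]]
      have "(\<integral>\<^sup>+y'. F p y' \<partial>N1) = h0 (fst p) y * ((c' p + c0 (fst p) y) + D1 (snd p))"
        unfolding F_def D1_def using s1 s2 h1x[OF sp(2)[OF p]]
        by (simp add: nn_integral_cmult nn_integral_add nn_integral_multc)
      then show "(\<integral>\<^sup>+y'. F p y' \<partial>N1) = h0 (fst p) y * (c' p + D1 (snd p)) + h0 (fst p) y * c0 (fst p) y"
        by (simp add: distrib_left ac_simps)
    qed
    finally show ?thesis .
  qed
  define E where "E p y = h0 (fst p) y * (c' p + D1 (snd p)) + h0 (fst p) y * c0 (fst p) y" for p y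
  have D1p: "(\<lambda>p. D1 (snd p)) \<in> borel_measurable \<pi>" by (rule measurable_compose[OF snd(1) D1m])
  have D0p: "(\<lambda>p. D0 (fst p)) \<in> borel_measurable \<pi>" by (rule measurable_compose[OF fst(1) D0m])
  have Em: "(\<lambda>(p, y). E p y) \<in> borel_measurable (\<pi> \<Otimes>\<^sub>M N0)"
    unfolding E_def case_prod_beta
    by (intro borel_measurable_times_ennreal borel_measurable_add comp0[OF H0 measurable_fst measurable_snd]
        comp0[OF c0m measurable_fst measurable_snd] measurable_compose[OF measurable_fst c'm] measurable_compose[OF measurable_fst D1p])
  have "(\<integral>\<^sup>+y. \<integral>\<^sup>+y'. K y y' * c y y' \<partial>N1 \<partial>N0) \<le> (\<integral>\<^sup>+y. \<integral>\<^sup>+p. E p y \<partial>\<pi> \<partial>N0)"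
    unfolding E_def by (intro nn_integral_mono inner)
  also have "\<dots> = (\<integral>\<^sup>+p. \<integral>\<^sup>+y. E p y \<partial>N0 \<partial>\<pi>)" using \<pi>N0.Fubini[OF Em] by simp
  also have "\<dots> = (\<integral>\<^sup>+p. (c' p + D1 (snd p)) + D0 (fst p) \<partial>\<pi>)"
  proof (rule nn_integral_cong)
    fix p assume p: "p \<in> space \<pi>"
    note s1 = sec[OF H0 sp(1)[OF p]] and s2 = sec[OF hc0 sp(1)[OF p]]
    show "(\<integral>\<^sup>+y. E p y \<partial>N0) = (c' p + D1 (snd p)) + D0 (fst p)"
      unfolding E_def D0_def using s1 s2 h0x[OF sp(1)[OF p]]
      by (simp add: nn_integral_cmult nn_integral_add nn_integral_multc)
  qed
  also have "\<dots> = (\<integral>\<^sup>+p. c' p \<partial>\<pi>) + (\<integral>\<^sup>+x. D1 x \<partial>M1) + (\<integral>\<^sup>+x. D0 x \<partial>M0)"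
    using c'm D1p D0p int1[OF D1m] int0[OF D0m] by (simp add: nn_integral_add)
  finally show "(\<integral>\<^sup>+y. \<integral>\<^sup>+y'. K y y' * c y y' \<partial>N1 \<partial>N0) \<le> (\<integral>\<^sup>+p. c' p \<partial>\<pi>)
        + (\<integral>\<^sup>+x. \<integral>\<^sup>+y. h0 x y * c0 x y \<partial>N0 \<partial>M0) + (\<integral>\<^sup>+x. \<integral>\<^sup>+y. h1 x y * c1 x y \<partial>N1 \<partial>M1)"
    unfolding D0_def D1_def by (simp add: ac_simps)
qed

lemma powr_uniformly_continuous:
  fixes p R :: real
  assumes "1 \<le> p" "0 < e"
  obtains \<eta> where "0 < \<eta>" "\<And>x y. x \<in> {0..R} \<Longrightarrow> y \<in> {0..R} \<Longrightarrow> \<bar>x - y\<bar> < \<eta> \<Longrightarrow> \<bar>x powr p - y powr p\<bar> < e"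
proof -
  have "continuous_on {0..R} (\<lambda>x. x powr p)"
    using assms(1) by (intro continuous_on_powr') auto
  then have "uniformly_continuous_on {0..R} (\<lambda>x. x powr p)"
    by (rule compact_uniformly_continuous) simp
  then obtain \<eta> where "0 < \<eta>" "\<And>x y. x \<in> {0..R} \<Longrightarrow> y \<in> {0..R} \<Longrightarrow> dist y x < \<eta> \<Longrightarrow> dist (y powr p) (x powr p) < e"
    unfolding uniformly_continuous_on_def using assms(2) by meson
  then show thesis using that[of \<eta>] by (simp add: dist_real_def)
qed

context compact_theta_space
begin

lemma endpoint_plan_marginals:
  assumes N: "N \<in> prob_borel_measures (geodesic_topology X d)"
  shows "distr (endpoint_plan X d N) (borel_of (forward_topology X d)) fst = interpolation X d N 0"
    "distr (endpoint_plan X d N) (borel_of (forward_topology X d)) snd = interpolation X d N 1"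
proof -
  let ?T = "forward_topology X d"
  have m: "fst \<in> borel_of (prod_topology ?T ?T) \<rightarrow>\<^sub>M borel_of ?T" "snd \<in> borel_of (prod_topology ?T ?T) \<rightarrow>\<^sub>M borel_of ?T"
    by (auto intro!: continuous_map_measurable continuous_map_fst continuous_map_snd)
  show "distr (endpoint_plan X d N) (borel_of ?T) fst = interpolation X d N 0"
    unfolding endpoint_plan_def interpolation_def
    by (subst distr_distr[OF m(1) endpoint_plan_prob(2)[OF N]]) (simp add: comp_def)
  show "distr (endpoint_plan X d N) (borel_of ?T) snd = interpolation X d N 1"
    unfolding endpoint_plan_def interpolation_def
    by (subst distr_distr[OF m(2) endpoint_plan_prob(2)[OF N]]) (simp add: comp_def)
qed

lemma interpolation_prob:
  assumes "N \<in> prob_borel_measures (geodesic_topology X d)" "t \<in> {0..1}"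
  shows "interpolation X d N t \<in> prob_borel_measures (forward_topology X d)"
  unfolding interpolation_def
  by (rule prob_borel_measures_distr[OF geodesic_plan(1)[OF assms(1)] plan_evaluation_measurable[OF assms]])

lemma endpoint_plan_coupling:
  assumes "N \<in> prob_borel_measures (geodesic_topology X d)"
  shows "endpoint_plan X d N \<in> couplings (forward_topology X d) (interpolation X d N 0) (interpolation X d N 1)"
  unfolding couplings_def using endpoint_plan_prob(1)[OF assms] endpoint_plan_marginals[OF assms] by simp

lemma cost_measurable:
  "(\<lambda>(x, y). ennreal (d x y powr p)) \<in> borel_measurable (borel_of (prod_topology (forward_topology X d) (forward_topology X d)))"
  using powr_real_measurable[OF continuous_map_real_measurable[OF dist_continuous] borel_measurable_const[of p]]
  by (simp add: case_prod_beta)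

lemma length_powr_integrable:
  assumes N: "N \<in> prob_borel_measures (geodesic_topology X d)" and p: "1 \<le> p"
  shows "(\<lambda>\<gamma>. d (\<gamma> 0) (\<gamma> 1) powr p) \<in> borel_measurable N" "integrable N (\<lambda>\<gamma>. d (\<gamma> 0) (\<gamma> 1) powr p)"
proof -
  interpret N: prob_space N by (rule geodesic_plan[OF N])
  obtain L where L: "0 < L" "\<And>x y. x \<in> X \<Longrightarrow> y \<in> X \<Longrightarrow> d x y \<le> L" using dist_bounded by metis
  show m: "(\<lambda>\<gamma>. d (\<gamma> 0) (\<gamma> 1) powr p) \<in> borel_measurable N"
    using continuous_map_real_measurable[OF length_continuous] unfolding geodesic_plan_measurable[OF N] by simp
  show "integrable N (\<lambda>\<gamma>. d (\<gamma> 0) (\<gamma> 1) powr p)"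
  proof (rule N.integrable_const_bound[OF AE_I2 m])
    fix \<gamma> assume "\<gamma> \<in> space N"
    then have \<gamma>: "\<gamma> \<in> geodesics X d" using geodesic_plan(3)[OF N] by simp
    then have "d (\<gamma> 0) (\<gamma> 1) \<le> L" using L(2) geodesics_in by simp
    then show "norm (d (\<gamma> 0) (\<gamma> 1) powr p) \<le> L powr p"
      using length_nonneg[OF \<gamma>] p by (simp add: powr_mono2)
  qed
qed

lemma transport_cost_endpoint_plan:
  assumes N: "N \<in> prob_borel_measures (geodesic_topology X d)" and p: "1 \<le> p"
  shows "transport_cost d p (endpoint_plan X d N) = ennreal (\<integral>\<gamma>. d (\<gamma> 0) (\<gamma> 1) powr p \<partial>N)"
proof -
  have "transport_cost d p (endpoint_plan X d N) = (\<integral>\<^sup>+\<gamma>. ennreal (d (\<gamma> 0) (\<gamma> 1) powr p) \<partial>N)"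
    unfolding transport_cost_def endpoint_plan_def
    by (subst nn_integral_distr[OF endpoint_plan_prob(2)[OF N]]) (use cost_measurable in auto)
  also have "\<dots> = ennreal (\<integral>\<gamma>. d (\<gamma> 0) (\<gamma> 1) powr p \<partial>N)"
    using length_powr_integrable[OF N p] by (intro nn_integral_eq_integral) auto
  finally show ?thesis .
qed

lemma symd_measurable:
  assumes "f \<in> N \<rightarrow>\<^sub>M borel_of (forward_topology X d)" "g \<in> N \<rightarrow>\<^sub>M borel_of (forward_topology X d)"
  shows "(\<lambda>x. symd d (f x) (g x)) \<in> borel_measurable N"
  unfolding symd_def using dist_measurable[OF assms] dist_measurable[OF assms(2,1)]
  by (intro borel_measurable_max) auto

end

section \<open>Wasserstein convergence and optimality of the limit plan\<close>

context gh_limit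
begin

interpretation G: compact_theta_space \<theta> "geodesics X d" "uniform_dist d" by (rule compact_theta_geodesics)

text \<open>A single coupling of the measures \<open>Q\<close> and \<open>P k\<close> on curves is
  evaluated at every time. The resulting bound does not depend on \<open>t\<close>, hence holds for
  the supremum.\<close>

theorem wasserstein_limit:
  assumes p: "1 \<le> p"
  shows "(\<lambda>k. SUP t\<in>{0..1}. wasserstein X d p (interpolation X d Q t)
      (distr (interpolation (Y k) (\<rho> k) (P k) t) (borel_of (forward_topology X d)) (f k))) \<longlonglongrightarrow> 0"
proof (rule order_tendstoI)
  fix a :: ennreal assume "0 < a"
  then obtain b' where b': "0 < b'" "b' < a" using dense by blast
  then obtain b where b: "0 < b" and ba: "ennreal b < a"
    by (cases b') (auto simp: ennreal_less_zero_iff)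
  obtain B where B: "0 < B" "\<And>x y. x \<in> X \<Longrightarrow> y \<in> X \<Longrightarrow> d x y \<le> B" using dist_bounded by metis
  \<comment> \<open>Half of the allowed cost \<open>b powr p\<close> is for well matched curves,
    whose positions differ by at most \<open>\<tau>\<close>; the other half is for the exceptional
    mass \<open>\<beta>\<close>, which costs at most \<open>B powr p\<close> per unit.\<close>
  define c where "c = b powr p / 2"
  define \<tau> where "\<tau> = c powr (1 / p)"
  define \<beta> where "\<beta> = min 1 (c / B powr p)"
  have c: "0 < c" unfolding c_def using b by simp
  have \<tau>: "0 < \<tau>" "\<tau> powr p = c" unfolding \<tau>_def using c p by (auto simp: powr_powr)
  have \<beta>: "0 < \<beta>" "\<beta> \<le> 1" "B powr p * \<beta> \<le> c"
    unfolding \<beta>_def using c B(1) by (auto simp: min_def field_simps)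
  have ev: "\<forall>\<^sub>F k in sequentially. \<exists>h. coupling_density Q (P k) h \<and>
    (\<forall>c e C. (\<lambda>(x, y). c x y) \<in> borel_measurable (Q \<Otimes>\<^sub>M P k) \<longrightarrow>
      (\<forall>x\<in>geodesics X d. \<forall>y\<in>space (P k). symd (uniform_dist d) x (\<Phi> k y) < \<tau>/2 \<longrightarrow> c x y \<le> e) \<longrightarrow>
      (\<forall>x\<in>geodesics X d. \<forall>y\<in>space (P k). c x y \<le> C) \<longrightarrow>
      (\<integral>\<^sup>+x. \<integral>\<^sup>+y. h x y * c x y \<partial>P k \<partial>Q) \<le> e + C * ennreal \<beta>)"
  proof (rule G.S.weak_convergence_coupling)
    show "Q \<in> prob_borel_measures G.S.mtopology" using Q_prob unfolding geodesic_topology_eq .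
    show "\<Phi> k \<in> P k \<rightarrow>\<^sub>M borel_of G.S.mtopology" for k using \<Phi>P unfolding geodesic_topology_eq .
    show "(\<lambda>k. \<integral>y. g (\<Phi> k y) \<partial>P k) \<longlonglongrightarrow> (\<integral>x. g x \<partial>Q)" if "continuous_map G.S.mtopology euclideanreal g" for g
      using Q_lim[of g] that unfolding geodesic_topology_eq by blast
    show "prob_space (P k)" for k by (rule P_props)
    show "0 < \<tau>/2" using \<tau>(1) by simp
    show "0 < \<beta>" "\<beta> \<le> 1" by (fact \<beta>)+
  qed
  have "\<forall>\<^sub>F k in sequentially. \<delta> k < \<tau>/2" by (rule order_tendstoD(2)[OF \<delta>_lim]) (use \<tau>(1) in simp)
  with ev show "\<forall>\<^sub>F k in sequentially. (SUP t\<in>{0..1}. wasserstein X d p (interpolation X d Q t)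
      (distr (interpolation (Y k) (\<rho> k) (P k) t) (borel_of (forward_topology X d)) (f k))) < a"
  proof eventually_elim
    case (elim k)
    from elim(1) obtain h where h: "coupling_density Q (P k) h"
      and b': "\<forall>c e C. (\<lambda>(x, y). c x y) \<in> borel_measurable (Q \<Otimes>\<^sub>M P k) \<longrightarrow>
      (\<forall>x\<in>geodesics X d. \<forall>y\<in>space (P k). symd (uniform_dist d) x (\<Phi> k y) < \<tau>/2 \<longrightarrow> c x y \<le> e) \<longrightarrow>
      (\<forall>x\<in>geodesics X d. \<forall>y\<in>space (P k). c x y \<le> C) \<longrightarrow>
      (\<integral>\<^sup>+x. \<integral>\<^sup>+y. h x y * c x y \<partial>P k \<partial>Q) \<le> e + C * ennreal \<beta>" by (elim exE conjE)
    note bound = b'[THEN spec, THEN spec, THEN spec, THEN mp, THEN mp, THEN mp]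
    have "wasserstein X d p (interpolation X d Q t)
      (distr (interpolation (Y k) (\<rho> k) (P k) t) (borel_of (forward_topology X d)) (f k)) \<le> ennreal b"
      if t: "t \<in> {0..1}" for t
    proof -
      have eq: "distr (interpolation (Y k) (\<rho> k) (P k) t) (borel_of (forward_topology X d)) (f k)
        = distr (P k) (borel_of (forward_topology X d)) (\<lambda>\<gamma>. f k (\<gamma> t))"
        unfolding interpolation_def
        by (subst distr_distr[OF f_meas compact_theta_space.plan_evaluation_measurable[OF Y P_prob t]]) (simp add: comp_def)
      note em = plan_evaluation_measurable[OF Q_prob t] and fm = f_eval_measurable[OF t, of k]
      note C = density_coupling[OF geodesic_plan(1)[OF Q_prob] P_props(1) h em fm]
      have "(\<integral>\<^sup>+\<eta>. \<integral>\<^sup>+\<gamma>. h \<eta> \<gamma> * ennreal (d (\<eta> t) (f k (\<gamma> t)) powr p) \<partial>P k \<partial>Q) \<le> ennreal c + ennreal (B powr p) * ennreal \<beta>"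
      proof (rule bound)
        show "(\<lambda>(\<eta>, \<gamma>). ennreal (d (\<eta> t) (f k (\<gamma> t)) powr p)) \<in> borel_measurable (Q \<Otimes>\<^sub>M P k)"
          using dist_measurable[OF measurable_compose[OF measurable_fst em] measurable_compose[OF measurable_snd fm]]
          by (simp add: case_prod_beta)
        show "\<forall>\<eta>\<in>geodesics X d. \<forall>\<gamma>\<in>space (P k). symd (uniform_dist d) \<eta> (\<Phi> k \<gamma>) < \<tau>/2 \<longrightarrow>
          ennreal (d (\<eta> t) (f k (\<gamma> t)) powr p) \<le> ennreal c"
        proof (intro ballI impI)
          fix \<eta> \<gamma> assume \<eta>: "\<eta> \<in> geodesics X d" and "\<gamma> \<in> space (P k)" and cl: "symd (uniform_dist d) \<eta> (\<Phi> k \<gamma>) < \<tau>/2"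
          then have \<gamma>: "\<gamma> \<in> geodesics (Y k) (\<rho> k)" by (simp add: P_props)
          have i: "\<eta> t \<in> X" "\<Phi> k \<gamma> t \<in> X" "f k (\<gamma> t) \<in> X"
            using geodesics_in[OF \<eta> t] geodesics_in[OF \<Phi>_in[OF \<gamma>] t] f_in Y_in[OF \<gamma> t] by auto
          have "d (\<eta> t) (f k (\<gamma> t)) \<le> symd d (\<eta> t) (\<Phi> k \<gamma> t) + symd d (f k (\<gamma> t)) (\<Phi> k \<gamma> t)"
            using le_symd(1)[of d "\<eta> t" "f k (\<gamma> t)"] S.triangle'[OF i(1,2,3)] by linarith
          also have "\<dots> \<le> \<tau>"
            using symd_le_symd_uniform[OF \<eta> \<Phi>_in[OF \<gamma>] t] cl \<Phi>_near[OF \<gamma> t] elim(2) by linarith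
          finally have "d (\<eta> t) (f k (\<gamma> t)) powr p \<le> \<tau> powr p"
            using nonneg[OF i(1,3)] p by (intro powr_mono2) auto
          then show "ennreal (d (\<eta> t) (f k (\<gamma> t)) powr p) \<le> ennreal c" using \<tau>(2) by (simp add: ennreal_leI)
        qed
        show "\<forall>\<eta>\<in>geodesics X d. \<forall>\<gamma>\<in>space (P k). ennreal (d (\<eta> t) (f k (\<gamma> t)) powr p) \<le> ennreal (B powr p)"
        proof (intro ballI ennreal_leI powr_mono2)
          fix \<eta> \<gamma> assume "\<eta> \<in> geodesics X d" "\<gamma> \<in> space (P k)"
          then have "\<eta> t \<in> X" "f k (\<gamma> t) \<in> X" using geodesics_in t f_in Y_in by (auto simp: P_props)
          then show "d (\<eta> t) (f k (\<gamma> t)) \<le> B" "0 \<le> d (\<eta> t) (f k (\<gamma> t))" using B(2) nonneg by auto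
        qed (use p in auto)
      qed
      also have "\<dots> \<le> ennreal (b powr p)"
        using \<beta> c by (simp add: ennreal_mult[symmetric] ennreal_plus[symmetric] c_def ennreal_leI del: ennreal_plus)
      finally have "wasserstein X d p (distr Q (borel_of (forward_topology X d)) (\<lambda>\<gamma>. \<gamma> t))
          (distr (P k) (borel_of (forward_topology X d)) (\<lambda>\<gamma>. f k (\<gamma> t))) \<le> ennreal ((b powr p) powr (1 / p))"
        unfolding C(2)[symmetric] using p by (intro wasserstein_le[OF C(1)]) auto
      then show ?thesis unfolding eq using b p by (simp add: powr_powr interpolation_def)
    qed
    then show ?case using ba by (meson SUP_least le_less_trans)
  qed
qed simp

lemma cost_limit:
  assumes p: "1 \<le> p"
  shows "(\<lambda>k. \<integral>\<gamma>. \<rho> k (\<gamma> 0) (\<gamma> 1) powr p \<partial>P k) \<longlonglongrightarrow> (\<integral>\<gamma>. d (\<gamma> 0) (\<gamma> 1) powr p \<partial>Q)"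
proof -
  obtain B where B: "0 < B" "\<And>x y. x \<in> X \<Longrightarrow> y \<in> X \<Longrightarrow> d x y \<le> B" using dist_bounded by metis
  have 0: "(0::real) \<in> {0..1}" and 1: "(1::real) \<in> {0..1}" by auto
  have lenY: "0 \<le> \<rho> k (\<gamma> 0) (\<gamma> 1)" "\<rho> k (\<gamma> 0) (\<gamma> 1) \<le> B + \<epsilon> k" if "\<gamma> \<in> geodesics (Y k) (\<rho> k)" for k \<gamma>
    using compact_theta_space.length_nonneg[OF Y that] isom[OF Y_in[OF that 0] Y_in[OF that 1]]
      B(2)[OF f_in[OF Y_in[OF that 0]] f_in[OF Y_in[OF that 1]]] by auto
  show ?thesis
  proof (rule transfer_limit[where C="\<lambda>k. (B + \<epsilon> k) powr p"])
    show "(\<lambda>\<gamma>. \<rho> k (\<gamma> 0) (\<gamma> 1) powr p) \<in> borel_measurable (P k)" for k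
      by (rule compact_theta_space.length_powr_integrable(1)[OF Y P_prob p])
    show "continuous_map (geodesic_topology X d) euclideanreal (\<lambda>\<gamma>. d (\<gamma> 0) (\<gamma> 1) powr p)"
    proof -
      \<comment> \<open>The power is continuous on the nonnegative half-line, so the length is
        regarded as a map into it.\<close>
      have "continuous_map (top_of_set {0..}) euclideanreal (\<lambda>x::real. x powr p)"
        using p by (simp, intro continuous_on_powr') auto
      moreover have "continuous_map (geodesic_topology X d) (top_of_set {0..}) (\<lambda>\<gamma>. d (\<gamma> 0) (\<gamma> 1))"
        using length_continuous length_nonneg
        by (auto simp: continuous_map_in_subtopology topspace_geodesic_topology)
      ultimately show ?thesis
        by (rule continuous_map_compose[unfolded o_def, rotated])
    qed
    show "\<bar>\<rho> k (\<gamma> 0) (\<gamma> 1) powr p\<bar> \<le> (B + \<epsilon> k) powr p" if "\<gamma> \<in> geodesics (Y k) (\<rho> k)" for k \<gamma>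
      using lenY[OF that] p by (simp add: powr_mono2)
    fix e :: real assume e: "0 < e"
    obtain \<eta> where \<eta>: "0 < \<eta>" "\<And>x y. x \<in> {0..B + 1} \<Longrightarrow> y \<in> {0..B + 1} \<Longrightarrow> \<bar>x - y\<bar> < \<eta> \<Longrightarrow> \<bar>x powr p - y powr p\<bar> < e"
      using powr_uniformly_continuous[OF p e] by metis
    have "\<forall>\<^sub>F k in sequentially. \<epsilon> k + 2 * \<delta> k < \<eta>" by (rule order_tendstoD(2)[OF length_error_lim \<eta>(1)])
    moreover have "\<forall>\<^sub>F k in sequentially. \<epsilon> k < 1" by (rule order_tendstoD(2)[OF \<epsilon>_lim]) simp
    ultimately show "\<forall>\<^sub>F k in sequentially. \<forall>\<gamma>\<in>geodesics (Y k) (\<rho> k).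
      \<bar>\<rho> k (\<gamma> 0) (\<gamma> 1) powr p - d (\<Phi> k \<gamma> 0) (\<Phi> k \<gamma> 1) powr p\<bar> \<le> e"
    proof eventually_elim
      case (elim k)
      show ?case
      proof
        fix \<gamma> assume \<gamma>: "\<gamma> \<in> geodesics (Y k) (\<rho> k)"
        have "\<rho> k (\<gamma> 0) (\<gamma> 1) \<in> {0..B + 1}" using lenY[OF \<gamma>] elim(2) by simp
        moreover have "d (\<Phi> k \<gamma> 0) (\<Phi> k \<gamma> 1) \<in> {0..B + 1}"
          using length_nonneg[OF \<Phi>_in[OF \<gamma>]] B(2)[OF geodesics_in[OF \<Phi>_in[OF \<gamma>] 0] geodesics_in[OF \<Phi>_in[OF \<gamma>] 1]] by simp
        moreover have "\<bar>\<rho> k (\<gamma> 0) (\<gamma> 1) - d (\<Phi> k \<gamma> 0) (\<Phi> k \<gamma> 1)\<bar> < \<eta>" using length_\<Phi>[OF \<gamma>] elim(1) by linarith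
        ultimately show "\<bar>\<rho> k (\<gamma> 0) (\<gamma> 1) powr p - d (\<Phi> k \<gamma> 0) (\<Phi> k \<gamma> 1) powr p\<bar> \<le> e"
          using \<eta>(2) less_imp_le by blast
      qed
    qed
  qed
qed

text \<open>A competitor \<open>\<pi>'\<close> is glued at both ends to \<open>P k\<close>: its
  first marginal is coupled with the initial points of curves, its second with the final points.
  These couplings are densities with respect to \<open>P k\<close> itself, so the glued plan is
  evaluated in \<open>Y k\<close> directly, without any map from \<open>X\<close> back to
  \<open>Y k\<close>.\<close>

theorem limit_optimal:
  assumes p: "1 \<le> p" and opt: "\<And>k. dynamical_optimal_plan (Y k) (\<rho> k) p (P k)"
  shows "optimal_plan X d p (interpolation X d Q 0) (interpolation X d Q 1) (endpoint_plan X d Q)"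
  unfolding optimal_plan_def
proof (intro conjI ballI endpoint_plan_coupling[OF Q_prob])
  let ?T = "forward_topology X d"
  define \<mu>0 where "\<mu>0 = interpolation X d Q 0"
  define \<mu>1 where "\<mu>1 = interpolation X d Q 1"
  fix \<pi>' assume "\<pi>' \<in> couplings ?T (interpolation X d Q 0) (interpolation X d Q 1)"
  then have \<pi>': "\<pi>' \<in> prob_borel_measures (prod_topology ?T ?T)" "distr \<pi>' (borel_of ?T) fst = \<mu>0" "distr \<pi>' (borel_of ?T) snd = \<mu>1"
    by (auto simp: couplings_def \<mu>0_def \<mu>1_def)
  note \<pi>'s = prob_borel_measuresD[OF \<pi>'(1)]
  have 0: "(0::real) \<in> {0..1}" and 1: "(1::real) \<in> {0..1}" by auto
  have \<mu>0: "\<mu>0 \<in> prob_borel_measures ?T" and \<mu>1: "\<mu>1 \<in> prob_borel_measures ?T"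
    unfolding \<mu>0_def \<mu>1_def using interpolation_prob[OF Q_prob] 0 1 by auto
  note \<mu>0s = prob_borel_measuresD[OF \<mu>0] and \<mu>1s = prob_borel_measuresD[OF \<mu>1]
  obtain B where B: "0 < B" "\<And>x y. x \<in> X \<Longrightarrow> y \<in> X \<Longrightarrow> d x y \<le> B" using dist_bounded by metis
  define cost where "cost = (\<integral>\<gamma>. d (\<gamma> 0) (\<gamma> 1) powr p \<partial>Q)"
  have lim0: "(\<lambda>k. \<integral>\<gamma>. g (f k (\<gamma> 0)) \<partial>P k) \<longlonglongrightarrow> (\<integral>x. g x \<partial>\<mu>0)"
    and lim1: "(\<lambda>k. \<integral>\<gamma>. g (f k (\<gamma> 1)) \<partial>P k) \<longlonglongrightarrow> (\<integral>x. g x \<partial>\<mu>1)"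
    if g: "continuous_map ?T euclideanreal g" for g
  proof -
    have "continuous_map (prod_topology ?T ?T) euclideanreal (g \<circ> fst)" "continuous_map (prod_topology ?T ?T) euclideanreal (g \<circ> snd)"
      using g by (auto intro: continuous_map_compose continuous_map_fst continuous_map_snd)
    note this[THEN endpoint_limit]
    then show "(\<lambda>k. \<integral>\<gamma>. g (f k (\<gamma> 0)) \<partial>P k) \<longlonglongrightarrow> (\<integral>x. g x \<partial>\<mu>0)" "(\<lambda>k. \<integral>\<gamma>. g (f k (\<gamma> 1)) \<partial>P k) \<longlonglongrightarrow> (\<integral>x. g x \<partial>\<mu>1)"
      unfolding \<mu>0_def \<mu>1_def interpolation_def
      by (auto simp: integral_distr[OF plan_evaluation_measurable[OF Q_prob 0] continuous_map_real_measurable[OF g]]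
          integral_distr[OF plan_evaluation_measurable[OF Q_prob 1] continuous_map_real_measurable[OF g]])
  qed
  \<comment> \<open>The \<open>4 * e\<close> consist of a tolerance \<open>e\<close> for matched
    mass and at most \<open>e\<close> for exceptional mass, at either end.\<close>
  have main: "\<forall>\<^sub>F k in sequentially. ennreal (\<integral>\<gamma>. \<rho> k (\<gamma> 0) (\<gamma> 1) powr p \<partial>P k) \<le> transport_cost d p \<pi>' + ennreal (4 * e)"
    if e: "0 < e" for e
  proof -
    \<comment> \<open>Bounds every cost in \<open>Y k\<close> as soon as
      \<open>\<epsilon> k \<le> 1\<close>.\<close>
    define C where "C = (B + 1) powr p"
    have C: "0 < C" unfolding C_def using B(1) by simp
    define \<beta> where "\<beta> = min 1 (e / C)"
    have \<beta>: "0 < \<beta>" "\<beta> \<le> 1" "C * \<beta> \<le> e" unfolding \<beta>_def using e C by (auto simp: min_def field_simps)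
    \<comment> \<open>The interval reaches to \<open>B + 3\<close> because a distance of at most
      \<open>B\<close> will be compared with its sum with \<open>2 * \<tau> + \<epsilon> k\<close>,
      where both \<open>\<tau>\<close> and \<open>\<epsilon> k\<close> are at most 1.\<close>
    obtain \<eta> where \<eta>: "0 < \<eta>" "\<And>x y. x \<in> {0..B + 3} \<Longrightarrow> y \<in> {0..B + 3} \<Longrightarrow> \<bar>x - y\<bar> < \<eta> \<Longrightarrow> \<bar>x powr p - y powr p\<bar> < e"
      using powr_uniformly_continuous[OF p e] by metis
    define \<tau> where "\<tau> = min 1 (\<eta>/4)"
    have \<tau>: "0 < \<tau>" "\<tau> \<le> 1" "\<tau> \<le> \<eta>/4" unfolding \<tau>_def using \<eta>(1) by auto
    have ev0: "\<forall>\<^sub>F k in sequentially. \<exists>h. coupling_density \<mu>0 (P k) h \<and>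
      (\<forall>c e C. (\<lambda>(x, y). c x y) \<in> borel_measurable (\<mu>0 \<Otimes>\<^sub>M P k) \<longrightarrow>
      (\<forall>x\<in>X. \<forall>y\<in>space (P k). symd d x (f k (y 0)) < \<tau> \<longrightarrow> c x y \<le> e) \<longrightarrow>
      (\<forall>x\<in>X. \<forall>y\<in>space (P k). c x y \<le> C) \<longrightarrow>
      (\<integral>\<^sup>+x. \<integral>\<^sup>+y. h x y * c x y \<partial>P k \<partial>\<mu>0) \<le> e + C * ennreal \<beta>)"
    proof (rule S.weak_convergence_coupling)
      show "\<mu>0 \<in> prob_borel_measures S.mtopology" using \<mu>0 unfolding forward_topology_eq .
      show "(\<lambda>\<gamma>. f k (\<gamma> 0)) \<in> P k \<rightarrow>\<^sub>M borel_of S.mtopology" for k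
        using f_eval_measurable[OF 0] unfolding forward_topology_eq .
      show "(\<lambda>k. \<integral>\<gamma>. g (f k (\<gamma> 0)) \<partial>P k) \<longlonglongrightarrow> (\<integral>x. g x \<partial>\<mu>0)" if "continuous_map S.mtopology euclideanreal g" for g
        using lim0[of g] that unfolding forward_topology_eq by blast
      show "prob_space (P k)" for k by (rule P_props)
      show "0 < \<beta>" "\<beta> \<le> 1" by (fact \<beta>)+
      show "0 < \<tau>" by (fact \<tau>(1))
    qed
    have ev1: "\<forall>\<^sub>F k in sequentially. \<exists>h. coupling_density \<mu>1 (P k) h \<and>
      (\<forall>c e C. (\<lambda>(x, y). c x y) \<in> borel_measurable (\<mu>1 \<Otimes>\<^sub>M P k) \<longrightarrow>
      (\<forall>x\<in>X. \<forall>y\<in>space (P k). symd d x (f k (y 1)) < \<tau> \<longrightarrow> c x y \<le> e) \<longrightarrow>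
      (\<forall>x\<in>X. \<forall>y\<in>space (P k). c x y \<le> C) \<longrightarrow>
      (\<integral>\<^sup>+x. \<integral>\<^sup>+y. h x y * c x y \<partial>P k \<partial>\<mu>1) \<le> e + C * ennreal \<beta>)"
    proof (rule S.weak_convergence_coupling)
      show "\<mu>1 \<in> prob_borel_measures S.mtopology" using \<mu>1 unfolding forward_topology_eq .
      show "(\<lambda>\<gamma>. f k (\<gamma> 1)) \<in> P k \<rightarrow>\<^sub>M borel_of S.mtopology" for k
        using f_eval_measurable[OF 1] unfolding forward_topology_eq .
      show "(\<lambda>k. \<integral>\<gamma>. g (f k (\<gamma> 1)) \<partial>P k) \<longlonglongrightarrow> (\<integral>x. g x \<partial>\<mu>1)" if "continuous_map S.mtopology euclideanreal g" for g
        using lim1[of g] that unfolding forward_topology_eq by blast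
      show "prob_space (P k)" for k by (rule P_props)
      show "0 < \<beta>" "\<beta> \<le> 1" by (fact \<beta>)+
      show "0 < \<tau>" by (fact \<tau>(1))
    qed
    have ev\<epsilon>: "\<forall>\<^sub>F k in sequentially. \<epsilon> k < min 1 (\<eta>/4)"
      by (rule order_tendstoD(2)[OF \<epsilon>_lim]) (use \<eta>(1) in simp)
    show ?thesis
      using ev0 ev1 ev\<epsilon>
    proof eventually_elim
      case (elim k)
      from elim(1) obtain h0 where h0: "coupling_density \<mu>0 (P k) h0"
        and b0': "\<forall>c e C. (\<lambda>(x, y). c x y) \<in> borel_measurable (\<mu>0 \<Otimes>\<^sub>M P k) \<longrightarrow>
        (\<forall>x\<in>X. \<forall>y\<in>space (P k). symd d x (f k (y 0)) < \<tau> \<longrightarrow> c x y \<le> e) \<longrightarrow>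
        (\<forall>x\<in>X. \<forall>y\<in>space (P k). c x y \<le> C) \<longrightarrow>
        (\<integral>\<^sup>+x. \<integral>\<^sup>+y. h0 x y * c x y \<partial>P k \<partial>\<mu>0) \<le> e + C * ennreal \<beta>" by (elim exE conjE)
      note b0 = b0'[THEN spec, THEN spec, THEN spec, THEN mp, THEN mp, THEN mp]
      from elim(2) obtain h1 where h1: "coupling_density \<mu>1 (P k) h1"
        and b1': "\<forall>c e C. (\<lambda>(x, y). c x y) \<in> borel_measurable (\<mu>1 \<Otimes>\<^sub>M P k) \<longrightarrow>
        (\<forall>x\<in>X. \<forall>y\<in>space (P k). symd d x (f k (y 1)) < \<tau> \<longrightarrow> c x y \<le> e) \<longrightarrow>
        (\<forall>x\<in>X. \<forall>y\<in>space (P k). c x y \<le> C) \<longrightarrow>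
        (\<integral>\<^sup>+x. \<integral>\<^sup>+y. h1 x y * c x y \<partial>P k \<partial>\<mu>1) \<le> e + C * ennreal \<beta>" by (elim exE conjE)
      note b1 = b1'[THEN spec, THEN spec, THEN spec, THEN mp, THEN mp, THEN mp]
      interpret Yk: compact_theta_space \<theta> "Y k" "\<rho> k" by (rule Y)
      \<comment> \<open>A two-valued penalty: the tolerance \<open>e\<close> if the endpoint is well
        matched, otherwise the bound \<open>C\<close>, which alone dominates any cost in
        \<open>Y k\<close>. The pointwise inequality \<open>le\<close> then holds whether or not the
        endpoints match.\<close>
      define c where "c t x \<gamma> = (if symd d x (f k (\<gamma> t)) < \<tau> then ennreal e else ennreal C)" for t x and \<gamma> :: "real \<Rightarrow> 'a"
      have cm: "(\<lambda>(x, \<gamma>). c t x \<gamma>) \<in> borel_measurable (\<mu> \<Otimes>\<^sub>M P k)" if t: "t \<in> {0..1}" and \<mu>: "\<mu> \<in> prob_borel_measures ?T" for t \<mu>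
      proof -
        have "fst \<in> \<mu> \<Otimes>\<^sub>M P k \<rightarrow>\<^sub>M borel_of ?T"
          using measurable_fst[of \<mu> "P k"] measurable_cong_sets[OF refl prob_borel_measuresD(2)[OF \<mu>]] by blast
        note [measurable] = symd_measurable[OF this measurable_compose[OF measurable_snd f_eval_measurable[OF t, of k]]]
        show ?thesis unfolding c_def case_prod_beta by measurable
      qed
      \<comment> \<open>The maximum appears because the tolerance \<open>e\<close> and the bound
        \<open>C\<close> are not ordered.\<close>
      have cb: "(\<forall>x\<in>X. \<forall>y\<in>space (P k). symd d x (f k (y t)) < \<tau> \<longrightarrow> c t x y \<le> ennreal e)"
        "(\<forall>x\<in>X. \<forall>y\<in>space (P k). c t x y \<le> ennreal (max e C))" for t
        unfolding c_def by (auto intro!: ennreal_leI)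
      have le: "ennreal (\<rho> k (\<gamma> 0) (\<gamma>' 1) powr p) \<le> ennreal (d (fst q) (snd q) powr p) + c 0 (fst q) \<gamma> + c 1 (snd q) \<gamma>'"
        if q: "q \<in> space \<pi>'" and \<gamma>s: "\<gamma> \<in> space (P k)" "\<gamma>' \<in> space (P k)" for q \<gamma> \<gamma>'
      proof -
        have \<gamma>: "\<gamma> 0 \<in> Y k" "\<gamma>' 1 \<in> Y k" using \<gamma>s Y_in 0 1 by (auto simp: P_props)
        have qX: "fst q \<in> X" "snd q \<in> X" using q by (auto simp: \<pi>'s)
        note fX = f_in[OF \<gamma>(1)] f_in[OF \<gamma>(2)]
        have nn: "0 \<le> \<rho> k (\<gamma> 0) (\<gamma>' 1)" using Yk.nonneg \<gamma> by blast
        have "\<rho> k (\<gamma> 0) (\<gamma>' 1) \<le> B + 1" using isom[OF \<gamma>] B(2)[OF fX] elim(3) by linarith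
        then have leC: "\<rho> k (\<gamma> 0) (\<gamma>' 1) powr p \<le> C" unfolding C_def using nn p by (intro powr_mono2) auto
        consider (good) "symd d (fst q) (f k (\<gamma> 0)) < \<tau>" "symd d (snd q) (f k (\<gamma>' 1)) < \<tau>"
          | (bad0) "\<not> symd d (fst q) (f k (\<gamma> 0)) < \<tau>" | (bad1) "\<not> symd d (snd q) (f k (\<gamma>' 1)) < \<tau>" by blast
        then show ?thesis
        proof cases
          case good
          define s where "s = d (fst q) (snd q) + 2 * \<tau> + \<epsilon> k"
          have \<epsilon>0: "0 \<le> \<epsilon> k" using isom[OF \<gamma>] by linarith
          have "\<rho> k (\<gamma> 0) (\<gamma>' 1) \<le> s"
            using isom[OF \<gamma>] dist_perturb[OF qX fX] good unfolding s_def by linarith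
          then have "\<rho> k (\<gamma> 0) (\<gamma>' 1) powr p \<le> s powr p" using nn p by (intro powr_mono2) auto
          also have "\<dots> \<le> d (fst q) (snd q) powr p + e"
          proof -
            have "s \<in> {0..B + 3}" "d (fst q) (snd q) \<in> {0..B + 3}" "\<bar>s - d (fst q) (snd q)\<bar> < \<eta>"
              using nonneg[OF qX] B(2)[OF qX] \<tau> \<epsilon>0 elim(3) unfolding s_def by auto
            from \<eta>(2)[OF this] show ?thesis by linarith
          qed
          finally have "ennreal (\<rho> k (\<gamma> 0) (\<gamma>' 1) powr p) \<le> ennreal (d (fst q) (snd q) powr p) + ennreal e"
            using e by (simp add: ennreal_plus[symmetric] ennreal_leI del: ennreal_plus)
          also have "\<dots> \<le> ennreal (d (fst q) (snd q) powr p) + c 0 (fst q) \<gamma> + c 1 (snd q) \<gamma>'"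
            using good by (simp add: c_def add_increasing2)
          finally show ?thesis .
        next
          case bad0
          then have "ennreal (\<rho> k (\<gamma> 0) (\<gamma>' 1) powr p) \<le> c 0 (fst q) \<gamma>" using leC by (simp add: c_def ennreal_leI)
          then show ?thesis by (meson add_increasing add_increasing2 zero_le)
        next
          case bad1
          then have "ennreal (\<rho> k (\<gamma> 0) (\<gamma>' 1) powr p) \<le> c 1 (snd q) \<gamma>'" using leC by (simp add: c_def ennreal_leI)
          then show ?thesis by (meson add_increasing zero_le)
        qed
      qed
      have fsts: "fst \<in> \<pi>' \<rightarrow>\<^sub>M \<mu>0" "snd \<in> \<pi>' \<rightarrow>\<^sub>M \<mu>1"
      proof -
        have "fst \<in> borel_of (prod_topology ?T ?T) \<rightarrow>\<^sub>M borel_of ?T" "snd \<in> borel_of (prod_topology ?T ?T) \<rightarrow>\<^sub>M borel_of ?T"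
          by (auto intro!: continuous_map_measurable continuous_map_fst continuous_map_snd)
        then show "fst \<in> \<pi>' \<rightarrow>\<^sub>M \<mu>0" "snd \<in> \<pi>' \<rightarrow>\<^sub>M \<mu>1"
          using measurable_cong_sets[OF \<pi>'s(2) \<mu>0s(2)] measurable_cong_sets[OF \<pi>'s(2) \<mu>1s(2)] by blast+
      qed
      have ds: "distr \<pi>' \<mu>0 fst = \<mu>0" "distr \<pi>' \<mu>1 snd = \<mu>1"
        using \<pi>'(2,3) distr_cong[OF refl \<mu>0s(2)[symmetric], of \<pi>' fst fst] distr_cong[OF refl \<mu>1s(2)[symmetric], of \<pi>' snd snd] by auto
      define K where "K y y' = (\<integral>\<^sup>+p. h0 (fst p) y * h1 (snd p) y' \<partial>\<pi>')" for y y'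
      note glue = coupling_density_glue[OF \<pi>'s(1) P_props(1)[of k] P_props(1)[of k] \<mu>0s(1) \<mu>1s(1) fsts(1) ds(1) fsts(2) ds(2) h0 h1, folded K_def]
      note ek = Yk.plan_evaluation_measurable[OF P_prob 0] Yk.plan_evaluation_measurable[OF P_prob 1]
      note C' = Yk.density_coupling[OF P_props(1) P_props(1) glue(1) ek]
      have "ennreal (\<integral>\<gamma>. \<rho> k (\<gamma> 0) (\<gamma> 1) powr p \<partial>P k) = transport_cost (\<rho> k) p (endpoint_plan (Y k) (\<rho> k) (P k))"
        by (rule Yk.transport_cost_endpoint_plan[OF P_prob p, symmetric])
      also have "\<dots> \<le> (\<integral>\<^sup>+\<gamma>. \<integral>\<^sup>+\<gamma>'. K \<gamma> \<gamma>' * ennreal (\<rho> k (\<gamma> 0) (\<gamma>' 1) powr p) \<partial>P k \<partial>P k)"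
        unfolding C'(2)[symmetric]
        using opt[of k] C'(1) unfolding dynamical_optimal_plan_def optimal_plan_def Yk.endpoint_plan_marginals[OF P_prob]
        by (simp add: interpolation_def)
      also have "\<dots> \<le> (\<integral>\<^sup>+q. ennreal (d (fst q) (snd q) powr p) \<partial>\<pi>')
        + (\<integral>\<^sup>+x. \<integral>\<^sup>+y. h0 x y * c 0 x y \<partial>P k \<partial>\<mu>0) + (\<integral>\<^sup>+x. \<integral>\<^sup>+y. h1 x y * c 1 x y \<partial>P k \<partial>\<mu>1)"
      proof (rule glue(2)[OF _ _ cm[OF 0 \<mu>0] cm[OF 1 \<mu>1] le])
        show "(\<lambda>(y, y'). ennreal (\<rho> k (y 0) (y' 1) powr p)) \<in> borel_measurable (P k \<Otimes>\<^sub>M P k)"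
          using Yk.dist_measurable[OF measurable_compose[OF measurable_fst ek(1)] measurable_compose[OF measurable_snd ek(2)]]
          by (simp add: case_prod_beta)
        show "(\<lambda>q. ennreal (d (fst q) (snd q) powr p)) \<in> borel_measurable \<pi>'"
          using cost_measurable[of p] unfolding measurable_cong_sets[OF \<pi>'s(2) refl] case_prod_unfold .
      qed
      also have "\<dots> \<le> transport_cost d p \<pi>' + (ennreal e + ennreal (max e C) * ennreal \<beta>) + (ennreal e + ennreal (max e C) * ennreal \<beta>)"
        by (intro add_mono b0[OF cm[OF 0 \<mu>0] cb] b1[OF cm[OF 1 \<mu>1] cb]) (simp add: transport_cost_def case_prod_unfold)
      also have "\<dots> = transport_cost d p \<pi>' + ennreal (2 * e + 2 * (max e C * \<beta>))"
      proof -
        have m0: "0 \<le> max e C * \<beta>" using e \<beta>(1) by simp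
        have "ennreal (max e C) * ennreal \<beta> = ennreal (max e C * \<beta>)" using e \<beta>(1) by (simp add: ennreal_mult)
        moreover have "ennreal (2 * e + 2 * (max e C * \<beta>)) = (ennreal e + ennreal (max e C * \<beta>)) + (ennreal e + ennreal (max e C * \<beta>))"
          using m0 e by (simp add: ennreal_plus[symmetric] mult.commute del: ennreal_plus)
        ultimately show ?thesis by (simp add: add.assoc)
      qed
      also have "\<dots> \<le> transport_cost d p \<pi>' + ennreal (4 * e)"
      proof (intro add_left_mono ennreal_leI)
        have "max e C * \<beta> \<le> e" using \<beta> e by (cases "e \<le> C") (auto simp: max_def mult_left_le)
        then show "2 * e + 2 * (max e C * \<beta>) \<le> 4 * e" by linarith
      qed
      finally show ?case .
    qed
  qed
  show "transport_cost d p (endpoint_plan X d Q) \<le> transport_cost d p \<pi>'"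
  proof (cases "transport_cost d p \<pi>'")
    case (real r)
    have "cost \<le> r + e" if e: "0 < e" for e
    proof (rule tendsto_upperbound[OF cost_limit[OF p, folded cost_def]])
      have "\<forall>\<^sub>F k in sequentially. ennreal (\<integral>\<gamma>. \<rho> k (\<gamma> 0) (\<gamma> 1) powr p \<partial>P k) \<le> transport_cost d p \<pi>' + ennreal (4 * (e/4))"
        by (rule main) (use e in simp)
      then show "\<forall>\<^sub>F k in sequentially. (\<integral>\<gamma>. \<rho> k (\<gamma> 0) (\<gamma> 1) powr p \<partial>P k) \<le> r + e"
      proof eventually_elim
        case (elim k)
        then have "ennreal (\<integral>\<gamma>. \<rho> k (\<gamma> 0) (\<gamma> 1) powr p \<partial>P k) \<le> ennreal (r + e)"
          using real e by (simp add: ennreal_plus[symmetric] del: ennreal_plus)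
        then show ?case using real e by (subst (asm) ennreal_le_iff) auto
      qed
    qed simp
    then have "cost \<le> r" by (rule field_le_epsilon)
    then show ?thesis unfolding transport_cost_endpoint_plan[OF Q_prob p] cost_def real by (simp add: ennreal_leI)
  qed simp
qed

theorem limit_dynamical_optimal:
  assumes "1 \<le> p" "\<And>k. dynamical_optimal_plan (Y k) (\<rho> k) p (P k)"
  shows "dynamical_optimal_plan X d p Q"
  unfolding dynamical_optimal_plan_def endpoint_plan_marginals[OF Q_prob]
  using limit_optimal[OF assms] Q_prob by simp

end

section \<open>Monotonicity and speed fields\<close>

text \<open>McShane's extension, the infimum of the functions \<open>g c + A * sqrt (d x c)\<close>.
  The square root is subadditive, so the root of a metric satisfies the triangle inequality and the
  argument for Lipschitz functions carries over; nonnegativity survives the infimum.\<close>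

lemma (in compact_metric) holder_extension:
  fixes g :: "'a \<Rightarrow> real"
  assumes C: "C \<subseteq> M" "C \<noteq> {}" and A: "0 \<le> A"
    and nn: "\<And>x. x \<in> C \<Longrightarrow> 0 \<le> g x"
    and hol: "\<And>x y. x \<in> C \<Longrightarrow> y \<in> C \<Longrightarrow> \<bar>g x - g y\<bar> \<le> A * sqrt (d x y)"
  obtains w where "continuous_map mtopology euclideanreal w" "\<And>x. x \<in> M \<Longrightarrow> 0 \<le> w x" "\<And>x. x \<in> C \<Longrightarrow> w x = g x"
proof -
  define w where "w x = (INF c\<in>C. g c + A * sqrt (d x c))" for x
  have bdd: "bdd_below ((\<lambda>c. g c + A * sqrt (d x c)) ` C)" for x
    using nn A by (intro bdd_belowI2[of _ 0]) simp
  have le: "w x \<le> w y + A * sqrt (d x y)" if xy: "x \<in> M" "y \<in> M" for x y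
  proof -
    have "w x - A * sqrt (d x y) \<le> g c + A * sqrt (d y c)" if c: "c \<in> C" for c
    proof -
      have "w x \<le> g c + A * sqrt (d x c)" unfolding w_def by (rule cINF_lower[OF bdd c])
      moreover have "sqrt (d x c) \<le> sqrt (d x y) + sqrt (d y c)"
        using triangle[OF xy, of c] c C(1) sqrt_add_le_add_sqrt[of "d x y" "d y c"] by (meson nonneg order_trans real_sqrt_le_mono subsetD)
      then have "A * sqrt (d x c) \<le> A * sqrt (d x y) + A * sqrt (d y c)"
        using A by (metis distrib_left mult_left_mono)
      ultimately show ?thesis by linarith
    qed
    then have "w x - A * sqrt (d x y) \<le> w y" unfolding w_def[of y] by (rule cINF_greatest[OF C(2)])
    then show ?thesis by linarith
  qed
  show thesis
  proof (rule that[of w])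
    show "continuous_map mtopology euclideanreal w"
    proof (rule continuous_map_realI)
      fix x and e :: real assume x: "x \<in> M" and e: "0 < e"
      have "\<bar>w x - w y\<bar> < e" if y: "y \<in> M" "d x y < (e / (A + 1))\<^sup>2" for y
      proof -
        have "sqrt (d x y) < e / (A + 1)"
          using y(2) e A by (intro real_less_lsqrt) auto
        then have "(A + 1) * sqrt (d x y) < e" using A by (simp add: pos_less_divide_eq mult.commute)
        moreover have "A * sqrt (d x y) \<le> (A + 1) * sqrt (d x y)" by (intro mult_right_mono) auto
        ultimately show ?thesis using le[OF x y(1)] le[OF y(1) x] by (simp add: commute abs_le_iff)
      qed
      then show "\<exists>\<delta>>0. \<forall>y\<in>M. d x y < \<delta> \<longrightarrow> \<bar>w x - w y\<bar> < e"
        using e A by (intro exI[of _ "(e / (A + 1))\<^sup>2"]) auto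
    qed
    show "0 \<le> w x" if "x \<in> M" for x
      unfolding w_def using nn A by (intro cINF_greatest[OF C(2)]) simp
    show "w x = g x" if x: "x \<in> C" for x
    proof (rule antisym)
      have "w x \<le> g x + A * sqrt (d x x)" unfolding w_def by (rule cINF_lower[OF bdd x])
      then show "w x \<le> g x" using x C(1) by auto
      show "g x \<le> w x"
        unfolding w_def using hol[OF x] by (intro cINF_greatest[OF C(2)]) (smt (verit))
    qed
  qed
qed

lemma emeasure_distr_nn_integral:
  assumes "f \<in> M \<rightarrow>\<^sub>M N" "A \<in> sets N"
  shows "emeasure (distr M N f) A = (\<integral>\<^sup>+x. indicator A (f x) \<partial>M)"
proof -
  have "emeasure (distr M N f) A = (\<integral>\<^sup>+y. indicator A y \<partial>distr M N f)"
    using nn_integral_indicator[of A "distr M N f"] assms(2) by simp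
  also have "\<dots> = (\<integral>\<^sup>+x. indicator A (f x) \<partial>M)"
    by (rule nn_integral_distr[OF assms(1)]) (use assms(2) in simp)
  finally show ?thesis .
qed

section \<open>Quadratic cost: monotone pairs of curves, and speed as a function of position\<close>

context compact_theta_space
begin

interpretation G: compact_theta_space \<theta> "geodesics X d" "uniform_dist d" by (rule compact_theta_geodesics)

text \<open>Cyclical monotonicity of the squared distance for cycles of length two.\<close>

definition pairwise_monotone :: "(real \<Rightarrow> 'a) \<Rightarrow> (real \<Rightarrow> 'a) \<Rightarrow> bool" where
  "pairwise_monotone \<gamma> \<eta> \<longleftrightarrow>
    (d (\<gamma> 0) (\<gamma> 1))\<^sup>2 + (d (\<eta> 0) (\<eta> 1))\<^sup>2 \<le> (d (\<gamma> 0) (\<eta> 1))\<^sup>2 + (d (\<eta> 0) (\<gamma> 1))\<^sup>2"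

text \<open>If a set of pairs of curves violates monotonicity, exchanging the final points of two
  independent copies of the random curve on that set keeps both marginals, since the set is
  symmetric, and lowers the cost.\<close>

lemma AE_pairwise_monotone:
  assumes N: "N \<in> prob_borel_measures (geodesic_topology X d)"
    and opt: "optimal_plan X d 2 (interpolation X d N 0) (interpolation X d N 1) (endpoint_plan X d N)"
  shows "AE q in N \<Otimes>\<^sub>M N. pairwise_monotone (fst q) (snd q)"
proof -
  let ?T = "forward_topology X d"
  interpret N: prob_space N by (rule geodesic_plan[OF N])
  interpret NN: pair_prob_space N N ..
  have 0: "(0::real) \<in> {0..1}" and 1: "(1::real) \<in> {0..1}" by auto
  have sN: "space N = geodesics X d" by (rule geodesic_plan(3)[OF N])
  have e1: "(\<lambda>q. (fst q) t) \<in> N \<Otimes>\<^sub>M N \<rightarrow>\<^sub>M borel_of ?T" and e2: "(\<lambda>q. (snd q) t) \<in> N \<Otimes>\<^sub>M N \<rightarrow>\<^sub>M borel_of ?T"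
    if "t \<in> {0..1}" for t
    using measurable_compose[OF measurable_fst plan_evaluation_measurable[OF N that]]
      measurable_compose[OF measurable_snd plan_evaluation_measurable[OF N that]] by auto
  define a b a' b' where "a q = (d (fst q 0) (fst q 1))\<^sup>2" and "b q = (d (fst q 0) (snd q 1))\<^sup>2"
    and "a' q = (d (snd q 0) (snd q 1))\<^sup>2" and "b' q = (d (snd q 0) (fst q 1))\<^sup>2"
    for q :: "(real \<Rightarrow> 'a) \<times> (real \<Rightarrow> 'a)"
  have m[measurable]: "a \<in> borel_measurable (N \<Otimes>\<^sub>M N)" "b \<in> borel_measurable (N \<Otimes>\<^sub>M N)"
    "a' \<in> borel_measurable (N \<Otimes>\<^sub>M N)" "b' \<in> borel_measurable (N \<Otimes>\<^sub>M N)"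
    unfolding a_def b_def a'_def b'_def
    using dist_measurable[OF e1[OF 0] e1[OF 1]] dist_measurable[OF e1[OF 0] e2[OF 1]]
      dist_measurable[OF e2[OF 0] e2[OF 1]] dist_measurable[OF e2[OF 0] e1[OF 1]] by simp_all
  obtain L where L: "0 < L" "\<And>x y. x \<in> X \<Longrightarrow> y \<in> X \<Longrightarrow> d x y \<le> L" using dist_bounded by metis
  have qin: "fst q t \<in> X" "snd q t \<in> X" if "q \<in> space (N \<Otimes>\<^sub>M N)" "t \<in> {0..1}" for q t
    using that geodesics_in sN by (auto simp: space_pair_measure)
  have sq: "(d x y)\<^sup>2 \<le> L\<^sup>2" if "x \<in> X" "y \<in> X" for x y
    using L(2)[OF that] nonneg[OF that] by (intro power_mono) auto
  have bd: "\<bar>a q\<bar> \<le> L\<^sup>2" "\<bar>b q\<bar> \<le> L\<^sup>2" "\<bar>a' q\<bar> \<le> L\<^sup>2" "\<bar>b' q\<bar> \<le> L\<^sup>2" if "q \<in> space (N \<Otimes>\<^sub>M N)" for q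
    unfolding a_def b_def a'_def b'_def using qin[OF that 0] qin[OF that 1] sq by auto
  define B where "B = {q \<in> space (N \<Otimes>\<^sub>M N). b q + b' q < a q + a' q}"
  have Bm[measurable]: "B \<in> sets (N \<Otimes>\<^sub>M N)" unfolding B_def by measurable
  define Bc where "Bc = space (N \<Otimes>\<^sub>M N) - B"
  have Bcm: "Bc \<in> sets (N \<Otimes>\<^sub>M N)" unfolding Bc_def by (rule sets.compl_sets[OF Bm])
  \<comment> \<open>On the bad set the first curve takes over the final point of the second. Initial
    points are untouched, so only the second marginal of \<open>\<pi>\<close> draws on the symmetry
    of \<open>B\<close>.\<close>
  define S where "S q = (if q \<in> B then snd q 1 else fst q 1)" for q
  have Sm: "S \<in> N \<Otimes>\<^sub>M N \<rightarrow>\<^sub>M borel_of ?T"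
    unfolding S_def by (rule measurable_If_set[OF e2[OF 1] e1[OF 1]]) (use Bm in simp)
  have SSm: "(\<lambda>q. (fst q 0, S q)) \<in> N \<Otimes>\<^sub>M N \<rightarrow>\<^sub>M borel_of (prod_topology ?T ?T)"
    by (rule measurable_pairI[OF e1[OF 0] Sm])
  define \<pi> where "\<pi> = distr (N \<Otimes>\<^sub>M N) (borel_of (prod_topology ?T ?T)) (\<lambda>q. (fst q 0, S q))"
  have mT: "fst \<in> borel_of (prod_topology ?T ?T) \<rightarrow>\<^sub>M borel_of ?T" "snd \<in> borel_of (prod_topology ?T ?T) \<rightarrow>\<^sub>M borel_of ?T"
    by (auto intro!: continuous_map_measurable continuous_map_fst continuous_map_snd)
  have swap: "(\<integral>\<^sup>+q. F q \<partial>(N \<Otimes>\<^sub>M N)) = (\<integral>\<^sup>+q. F (snd q, fst q) \<partial>(N \<Otimes>\<^sub>M N))"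
    if "F \<in> borel_measurable (N \<Otimes>\<^sub>M N)" for F :: "_ \<Rightarrow> ennreal"
    by (subst NN.distr_pair_swap, subst nn_integral_distr) (use that in \<open>simp_all add: case_prod_unfold\<close>)
  have swap_real: "(\<integral>q. F q \<partial>(N \<Otimes>\<^sub>M N)) = (\<integral>q. F (snd q, fst q) \<partial>(N \<Otimes>\<^sub>M N))"
    if "F \<in> borel_measurable (N \<Otimes>\<^sub>M N)" for F :: "_ \<Rightarrow> real"
    by (subst NN.distr_pair_swap, subst integral_distr) (use that in \<open>simp_all add: case_prod_unfold\<close>)
  have B_swap: "(snd q, fst q) \<in> B \<longleftrightarrow> q \<in> B" if "q \<in> space (N \<Otimes>\<^sub>M N)" for q
    using that unfolding B_def a_def b_def a'_def b'_def by (auto simp: space_pair_measure add.commute)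
  have first: "(\<integral>\<^sup>+q. g (fst q) \<partial>(N \<Otimes>\<^sub>M N)) = (\<integral>\<^sup>+\<gamma>. g \<gamma> \<partial>N)" if "g \<in> borel_measurable N" for g :: "_ \<Rightarrow> ennreal"
    using that by (subst N.nn_integral_fst[symmetric]) (auto simp: N.emeasure_space_1 intro: measurable_compose[OF measurable_fst])
  have "distr \<pi> (borel_of ?T) fst = interpolation X d N 0"
  proof (rule measure_eqI)
    fix A assume "A \<in> sets (distr \<pi> (borel_of ?T) fst)"
    then have A: "A \<in> sets (borel_of ?T)" by simp
    note em0 = plan_evaluation_measurable[OF N 0]
    have "emeasure (distr \<pi> (borel_of ?T) fst) A = emeasure (distr (N \<Otimes>\<^sub>M N) (borel_of ?T) (\<lambda>q. fst q 0)) A"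
      unfolding \<pi>_def by (subst distr_distr[OF mT(1) SSm]) (simp add: comp_def)
    also have "\<dots> = (\<integral>\<^sup>+q. indicator A (fst q 0) \<partial>(N \<Otimes>\<^sub>M N))"
      by (rule emeasure_distr_nn_integral[OF e1[OF 0] A])
    also have "\<dots> = (\<integral>\<^sup>+\<gamma>. indicator A (\<gamma> 0) \<partial>N)"
      by (rule first) (use measurable_compose[OF em0 borel_measurable_indicator[OF A]] in simp)
    also have "\<dots> = emeasure (interpolation X d N 0) A"
      unfolding interpolation_def by (rule emeasure_distr_nn_integral[OF em0 A, symmetric])
    finally show "emeasure (distr \<pi> (borel_of ?T) fst) A = emeasure (interpolation X d N 0) A" .
  qed (simp add: interpolation_def)
  moreover have "distr \<pi> (borel_of ?T) snd = interpolation X d N 1"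
  proof (rule measure_eqI)
    fix A assume "A \<in> sets (distr \<pi> (borel_of ?T) snd)"
    then have A: "A \<in> sets (borel_of ?T)" by simp
    note em1 = plan_evaluation_measurable[OF N 1]
    have i1[measurable]: "(\<lambda>q. indicator A (fst q 1) :: ennreal) \<in> borel_measurable (N \<Otimes>\<^sub>M N)"
      using measurable_compose[OF e1[OF 1] borel_measurable_indicator[OF A]] by simp
    have i2[measurable]: "(\<lambda>q. indicator A (snd q 1) :: ennreal) \<in> borel_measurable (N \<Otimes>\<^sub>M N)"
      using measurable_compose[OF e2[OF 1] borel_measurable_indicator[OF A]] by simp
    have "emeasure (distr \<pi> (borel_of ?T) snd) A = emeasure (distr (N \<Otimes>\<^sub>M N) (borel_of ?T) S) A"
      unfolding \<pi>_def by (subst distr_distr[OF mT(2) SSm]) (simp add: comp_def)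
    also have "\<dots> = (\<integral>\<^sup>+q. indicator A (S q) \<partial>(N \<Otimes>\<^sub>M N))"
      by (rule emeasure_distr_nn_integral[OF Sm A])
    also have "\<dots> = (\<integral>\<^sup>+q. indicator B q * indicator A (snd q 1) + indicator Bc q * indicator A (fst q 1) \<partial>(N \<Otimes>\<^sub>M N))"
      by (rule nn_integral_cong) (simp add: S_def Bc_def indicator_def)
    also have "\<dots> = (\<integral>\<^sup>+q. indicator B q * indicator A (snd q 1) \<partial>(N \<Otimes>\<^sub>M N)) + (\<integral>\<^sup>+q. indicator Bc q * indicator A (fst q 1) \<partial>(N \<Otimes>\<^sub>M N))"
      by (rule nn_integral_add; intro borel_measurable_times_ennreal borel_measurable_indicator i1 i2 Bm Bcm)
    also have "(\<integral>\<^sup>+q. indicator B q * indicator A (snd q 1) \<partial>(N \<Otimes>\<^sub>M N)) = (\<integral>\<^sup>+q. indicator B (snd q, fst q) * indicator A (fst q 1) \<partial>(N \<Otimes>\<^sub>M N))"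
      by (subst swap) (auto intro!: borel_measurable_times_ennreal i2)
    also have "\<dots> = (\<integral>\<^sup>+q. indicator B q * indicator A (fst q 1) \<partial>(N \<Otimes>\<^sub>M N))"
      using B_swap by (intro nn_integral_cong) (auto simp: indicator_def)
    also have "\<dots> + (\<integral>\<^sup>+q. indicator Bc q * indicator A (fst q 1) \<partial>(N \<Otimes>\<^sub>M N)) = (\<integral>\<^sup>+q. indicator B q * indicator A (fst q 1) + indicator Bc q * indicator A (fst q 1) \<partial>(N \<Otimes>\<^sub>M N))"
      by (rule nn_integral_add[symmetric]; intro borel_measurable_times_ennreal borel_measurable_indicator i1 i2 Bm Bcm)
    also have "\<dots> = (\<integral>\<^sup>+q. indicator A (fst q 1) \<partial>(N \<Otimes>\<^sub>M N))"
      by (rule nn_integral_cong) (simp add: Bc_def indicator_def)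
    also have "\<dots> = (\<integral>\<^sup>+\<gamma>. indicator A (\<gamma> 1) \<partial>N)"
      by (rule first) (use measurable_compose[OF em1 borel_measurable_indicator[OF A]] in simp)
    also have "\<dots> = emeasure (interpolation X d N 1) A"
      unfolding interpolation_def by (rule emeasure_distr_nn_integral[OF em1 A, symmetric])
    finally show "emeasure (distr \<pi> (borel_of ?T) snd) A = emeasure (interpolation X d N 1) A" .
  qed (simp add: interpolation_def)
  ultimately have \<pi>: "\<pi> \<in> couplings ?T (interpolation X d N 0) (interpolation X d N 1)"
    unfolding couplings_def using prob_borel_measures_distr[OF NN.P.prob_space_axioms SSm] by (simp add: \<pi>_def)
  define s where "s q = (if q \<in> B then b q else a q)" for q
  have sm[measurable]: "s \<in> borel_measurable (N \<Otimes>\<^sub>M N)" unfolding s_def by measurable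
  have sb: "\<bar>s q\<bar> \<le> L\<^sup>2" "0 \<le> s q" if "q \<in> space (N \<Otimes>\<^sub>M N)" for q
    unfolding s_def using bd[OF that] by (auto simp: a_def b_def)
  have int: "integrable (N \<Otimes>\<^sub>M N) g" if "g \<in> borel_measurable (N \<Otimes>\<^sub>M N)" "\<And>q. q \<in> space (N \<Otimes>\<^sub>M N) \<Longrightarrow> \<bar>g q\<bar> \<le> R"
    for g :: "_ \<Rightarrow> real" and R
    using that by (intro NN.P.integrable_const_bound[of _ R] AE_I2) auto
  have "transport_cost d 2 \<pi> = (\<integral>\<^sup>+q. ennreal (s q) \<partial>(N \<Otimes>\<^sub>M N))"
  proof -
    have "transport_cost d 2 \<pi> = (\<integral>\<^sup>+q. ennreal (d (fst q 0) (S q) powr 2) \<partial>(N \<Otimes>\<^sub>M N))"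
      unfolding transport_cost_def \<pi>_def
      by (subst nn_integral_distr[OF SSm]) (use cost_measurable in auto)
    also have "\<dots> = (\<integral>\<^sup>+q. ennreal (s q) \<partial>(N \<Otimes>\<^sub>M N))"
    proof (rule nn_integral_cong)
      fix q assume q: "q \<in> space (N \<Otimes>\<^sub>M N)"
      have "d (fst q 0) (S q) powr 2 = (d (fst q 0) (S q))\<^sup>2"
        using nonneg qin[OF q 0] qin[OF q 1] by (intro powr_numeral) (simp add: S_def)
      also have "\<dots> = s q" by (simp add: S_def s_def a_def b_def)
      finally show "ennreal (d (fst q 0) (S q) powr 2) = ennreal (s q)" by simp
    qed
    finally show ?thesis .
  qed
  also have "\<dots> = ennreal (\<integral>q. s q \<partial>(N \<Otimes>\<^sub>M N))"
    using int[OF sm sb(1)] sb(2) by (intro nn_integral_eq_integral) auto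
  finally have cost\<pi>: "transport_cost d 2 \<pi> = ennreal (\<integral>q. s q \<partial>(N \<Otimes>\<^sub>M N))" .
  have "transport_cost d 2 (endpoint_plan X d N) = (\<integral>\<^sup>+q. ennreal (a q) \<partial>(N \<Otimes>\<^sub>M N))"
  proof -
    have "transport_cost d 2 (endpoint_plan X d N) = (\<integral>\<^sup>+\<gamma>. ennreal (d (\<gamma> 0) (\<gamma> 1) powr 2) \<partial>N)"
      unfolding transport_cost_def endpoint_plan_def
      by (subst nn_integral_distr[OF endpoint_plan_prob(2)[OF N]]) (use cost_measurable in auto)
    also have "\<dots> = (\<integral>\<^sup>+q. ennreal (d (fst q 0) (fst q 1) powr 2) \<partial>(N \<Otimes>\<^sub>M N))"
      by (rule first[symmetric]) (use length_powr_integrable(1)[OF N, of 2] in simp)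
    also have "\<dots> = (\<integral>\<^sup>+q. ennreal (a q) \<partial>(N \<Otimes>\<^sub>M N))"
      using nonneg qin 0 1 by (intro nn_integral_cong) (simp add: a_def powr_numeral)
    finally show ?thesis .
  qed
  also have "\<dots> = ennreal (\<integral>q. a q \<partial>(N \<Otimes>\<^sub>M N))"
    using int[OF m(1) bd(1)] by (intro nn_integral_eq_integral) (auto simp: a_def)
  finally have cost0: "transport_cost d 2 (endpoint_plan X d N) = ennreal (\<integral>q. a q \<partial>(N \<Otimes>\<^sub>M N))" .
  have "ennreal (\<integral>q. a q \<partial>(N \<Otimes>\<^sub>M N)) \<le> ennreal (\<integral>q. s q \<partial>(N \<Otimes>\<^sub>M N))"
    using opt \<pi> unfolding optimal_plan_def cost\<pi>[symmetric] cost0[symmetric] by blast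
  moreover have "0 \<le> (\<integral>q. s q \<partial>(N \<Otimes>\<^sub>M N))" using sb(2) by (intro Bochner_Integration.integral_nonneg_AE AE_I2) auto
  ultimately have ge: "(\<integral>q. a q \<partial>(N \<Otimes>\<^sub>M N)) \<le> (\<integral>q. s q \<partial>(N \<Otimes>\<^sub>M N))" by (simp add: ennreal_le_iff)
  \<comment> \<open>\<open>D\<close> is the change of cost caused by the exchange, \<open>D'\<close>
    its mirror image. Swapping the two copies shows that their integrals agree, so by optimality
    \<open>D + D'\<close> has nonnegative integral; being negative on \<open>B\<close> and zero
    elsewhere, it forces \<open>B\<close> to be null.\<close>
  define D where "D q = indicator B q * (b q - a q)" for q
  define D' where "D' q = indicator B q * (b' q - a' q)" for q
  have Dm[measurable]: "D \<in> borel_measurable (N \<Otimes>\<^sub>M N)" "D' \<in> borel_measurable (N \<Otimes>\<^sub>M N)"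
    unfolding D_def D'_def by measurable
  have Db: "\<bar>D q\<bar> \<le> 2 * L\<^sup>2" "\<bar>D' q\<bar> \<le> 2 * L\<^sup>2" if "q \<in> space (N \<Otimes>\<^sub>M N)" for q
    using bd[OF that] unfolding D_def D'_def by (auto simp: indicator_def)
  have "(\<integral>q. D q \<partial>(N \<Otimes>\<^sub>M N)) = (\<integral>q. s q - a q \<partial>(N \<Otimes>\<^sub>M N))"
    by (rule Bochner_Integration.integral_cong) (auto simp: D_def s_def indicator_def)
  also have "\<dots> \<ge> 0" using ge int[OF sm sb(1)] int[OF m(1) bd(1)] by simp
  finally have D0: "0 \<le> (\<integral>q. D q \<partial>(N \<Otimes>\<^sub>M N))" .
  have "(\<integral>q. D q \<partial>(N \<Otimes>\<^sub>M N)) = (\<integral>q. D' q \<partial>(N \<Otimes>\<^sub>M N))"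
  proof -
    have "(\<integral>q. D q \<partial>(N \<Otimes>\<^sub>M N)) = (\<integral>q. D (snd q, fst q) \<partial>(N \<Otimes>\<^sub>M N))" by (rule swap_real[OF Dm(1)])
    also have "\<dots> = (\<integral>q. D' q \<partial>(N \<Otimes>\<^sub>M N))"
      using B_swap by (intro Bochner_Integration.integral_cong) (auto simp: D_def D'_def indicator_def a_def b_def a'_def b'_def)
    finally show ?thesis .
  qed
  then have sum0: "0 \<le> (\<integral>q. D q + D' q \<partial>(N \<Otimes>\<^sub>M N))"
    using D0 int[OF Dm(1) Db(1)] int[OF Dm(2) Db(2)] by simp
  define E where "E q = - (D q + D' q)" for q
  have E0: "0 \<le> E q" for q by (auto simp: E_def D_def D'_def indicator_def B_def)
  have Ei: "integrable (N \<Otimes>\<^sub>M N) E"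
    unfolding E_def using int[OF Dm(1) Db(1)] int[OF Dm(2) Db(2)]
    by (intro Bochner_Integration.integrable_minus Bochner_Integration.integrable_add) auto
  have "(\<integral>q. E q \<partial>(N \<Otimes>\<^sub>M N)) = - (\<integral>q. D q + D' q \<partial>(N \<Otimes>\<^sub>M N))"
    unfolding E_def by (rule integral_minus)
  then have "(\<integral>q. E q \<partial>(N \<Otimes>\<^sub>M N)) = 0"
    using sum0 Bochner_Integration.integral_nonneg_AE[of E "N \<Otimes>\<^sub>M N"] E0 by simp
  then have "AE q in N \<Otimes>\<^sub>M N. E q = 0"
    using integral_nonneg_eq_0_iff_AE[OF Ei] E0 by simp
  then show ?thesis
    using AE_space
  proof eventually_elim
    case (elim q)
    then have "q \<notin> B" by (auto simp: E_def D_def D'_def B_def indicator_def)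
    then show ?case using elim(2) unfolding B_def pairwise_monotone_def a_def b_def a'_def b'_def by auto
  qed
qed

text \<open>Violation is an open condition on pairs. Around a violating pair of supporting curves
  there would be a box of violating pairs of positive product measure, against the almost sure
  statement.\<close>

lemma supp_pairwise_monotone:
  assumes N: "N \<in> prob_borel_measures (geodesic_topology X d)"
    and opt: "optimal_plan X d 2 (interpolation X d N 0) (interpolation X d N 1) (endpoint_plan X d N)"
    and \<gamma>: "\<gamma> \<in> G.S.supp N" and \<eta>: "\<eta> \<in> G.S.supp N"
  shows "pairwise_monotone \<gamma> \<eta>"
proof (rule ccontr)
  assume neg: "\<not> pairwise_monotone \<gamma> \<eta>"
  let ?G = "geodesic_topology X d"
  interpret N: prob_space N by (rule geodesic_plan[OF N])
  interpret NN: pair_prob_space N N ..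
  have 0: "(0::real) \<in> {0..1}" and 1: "(1::real) \<in> {0..1}" by auto
  have T: "?G = G.S.mtopology" by (simp add: geodesic_topology_def G.forward_topology_eq)
  have in_G: "\<gamma> \<in> geodesics X d" "\<eta> \<in> geodesics X d" using \<gamma> \<eta> G.S.supp_subset by auto
  have ev: "continuous_map (prod_topology ?G ?G) (forward_topology X d) (\<lambda>q. (fst q) t)"
    "continuous_map (prod_topology ?G ?G) (forward_topology X d) (\<lambda>q. (snd q) t)" if "t \<in> {0..1}" for t
    using continuous_map_compose[OF continuous_map_fst evaluation_continuous[OF that]]
      continuous_map_compose[OF continuous_map_snd evaluation_continuous[OF that]] by (auto simp: o_def)
  have cd: "continuous_map (prod_topology ?G ?G) euclideanreal (\<lambda>q. d (u q) (v q))"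
    if "continuous_map (prod_topology ?G ?G) (forward_topology X d) u" "continuous_map (prod_topology ?G ?G) (forward_topology X d) v" for u v
    using continuous_map_compose[OF continuous_map_pairedI[OF that] dist_continuous] by (simp add: o_def)
  define F where "F q = (d (fst q 0) (fst q 1))\<^sup>2 + (d (snd q 0) (snd q 1))\<^sup>2 - ((d (fst q 0) (snd q 1))\<^sup>2 + (d (snd q 0) (fst q 1))\<^sup>2)"
    for q :: "(real \<Rightarrow> 'a) \<times> (real \<Rightarrow> 'a)"
  have "continuous_map (prod_topology ?G ?G) euclideanreal F"
    unfolding F_def using ev 0 1
    by (intro continuous_map_diff continuous_map_add continuous_map_real_pow cd) auto
  then have op: "openin (prod_topology ?G ?G) {q \<in> topspace (prod_topology ?G ?G). F q \<in> {0<..}}"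
    by (rule openin_continuous_map_preimage) simp
  have mem: "(\<gamma>, \<eta>) \<in> {q \<in> topspace (prod_topology ?G ?G). F q \<in> {0<..}}"
    using neg in_G by (simp add: F_def pairwise_monotone_def topspace_geodesic_topology)
  from op[unfolded openin_prod_topology_alt, THEN spec, THEN spec, THEN mp, OF mem]
  obtain U V where UV: "openin ?G U" "openin ?G V" "\<gamma> \<in> U" "\<eta> \<in> V"
    "U \<times> V \<subseteq> {q \<in> topspace (prod_topology ?G ?G). F q \<in> {0<..}}"
    by (elim exE conjE)
  have pos: "0 < measure N W" if W: "openin ?G W" "\<zeta> \<in> W" and \<zeta>: "\<zeta> \<in> G.S.supp N" for W \<zeta>
  proof -
    obtain r where r: "r > 0" "G.S.mball \<zeta> r \<subseteq> W" using W unfolding T G.S.openin_mtopology by blast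
    have "measure N (G.S.mball \<zeta> r) \<le> measure N W"
      by (rule N.finite_measure_mono[OF r(2)]) (use W(1) openin_sets_borel_of geodesic_plan(2)[OF N] in blast)
    then show ?thesis using \<zeta> r(1) unfolding G.S.supp_def by force
  qed
  have s: "U \<in> sets N" "V \<in> sets N" using UV openin_sets_borel_of geodesic_plan(2)[OF N] by auto
  have "AE q in N \<Otimes>\<^sub>M N. q \<notin> U \<times> V"
    using AE_pairwise_monotone[OF N opt]
  proof eventually_elim
    case (elim q)
    then have "\<not> 0 < F q" by (simp add: F_def pairwise_monotone_def)
    then show ?case using UV(5) by auto
  qed
  then have "emeasure (N \<Otimes>\<^sub>M N) (U \<times> V) = 0"
    using AE_iff_null_sets[of "U \<times> V" "N \<Otimes>\<^sub>M N"] s by (simp add: pair_measureI null_setsD1)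
  then have "emeasure N U = 0 \<or> emeasure N V = 0"
    using s by (simp add: N.emeasure_pair_measure_Times)
  then show False using pos[OF UV(1,3) \<gamma>] pos[OF UV(2,4) \<eta>] by (auto simp: measure_def)
qed

text \<open>Mather's shortening lemma, in the form given by Villani.\<close>

lemma length_holder:
  assumes t: "0 < t" "t < 1"
  obtains A where "0 \<le> A" "\<And>\<gamma> \<eta>. \<gamma> \<in> geodesics X d \<Longrightarrow> \<eta> \<in> geodesics X d \<Longrightarrow> pairwise_monotone \<gamma> \<eta> \<Longrightarrow>
    \<bar>d (\<gamma> 0) (\<gamma> 1) - d (\<eta> 0) (\<eta> 1)\<bar> \<le> A * sqrt (symd d (\<gamma> t) (\<eta> t))"
proof -
  obtain B where B: "0 < B" "\<And>x y. x \<in> X \<Longrightarrow> y \<in> X \<Longrightarrow> symd d x y \<le> B"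
    using S.mdist_bounded by metis
  \<comment> \<open>\<open>3 * B\<close> comes from expanding the square of \<open>x + s\<close>
    with \<open>x\<close> and \<open>s\<close> at most \<open>B\<close>, and
    \<open>t * (1 - t)\<close> from the strict convexity of the square. The constant blows up at the
    endpoints, where curves of different speeds may meet.\<close>
  define A where "A = sqrt (3 * B / (t * (1 - t)))"
  have "\<bar>d (\<gamma> 0) (\<gamma> 1) - d (\<eta> 0) (\<eta> 1)\<bar> \<le> A * sqrt (symd d (\<gamma> t) (\<eta> t))"
    if \<gamma>: "\<gamma> \<in> geodesics X d" and \<eta>: "\<eta> \<in> geodesics X d" and mono: "pairwise_monotone \<gamma> \<eta>" for \<gamma> \<eta>
  proof -
    have I: "(0::real) \<in> {0..1}" "(1::real) \<in> {0..1}" "t \<in> {0..1}" using t by auto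
    note \<gamma>X = I[THEN geodesics_in[OF \<gamma>]] and \<eta>X = I[THEN geodesics_in[OF \<eta>]]
    define L L' s where "L = d (\<gamma> 0) (\<gamma> 1)" and "L' = d (\<eta> 0) (\<eta> 1)" and "s = symd d (\<gamma> t) (\<eta> t)"
    have L: "0 \<le> L" "L \<le> B" "0 \<le> L'" "L' \<le> B" "0 \<le> s" "s \<le> B"
      unfolding L_def L'_def s_def
      using nonneg[OF \<gamma>X(1,2)] nonneg[OF \<eta>X(1,2)] B(2)[OF \<gamma>X(1,2)] B(2)[OF \<eta>X(1,2)] B(2)[OF \<gamma>X(3) \<eta>X(3)]
        le_symd(1)[of d "\<gamma> 0" "\<gamma> 1"] le_symd(1)[of d "\<eta> 0" "\<eta> 1"] by auto
    \<comment> \<open>Without a gap between the curves at time \<open>t\<close>, \<open>u\<close>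
      and \<open>u'\<close> would be the lengths of the two crossed curves, which change over at
      that time; the gap costs at most \<open>s\<close> more.\<close>
    define u u' where "u = t * L + (1 - t) * L'" and "u' = t * L' + (1 - t) * L"
    have u: "0 \<le> u" "u \<le> B" "0 \<le> u'" "u' \<le> B"
      unfolding u_def u'_def using L t convex_bound_le[of L B L' t "1 - t"] convex_bound_le[of L' B L t "1 - t"] by auto
    have "d (\<gamma> 0) (\<eta> 1) \<le> d (\<gamma> 0) (\<gamma> t) + (d (\<gamma> t) (\<eta> t) + d (\<eta> t) (\<eta> 1))"
      using triangle[OF \<gamma>X(1,3) \<eta>X(2)] triangle[OF \<gamma>X(3) \<eta>X(3,2)] by linarith
    also have "\<dots> \<le> u + s"
      using geodesics_dist[OF \<gamma>, of 0 t] geodesics_dist[OF \<eta>, of t 1] t le_symd(1)[of d "\<gamma> t" "\<eta> t"]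
      by (simp add: u_def s_def L_def L'_def)
    finally have 1: "(d (\<gamma> 0) (\<eta> 1))\<^sup>2 \<le> (u + s)\<^sup>2" using nonneg[OF \<gamma>X(1) \<eta>X(2)] by (intro power_mono)
    have "d (\<eta> 0) (\<gamma> 1) \<le> d (\<eta> 0) (\<eta> t) + (d (\<eta> t) (\<gamma> t) + d (\<gamma> t) (\<gamma> 1))"
      using triangle[OF \<eta>X(1,3) \<gamma>X(2)] triangle[OF \<eta>X(3) \<gamma>X(3,2)] by linarith
    also have "\<dots> \<le> u' + s"
      using geodesics_dist[OF \<eta>, of 0 t] geodesics_dist[OF \<gamma>, of t 1] t le_symd(2)[of d "\<eta> t" "\<gamma> t"]
      by (simp add: u'_def s_def L_def L'_def)
    finally have 2: "(d (\<eta> 0) (\<gamma> 1))\<^sup>2 \<le> (u' + s)\<^sup>2" using nonneg[OF \<eta>X(1) \<gamma>X(2)] by (intro power_mono)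
    have sq: "(x + s)\<^sup>2 \<le> x\<^sup>2 + 3 * B * s" if "0 \<le> x" "x \<le> B" for x
    proof -
      have "(x + s)\<^sup>2 = x\<^sup>2 + (2 * x + s) * s" by (simp add: power2_eq_square algebra_simps)
      also have "\<dots> \<le> x\<^sup>2 + (3 * B) * s" using that L by (intro add_left_mono mult_right_mono) auto
      finally show ?thesis by simp
    qed
    have "L\<^sup>2 + L'\<^sup>2 \<le> u\<^sup>2 + u'\<^sup>2 + 6 * B * s"
      using mono 1 2 sq[OF u(1,2)] sq[OF u(3,4)] unfolding pairwise_monotone_def L_def[symmetric] L'_def[symmetric] by linarith
    \<comment> \<open>Both pairs of lengths have the same sum, but the crossed pair is closer
      together and so has the smaller sum of squares; the deficit is quadratic in
      \<open>L - L'\<close>.\<close>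
    moreover have "u\<^sup>2 + u'\<^sup>2 = L\<^sup>2 + L'\<^sup>2 - 2 * (t * (1 - t)) * (L - L')\<^sup>2"
      unfolding u_def u'_def by (simp add: power2_eq_square algebra_simps)
    ultimately have "(t * (1 - t)) * (L - L')\<^sup>2 \<le> 3 * B * s" by linarith
    then have "(L - L')\<^sup>2 \<le> 3 * B / (t * (1 - t)) * s"
      using t by (simp add: field_simps)
    then have "sqrt ((L - L')\<^sup>2) \<le> sqrt (3 * B / (t * (1 - t)) * s)" by (rule real_sqrt_le_mono)
    then show ?thesis by (simp only: A_def real_sqrt_mult L_def L'_def s_def real_sqrt_abs)
  qed
  moreover have "0 \<le> A" unfolding A_def using B(1) t by simp
  ultimately show thesis by (rule that[rotated])
qed

text \<open>The Hoelder estimate at distance 0 says that curves of \<open>S\<close> through a common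
  point at time \<open>t\<close> have equal lengths. Length is therefore a function of the position,
  Hoelder continuous where it is defined, and it extends to the whole space.\<close>

lemma speed_function:
  assumes t: "0 < t" "t < 1" and S: "S \<subseteq> geodesics X d" "S \<noteq> {}"
    and mono: "\<And>\<gamma> \<eta>. \<gamma> \<in> S \<Longrightarrow> \<eta> \<in> S \<Longrightarrow> pairwise_monotone \<gamma> \<eta>"
  obtains w where "continuous_map (forward_topology X d) euclideanreal w" "\<And>x. x \<in> X \<Longrightarrow> 0 \<le> w x"
    "\<And>\<gamma>. \<gamma> \<in> S \<Longrightarrow> w (\<gamma> t) = d (\<gamma> 0) (\<gamma> 1)"
proof -
  have tI: "t \<in> {0..1}" using t by simp
  obtain A where A: "0 \<le> A" "\<And>\<gamma> \<eta>. \<gamma> \<in> geodesics X d \<Longrightarrow> \<eta> \<in> geodesics X d \<Longrightarrow> pairwise_monotone \<gamma> \<eta> \<Longrightarrow>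
    \<bar>d (\<gamma> 0) (\<gamma> 1) - d (\<eta> 0) (\<eta> 1)\<bar> \<le> A * sqrt (symd d (\<gamma> t) (\<eta> t))"
    using length_holder[OF t] by blast
  define c where "c x = (SOME \<gamma>. \<gamma> \<in> S \<and> \<gamma> t = x)" for x
  have c: "c x \<in> S" "c x t = x" if "x \<in> (\<lambda>\<gamma>. \<gamma> t) ` S" for x
    using someI_ex[of "\<lambda>\<gamma>. \<gamma> \<in> S \<and> \<gamma> t = x"] that unfolding c_def by auto
  define g where "g x = d (c x 0) (c x 1)" for x
  have hol: "\<bar>d (\<gamma> 0) (\<gamma> 1) - d (\<eta> 0) (\<eta> 1)\<bar> \<le> A * sqrt (symd d (\<gamma> t) (\<eta> t))" if "\<gamma> \<in> S" "\<eta> \<in> S" for \<gamma> \<eta>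
    using A(2) mono that S(1) by blast
  obtain w where w: "continuous_map S.mtopology euclideanreal w" "\<And>x. x \<in> X \<Longrightarrow> 0 \<le> w x"
    "\<And>x. x \<in> (\<lambda>\<gamma>. \<gamma> t) ` S \<Longrightarrow> w x = g x"
  proof (rule S.holder_extension[of "(\<lambda>\<gamma>. \<gamma> t) ` S" A g])
    show "(\<lambda>\<gamma>. \<gamma> t) ` S \<subseteq> X" using geodesics_in tI S(1) by blast
    show "0 \<le> g x" if "x \<in> (\<lambda>\<gamma>. \<gamma> t) ` S" for x unfolding g_def using length_nonneg c[OF that] S(1) by blast
    show "\<bar>g x - g y\<bar> \<le> A * sqrt (symd d x y)" if "x \<in> (\<lambda>\<gamma>. \<gamma> t) ` S" "y \<in> (\<lambda>\<gamma>. \<gamma> t) ` S" for x y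
      unfolding g_def using hol[OF c(1)[OF that(1)] c(1)[OF that(2)]] c(2)[OF that(1)] c(2)[OF that(2)] by simp
  qed (use S(2) A(1) in auto)
  show thesis
  proof (rule that[of w])
    show "continuous_map (forward_topology X d) euclideanreal w" using w(1) by (simp add: forward_topology_eq)
    show "w (\<gamma> t) = d (\<gamma> 0) (\<gamma> 1)" if \<gamma>: "\<gamma> \<in> S" for \<gamma>
    proof -
      have x: "\<gamma> t \<in> (\<lambda>\<gamma>. \<gamma> t) ` S" using \<gamma> by blast
      have "symd d (c (\<gamma> t) t) (\<gamma> t) = 0" using c(2)[OF x] symd_eq_0_iff geodesics_in[of \<gamma> t] S(1) \<gamma> tI by auto
      then show ?thesis using w(3)[OF x] hol[OF c(1)[OF x] \<gamma>] by (simp add: g_def)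
    qed
  qed (rule w(2))
qed

text \<open>When the length is a function \<open>w\<close> of the position at time \<open>t\<close>,
  the quadratic weight can be pulled through the evaluation map. Half of the square of
  \<open>w\<close> is then a density of the energy, and uniqueness of Radon-Nikodym derivatives
  gives the rest.\<close>

lemma speed_fieldI:
  assumes N: "N \<in> prob_borel_measures (geodesic_topology X d)" and t: "t \<in> {0..1}"
    and w: "w \<in> borel_measurable (borel_of (forward_topology X d))" "\<And>x. x \<in> X \<Longrightarrow> 0 \<le> w x"
    and ae: "AE \<gamma> in N. w (\<gamma> t) = d (\<gamma> 0) (\<gamma> 1)"
  shows "speed_field X d N t w"
proof -
  let ?T = "forward_topology X d"
  note em = plan_evaluation_measurable[OF N t]
  have I: "prob_space (interpolation X d N t)" "sets (interpolation X d N t) = sets (borel_of ?T)" "space (interpolation X d N t) = X"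
    using prob_borel_measuresD[OF interpolation_prob[OF N t]] by auto
  interpret I: prob_space "interpolation X d N t" by (rule I)
  have Lm: "(\<lambda>\<gamma>. d (\<gamma> 0) (\<gamma> 1)) \<in> borel_measurable N"
    using continuous_map_real_measurable[OF length_continuous] unfolding geodesic_plan_measurable[OF N] .
  have wm: "(\<lambda>\<gamma>. w (\<gamma> t)) \<in> borel_measurable N" by (rule measurable_compose[OF em w(1)])
  have w2: "(\<lambda>x. ennreal ((w x)\<^sup>2 / 2)) \<in> borel_measurable (borel_of ?T)" using w(1) by simp
  have "density N (\<lambda>\<gamma>. ennreal ((d (\<gamma> 0) (\<gamma> 1))\<^sup>2 / 2)) = density N (\<lambda>\<gamma>. ennreal ((w (\<gamma> t))\<^sup>2 / 2))"
    by (rule density_cong) (use Lm wm ae in \<open>auto elim!: eventually_mono\<close>)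
  then have "kinetic_energy X d N t = density (interpolation X d N t) (\<lambda>x. ennreal ((w x)\<^sup>2 / 2))"
    unfolding kinetic_energy_eq[OF N] interpolation_def by (simp add: density_distr[OF w2 em])
  then have "AE x in interpolation X d N t. ennreal ((w x)\<^sup>2 / 2) = RN_deriv (interpolation X d N t) (kinetic_energy X d N t) x"
    by (intro I.RN_deriv_unique) (use w2 measurable_cong_sets[OF I(2) refl] in auto)
  then have "AE x in interpolation X d N t.
      w x = sqrt (2 * enn2real (RN_deriv (interpolation X d N t) (kinetic_energy X d N t) x))"
    using AE_space
  proof eventually_elim
    case (elim x)
    then have "0 \<le> w x" using w(2) I(3) by simp
    then show ?case unfolding elim(1)[symmetric] by simp
  qed
  then show ?thesis unfolding speed_field_def using w by auto
qed

end

section \<open>Convergence of supports and of speed fields\<close>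

context gh_limit
begin

interpretation G: compact_theta_space \<theta> "geodesics X d" "uniform_dist d" by (rule compact_theta_geodesics)

text \<open>The Hausdorff limit of the images of the supports, recovered as the zero set of the
  limit of their distance functions.\<close>

definition limit_supp :: "(real \<Rightarrow> 'b) set" where
  "limit_supp = {\<eta> \<in> geodesics X d. S_dist \<eta> = 0}"

lemma limit_supp_subset: "limit_supp \<subseteq> geodesics X d"
  by (auto simp: limit_supp_def)

lemma plan_supp_in: "\<gamma> \<in> plan_supp k \<Longrightarrow> \<gamma> \<in> geodesics (Y k) (\<rho> k)"
  using plan_supp(1) by blast

lemma supp_dist_bdd: "bdd_below ((\<lambda>\<gamma>. symd (uniform_dist d) (\<Phi> k \<gamma>) \<eta>) ` plan_supp k)"
  by (intro bdd_belowI2[of _ 0]) simp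

text \<open>One half of Hausdorff convergence, where the curve of the limit set is fixed;
  \<open>S_dist_plan_supp\<close> and \<open>near_limit_supp\<close> together give the other
  half.\<close>

lemma limit_supp_approx:
  assumes \<eta>: "\<eta> \<in> limit_supp" and e: "0 < e"
  shows "\<forall>\<^sub>F k in sequentially. \<exists>\<gamma>\<in>plan_supp k. symd (uniform_dist d) (\<Phi> k \<gamma>) \<eta> < e"
proof -
  have \<eta>': "\<eta> \<in> geodesics X d" "S_dist \<eta> = 0" using \<eta> by (auto simp: limit_supp_def)
  have "(\<lambda>k. INF \<gamma>\<in>plan_supp k. symd (uniform_dist d) (\<Phi> k \<gamma>) \<eta>) \<longlonglongrightarrow> 0"
    using tendsto_uniform_limitI[OF S_dist_lim \<eta>'(1)] \<eta>'(2) by simp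
  from order_tendstoD(2)[OF this e] show ?thesis
    by eventually_elim (simp add: cINF_less_iff[OF plan_supp(2) supp_dist_bdd])
qed

text \<open>The \<open>k\<close>-th distance function vanishes at the image of each supporting
  curve. Uniform convergence is essential, because the point of evaluation moves with
  \<open>k\<close>.\<close>

lemma S_dist_plan_supp:
  assumes e: "0 < e"
  shows "\<forall>\<^sub>F k in sequentially. \<forall>\<gamma>\<in>plan_supp k. S_dist (\<Phi> k \<gamma>) < e"
  using uniform_limitD[OF S_dist_lim e]
proof eventually_elim
  case (elim k)
  show ?case
  proof
    fix \<gamma> assume \<gamma>: "\<gamma> \<in> plan_supp k"
    have \<Phi>: "\<Phi> k \<gamma> \<in> geodesics X d" by (rule \<Phi>_in[OF plan_supp_in[OF \<gamma>]])
    define I where "I = (INF \<zeta>\<in>plan_supp k. symd (uniform_dist d) (\<Phi> k \<zeta>) (\<Phi> k \<gamma>))"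
    have "I \<le> symd (uniform_dist d) (\<Phi> k \<gamma>) (\<Phi> k \<gamma>)"
      unfolding I_def by (rule cINF_lower[OF supp_dist_bdd \<gamma>])
    then have "I \<le> 0" using \<Phi> by simp
    moreover have "dist I (S_dist (\<Phi> k \<gamma>)) < e" unfolding I_def using elim \<Phi> by blast
    ultimately show "S_dist (\<Phi> k \<gamma>) < e" unfolding dist_real_def by linarith
  qed
qed

text \<open>A small value of the limit function does not by itself exhibit a nearby zero.
  Compactness does: curves with values tending to 0 and far from all zeros would subconverge to a
  zero.\<close>

lemma near_limit_supp:
  assumes e: "0 < e"
  shows "\<exists>c>0. \<forall>\<eta>\<in>geodesics X d. S_dist \<eta> < c \<longrightarrow> (\<exists>\<zeta>\<in>limit_supp. symd (uniform_dist d) \<eta> \<zeta> < e)"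
proof (rule ccontr)
  assume neg: "\<not> ?thesis"
  have "\<forall>n. \<exists>\<eta>. \<eta> \<in> geodesics X d \<and> S_dist \<eta> < 1 / real (Suc n) \<and> (\<forall>\<zeta>\<in>limit_supp. \<not> symd (uniform_dist d) \<eta> \<zeta> < e)"
  proof
    fix n
    have "0 < 1 / real (Suc n)" by simp
    then show "\<exists>\<eta>. \<eta> \<in> geodesics X d \<and> S_dist \<eta> < 1 / real (Suc n) \<and> (\<forall>\<zeta>\<in>limit_supp. \<not> symd (uniform_dist d) \<eta> \<zeta> < e)"
      using neg by blast
  qed
  then obtain \<eta> where \<eta>: "\<And>n. \<eta> n \<in> geodesics X d" "\<And>n. S_dist (\<eta> n) < 1 / real (Suc n)"
    "\<And>n \<zeta>. \<zeta> \<in> limit_supp \<Longrightarrow> \<not> symd (uniform_dist d) (\<eta> n) \<zeta> < e" by metis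
  obtain \<zeta> r where \<zeta>: "\<zeta> \<in> geodesics X d" and r: "strict_mono (r :: nat \<Rightarrow> nat)"
    and lim: "(\<lambda>n. symd (uniform_dist d) (\<eta> (r n)) \<zeta>) \<longlonglongrightarrow> 0"
    by (rule G.S.convergent_subseq[of \<eta>, OF \<eta>(1)])
  have "(\<lambda>n. 1 / real (Suc n)) \<longlonglongrightarrow> 0" by (rule LIMSEQ_Suc[OF lim_1_over_n])
  from LIMSEQ_subseq_LIMSEQ[OF this r] have "(\<lambda>n. 1 / real (Suc (r n)) + symd (uniform_dist d) (\<eta> (r n)) \<zeta>) \<longlonglongrightarrow> 0 + 0"
    using lim by (intro tendsto_add) (auto simp: o_def)
  moreover have "S_dist \<zeta> \<le> 1 / real (Suc (r n)) + symd (uniform_dist d) (\<eta> (r n)) \<zeta>" for n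
    using S_dist_lipschitz[OF \<eta>(1) \<zeta>, of "r n"] \<eta>(2)[of "r n"] by linarith
  ultimately have "S_dist \<zeta> \<le> 0" using LIMSEQ_le_const by fastforce
  then have "\<zeta> \<in> limit_supp" using S_dist_nonneg[OF \<zeta>] \<zeta> by (simp add: limit_supp_def)
  moreover have "\<forall>\<^sub>F n in sequentially. symd (uniform_dist d) (\<eta> (r n)) \<zeta> < e"
    by (rule order_tendstoD(2)[OF lim e])
  ultimately show False using \<eta>(3) by (auto simp: eventually_sequentially)
qed

text \<open>\<open>S_dist\<close> is small on the images of supporting curves, so its integrals
  against the images of the plans tend to 0; by weak convergence its integral against
  \<open>Q\<close> vanishes.\<close>

lemma AE_limit_supp: "AE \<eta> in Q. \<eta> \<in> limit_supp"
proof -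
  interpret Q: prob_space Q by (rule geodesic_plan[OF Q_prob])
  have c: "continuous_map (geodesic_topology X d) euclideanreal S_dist"
    unfolding geodesic_topology_eq
  proof (rule G.S.continuous_map_realI)
    fix \<eta> and e :: real assume "\<eta> \<in> geodesics X d" "0 < e"
    then show "\<exists>\<delta>>0. \<forall>\<zeta>\<in>geodesics X d. symd (uniform_dist d) \<eta> \<zeta> < \<delta> \<longrightarrow> \<bar>S_dist \<eta> - S_dist \<zeta>\<bar> < e"
      using S_dist_lipschitz by (intro exI[of _ e]) (auto intro: le_less_trans)
  qed
  have int: "integrable Q S_dist"
    by (rule G.S.integrable_continuous[OF Q.finite_measure_axioms])
      (use c geodesic_plan(2)[OF Q_prob] in \<open>simp_all add: geodesic_topology_eq\<close>)
  obtain B where B: "\<And>\<eta>. \<eta> \<in> geodesics X d \<Longrightarrow> \<bar>S_dist \<eta>\<bar> \<le> B"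
    using G.S.continuous_map_real_bounded[of S_dist] c unfolding geodesic_topology_eq by metis
  have le_e: "(\<integral>\<eta>. S_dist \<eta> \<partial>Q) \<le> e" if e: "0 < e" for e
  proof (rule tendsto_upperbound[OF Q_lim[OF c]])
    show "\<forall>\<^sub>F k in sequentially. (\<integral>\<gamma>. S_dist (\<Phi> k \<gamma>) \<partial>P k) \<le> e"
      using S_dist_plan_supp[OF e]
    proof eventually_elim
      case (elim k)
      interpret Pk: prob_space "P k" by (rule P_props)
      have i: "integrable (P k) (\<lambda>\<gamma>. S_dist (\<Phi> k \<gamma>))"
        using B \<Phi>_in continuous_map_real_comp_measurable[OF c \<Phi>P]
        by (intro Pk.integrable_const_bound[of _ B] AE_I2) (auto simp: P_props)
      have "(\<integral>\<gamma>. S_dist (\<Phi> k \<gamma>) \<partial>P k) \<le> (\<integral>\<gamma>. e \<partial>P k)"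
      proof (rule integral_mono_AE[OF i])
        show "AE \<gamma> in P k. S_dist (\<Phi> k \<gamma>) \<le> e"
          using plan_supp(3)[of k] by eventually_elim (use elim in \<open>auto intro: less_imp_le\<close>)
      qed simp
      then show ?case by (simp add: Pk.prob_space)
    qed
  qed simp
  have "(\<integral>\<eta>. S_dist \<eta> \<partial>Q) \<le> 0" by (rule field_le_epsilon) (simp only: add_0 le_e)
  moreover have nn: "AE \<eta> in Q. 0 \<le> S_dist \<eta>"
    using S_dist_nonneg by (intro AE_I2) (simp add: geodesic_plan(3)[OF Q_prob])
  ultimately have "(\<integral>\<eta>. S_dist \<eta> \<partial>Q) = 0" using Bochner_Integration.integral_nonneg_AE[OF nn] by simp
  then have "AE \<eta> in Q. S_dist \<eta> = 0" using integral_nonneg_eq_0_iff_AE[OF int nn] by simp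
  then show ?thesis
    using AE_space by eventually_elim (simp add: limit_supp_def geodesic_plan(3)[OF Q_prob])
qed

lemma limit_supp_nonempty: "limit_supp \<noteq> {}"
proof
  interpret Q: prob_space Q by (rule geodesic_plan[OF Q_prob])
  assume "limit_supp = {}"
  then have "AE \<eta> in Q. False" using AE_limit_supp by simp
  then show False by simp
qed

lemma plan_supp_monotone:
  assumes opt: "dynamical_optimal_plan (Y k) (\<rho> k) 2 (P k)"
    and "\<gamma> \<in> plan_supp k" "\<eta> \<in> plan_supp k"
  shows "compact_theta_space.pairwise_monotone (\<rho> k) \<gamma> \<eta>"
proof -
  interpret Yk: compact_theta_space \<theta> "Y k" "\<rho> k" by (rule Y)
  show ?thesis
    by (rule Yk.supp_pairwise_monotone[OF P_prob])
      (use assms in \<open>simp_all add: plan_supp_def dynamical_optimal_plan_def Yk.endpoint_plan_marginals[OF P_prob]\<close>)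
qed

text \<open>Inherited from the plans \<open>P k\<close> and not from optimality of \<open>Q\<close>,
  which would say nothing about limits of supporting curves whose mass disappears in the
  limit.\<close>

lemma limit_supp_monotone:
  assumes opt: "\<And>k. dynamical_optimal_plan (Y k) (\<rho> k) 2 (P k)"
    and \<gamma>: "\<gamma> \<in> limit_supp" and \<eta>: "\<eta> \<in> limit_supp"
  shows "pairwise_monotone \<gamma> \<eta>"
proof -
  have I: "(0::real) \<in> {0..1}" "(1::real) \<in> {0..1}" by auto
  have \<gamma>G: "\<gamma> \<in> geodesics X d" and \<eta>G: "\<eta> \<in> geodesics X d" using \<gamma> \<eta> limit_supp_subset by auto
  obtain B where B: "0 < B" "\<And>x y. x \<in> X \<Longrightarrow> y \<in> X \<Longrightarrow> d x y \<le> B" using dist_bounded by metis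
  have approx: "(d (\<gamma> 0) (\<gamma> 1))\<^sup>2 + (d (\<eta> 0) (\<eta> 1))\<^sup>2 \<le> (d (\<gamma> 0) (\<eta> 1))\<^sup>2 + (d (\<eta> 0) (\<gamma> 1))\<^sup>2 + c"
    if c: "0 < c" for c
  proof -
    \<comment> \<open>Four squared distances are exchanged, each with an error of at most
      \<open>(2 * B + 1) * e\<close>; the distances in \<open>Y k\<close> are at most
      \<open>B + 1\<close> because \<open>e \<le> 1\<close>.\<close>
    define e where "e = min 1 (c / (4 * (2 * B + 1)))"
    have e: "0 < e" "e \<le> 1" unfolding e_def using c B(1) by auto
    have "4 * (2 * B + 1) * e \<le> 4 * (2 * B + 1) * (c / (4 * (2 * B + 1)))"
      unfolding e_def using B(1) by (intro mult_left_mono) auto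
    then have e3: "4 * (2 * B + 1) * e \<le> c" using B(1) by simp
    have "\<forall>\<^sub>F k in sequentially. (\<exists>\<gamma>'\<in>plan_supp k. symd (uniform_dist d) (\<Phi> k \<gamma>') \<gamma> < e/4) \<and>
      (\<exists>\<eta>'\<in>plan_supp k. symd (uniform_dist d) (\<Phi> k \<eta>') \<eta> < e/4) \<and> \<epsilon> k + 2 * \<delta> k < e/2"
      by (intro eventually_conj limit_supp_approx \<gamma> \<eta> order_tendstoD(2)[OF length_error_lim]) (use e in auto)
    then obtain k where k: "\<exists>\<gamma>'\<in>plan_supp k. symd (uniform_dist d) (\<Phi> k \<gamma>') \<gamma> < e/4"
      "\<exists>\<eta>'\<in>plan_supp k. symd (uniform_dist d) (\<Phi> k \<eta>') \<eta> < e/4" "\<epsilon> k + 2 * \<delta> k < e/2"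
      using eventually_happens'[OF sequentially_bot] by blast
    obtain \<gamma>' \<eta>' where \<gamma>': "\<gamma>' \<in> plan_supp k" "symd (uniform_dist d) (\<Phi> k \<gamma>') \<gamma> < e/4"
      and \<eta>': "\<eta>' \<in> plan_supp k" "symd (uniform_dist d) (\<Phi> k \<eta>') \<eta> < e/4" using k by blast
    have close: "\<bar>\<rho> k (\<alpha>' 0) (\<beta>' 1) - d (\<alpha> 0) (\<beta> 1)\<bar> \<le> e"
      if \<alpha>: "\<alpha>' \<in> plan_supp k" "\<alpha> \<in> geodesics X d" "symd (uniform_dist d) (\<Phi> k \<alpha>') \<alpha> < e/4"
        and \<beta>: "\<beta>' \<in> plan_supp k" "\<beta> \<in> geodesics X d" "symd (uniform_dist d) (\<Phi> k \<beta>') \<beta> < e/4" for \<alpha>' \<alpha> \<beta>' \<beta>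
    proof -
      note \<alpha>G = plan_supp_in[OF \<alpha>(1)] and \<beta>G = plan_supp_in[OF \<beta>(1)]
      note y = Y_in[OF \<alpha>G I(1)] Y_in[OF \<beta>G I(2)]
      note g = geodesics_in[OF \<Phi>_in[OF \<alpha>G] I(1)] geodesics_in[OF \<Phi>_in[OF \<beta>G] I(2)]
      note x = geodesics_in[OF \<alpha>(2) I(1)] geodesics_in[OF \<beta>(2) I(2)]
      show ?thesis
        using isom[OF y] dist_perturb[OF f_in[OF y(1)] f_in[OF y(2)] g] dist_perturb[OF g x]
          \<Phi>_near[OF \<alpha>G I(1)] \<Phi>_near[OF \<beta>G I(2)] symd_le_symd_uniform[OF \<Phi>_in[OF \<alpha>G] \<alpha>(2) I(1)]
          symd_le_symd_uniform[OF \<Phi>_in[OF \<beta>G] \<beta>(2) I(2)] \<alpha>(3) \<beta>(3) k(3) by linarith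
    qed
    have sq: "\<bar>a\<^sup>2 - b\<^sup>2\<bar> \<le> (2 * B + 1) * e" if "0 \<le> a" "0 \<le> b" "b \<le> B" "\<bar>a - b\<bar> \<le> e" for a b
    proof -
      have "a\<^sup>2 - b\<^sup>2 = (a + b) * (a - b)" by (simp add: power2_eq_square algebra_simps)
      then have "\<bar>a\<^sup>2 - b\<^sup>2\<bar> = (a + b) * \<bar>a - b\<bar>" using that by (simp add: abs_mult)
      also have "\<dots> \<le> (2 * B + 1) * e" using that e by (intro mult_mono) auto
      finally show ?thesis .
    qed
    have sqd: "\<bar>(\<rho> k (\<alpha>' 0) (\<beta>' 1))\<^sup>2 - (d (\<alpha> 0) (\<beta> 1))\<^sup>2\<bar> \<le> (2 * B + 1) * e"
      if \<alpha>: "\<alpha>' \<in> plan_supp k" "\<alpha> \<in> geodesics X d" "symd (uniform_dist d) (\<Phi> k \<alpha>') \<alpha> < e/4"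
        and \<beta>: "\<beta>' \<in> plan_supp k" "\<beta> \<in> geodesics X d" "symd (uniform_dist d) (\<Phi> k \<beta>') \<beta> < e/4" for \<alpha>' \<alpha> \<beta>' \<beta>
    proof (rule sq[OF _ _ _ close[OF that]])
      show "0 \<le> \<rho> k (\<alpha>' 0) (\<beta>' 1)"
        using irreversible_metric_space.nonneg[of "Y k" "\<rho> k"] theta_metric_space.axioms(1)[OF Y_theta]
          Y_in[OF plan_supp_in[OF \<alpha>(1)] I(1)] Y_in[OF plan_supp_in[OF \<beta>(1)] I(2)] by blast
      show "0 \<le> d (\<alpha> 0) (\<beta> 1)" "d (\<alpha> 0) (\<beta> 1) \<le> B"
        using nonneg B(2) geodesics_in[OF \<alpha>(2) I(1)] geodesics_in[OF \<beta>(2) I(2)] by auto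
    qed
    have "(\<rho> k (\<gamma>' 0) (\<gamma>' 1))\<^sup>2 + (\<rho> k (\<eta>' 0) (\<eta>' 1))\<^sup>2 \<le> (\<rho> k (\<gamma>' 0) (\<eta>' 1))\<^sup>2 + (\<rho> k (\<eta>' 0) (\<gamma>' 1))\<^sup>2"
      using plan_supp_monotone[OF opt \<gamma>'(1) \<eta>'(1)]
      unfolding compact_theta_space.pairwise_monotone_def[OF Y] .
    then show ?thesis
      using sqd[OF \<gamma>'(1) \<gamma>G \<gamma>'(2) \<gamma>'(1) \<gamma>G \<gamma>'(2)] sqd[OF \<eta>'(1) \<eta>G \<eta>'(2) \<eta>'(1) \<eta>G \<eta>'(2)]
        sqd[OF \<gamma>'(1) \<gamma>G \<gamma>'(2) \<eta>'(1) \<eta>G \<eta>'(2)] sqd[OF \<eta>'(1) \<eta>G \<eta>'(2) \<gamma>'(1) \<gamma>G \<gamma>'(2)] e3 by linarith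
  qed
  show ?thesis unfolding pairwise_monotone_def by (rule field_le_epsilon) (rule approx)
qed

theorem speed_limit:
  assumes opt: "\<And>k. dynamical_optimal_plan (Y k) (\<rho> k) 2 (P k)"
    and inv: "\<And>k x. x \<in> X \<Longrightarrow> h k x \<in> Y k" "\<And>k x. x \<in> X \<Longrightarrow> d (f k (h k x)) x \<le> \<epsilon> k"
    and t: "0 < t" "t < 1"
  shows "\<exists>vk v. (\<forall>k. speed_field (Y k) (\<rho> k) (P k) t (vk k)) \<and> speed_field X d Q t v \<and>
    uniform_limit X (\<lambda>k x. vk k (h k x)) v sequentially"
proof -
  have tI: "t \<in> {0..1}" using t by simp
  have I: "(0::real) \<in> {0..1}" "(1::real) \<in> {0..1}" by auto
  obtain v where v: "continuous_map (forward_topology X d) euclideanreal v" "\<And>x. x \<in> X \<Longrightarrow> 0 \<le> v x"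
    "\<And>\<eta>. \<eta> \<in> limit_supp \<Longrightarrow> v (\<eta> t) = d (\<eta> 0) (\<eta> 1)"
    using speed_function[OF t limit_supp_subset limit_supp_nonempty limit_supp_monotone[OF opt]] by metis
  have "\<exists>w. continuous_map (forward_topology (Y k) (\<rho> k)) euclideanreal w \<and> (\<forall>y\<in>Y k. 0 \<le> w y) \<and>
    (\<forall>\<gamma>\<in>plan_supp k. w (\<gamma> t) = \<rho> k (\<gamma> 0) (\<gamma> 1))" for k
  proof -
    interpret Yk: compact_theta_space \<theta> "Y k" "\<rho> k" by (rule Y)
    obtain w where "continuous_map (forward_topology (Y k) (\<rho> k)) euclideanreal w" "\<And>y. y \<in> Y k \<Longrightarrow> 0 \<le> w y"
      "\<And>\<gamma>. \<gamma> \<in> plan_supp k \<Longrightarrow> w (\<gamma> t) = \<rho> k (\<gamma> 0) (\<gamma> 1)"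
      using Yk.speed_function[OF t plan_supp(1) plan_supp(2) plan_supp_monotone[OF opt]] by metis
    then show ?thesis by blast
  qed
  then obtain w where w: "\<And>k. continuous_map (forward_topology (Y k) (\<rho> k)) euclideanreal (w k)"
    "\<And>k y. y \<in> Y k \<Longrightarrow> 0 \<le> w k y" "\<And>k \<gamma>. \<gamma> \<in> plan_supp k \<Longrightarrow> w k (\<gamma> t) = \<rho> k (\<gamma> 0) (\<gamma> 1)" by metis
  define C where "C k = (\<lambda>\<gamma>. \<gamma> t) ` plan_supp k" for k
  \<comment> \<open>On \<open>C k\<close> the values are dictated by the plan. The complement is
    negligible, so the representative may be prescribed there; with \<open>v \<circ> f k\<close>
    convergence off \<open>C k\<close> is a matter of the continuity of \<open>v\<close>, as
    \<open>f k \<circ> h k\<close> is close to the identity.\<close>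
  define vk where "vk k y = (if y \<in> C k then w k y else v (f k y))" for k y
  \<comment> \<open>Continuous images of Borel sets need not be Borel; \<open>C k\<close> is Borel
    because the support is compact.\<close>
  have Cm: "C k \<in> sets (borel_of (forward_topology (Y k) (\<rho> k)))" for k
  proof -
    interpret Yk: compact_theta_space \<theta> "Y k" "\<rho> k" by (rule Y)
    interpret GY: compact_theta_space \<theta> "geodesics (Y k) (\<rho> k)" "uniform_dist (\<rho> k)" by (rule Yk.compact_theta_geodesics)
    have "compactin (geodesic_topology (Y k) (\<rho> k)) (plan_supp k)"
      using closedin_compact_space[OF _ plan_supp(4)] GY.compact_forward_topology
      by (simp add: geodesic_topology_def)
    then have "compactin (forward_topology (Y k) (\<rho> k)) (C k)"
      unfolding C_def by (rule image_compactin[OF _ Yk.evaluation_continuous[OF tI]])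
    moreover have "Hausdorff_space (forward_topology (Y k) (\<rho> k))"
      unfolding Yk.forward_topology_eq by (rule Yk.S.Hausdorff_space_mtopology)
    ultimately show ?thesis by (intro closedin_sets_borel_of compactin_imp_closedin)
  qed
  have sf: "speed_field (Y k) (\<rho> k) (P k) t (vk k)" for k
  proof (rule compact_theta_space.speed_fieldI[OF Y P_prob tI])
    show "vk k \<in> borel_measurable (borel_of (forward_topology (Y k) (\<rho> k)))"
      unfolding vk_def
      by (rule measurable_If_set[OF continuous_map_real_measurable[OF w(1)]
            continuous_map_real_comp_measurable[OF v(1) f_meas]]) (use Cm[of k] sets.Int_space_eq2[OF Cm[of k]] in simp)
    show "0 \<le> vk k y" if "y \<in> Y k" for y unfolding vk_def using w(2) v(2) f_in that by auto
    show "AE \<gamma> in P k. vk k (\<gamma> t) = \<rho> k (\<gamma> 0) (\<gamma> 1)"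
      using plan_supp(3)[of k] by eventually_elim (simp add: vk_def C_def w(3))
  qed
  have sfQ: "speed_field X d Q t v"
  proof (rule speed_fieldI[OF Q_prob tI continuous_map_real_measurable[OF v(1)] v(2)])
    show "AE \<eta> in Q. v (\<eta> t) = d (\<eta> 0) (\<eta> 1)" using AE_limit_supp by eventually_elim (rule v(3))
  qed
  have "uniform_limit X (\<lambda>k x. vk k (h k x)) v sequentially"
  proof (rule uniform_limitI)
    fix e :: real assume e: "0 < e"
    obtain \<eta> where \<eta>: "0 < \<eta>" "\<And>x y. x \<in> X \<Longrightarrow> y \<in> X \<Longrightarrow> symd d x y < \<eta> \<Longrightarrow> \<bar>v x - v y\<bar> < e/2"
      using S.uniform_continuity[OF v(1)[unfolded forward_topology_eq] half_gt_zero[OF e]] by metis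
    \<comment> \<open>For lengths, \<open>e/8\<close> from \<open>\<Phi> k\<close> and twice
      \<open>e/8\<close> from the endpoints of a nearby limit curve stay below \<open>e/2\<close>;
      for positions three terms of at most \<open>\<eta>/3\<close> are added.\<close>
    define e' where "e' = min (\<eta>/3) (e/8)"
    have e': "0 < e'" "e' \<le> \<eta>/3" "e' \<le> e/8" unfolding e'_def using \<eta>(1) e by auto
    obtain c where c: "0 < c" "\<And>\<zeta>. \<zeta> \<in> geodesics X d \<Longrightarrow> S_dist \<zeta> < c \<Longrightarrow> \<exists>\<xi>\<in>limit_supp. symd (uniform_dist d) \<zeta> \<xi> < e'"
      using near_limit_supp[OF e'(1)] by blast
    have "(\<lambda>k. \<theta> * \<epsilon> k) \<longlonglongrightarrow> 0" using tendsto_mult_left[OF \<epsilon>_lim, of \<theta>] by simp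
    then have "\<forall>\<^sub>F k in sequentially. \<theta> * \<epsilon> k < \<eta>/3" by (rule order_tendstoD(2)) (use \<eta>(1) in simp)
    moreover have "\<forall>\<^sub>F k in sequentially. \<epsilon> k + 2 * \<delta> k < e/8"
      by (rule order_tendstoD(2)[OF length_error_lim]) (use e in simp)
    moreover have "\<forall>\<^sub>F k in sequentially. \<delta> k < \<eta>/3" by (rule order_tendstoD(2)[OF \<delta>_lim]) (use \<eta>(1) in simp)
    ultimately show "\<forall>\<^sub>F k in sequentially. \<forall>x\<in>X. dist (vk k (h k x)) (v x) < e"
      using S_dist_plan_supp[OF c(1)]
    proof eventually_elim
      case (elim k)
      show ?case
      proof
        fix x assume x: "x \<in> X"
        define y where "y = h k x"
        have y: "y \<in> Y k" "f k y \<in> X" unfolding y_def using inv(1)[OF x] f_in by auto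
        have "symd d (f k y) x \<le> \<theta> * d (f k y) x" by (rule symd_le[OF y(2) x])
        also have "\<dots> \<le> \<theta> * \<epsilon> k" using inv(2)[OF x, of k] theta_ge_1 by (simp add: y_def)
        finally have fyx: "symd d (f k y) x < \<eta>/3" using elim(1) by linarith
        show "dist (vk k (h k x)) (v x) < e"
        proof (cases "y \<in> C k")
          case False
          then have "vk k (h k x) = v (f k y)" by (simp add: vk_def y_def)
          moreover have "symd d (f k y) x < \<eta>" using fyx \<eta>(1) by linarith
          ultimately show ?thesis using \<eta>(2)[OF y(2) x] e by (simp add: dist_real_def)
        next
          case True
          \<comment> \<open>The comparison runs over a limit curve \<open>\<xi>\<close> near
            \<open>\<Phi> k \<gamma>\<close>: its length is close to that of
            \<open>\<gamma>\<close>, and at time \<open>t\<close> it passes near \<open>x\<close>,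
            where the continuity of \<open>v\<close> takes over.\<close>
          then obtain \<gamma> where \<gamma>: "\<gamma> \<in> plan_supp k" "y = \<gamma> t" unfolding C_def by blast
          note \<gamma>G = plan_supp_in[OF \<gamma>(1)]
          obtain \<xi> where \<xi>: "\<xi> \<in> limit_supp" "symd (uniform_dist d) (\<Phi> k \<gamma>) \<xi> < e'"
            using c(2)[OF \<Phi>_in[OF \<gamma>G]] elim(4) \<gamma>(1) by blast
          have \<xi>G: "\<xi> \<in> geodesics X d" using \<xi>(1) limit_supp_subset by blast
          have near: "symd d (\<Phi> k \<gamma> s) (\<xi> s) < e'" if "s \<in> {0..1}" for s
            using symd_le_symd_uniform[OF \<Phi>_in[OF \<gamma>G] \<xi>G that] \<xi>(2) by linarith
          note g = geodesics_in[OF \<Phi>_in[OF \<gamma>G]] and z = geodesics_in[OF \<xi>G]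
          have "vk k (h k x) = \<rho> k (\<gamma> 0) (\<gamma> 1)"
            using True w(3)[OF \<gamma>(1)] \<gamma>(2) by (simp add: vk_def y_def)
          moreover have "\<bar>d (\<Phi> k \<gamma> 0) (\<Phi> k \<gamma> 1) - d (\<xi> 0) (\<xi> 1)\<bar> < 2 * e'"
            using dist_perturb[OF g[OF I(1)] g[OF I(2)] z[OF I(1)] z[OF I(2)]] near[OF I(1)] near[OF I(2)] by linarith
          ultimately have 1: "\<bar>vk k (h k x) - v (\<xi> t)\<bar> < e/2"
            using length_\<Phi>[OF \<gamma>G] v(3)[OF \<xi>(1)] elim(2) e'(3) by linarith
          have "symd d (\<xi> t) x \<le> symd d (\<Phi> k \<gamma> t) (\<xi> t) + (symd d (f k y) (\<Phi> k \<gamma> t) + symd d (f k y) x)"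
            using symd_triangle[OF z[OF tI] g[OF tI] x] symd_triangle[OF g[OF tI] y(2) x]
              symd_commute[of d "\<xi> t" "\<Phi> k \<gamma> t"] symd_commute[of d "f k y" "\<Phi> k \<gamma> t"] by linarith
          also have "\<dots> < \<eta>"
            using near[OF tI] e'(2) \<Phi>_near[OF \<gamma>G tI] elim(3) fyx unfolding \<gamma>(2) by linarith
          finally have "\<bar>v (\<xi> t) - v x\<bar> < e/2" using \<eta>(2)[OF z[OF tI] x] by blast
          then show ?thesis using 1 unfolding dist_real_def by linarith
        qed
      qed
    qed
  qed
  then show ?thesis using sf sfQ by blast
qed

end

theorem theorem4p23:
  fixes \<theta> :: real
    and X\<^sub>k :: "nat \<Rightarrow> 'a set" and d\<^sub>k :: "nat \<Rightarrow> 'a \<Rightarrow> 'a \<Rightarrow> real"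
    and X :: "'b set" and d :: "'b \<Rightarrow> 'b \<Rightarrow> real"
    and \<epsilon> :: "nat \<Rightarrow> real" and f :: "nat \<Rightarrow> 'a \<Rightarrow> 'b"
    and P\<^sub>k :: "nat \<Rightarrow> (real \<Rightarrow> 'a) measure"
  assumes "\<theta> \<ge> 1"
    and "\<And>k. theta_geodesic_space \<theta> (X\<^sub>k k) (d\<^sub>k k)"
    and "\<And>k. compact_space (forward_topology (X\<^sub>k k) (d\<^sub>k k))"
    and "theta_geodesic_space \<theta> X d"
    and "compact_space (forward_topology X d)"
    and "\<And>k. \<epsilon> k > 0"
    and "\<epsilon> \<longlonglongrightarrow> 0"
    and "\<And>k. eps_isometry (X\<^sub>k k) (d\<^sub>k k) X d (\<epsilon> k) (f k)"
    and "\<And>k. f k \<in> borel_of (forward_topology (X\<^sub>k k) (d\<^sub>k k)) \<rightarrow>\<^sub>M borel_of (forward_topology X d)"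
    and "\<And>k. P\<^sub>k k \<in> prob_borel_measures (geodesic_topology (X\<^sub>k k) (d\<^sub>k k))"
  shows "\<exists>(r :: nat \<Rightarrow> nat) (P :: (real \<Rightarrow> 'b) measure).
    strict_mono r \<and>
    P \<in> prob_borel_measures (geodesic_topology X d) \<and>
    \<comment> \<open>(i)\<close>
    limitin (weak_prob_topology (path_measure_topology X d))
      (\<lambda>k. distr (P\<^sub>k (r k)) (borel_of (path_measure_topology X d))
             (\<lambda>\<gamma>. path_measure X d (compose {0..1} (f (r k)) \<gamma>)))
      (distr P (borel_of (path_measure_topology X d)) (path_measure X d))
      sequentially \<and>
    \<comment> \<open>(ii)\<close>
    limitin (weak_prob_topology (prod_topology (forward_topology X d) (forward_topology X d)))
      (\<lambda>k. distr (endpoint_plan (X\<^sub>k (r k)) (d\<^sub>k (r k)) (P\<^sub>k (r k)))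
             (borel_of (prod_topology (forward_topology X d) (forward_topology X d)))
             (map_prod (f (r k)) (f (r k))))
      (endpoint_plan X d P)
      sequentially \<and>
    \<comment> \<open>(iii)\<close>
    (\<forall>p\<ge>1.
      (\<lambda>k. SUP t\<in>{0..1}. wasserstein X d p
             (interpolation X d P t)
             (distr (interpolation (X\<^sub>k (r k)) (d\<^sub>k (r k)) (P\<^sub>k (r k)) t)
               (borel_of (forward_topology X d)) (f (r k))))
      \<longlonglongrightarrow> 0) \<and>
    \<comment> \<open>(iv)\<close>
    (\<forall>t\<in>{0<..<1}.
      limitin (weak_topology (forward_topology X d))
        (\<lambda>k. distr (kinetic_energy (X\<^sub>k (r k)) (d\<^sub>k (r k)) (P\<^sub>k (r k)) t)
               (borel_of (forward_topology X d)) (f (r k)))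
        (kinetic_energy X d P t)
        sequentially) \<and>
    (\<forall>p\<ge>1.
      (\<forall>k. dynamical_optimal_plan (X\<^sub>k k) (d\<^sub>k k) p (P\<^sub>k k)) \<longrightarrow>
      \<comment> \<open>(v)\<close>
      dynamical_optimal_plan X d p P \<and>
      optimal_plan X d p (interpolation X d P 0) (interpolation X d P 1) (endpoint_plan X d P) \<and>
      displacement_interpolation X d p (interpolation X d P) \<and>
      \<comment> \<open>(vi)\<close>
      (p = 2 \<longrightarrow>
        (\<forall>f\<^sub>r. (\<forall>k. approx_inverse (X\<^sub>k k) X d (\<epsilon> k) (f k) (f\<^sub>r k)) \<longrightarrow>
          (\<forall>t\<in>{0<..<1}. \<exists>v\<^sub>k v.
            (\<forall>k. speed_field (X\<^sub>k (r k)) (d\<^sub>k (r k)) (P\<^sub>k (r k)) t (v\<^sub>k k)) \<and>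
            speed_field X d P t v \<and>
            uniform_limit X (\<lambda>k x. v\<^sub>k k (f\<^sub>r (r k) x)) v sequentially))))"
proof -
  have compact: "compact_theta_space \<theta> (X\<^sub>k k) (d\<^sub>k k)" for k
    using assms(2,3) by (intro compact_theta_space.intro compact_theta_space_axioms.intro) (auto simp: theta_geodesic_space_def)
  have compactX: "compact_theta_space \<theta> X d"
    using assms(4,5) by (intro compact_theta_space.intro compact_theta_space_axioms.intro) (auto simp: theta_geodesic_space_def)
  interpret gh_convergence \<theta> X d X\<^sub>k d\<^sub>k \<epsilon> f P\<^sub>k
  proof (intro gh_convergence.intro gh_convergence_axioms.intro compactX compact)
    show "f k x \<in> X" if "x \<in> X\<^sub>k k" for k x
      using assms(8)[of k] that unfolding eps_isometry_def by blast
    show "\<bar>d (f k x) (f k x') - d\<^sub>k k x x'\<bar> \<le> \<epsilon> k" if "x \<in> X\<^sub>k k" "x' \<in> X\<^sub>k k" for k x x'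
      using assms(8)[of k] that unfolding eps_isometry_def by blast
  qed (use assms in auto)
  \<comment> \<open>The extraction depends neither on an exponent nor on optimality, so the same
    \<open>r\<close> and \<open>Q\<close> serve every \<open>p\<close> and all six
    assertions.\<close>
  obtain r \<Phi> \<delta> Q S_dist where r: "strict_mono (r :: nat \<Rightarrow> nat)"
    and lim: "gh_limit \<theta> X d (\<lambda>k. X\<^sub>k (r k)) (\<lambda>k. d\<^sub>k (r k)) (\<lambda>k. \<epsilon> (r k)) (\<lambda>k. f (r k)) (\<lambda>k. P\<^sub>k (r k)) \<Phi> \<delta> Q S_dist"
    using gh_limit_exists by (elim exE conjE)
  interpret L: gh_limit \<theta> X d "\<lambda>k. X\<^sub>k (r k)" "\<lambda>k. d\<^sub>k (r k)" "\<lambda>k. \<epsilon> (r k)" "\<lambda>k. f (r k)" "\<lambda>k. P\<^sub>k (r k)" \<Phi> \<delta> Q S_dist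
    by (rule lim)
  show ?thesis
  proof (intro exI[of _ r] exI[of _ Q] conjI allI impI ballI)
    fix p :: real assume p: "1 \<le> p" and opt: "\<forall>k. dynamical_optimal_plan (X\<^sub>k k) (d\<^sub>k k) p (P\<^sub>k k)"
    show dyn: "dynamical_optimal_plan X d p Q" by (rule L.limit_dynamical_optimal[OF p]) (use opt in blast)
    show "optimal_plan X d p (interpolation X d Q 0) (interpolation X d Q 1) (endpoint_plan X d Q)"
      by (rule L.limit_optimal[OF p]) (use opt in blast)
    show "displacement_interpolation X d p (interpolation X d Q)"
      unfolding displacement_interpolation_def using dyn by blast
    fix f\<^sub>r t assume "p = 2" and inv: "\<forall>k. approx_inverse (X\<^sub>k k) X d (\<epsilon> k) (f k) (f\<^sub>r k)" and t: "t \<in> {0<..<1::real}"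
    then show "\<exists>v\<^sub>k v. (\<forall>k. speed_field (X\<^sub>k (r k)) (d\<^sub>k (r k)) (P\<^sub>k (r k)) t (v\<^sub>k k)) \<and>
        speed_field X d Q t v \<and> uniform_limit X (\<lambda>k x. v\<^sub>k k (f\<^sub>r (r k) x)) v sequentially"
      using opt by (intro L.speed_limit) (auto simp: approx_inverse_def)
  qed (use r L.Q_prob L.path_plan_limit L.endpoint_plan_limit L.wasserstein_limit L.kinetic_energy_limit in auto)
qed

end
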